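(* Let $K\subset \mathbb{S}^1$ be a Cantor subset and let $f\in \mathrm{Homeo}_{<}(K)$. The following are equivalent. (1) The element $f$ is distorted in $\mathrm{Homeo}_{<}(K)$. (2) The sequence $(d(f^n))_{n\ge 0}$ is bounded. (3) The element $f$ is a multihomeomorphism of the circle.
   Context: A Cantor subset of $\mathbb{S}^1$ is an infinite compact totally disconnected subset in which every point is an accumulation point. A homeomorphism $f$ of $K$ is locally monotone if for every $x\in K$ there exist open intervals $I\ni x$ and $J\ni f(x)$ of $\mathbb{S}^1$ and a homeomorphism $\tilde f:I\to J$ with $f|_{I\cap K}=\tilde f|_{I\cap K}$. $\mathrm{Homeo}_{<}(K)$ is the group (under composition) of locally monotone homeomorphisms of $K$. Discontinuities: for $f\in\mathrm{Homeo}_<(K)$, a point $a\in K$ is a discontinuity of $f$ if $a$ is an endpoint of a connected component $I$ of $\mathbb{S}^1\setminus K$ such that the images under $f$ of the two endpoints of $I$ are not the two endpoints of a connected component of $\mathbb{S}^1\setminus K$. The set $\mathrm{Disc}(f)$ of discontinuities of $f$ is finite, and $d(f)$ denotes its cardinality. Distortion: for a group $G$ generated by a finite set $S$, $\ell_S$ is the word length with respect to $S$. An element $f\in G$ is distorted in $G$ if $\lim_{n\to+\infty}\ell_S(f^n)/n=0$ (independent of $S$). An element of an arbitrary group is distorted if it belongs to some finitely generated subgroup in which it is distorted. Multihomeomorphism: for $n\ge1$, $\mathbb{S}^1_n$ is the disjoint union of $n$ circles. An element $f\in \mathrm{Homeo}_<(K)$ is a multihomeomorphism of the circle if there exist $n\ge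 1$ and a continuous locally monotone map $h:K\to\mathbb{S}^1_n$ (every point of $K$ has a neighborhood in $K$ of the form $I\cap K$, with $I$ an open interval, that $h$ maps monotonically into an interval of one of the circles) which is a homeomorphism onto its image, such that $hfh^{-1}$ is the restriction to $h(K)$ of a homeomorphism of $\mathbb{S}^1_n$. *)

theory Defs
  imports "HOL-Analysis.Analysis" "HOL-Algebra.Bij" "HOL-Algebra.Generated_Groups"
begin

abbreviation circle :: "complex set"
  where "circle \<equiv> sphere 0 1"

text \<open>The bound on the length makes \<^const>\<open>cis\<close> injective on the parameter interval; the largest
  open intervals of the circle are the complements of points.\<close>

definition open_circle_interval :: "complex set \<Rightarrow> bool"
  where "open_circle_interval I \<longleftrightarrow>
    (\<exists>a b. a < b \<and> b \<le> a + 2 * pi \<and> I = cis ` {a<..<b})"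

definition cantor_subset :: "complex set \<Rightarrow> bool"
  where "cantor_subset K \<longleftrightarrow>
    K \<subseteq> circle \<and> infinite K \<and> compact K \<and>
    (\<forall>x\<in>K. connected_component_set K x = {x}) \<and> (\<forall>x\<in>K. x islimpt K)"

definition locally_monotone_homeo :: "complex set \<Rightarrow> (complex \<Rightarrow> complex) \<Rightarrow> bool"
  where "locally_monotone_homeo K f \<longleftrightarrow>
    (\<exists>f'. homeomorphism K K f f') \<and>
    (\<forall>x\<in>K. \<exists>I J g g'. open_circle_interval I \<and> open_circle_interval J \<and> x \<in> I \<and> f x \<in> J \<and>
       homeomorphism I J g g' \<and> (\<forall>y \<in> I \<inter> K. f y = g y))"

text \<open>Self-maps of \<open>K\<close> are represented by functions that are \<^const>\<open>undefined\<close> outside \<open>K\<close>,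
  as in \<^const>\<open>BijGroup\<close>.\<close>

definition Homeo_lt :: "complex set \<Rightarrow> (complex \<Rightarrow> complex) monoid"
  where "Homeo_lt K = (BijGroup K)\<lparr>carrier := {f \<in> Bij K. locally_monotone_homeo K f}\<rparr>"


section \<open>Discontinuities\<close>

definition circle_endpoints :: "complex set \<Rightarrow> complex set"
  where "circle_endpoints I = (top_of_set circle) frontier_of I"

definition Disc :: "complex set \<Rightarrow> (complex \<Rightarrow> complex) \<Rightarrow> complex set"
  where "Disc K f =
    {a \<in> K. \<exists>I \<in> components (circle - K). a \<in> circle_endpoints I \<and>
       \<not> (\<exists>J \<in> components (circle - K). f ` circle_endpoints I = circle_endpoints J)}"

text \<open>By compactness of \<open>K\<close>, the set \<^term>\<open>Disc K f\<close> is finite for locally monotone \<open>f\<close>, so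
  \<^const>\<open>card\<close> does not hide an infinite set here.\<close>

definition num_disc :: "complex set \<Rightarrow> (complex \<Rightarrow> complex) \<Rightarrow> nat"
  where "num_disc K f = card (Disc K f)"


section \<open>Distortion\<close>

definition word_length :: "('a, 'b) monoid_scheme \<Rightarrow> 'a set \<Rightarrow> 'a \<Rightarrow> nat"
  where "word_length G S g =
    (LEAST n. \<exists>ws. length ws = n \<and> set ws \<subseteq> S \<union> m_inv G ` S \<and>
       foldr (\<lambda>x y. x \<otimes>\<^bsub>G\<^esub> y) ws \<one>\<^bsub>G\<^esub> = g)"

text \<open>Distortion in a finitely generated group. Word lengths for two finite generating sets are
  comparable up to multiplicative constants, so quantifying existentially or universally over the
  finite generating set \<open>S\<close> makes no difference.\<close>

definition distorted_fg :: "('a, 'b) monoid_scheme \<Rightarrow> 'a \<Rightarrow> bool"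
  where "distorted_fg G f \<longleftrightarrow> f \<in> carrier G \<and>
    (\<exists>S. finite S \<and> S \<subseteq> carrier G \<and> generate G S = carrier G \<and>
      (\<lambda>n::nat. real (word_length G S (f [^]\<^bsub>G\<^esub> n)) / real n) \<longlonglongrightarrow> 0)"

definition distorted :: "('a, 'b) monoid_scheme \<Rightarrow> 'a \<Rightarrow> bool"
  where "distorted G f \<longleftrightarrow> (\<exists>H. subgroup H G \<and> distorted_fg (G\<lparr>carrier := H\<rparr>) f)"


section \<open>Multihomeomorphisms\<close>

text \<open>The disjoint union of \<open>n\<close> circles, topologised as a subspace of \<^typ>\<open>nat \<times> complex\<close>, where
  \<^typ>\<open>nat\<close> is discrete.\<close>

definition multicircle :: "nat \<Rightarrow> (nat \<times> complex) set"
  where "multicircle n = {..<n} \<times> circle"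

text \<open>Monotonicity is expressed in angular coordinates \<open>t\<close> on an open interval around \<open>x\<close> and
  \<open>u t\<close> on an open interval of the \<open>k\<close>-th circle; both orientations are allowed.\<close>

definition locally_monotone_map :: "complex set \<Rightarrow> nat \<Rightarrow> (complex \<Rightarrow> nat \<times> complex) \<Rightarrow> bool"
  where "locally_monotone_map K n h \<longleftrightarrow>
    (\<forall>x\<in>K. \<exists>a b c d k u.
       a < b \<and> b \<le> a + 2 * pi \<and> c < d \<and> d \<le> c + 2 * pi \<and> k < n \<and> x \<in> cis ` {a<..<b} \<and>
       (let T = {t \<in> {a<..<b}. cis t \<in> K} in
          u ` T \<subseteq> {c<..<d} \<and> (mono_on T u \<or> antimono_on T u) \<and>
          (\<forall>t\<in>T. h (cis t) = (k, cis (u t)))))"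

definition multihomeomorphism :: "complex set \<Rightarrow> (complex \<Rightarrow> complex) \<Rightarrow> bool"
  where "multihomeomorphism K f \<longleftrightarrow>
    (\<exists>n\<ge>1. \<exists>h h' F F'. h ` K \<subseteq> multicircle n \<and> locally_monotone_map K n h \<and>
       homeomorphism K (h ` K) h h' \<and>
       homeomorphism (multicircle n) (multicircle n) F F' \<and>
       (\<forall>y \<in> h ` K. h (f (h' y)) = F y))"

end

theory Submission
  imports Defs "HOL-Real_Asymp.Real_Asymp"
begin

text \<open>Cut the circle at a point outside \<open>K\<close>. Then \<open>K\<close> becomes a Cantor set \<open>L\<close> of reals, and the
  group becomes the group of bijections of \<open>L\<close> that are continuous and locally monotone (\<open>PH L\<close>).
  A point of \<open>L\<close> has at most one neighbour across a gap of the circle (\<open>cadj\<close>), so the gaps are a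
  matching of the one-sided limit points, and the discontinuities of \<open>f\<close> are the points whose pair is
  broken by \<open>f\<close>. There are finitely many, because short gaps lie in a region where \<open>f\<close> is monotone
  (\<open>finite_bad_gaps\<close>).

  Call a pair stable if its images under all late iterates of \<open>f\<close> are matched. If infinitely many pairs
  are unstable, they all break at finitely many points, so infinitely many of them run through the same
  orbit, are matched at early times of it and unmatched at late times; then the number of broken pairs
  of \<open>f ^ n\<close> grows linearly (\<open>unstable_linear_growth\<close>). If finitely many pairs are unstable, the number is
  bounded (\<open>finite_unstable_imp_bounded\<close>). The number of discontinuities is subadditive, hence at most
  a multiple of word length. For a distorted \<open>f\<close> it is therefore sublinear along the powers, and so it
  is bounded.

  Conversely, let \<open>f ^ n\<close> have boundedly many discontinuities. Cutting \<open>L\<close> at the broken gaps of \<open>f ^ n\<close>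
  leaves boundedly many pieces on which \<open>f ^ n\<close> is monotone, and up to order automorphisms of \<open>L\<close> on both
  sides, \<open>f ^ n\<close> is determined by the order and direction of the pieces, that is by finitely many
  possibilities (\<open>same_type_imp_double_coset\<close>). This uses that all Cantor sets of reals are order
  isomorphic (\<open>cantor_oiso\<close>). Any sequence \<open>u\<close> of order automorphisms lies in a finitely generated group
  with the length of \<open>u k\<close> linear in \<open>k\<close> (\<open>controlled_OA\<close>): after fragmentation and conjugation the
  \<open>u k\<close> live in an inner interval, where the whole sequence is stored in one infinite product and each
  term is recovered as a commutator (\<open>controlled_inner_interval\<close>). With this for the sequence
  \<open>f ^ (k ^ 2)\<close>, the length of \<open>f ^ n\<close> is of the order of \<open>sqrt n\<close>, and \<open>f\<close> is distorted.

  A multihomeomorphism has boundedly many discontinuities: the embedding takes adjacent points of \<open>K\<close>, up to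
  finitely many, to the two ends of an arc of the complement, and homeomorphisms of the circles preserve
  the latter relation (\<open>multihomeomorphism_imp_bounded\<close>). For the converse, only finitely many pairs are
  unstable. Cut \<open>L\<close> at the unstable gaps and put the pieces together along stable pairs as long as two
  ends of different components form a stable pair (\<open>merge\<close>). When this stops, \<open>f\<close> permutes the
  glued pairs, which are formed by two neighbours in a component or by the two ends of a component
  (\<open>glued_preserved\<close>). Winding each component onto a circle of its own makes these the pairs of end
  points of the complementary arcs, and \<open>f\<close> extends across the arcs to a homeomorphism of the circles (\<open>gap_homeomorphism_extends\<close>).\<close>

section \<open>Gaps of compact sets of reals\<close>

definition consec :: "real set \<Rightarrow> real \<Rightarrow> real \<Rightarrow> bool"
  where "consec A a b \<longleftrightarrow> a \<in> A \<and> b \<in> A \<and> a < b \<and> {a<..<b} \<inter> A = {}"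

lemma consecD:
  assumes "consec A a b"
  shows "a \<in> A" "b \<in> A" "a < b" "\<And>x. x \<in> A \<Longrightarrow> x \<le> a \<or> b \<le> x"
  using assms unfolding consec_def by force+

lemma consec_right_unique: "consec A a b \<Longrightarrow> consec A a c \<Longrightarrow> b = c"
  by (meson consecD leD le_less_linear order_antisym)

lemma consec_left_unique: "consec A a c \<Longrightarrow> consec A b c \<Longrightarrow> a = b"
  by (meson consecD leD le_less_linear order_antisym)

lemma consec_point_unique:
  assumes "consec A a b" "consec A c d" "a < z" "z < b" "c < z" "z < d"
  shows "a = c" "b = d"
  using consecD[OF assms(1)] consecD[OF assms(2)] assms(3-) by (smt (verit))+

lemma gap_around_point:
  assumes A: "closed A" and "x \<in> A" "y \<in> A" "x < z" "z < y" "z \<notin> A"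
  shows "\<exists>a b. consec A a b \<and> x \<le> a \<and> a < z \<and> z < b \<and> b \<le> y"
proof -
  have "compact (A \<inter> {x..z})" "compact (A \<inter> {z..y})"
    using A by (simp_all add: closed_Int_compact)
  moreover have "A \<inter> {x..z} \<noteq> {}" "A \<inter> {z..y} \<noteq> {}" using assms by force+
  ultimately obtain a b where a: "a \<in> A \<inter> {x..z}" "\<forall>t\<in>A \<inter> {x..z}. t \<le> a"
    and b: "b \<in> A \<inter> {z..y}" "\<forall>t\<in>A \<inter> {z..y}. b \<le> t"
    by (meson compact_attains_sup compact_attains_inf)
  have "a < z" "z < b" using a b assms by (force simp: less_le)+
  moreover have "{a<..<b} \<inter> A = {}"
  proof (rule ccontr)
    assume "{a<..<b} \<inter> A \<noteq> {}"
    then obtain w where "a < w" "w < b" "w \<in> A" by auto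
    moreover have "w \<le> a" if "w \<le> z"
      using a \<open>a < w\<close> that \<open>w \<in> A\<close> by (meson IntD2 IntI atLeastAtMost_iff less_imp_le order_trans)
    moreover have "b \<le> w" if "z \<le> w"
      using b \<open>w < b\<close> that \<open>w \<in> A\<close> by (meson IntD2 IntI atLeastAtMost_iff less_imp_le order_trans)
    ultimately show False by linarith
  qed
  ultimately have "consec A a b" using a b by (auto simp: consec_def)
  then show ?thesis using a b \<open>a < z\<close> \<open>z < b\<close> by auto
qed

text \<open>The left ends of these gaps are at least \<open>\<epsilon>\<close> apart, so they are told apart
  by the integer part of their quotient by \<open>\<epsilon>\<close>.\<close>
lemma finite_large_gaps:
  assumes "bounded A" "0 < \<epsilon>"
  shows "finite {(a,b). consec A a b \<and> \<epsilon> \<le> b - a}" (is "finite ?S")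
proof -
  obtain M where M: "\<forall>x\<in>A. \<bar>x\<bar> \<le> M" using assms(1) unfolding bounded_real by auto
  let ?F = "\<lambda>(a,b). \<lfloor>a / \<epsilon>\<rfloor>"
  have "inj_on ?F ?S"
  proof -
    have *: "\<lfloor>a / \<epsilon>\<rfloor> < \<lfloor>a' / \<epsilon>\<rfloor>"
      if "consec A a b" "\<epsilon> \<le> b - a" "consec A a' b'" "a < a'" for a b a' b'
    proof -
      have "a + \<epsilon> \<le> a'" using consecD[OF that(1)] consecD(1)[OF that(3)] that(2,4) by (smt (verit))
      then have "(a + \<epsilon>) / \<epsilon> \<le> a' / \<epsilon>" using assms(2) by (intro divide_right_mono) auto
      then have "a / \<epsilon> + 1 \<le> a' / \<epsilon>" using assms(2) by (simp add: add_divide_distrib)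
      then show ?thesis by linarith
    qed
    show ?thesis
    proof (rule inj_onI, clarify)
      fix a b a' b'
      assume h: "consec A a b" "\<epsilon> \<le> b - a" "consec A a' b'" "\<epsilon> \<le> b' - a'" "\<lfloor>a / \<epsilon>\<rfloor> = \<lfloor>a' / \<epsilon>\<rfloor>"
      have "a = a'" using *[OF h(1,2,3)] *[OF h(3,4,1)] h(5) by linarith
      then show "a = a' \<and> b = b'" using h(1,3) consec_right_unique by blast
    qed
  qed
  moreover have "?F ` ?S \<subseteq> {\<lfloor>-M/\<epsilon>\<rfloor>..\<lfloor>M/\<epsilon>\<rfloor>}"
  proof clarify
    fix a b assume "consec A a b"
    then have "-M \<le> a" "a \<le> M" using M consecD(1) by (smt (verit))+
    then show "\<lfloor>a / \<epsilon>\<rfloor> \<in> {\<lfloor>-M/\<epsilon>\<rfloor>..\<lfloor>M/\<epsilon>\<rfloor>}"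
      using assms(2) divide_right_mono[of "-M" a \<epsilon>] divide_right_mono[of a M \<epsilon>]
      by (auto intro!: floor_mono)
  qed
  ultimately show ?thesis by (meson finite_atLeastAtMost_int finite_imageD finite_subset)
qed

text \<open>The reason why every count of discontinuities is finite: gaps that are short compared with
  a Lebesgue number of the cover lie inside one of the good neighbourhoods, and only finitely many
  gaps are not short.\<close>
lemma finite_bad_gaps:
  assumes A: "compact A"
    and loc: "\<And>x. x \<in> A \<Longrightarrow> \<exists>\<delta>>0. \<forall>a b. consec A a b \<and> \<bar>a - x\<bar> < \<delta> \<and> \<bar>b - x\<bar> < \<delta> \<longrightarrow> R a b"
  shows "finite {(a,b). consec A a b \<and> \<not> R a b}"
proof -
  obtain \<delta> where \<delta>: "\<And>x. x \<in> A \<Longrightarrow> \<delta> x > 0"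
      "\<And>x a b. x \<in> A \<Longrightarrow> consec A a b \<Longrightarrow> \<bar>a - x\<bar> < \<delta> x \<Longrightarrow> \<bar>b - x\<bar> < \<delta> x \<Longrightarrow> R a b"
    using loc by metis
  have "A \<subseteq> \<Union> ((\<lambda>x. ball x (\<delta> x)) ` A)" using \<delta>(1) by force
  from Heine_Borel_lemma[OF A this] obtain e where e: "e > 0"
    "\<And>x. x \<in> A \<Longrightarrow> \<exists>B\<in>(\<lambda>x. ball x (\<delta> x)) ` A. ball x e \<subseteq> B" by (metis (no_types, lifting) imageE open_ball)
  have "{(a,b). consec A a b \<and> \<not> R a b} \<subseteq> {(a,b). consec A a b \<and> e \<le> b - a}"
  proof clarify
    fix a b assume h: "consec A a b" "\<not> R a b"
    show "e \<le> b - a"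
    proof (rule ccontr)
      assume "\<not> e \<le> b - a"
      then have "a \<in> ball a e" "b \<in> ball a e" using consecD(3)[OF h(1)] e(1) by (auto simp: dist_real_def)
      moreover obtain x where "x \<in> A" "ball a e \<subseteq> ball x (\<delta> x)" using e(2) consecD(1)[OF h(1)] by auto
      ultimately show False using \<delta>(2)[OF \<open>x\<in>A\<close> h(1)] h(2)
        by (metis dist_commute dist_real_def mem_ball subset_eq)
    qed
  qed
  then show ?thesis using finite_large_gaps[OF compact_imp_bounded[OF A] e(1)] finite_subset by blast
qed

section \<open>Any two Cantor sets of reals are order isomorphic\<close>

text \<open>For sets of reals, total disconnectedness says that no two points are the ends of an interval
  inside the set.\<close>
definition cantor :: "real set \<Rightarrow> bool"
  where "cantor A \<longleftrightarrow> compact A \<and> A \<noteq> {} \<and> (\<forall>x\<in>A. x islimpt A) \<and>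
    (\<forall>x\<in>A. \<forall>y\<in>A. x < y \<longrightarrow> (\<exists>z. x < z \<and> z < y \<and> z \<notin> A))"

definition oiso :: "real set \<Rightarrow> real set \<Rightarrow> (real \<Rightarrow> real) \<Rightarrow> bool"
  where "oiso A B \<phi> \<longleftrightarrow> strict_mono_on A \<phi> \<and> \<phi> ` A = B"

lemma cantor_gap_between:
  assumes "cantor A" "x \<in> A" "y \<in> A" "x < y"
  shows "\<exists>a b. consec A a b \<and> x \<le> a \<and> b \<le> y"
  using assms unfolding cantor_def by (meson compact_imp_closed gap_around_point)

lemma cantor_clopen:
  assumes "cantor A" "B \<subseteq> A" "closed B" "closed (A - B)" "B \<noteq> {}"
  shows "cantor B"
proof -
  have "compact B" using assms(1,2,3) compact_Int_closed[of A B] unfolding cantor_def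
    by (simp add: Int_absorb1)
  moreover have "x islimpt B" if "x \<in> B" for x
  proof -
    have "x islimpt (B \<union> (A - B))" using that assms unfolding cantor_def
      by (metis Un_Diff_cancel Un_absorb1 subsetD)
    moreover have "\<not> x islimpt (A - B)" using that assms(4) by (auto simp: closed_limpt)
    ultimately show ?thesis using islimpt_Un by blast
  qed
  ultimately show ?thesis using assms unfolding cantor_def by blast
qed

lemma cantor_cut:
  assumes "cantor A" "consec A a b"
  shows "cantor (A \<inter> {..a})" "cantor (A \<inter> {b..})"
proof -
  have "closed A" using assms(1) by (simp add: cantor_def compact_imp_closed)
  moreover have "A - A \<inter> {..a} = A \<inter> {b..}" "A - A \<inter> {b..} = A \<inter> {..a}"
    using consecD[OF assms(2)] by force+
  moreover have "A \<inter> {..a} \<noteq> {}" "A \<inter> {b..} \<noteq> {}" using consecD[OF assms(2)] by auto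
  moreover have "closed (A \<inter> {..a})" "closed (A \<inter> {b..})"
    using \<open>closed A\<close> by (simp_all add: closed_Int)
  ultimately show "cantor (A \<inter> {..a})" "cantor (A \<inter> {b..})"
    using cantor_clopen[OF assms(1) Int_lower1, of "{..a}"] cantor_clopen[OF assms(1) Int_lower1, of "{b..}"]
    by simp_all
qed

lemma cantor_two_points:
  assumes "cantor A" obtains x y where "x \<in> A" "y \<in> A" "x < y"
proof -
  obtain x where "x \<in> A" using assms unfolding cantor_def by auto
  then have "x islimpt A" using assms unfolding cantor_def by auto
  then obtain y where "y \<in> A" "y \<noteq> x" by (metis islimptE UNIV_I open_UNIV)
  then show ?thesis using that[of x y] that[of y x] \<open>x \<in> A\<close> by (meson linorder_neq_iff)
qed

definition widest_gap :: "real set \<Rightarrow> real \<times> real"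
  where "widest_gap A = (SOME g. consec A (fst g) (snd g) \<and> (\<forall>c d. consec A c d \<longrightarrow> d - c \<le> snd g - fst g))"

definition left_half :: "real set \<Rightarrow> real set" where "left_half A = A \<inter> {..fst (widest_gap A)}"
definition right_half :: "real set \<Rightarrow> real set" where "right_half A = A \<inter> {snd (widest_gap A)..}"

lemma widest_gap:
  assumes "cantor A"
  shows "consec A (fst (widest_gap A)) (snd (widest_gap A))"
    "consec A c d \<Longrightarrow> d - c \<le> snd (widest_gap A) - fst (widest_gap A)"
proof -
  obtain p q where pq: "consec A p q"
    by (meson assms cantor_gap_between cantor_two_points)
  let ?S = "{(a,b). consec A a b \<and> q - p \<le> b - a}"
  have fin: "finite ?S" using assms pq unfolding cantor_def
    by (intro finite_large_gaps) (auto intro: compact_imp_bounded dest: consecD(3))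
  have "?S \<noteq> {}" using pq by auto
  let ?W = "(\<lambda>h. snd h - fst h) ` ?S"
  have "Max ?W \<in> ?W" using fin \<open>?S \<noteq> {}\<close> by (intro Max_in) auto
  then obtain g where g: "g \<in> ?S" "snd g - fst g = Max ?W" by force
  then have g: "g \<in> ?S" "\<forall>h\<in>?S. snd h - fst h \<le> snd g - fst g" using fin by auto
  have "consec A (fst g) (snd g) \<and> (\<forall>c d. consec A c d \<longrightarrow> d - c \<le> snd g - fst g)"
  proof (intro conjI allI impI)
    show "consec A (fst g) (snd g)" using g by auto
    fix c d assume "consec A c d"
    then show "d - c \<le> snd g - fst g"
      using g by (cases "q - p \<le> d - c") auto
  qed
  from someI[of "\<lambda>g. consec A (fst g) (snd g) \<and> (\<forall>c d. consec A c d \<longrightarrow> d - c \<le> snd g - fst g)", OF this]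
  show "consec A (fst (widest_gap A)) (snd (widest_gap A))"
    "consec A c d \<Longrightarrow> d - c \<le> snd (widest_gap A) - fst (widest_gap A)"
    unfolding widest_gap_def by blast+
qed

lemma halves:
  assumes "cantor A"
  shows "cantor (left_half A)" "cantor (right_half A)" "left_half A \<union> right_half A = A"
    "\<And>x y. x \<in> left_half A \<Longrightarrow> y \<in> right_half A \<Longrightarrow> x < y"
    "left_half A \<subseteq> A" "right_half A \<subseteq> A"
proof -
  note c = consecD[OF widest_gap(1)[OF assms]]
  show "cantor (left_half A)" "cantor (right_half A)"
    using cantor_cut[OF assms widest_gap(1)[OF assms]] unfolding left_half_def right_half_def by auto
  show "left_half A \<union> right_half A = A" using c(4) unfolding left_half_def right_half_def by auto
  show "x \<in> left_half A \<Longrightarrow> y \<in> right_half A \<Longrightarrow> x < y" for x y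
    using c(3) unfolding left_half_def right_half_def by auto
  show "left_half A \<subseteq> A" "right_half A \<subseteq> A" unfolding left_half_def right_half_def by auto
qed

text \<open>A gap inside every set of a nested sequence of halves would be no wider than infinitely many
  different gaps, the ones at which the sets are split.\<close>
lemma nested_halves_unique:
  assumes N: "\<And>k. cantor (N k)" "\<And>k. N (Suc k) = left_half (N k) \<or> N (Suc k) = right_half (N k)"
    and x: "\<And>k. x \<in> N k" and y: "\<And>k. y \<in> N k"
  shows "x = y"
proof (rule ccontr)
  assume "x \<noteq> y"
  then obtain u v where uv: "u < v" "\<And>k. u \<in> N k" "\<And>k. v \<in> N k"
    using x y by (cases "x < y") (auto simp: not_less order.order_iff_strict)
  define lo where "lo k = fst (widest_gap (N k))" for k
  define hi where "hi k = snd (widest_gap (N k))" for k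
  have g: "consec (N k) (lo k) (hi k)" for k using widest_gap(1)[OF N(1)] by (simp add: lo_def hi_def)
  have half: "N (Suc k) = N k \<inter> {..lo k} \<or> N (Suc k) = N k \<inter> {hi k..}" for k
    using N(2) by (simp add: left_half_def right_half_def lo_def hi_def)
  have sub: "N (Suc k) \<subseteq> N k" for k using half[of k] by auto
  have anti: "N m \<subseteq> N k" if "k \<le> m" for k m by (rule lift_Suc_antimono_le[of N, OF sub that])
  obtain p q where pq: "consec (N 0) p q" "u \<le> p" "q \<le> v"
    using cantor_gap_between N(1) uv by blast
  have conv: "p \<in> N k \<and> q \<in> N k \<and> (\<forall>z\<in>N 0. u \<le> z \<and> z \<le> v \<longrightarrow> z \<in> N k)" for k
  proof -
    have "\<forall>z\<in>N 0. u \<le> z \<and> z \<le> v \<longrightarrow> z \<in> N k" for k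
    proof (induction k)
      case (Suc k)
      have "u \<in> N (Suc k)" "v \<in> N (Suc k)" using uv by auto
      then show ?case using half[of k] Suc by (auto dest: order_trans)
    qed auto
    then show ?thesis using pq consecD[OF pq(1)] by auto
  qed
  \<comment> \<open>A gap between two points that are never separated is never used for a split.\<close>
  have pqk: "consec (N k) p q" for k
    using conv[of k] pq(1) anti[of 0 k] unfolding consec_def by auto
  \<comment> \<open>A gap of a half is a gap of the whole, so every splitting gap is a gap of \<open>N 0\<close>.\<close>
  have gk: "consec (N 0) (lo k) (hi k)" for k
  proof -
    have "consec (N j) (lo k) (hi k)" if "j \<le> k" for j
      using that
    proof (induction "k - j" arbitrary: j)
      case 0 then show ?case using g by auto
    next
      case (Suc d)
      then have IH: "consec (N (Suc j)) (lo k) (hi k)" by auto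
      have "lo k \<in> N (Suc j)" "hi k \<in> N (Suc j)" "lo k < hi k" using consecD(1-3)[OF IH] by auto
      have "z \<in> N (Suc j)" if "z \<in> N j" "lo k < z" "z < hi k" for z
        using half[of j]
      proof
        assume h: "N (Suc j) = N j \<inter> {..lo j}"
        then have "hi k \<le> lo j" using \<open>hi k \<in> N (Suc j)\<close> by blast
        then show ?thesis using h that by simp
      next
        assume h: "N (Suc j) = N j \<inter> {hi j..}"
        then have "hi j \<le> lo k" using \<open>lo k \<in> N (Suc j)\<close> by blast
        then show ?thesis using h that by simp
      qed
      then show ?case using IH sub[of j] unfolding consec_def by auto
    qed
    then show ?thesis by auto
  qed
  have inj: "inj lo"
  proof (rule linorder_injI)
    fix k m :: nat assume "k < m"
    have "lo m \<in> N (Suc k)" using consecD(1)[OF g[of m]] anti[of "Suc k" m] \<open>k < m\<close> by auto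
    moreover have "hi m \<in> N (Suc k)" using consecD(2)[OF g[of m]] anti[of "Suc k" m] \<open>k < m\<close> by auto
    moreover have "hi m = hi k" if "lo k = lo m" using consec_right_unique gk that by metis
    moreover have "lo m < hi m" "lo k < hi k" using consecD(3)[OF g] by auto
    ultimately show "lo k \<noteq> lo m" using half[of k] by auto
  qed
  let ?S = "{(a,b). consec (N 0) a b \<and> q - p \<le> b - a}"
  have "range (\<lambda>k. (lo k, hi k)) \<subseteq> ?S"
    using gk widest_gap(2)[OF N(1) pqk] unfolding lo_def hi_def by blast
  moreover have "finite ?S" using N(1)[of 0] consecD(3)[OF pq(1)] unfolding cantor_def
    by (intro finite_large_gaps) (simp_all add: compact_imp_bounded)
  ultimately have "finite (range (\<lambda>k. (lo k, hi k)))" by (rule finite_subset)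
  moreover have "inj (\<lambda>k. (lo k, hi k))" using inj by (auto simp: inj_def)
  ultimately show False by (simp add: finite_image_iff)
qed

text \<open>A point \<open>x\<close> of \<open>A\<close> selects a nested sequence of halves of \<open>A\<close>; \<open>zoom\<close> performs the same
  choices in \<open>B\<close>.\<close>
primrec zoom :: "real \<Rightarrow> real set \<Rightarrow> real set \<Rightarrow> nat \<Rightarrow> real set \<times> real set" where
  "zoom x A B 0 = (A, B)"
| "zoom x A B (Suc k) = (let (P, Q) = zoom x A B k in
    if x \<in> left_half P then (left_half P, left_half Q) else (right_half P, right_half Q))"

lemma zoom_Suc:
  "fst (zoom x A B (Suc k)) = (if x \<in> left_half (fst (zoom x A B k)) then left_half (fst (zoom x A B k)) else right_half (fst (zoom x A B k)))"
  "snd (zoom x A B (Suc k)) = (if x \<in> left_half (fst (zoom x A B k)) then left_half (snd (zoom x A B k)) else right_half (snd (zoom x A B k)))"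
  by (simp_all add: case_prod_beta Let_def)

lemma zoom_props:
  assumes "cantor A" "cantor B" "x \<in> A"
  shows "cantor (fst (zoom x A B k)) \<and> cantor (snd (zoom x A B k)) \<and> x \<in> fst (zoom x A B k)"
proof (induction k)
  case (Suc k)
  then have c: "cantor (fst (zoom x A B k))" "cantor (snd (zoom x A B k))" "x \<in> fst (zoom x A B k)" by auto
  show ?case using halves(1-3)[OF c(1)] halves(1-2)[OF c(2)] c(3) unfolding zoom_Suc by auto
qed (use assms in simp)

text \<open>Compactness gives a point in all the sets, and halving at the widest gaps leaves no room for a
  second one.\<close>
lemma zoom_limit:
  assumes "cantor A" "cantor B" "x \<in> A"
  shows "\<exists>!y. \<forall>k. y \<in> snd (zoom x A B k)"
proof -
  let ?N = "\<lambda>k. snd (zoom x A B k)"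
  have c: "cantor (?N k)" for k using zoom_props[OF assms] by auto
  have s: "?N (Suc k) = left_half (?N k) \<or> ?N (Suc k) = right_half (?N k)" for k
    unfolding zoom_Suc by auto
  have sub: "?N (Suc k) \<subseteq> ?N k" for k using s[of k] halves(5,6)[OF c[of k]] by fastforce
  have "?N m \<subseteq> ?N k" if "k \<le> m" for k m by (rule lift_Suc_antimono_le[of ?N, OF sub that])
  then have "\<Inter>(range ?N) \<noteq> {}"
    using c by (intro compact_nest) (auto simp: cantor_def)
  then obtain y where y: "\<And>k. y \<in> ?N k" by auto
  show ?thesis
  proof (rule ex1I[of _ y])
    show "\<forall>k. y \<in> ?N k" using y by simp
    show "z = y" if "\<forall>k. z \<in> ?N k" for z
      by (rule nested_halves_unique[of ?N, OF c s]) (use that y in simp_all)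
  qed
qed

lemma zoom_same:
  assumes "\<And>j. j < k \<Longrightarrow> (x \<in> left_half (fst (zoom x A B j))) = (y \<in> left_half (fst (zoom x A B j)))"
  shows "zoom x A B k = zoom y A B k"
  using assms
proof (induction k)
  case (Suc k)
  then have "zoom x A B k = zoom y A B k" by auto
  then show ?case using Suc.prems[of k] by (simp add: case_prod_beta Let_def)
qed simp

text \<open>Repeated halving at the widest gap codes the points of a Cantor set by the sequences of choices
  between left and right. Every sequence occurs, different points have different sequences, and
  the order of the points is the lexicographic order of the sequences. None of this depends on the
  set.\<close>
theorem cantor_oiso:
  assumes A: "cantor A" and B: "cantor B"
  shows "\<exists>\<phi>. oiso A B \<phi>"
proof -
  define \<phi> where "\<phi> x = (THE y. \<forall>k. y \<in> snd (zoom x A B k))" for x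
  have \<phi>: "\<phi> x \<in> snd (zoom x A B k)" if "x \<in> A" for x k
    using theI'[OF zoom_limit[OF A B that]] unfolding \<phi>_def by auto
  have "\<phi> x < \<phi> y" if xy: "x \<in> A" "y \<in> A" "x < y" for x y
  proof -
    let ?D = "\<lambda>k. (x \<in> left_half (fst (zoom x A B k))) \<noteq> (y \<in> left_half (fst (zoom x A B k)))"
    have "\<exists>k. ?D k"
    proof (rule ccontr)
      assume "\<nexists>k. ?D k"
      then have eq: "zoom x A B k = zoom y A B k" for k using zoom_same by blast
      let ?N = "\<lambda>k. fst (zoom x A B k)"
      have "x = y"
      proof (rule nested_halves_unique[of ?N])
        show "cantor (?N k)" "x \<in> ?N k" for k using zoom_props[OF A B xy(1)] by auto
        show "y \<in> ?N k" for k using zoom_props[OF A B xy(2)] eq by auto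
        show "?N (Suc k) = left_half (?N k) \<or> ?N (Suc k) = right_half (?N k)" for k
          unfolding zoom_Suc by auto
      qed
      then show False using xy by auto
    qed
    then obtain k where k: "?D k" "\<And>j. j < k \<Longrightarrow> \<not> ?D j" using exists_least_iff[of ?D] by blast
    have eq: "zoom x A B k = zoom y A B k" using zoom_same[of k x A B y] k(2) by blast
    let ?P = "fst (zoom x A B k)" let ?Q = "snd (zoom x A B k)"
    have c: "cantor ?P" "cantor ?Q" "x \<in> ?P" "y \<in> ?P"
      using zoom_props[OF A B xy(1), of k] zoom_props[OF A B xy(2), of k] eq by auto
    have xl: "x \<in> left_half ?P" "y \<notin> left_half ?P"
      using k(1) halves(3,4)[OF c(1)] c(3,4) xy(3) by (metis UnE less_asym)+
    have "\<phi> x \<in> left_half ?Q" "\<phi> y \<in> right_half ?Q"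
      using \<phi>[OF xy(1), of "Suc k"] \<phi>[OF xy(2), of "Suc k"] xl eq unfolding zoom_Suc by auto
    then show ?thesis using halves(4)[OF c(2)] by auto
  qed
  then have mono: "strict_mono_on A \<phi>" by (auto simp: strict_mono_on_def)
  have "\<phi> x \<in> B" if "x \<in> A" for x using \<phi>[OF that, of 0] by auto
  moreover have "y \<in> \<phi> ` A" if yB: "y \<in> B" for y
  proof -
    obtain x where x: "\<And>k. x \<in> snd (zoom y B A k)" using zoom_limit[OF B A yB] by blast
    have "x \<in> A" using x[of 0] by auto
    have "zoom x A B k = prod.swap (zoom y B A k)" for k
    proof (induction k)
      case (Suc k)
      let ?P = "snd (zoom y B A k)" let ?Q = "fst (zoom y B A k)"
      have c: "cantor ?P" using zoom_props[OF B A yB] by auto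
      have "x \<in> left_half ?P \<longleftrightarrow> y \<in> left_half ?Q"
        using x[of "Suc k"] halves(4)[OF c, of x x] unfolding zoom_Suc by (auto split: if_splits)
      then show ?case using Suc.IH by (cases "zoom y B A k") (simp add: Let_def)
    qed simp
    then have "\<forall>k. y \<in> snd (zoom x A B k)" using zoom_props[OF B A yB] by auto
    then have "\<phi> x = y" using \<phi>[OF \<open>x \<in> A\<close>] zoom_limit[OF A B \<open>x \<in> A\<close>] by blast
    then show ?thesis using \<open>x \<in> A\<close> by blast
  qed
  ultimately show ?thesis using mono unfolding oiso_def by blast
qed

section \<open>Extending maps across gaps\<close>

text \<open>A compact set \<open>A\<close> together with arcs that fill its gaps. An arc is listed once for each of its
  two directions, and is determined by its ordered pair of end points; only finitely many arcs are
  large, so the arcs accumulate only at \<open>A\<close>.\<close>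
definition gap_system :: "'a::metric_space set \<Rightarrow> (real \<Rightarrow> 'a) set \<Rightarrow> bool"
  where "gap_system A \<Gamma> \<longleftrightarrow> compact A \<and>
    (\<forall>\<gamma>\<in>\<Gamma>. continuous_on {0..1} \<gamma> \<and> inj_on \<gamma> {0..1} \<and> \<gamma> 0 \<in> A \<and> \<gamma> 1 \<in> A \<and>
       (\<forall>t\<in>{0<..<1}. \<gamma> t \<notin> A) \<and> (\<lambda>t. \<gamma> (1 - t)) \<in> \<Gamma>) \<and>
    (\<forall>\<gamma>\<in>\<Gamma>. \<forall>\<gamma>'\<in>\<Gamma>. \<forall>s\<in>{0<..<1}. \<forall>t\<in>{0<..<1}. \<gamma> s = \<gamma>' t \<longrightarrow>
       (\<gamma>' = \<gamma> \<and> t = s) \<or> (\<gamma>' = (\<lambda>t. \<gamma> (1 - t)) \<and> t = 1 - s)) \<and>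
    (\<forall>\<gamma>\<in>\<Gamma>. \<forall>\<gamma>'\<in>\<Gamma>. \<gamma> 0 = \<gamma>' 0 \<and> \<gamma> 1 = \<gamma>' 1 \<longrightarrow> \<gamma> = \<gamma>') \<and>
    (\<forall>\<epsilon>>0. finite {\<gamma>\<in>\<Gamma>. \<exists>t\<in>{0..1}. \<epsilon> \<le> dist (\<gamma> 0) (\<gamma> t)})"

definition filled :: "'a set \<Rightarrow> (real \<Rightarrow> 'a) set \<Rightarrow> 'a set"
  where "filled A \<Gamma> = A \<union> (\<Union>\<gamma>\<in>\<Gamma>. \<gamma> ` {0..1})"

definition preserves_gaps :: "(real \<Rightarrow> 'a) set \<Rightarrow> (real \<Rightarrow> 'b) set \<Rightarrow> ('a \<Rightarrow> 'b) \<Rightarrow> bool"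
  where "preserves_gaps \<Gamma> \<Delta> g \<longleftrightarrow> (\<forall>\<gamma>\<in>\<Gamma>. \<exists>\<delta>\<in>\<Delta>. \<delta> 0 = g (\<gamma> 0) \<and> \<delta> 1 = g (\<gamma> 1))"

locale gap_map =
  fixes A :: "'a::metric_space set" and \<Gamma> and B :: "'b::metric_space set" and \<Delta> and g
  assumes dom: "gap_system A \<Gamma>" and cod: "gap_system B \<Delta>"
    and cont: "continuous_on A g" and inj: "inj_on g A" and into: "g ` A \<subseteq> B"
    and pres: "preserves_gaps \<Gamma> \<Delta> g"
begin

lemma dom_arc:
  assumes "\<gamma> \<in> \<Gamma>"
  shows "continuous_on {0..1} \<gamma>" "inj_on \<gamma> {0..1}" "\<gamma> 0 \<in> A" "\<gamma> 1 \<in> A" "(\<lambda>t. \<gamma> (1 - t)) \<in> \<Gamma>"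
    "\<And>t. 0 < t \<Longrightarrow> t < 1 \<Longrightarrow> \<gamma> t \<notin> A"
  using dom assms unfolding gap_system_def by auto

lemma cod_arc:
  assumes "\<gamma> \<in> \<Delta>"
  shows "continuous_on {0..1} \<gamma>" "inj_on \<gamma> {0..1}" "\<gamma> 0 \<in> B" "\<gamma> 1 \<in> B" "(\<lambda>t. \<gamma> (1 - t)) \<in> \<Delta>"
    "\<And>t. 0 < t \<Longrightarrow> t < 1 \<Longrightarrow> \<gamma> t \<notin> B"
  using cod assms unfolding gap_system_def by auto

lemma dom_ends: "\<gamma> \<in> \<Gamma> \<Longrightarrow> \<gamma>' \<in> \<Gamma> \<Longrightarrow> \<gamma> 0 = \<gamma>' 0 \<Longrightarrow> \<gamma> 1 = \<gamma>' 1 \<Longrightarrow> \<gamma> = \<gamma>'"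
  using dom unfolding gap_system_def by blast

lemma cod_ends: "\<gamma> \<in> \<Delta> \<Longrightarrow> \<gamma>' \<in> \<Delta> \<Longrightarrow> \<gamma> 0 = \<gamma>' 0 \<Longrightarrow> \<gamma> 1 = \<gamma>' 1 \<Longrightarrow> \<gamma> = \<gamma>'"
  using cod unfolding gap_system_def by blast

lemma dom_meet:
  "\<gamma> \<in> \<Gamma> \<Longrightarrow> \<gamma>' \<in> \<Gamma> \<Longrightarrow> 0 < s \<Longrightarrow> s < 1 \<Longrightarrow> 0 < t \<Longrightarrow> t < 1 \<Longrightarrow> \<gamma> s = \<gamma>' t \<Longrightarrow>
     (\<gamma>' = \<gamma> \<and> t = s) \<or> (\<gamma>' = (\<lambda>t. \<gamma> (1 - t)) \<and> t = 1 - s)"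
proof -
  assume h: "\<gamma> \<in> \<Gamma>" "\<gamma>' \<in> \<Gamma>" "0 < s" "s < 1" "0 < t" "t < 1" "\<gamma> s = \<gamma>' t"
  have "\<forall>\<gamma>\<in>\<Gamma>. \<forall>\<gamma>'\<in>\<Gamma>. \<forall>s\<in>{0<..<1}. \<forall>t\<in>{0<..<1}. \<gamma> s = \<gamma>' t \<longrightarrow>
       (\<gamma>' = \<gamma> \<and> t = s) \<or> (\<gamma>' = (\<lambda>t. \<gamma> (1 - t)) \<and> t = 1 - s)"
    using dom unfolding gap_system_def by (elim conjE)
  from bspec[OF bspec[OF bspec[OF bspec[OF this h(1)] h(2)], of s], of t] h(3-)
  show ?thesis by simp
qed

lemma cod_meet:
  "\<gamma> \<in> \<Delta> \<Longrightarrow> \<gamma>' \<in> \<Delta> \<Longrightarrow> 0 < s \<Longrightarrow> s < 1 \<Longrightarrow> 0 < t \<Longrightarrow> t < 1 \<Longrightarrow> \<gamma> s = \<gamma>' t \<Longrightarrow>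
     (\<gamma>' = \<gamma> \<and> t = s) \<or> (\<gamma>' = (\<lambda>t. \<gamma> (1 - t)) \<and> t = 1 - s)"
proof -
  assume h: "\<gamma> \<in> \<Delta>" "\<gamma>' \<in> \<Delta>" "0 < s" "s < 1" "0 < t" "t < 1" "\<gamma> s = \<gamma>' t"
  have "\<forall>\<gamma>\<in>\<Delta>. \<forall>\<gamma>'\<in>\<Delta>. \<forall>s\<in>{0<..<1}. \<forall>t\<in>{0<..<1}. \<gamma> s = \<gamma>' t \<longrightarrow>
       (\<gamma>' = \<gamma> \<and> t = s) \<or> (\<gamma>' = (\<lambda>t. \<gamma> (1 - t)) \<and> t = 1 - s)"
    using cod unfolding gap_system_def by (elim conjE)
  from bspec[OF bspec[OF bspec[OF bspec[OF this h(1)] h(2)], of s], of t] h(3-)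
  show ?thesis by simp
qed

definition arc_image :: "(real \<Rightarrow> 'a) \<Rightarrow> real \<Rightarrow> 'b"
  where "arc_image \<gamma> = (SOME \<delta>. \<delta> \<in> \<Delta> \<and> \<delta> 0 = g (\<gamma> 0) \<and> \<delta> 1 = g (\<gamma> 1))"

lemma arc_image:
  assumes "\<gamma> \<in> \<Gamma>"
  shows "arc_image \<gamma> \<in> \<Delta>" "arc_image \<gamma> 0 = g (\<gamma> 0)" "arc_image \<gamma> 1 = g (\<gamma> 1)"
proof -
  have "\<exists>\<delta>. \<delta> \<in> \<Delta> \<and> \<delta> 0 = g (\<gamma> 0) \<and> \<delta> 1 = g (\<gamma> 1)"
    using pres assms unfolding preserves_gaps_def by blast
  from someI_ex[OF this] show "arc_image \<gamma> \<in> \<Delta>" "arc_image \<gamma> 0 = g (\<gamma> 0)" "arc_image \<gamma> 1 = g (\<gamma> 1)"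
    unfolding arc_image_def by blast+
qed

lemma arc_image_rev:
  assumes "\<gamma> \<in> \<Gamma>" shows "arc_image (\<lambda>t. \<gamma> (1 - t)) = (\<lambda>t. arc_image \<gamma> (1 - t))"
  using arc_image[OF assms] arc_image[OF dom_arc(5)[OF assms]]
  by (intro cod_ends cod_arc(5)) auto

lemma arc_image_inj: "inj_on arc_image \<Gamma>"
proof (rule inj_onI)
  fix \<gamma> \<gamma>' assume h: "\<gamma> \<in> \<Gamma>" "\<gamma>' \<in> \<Gamma>" "arc_image \<gamma> = arc_image \<gamma>'"
  then have "g (\<gamma> 0) = g (\<gamma>' 0)" "g (\<gamma> 1) = g (\<gamma>' 1)" using arc_image by metis+
  then have "\<gamma> 0 = \<gamma>' 0" "\<gamma> 1 = \<gamma>' 1" using inj dom_arc(3,4) h by (auto dest: inj_onD)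
  then show "\<gamma> = \<gamma>'" using dom_ends h by auto
qed

definition extension :: "'a \<Rightarrow> 'b"
  where "extension x = (if x \<in> A then g x else
    (case SOME (\<gamma>, t). \<gamma> \<in> \<Gamma> \<and> 0 < t \<and> t < 1 \<and> \<gamma> t = x of (\<gamma>, t) \<Rightarrow> arc_image \<gamma> t))"

lemma extension_base: "x \<in> A \<Longrightarrow> extension x = g x"
  by (simp add: extension_def)

text \<open>A point outside \<open>A\<close> lies on only one arc up to reversal, and the image of a
  reversed arc is the reversed image, so the choice in the definition is immaterial.\<close>
lemma extension_arc:
  assumes "\<gamma> \<in> \<Gamma>" "0 \<le> t" "t \<le> 1"
  shows "extension (\<gamma> t) = arc_image \<gamma> t"
proof -
  consider "t = 0" | "t = 1" | "0 < t" "t < 1" using assms by linarith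
  then show ?thesis
  proof cases
    case 3
    let ?P = "\<lambda>(\<gamma>', s). \<gamma>' \<in> \<Gamma> \<and> 0 < s \<and> s < 1 \<and> \<gamma>' s = \<gamma> t"
    have "?P (\<gamma>, t)" using assms 3 by simp
    then have "?P (SOME p. ?P p)" by (rule someI)
    moreover obtain \<gamma>' s where ps: "(SOME p. ?P p) = (\<gamma>', s)" by (cases "SOME p. ?P p")
    ultimately have s: "\<gamma>' \<in> \<Gamma>" "0 < s" "s < 1" "\<gamma> t = \<gamma>' s" by auto
    have "extension (\<gamma> t) = (case SOME p. ?P p of (\<gamma>, t) \<Rightarrow> arc_image \<gamma> t)"
      unfolding extension_def using dom_arc(6)[OF assms(1) 3] by (rule if_not_P)
    also have "\<dots> = arc_image \<gamma>' s" unfolding ps by (rule prod.case)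
    also have "\<dots> = arc_image \<gamma> t"
      using dom_meet[OF assms(1) s(1) 3 s(2,3,4)] arc_image_rev[OF assms(1)] by auto
    finally show ?thesis .
  qed (use extension_base dom_arc arc_image assms in auto)
qed

text \<open>Near a point \<open>x\<close>, all but finitely many arcs are small together with their images; a point on
  such an arc is treated like the nearby end point of the arc, which belongs to \<open>A\<close>. The union of \<open>A\<close>
  with the other arcs is a finite union of closed sets on each of which the extension is continuous.\<close>
lemma extension_continuous: "continuous_on (filled A \<Gamma>) extension"
  unfolding continuous_on_iff
proof (intro ballI allI impI)
  fix x and e :: real assume x: "x \<in> filled A \<Gamma>" and e: "0 < e"
  have cA: "closed A" using dom compact_imp_closed unfolding gap_system_def by blast
  obtain d where d: "d > 0"
    "\<And>p. p \<in> A \<Longrightarrow> dist p x < d \<Longrightarrow> x \<in> A \<and> dist (g p) (g x) < e / 2"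
  proof (cases "x \<in> A")
    case True
    have "0 < e / 2" using e by simp
    then obtain d where "d > 0" "\<forall>p\<in>A. dist p x < d \<longrightarrow> dist (g p) (g x) < e / 2"
      using cont True unfolding continuous_on_iff by blast
    then show ?thesis using that[of d] True by auto
  next
    case False
    have "open (- A)" using cA by (simp add: open_Compl)
    then obtain d where "d > 0" "\<forall>y. dist y x < d \<longrightarrow> y \<in> - A"
      using False unfolding open_dist by blast
    then show ?thesis using that[of d] by auto
  qed
  define F where "F = {\<gamma>\<in>\<Gamma>. \<exists>t\<in>{0..1}. d / 2 \<le> dist (\<gamma> 0) (\<gamma> t)} \<union>
     {\<gamma>\<in>\<Gamma>. \<exists>t\<in>{0..1}. e / 2 \<le> dist (arc_image \<gamma> 0) (arc_image \<gamma> t)}"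
  have F_sub: "F \<subseteq> \<Gamma>" by (auto simp: F_def)
  have finF: "finite F"
  proof -
    have "finite {\<gamma>\<in>\<Gamma>. \<exists>t\<in>{0..1}. d / 2 \<le> dist (\<gamma> 0) (\<gamma> t)}"
      using dom d(1) unfolding gap_system_def by (meson half_gt_zero)
    moreover have "finite {\<gamma>\<in>\<Gamma>. \<exists>t\<in>{0..1}. e / 2 \<le> dist (arc_image \<gamma> 0) (arc_image \<gamma> t)}" (is "finite ?E")
    proof (rule inj_on_finite[of arc_image _ "{\<gamma>\<in>\<Delta>. \<exists>t\<in>{0..1}. e / 2 \<le> dist (\<gamma> 0) (\<gamma> t)}"])
      show "inj_on arc_image ?E" using arc_image_inj by (rule inj_on_subset) auto
      show "arc_image ` ?E \<subseteq> {\<gamma>\<in>\<Delta>. \<exists>t\<in>{0..1}. e / 2 \<le> dist (\<gamma> 0) (\<gamma> t)}"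
        using arc_image(1) by auto
      show "finite {\<gamma>\<in>\<Delta>. \<exists>t\<in>{0..1}. e / 2 \<le> dist (\<gamma> 0) (\<gamma> t)}"
        using cod e unfolding gap_system_def by (meson half_gt_zero)
    qed
    ultimately show ?thesis by (simp add: F_def)
  qed
  define U where "U = A \<union> (\<Union>\<gamma>\<in>F. \<gamma> ` {0..1})"
  have cl: "closed (\<gamma> ` {0..1})" if "\<gamma> \<in> F" for \<gamma>
    using that F_sub dom_arc(1)[of \<gamma>] by (auto intro!: compact_imp_closed compact_continuous_image)
  have cont_arc: "continuous_on (\<gamma> ` {0..1}) extension" if "\<gamma> \<in> F" for \<gamma>
  proof -
    have G: "\<gamma> \<in> \<Gamma>" using that F_sub by auto
    let ?i = "the_inv_into {0..1} \<gamma>"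
    have "continuous_on (\<gamma> ` {0..1}) ?i"
      by (rule continuous_on_inv_into[OF dom_arc(1)[OF G] compact_Icc dom_arc(2)[OF G]])
    moreover have "?i ` \<gamma> ` {0..1} \<subseteq> {0..1}"
      using the_inv_into_onto[OF dom_arc(2)[OF G]] by simp
    ultimately have "continuous_on (\<gamma> ` {0..1}) (\<lambda>y. arc_image \<gamma> (?i y))"
      by (rule continuous_on_compose2[OF cod_arc(1)[OF arc_image(1)[OF G]]])
    moreover have "extension y = arc_image \<gamma> (?i y)" if y: "y \<in> \<gamma> ` {0..1}" for y
    proof -
      obtain t where "t \<in> {0..1}" "y = \<gamma> t" using y by blast
      then show ?thesis using extension_arc[OF G] dom_arc(2)[OF G] by (simp add: the_inv_into_f_f)
    qed
    ultimately show ?thesis by (simp cong: continuous_on_cong)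
  qed
  have cU: "closed U" using cA cl finF by (simp add: U_def closed_Un closed_UN)
  have contU: "continuous_on U extension"
    unfolding U_def
  proof (rule continuous_on_closed_Un)
    show "continuous_on A extension" using cont by (simp cong: continuous_on_cong add: extension_base)
    show "continuous_on (\<Union>\<gamma>\<in>F. \<gamma> ` {0..1}) extension"
      by (rule continuous_on_closed_Union) (use finF cl cont_arc in auto)
  qed (use cA cl finF in \<open>simp_all add: closed_UN\<close>)
  obtain d' where d': "d' > 0" "\<And>z. z \<in> U \<Longrightarrow> dist z x < d' \<Longrightarrow> dist (extension z) (extension x) < e"
  proof (cases "x \<in> U")
    case True
    then show ?thesis using contU e that unfolding continuous_on_iff by meson
  next
    case False
    have "open (- U)" using cU by (simp add: open_Compl)
    then obtain d where "d > 0" "\<forall>y. dist y x < d \<longrightarrow> y \<in> - U"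
      using False unfolding open_dist by blast
    then show ?thesis using that[of d] by auto
  qed
  show "\<exists>d>0. \<forall>z\<in>filled A \<Gamma>. dist z x < d \<longrightarrow> dist (extension z) (extension x) < e"
  proof (intro exI[of _ "min (d / 2) d'"] conjI ballI impI)
    show "0 < min (d / 2) d'" using d d' by simp
    fix z assume z: "z \<in> filled A \<Gamma>" "dist z x < min (d / 2) d'"
    show "dist (extension z) (extension x) < e"
    proof (cases "z \<in> U")
      case True then show ?thesis using z d' by simp
    next
      case False
      then obtain \<gamma> t where g: "\<gamma> \<in> \<Gamma>" "\<gamma> \<notin> F" "t \<in> {0..1}" "z = \<gamma> t"
        using z(1) unfolding filled_def U_def by blast
      have 1: "dist (\<gamma> 0) z < d / 2" "dist (arc_image \<gamma> 0) (arc_image \<gamma> t) < e / 2"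
        using g unfolding F_def by (auto simp: not_le)
      have "dist (\<gamma> 0) x < d" using 1(1) z(2) dist_triangle[of "\<gamma> 0" x z] by simp
      then have 2: "x \<in> A" "dist (g (\<gamma> 0)) (g x) < e / 2" using d(2) dom_arc(3)[OF g(1)] by auto
      have "extension z = arc_image \<gamma> t" "extension x = g x"
        using extension_arc g extension_base 2 by auto
      then show ?thesis using 1(2) 2(2) arc_image(2)[OF g(1)]
          dist_triangle3[of "arc_image \<gamma> t" "g x" "g (\<gamma> 0)"] by simp
    qed
  qed
qed

lemma filled_cases:
  assumes "x \<in> filled A \<Gamma>"
  obtains "x \<in> A" | \<gamma> t where "\<gamma> \<in> \<Gamma>" "0 < t" "t < 1" "x = \<gamma> t"
proof -
  have "\<exists>\<gamma>\<in>\<Gamma>. \<exists>t. 0 < t \<and> t < 1 \<and> x = \<gamma> t" if "x \<notin> A"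
  proof -
    obtain \<gamma> t where t: "\<gamma> \<in> \<Gamma>" "t \<in> {0..1}" "x = \<gamma> t"
      using assms \<open>x \<notin> A\<close> unfolding filled_def by blast
    have "t \<noteq> 0" "t \<noteq> 1" using t dom_arc(3,4)[OF t(1)] \<open>x \<notin> A\<close> by metis+
    then show ?thesis using t by (intro bexI[of _ \<gamma>] exI[of _ t]) auto
  qed
  then show ?thesis using that by blast
qed

lemma extension_off: "x \<in> filled A \<Gamma> \<Longrightarrow> x \<notin> A \<Longrightarrow> extension x \<notin> B"
  by (erule filled_cases) (use extension_arc arc_image(1) cod_arc(6) in auto)

lemma extension_inj: "inj_on extension (filled A \<Gamma>)"
proof (rule inj_onI)
  fix x y assume h: "x \<in> filled A \<Gamma>" "y \<in> filled A \<Gamma>" "extension x = extension y"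
  have base: "extension z \<in> B" if "z \<in> A" for z using that into extension_base by auto
  show "x = y"
  proof (cases "x \<in> A")
    case True
    then have "y \<in> A" using base[of x] extension_off[OF h(2)] h(3) by auto
    then show ?thesis using True h(3) inj by (auto simp: extension_base dest: inj_onD)
  next
    case False
    then have "y \<notin> A" using base[of y] extension_off[OF h(1)] h(3) by auto
    obtain \<gamma> s where s: "\<gamma> \<in> \<Gamma>" "0 < s" "s < 1" "x = \<gamma> s" using filled_cases[OF h(1)] False by metis
    obtain \<gamma>' t where t: "\<gamma>' \<in> \<Gamma>" "0 < t" "t < 1" "y = \<gamma>' t" using filled_cases[OF h(2)] \<open>y \<notin> A\<close> by metis
    have "arc_image \<gamma> s = arc_image \<gamma>' t" using h(3) s t extension_arc by simp
    from cod_meet[OF arc_image(1)[OF s(1)] arc_image(1)[OF t(1)] s(2,3) t(2,3) this]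
    show ?thesis
    proof
      assume a: "arc_image \<gamma>' = arc_image \<gamma> \<and> t = s"
      then have "\<gamma>' = \<gamma>" using arc_image_inj s t by (auto dest: inj_onD)
      then show ?thesis using a s t by simp
    next
      assume a: "arc_image \<gamma>' = (\<lambda>t. arc_image \<gamma> (1 - t)) \<and> t = 1 - s"
      then have "arc_image \<gamma>' = arc_image (\<lambda>t. \<gamma> (1 - t))" using arc_image_rev[OF s(1)] by simp
      then have "\<gamma>' = (\<lambda>t. \<gamma> (1 - t))" using arc_image_inj t dom_arc(5)[OF s(1)] by (auto dest: inj_onD)
      then show ?thesis using a s t by simp
    qed
  qed
qed

lemma extension_into: "extension ` filled A \<Gamma> \<subseteq> filled B \<Delta>"
proof
  fix y assume "y \<in> extension ` filled A \<Gamma>"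
  then obtain x where x: "x \<in> filled A \<Gamma>" "y = extension x" by auto
  from x(1) show "y \<in> filled B \<Delta>"
  proof (cases rule: filled_cases)
    case 1 then show ?thesis using x(2) into extension_base by (auto simp: filled_def)
  next
    case (2 \<gamma> t)
    then have "y = arc_image \<gamma> t" using x(2) extension_arc by simp
    moreover have "t \<in> {0..1}" using 2 by simp
    ultimately show ?thesis using arc_image(1)[OF 2(1)] unfolding filled_def by blast
  qed
qed

end

text \<open>The extensions of \<open>g\<close> and \<open>g'\<close> are continuous and carry the arcs back
  and forth with the same parameter, so they are inverse to each other.\<close>
theorem gap_homeomorphism_extends:
  assumes A: "gap_system A \<Gamma>" and B: "gap_system B \<Delta>" and g: "homeomorphism A B g g'"
    and p: "preserves_gaps \<Gamma> \<Delta> g" "preserves_gaps \<Delta> \<Gamma> g'"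
  shows "\<exists>G G'. homeomorphism (filled A \<Gamma>) (filled B \<Delta>) G G' \<and> (\<forall>x\<in>A. G x = g x)"
proof -
  have gg: "\<And>x. x \<in> A \<Longrightarrow> g' (g x) = x" "\<And>y. y \<in> B \<Longrightarrow> g (g' y) = y" "g ` A = B" "g' ` B = A"
    "continuous_on A g" "continuous_on B g'"
    using g unfolding homeomorphism_def by auto
  interpret f: gap_map A \<Gamma> B \<Delta> g
    by unfold_locales (use A B gg p in \<open>auto intro: inj_on_inverseI\<close>)
  interpret b: gap_map B \<Delta> A \<Gamma> g'
    by unfold_locales (use A B gg p in \<open>auto intro: inj_on_inverseI\<close>)
  have 1: "b.extension (f.extension x) = x" if "x \<in> filled A \<Gamma>" for x
    using that
  proof (cases rule: f.filled_cases)
    case 1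
    then have "g x \<in> B" using gg(3) by blast
    then show ?thesis using gg 1 f.extension_base b.extension_base by metis
  next
    case (2 \<gamma> t)
    have "b.arc_image (f.arc_image \<gamma>) = \<gamma>"
      using f.arc_image[OF 2(1)] b.arc_image[OF f.arc_image(1)[OF 2(1)]] f.dom_arc(3,4)[OF 2(1)] 2(1) gg
      by (intro f.dom_ends) auto
    then show ?thesis using 2 f.extension_arc b.extension_arc[OF f.arc_image(1)[OF 2(1)]] by simp
  qed
  have 2: "f.extension (b.extension x) = x" if "x \<in> filled B \<Delta>" for x
    using that
  proof (cases rule: b.filled_cases)
    case 1
    then have "g' x \<in> A" using gg(4) by blast
    then show ?thesis using gg 1 f.extension_base b.extension_base by metis
  next
    case (2 \<gamma> t)
    have "f.arc_image (b.arc_image \<gamma>) = \<gamma>"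
      using b.arc_image[OF 2(1)] f.arc_image[OF b.arc_image(1)[OF 2(1)]] b.dom_arc(3,4)[OF 2(1)] 2(1) gg
      by (intro b.dom_ends) auto
    then show ?thesis using 2 b.extension_arc f.extension_arc[OF b.arc_image(1)[OF 2(1)]] by simp
  qed
  have "homeomorphism (filled A \<Gamma>) (filled B \<Delta>) f.extension b.extension"
    by (rule homeomorphismI) (use f.extension_continuous b.extension_continuous f.extension_into b.extension_into 1 2 in auto)
  then show ?thesis using f.extension_base by blast
qed

subsection \<open>Arcs between consecutive points of the line\<close>

definition seg :: "real \<Rightarrow> real \<Rightarrow> real \<Rightarrow> real" where "seg p q t = p + t * (q - p)"

definition segs :: "real set \<Rightarrow> (real \<Rightarrow> real) set"
  where "segs A = {seg p q | p q. consec A p q \<or> consec A q p}"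

lemma seg_ends [simp]: "seg p q 0 = p" "seg p q 1 = q"
  by (simp_all add: seg_def)

lemma seg_rev: "(\<lambda>t. seg p q (1 - t)) = seg q p"
  by (rule ext) (simp add: seg_def algebra_simps)

lemma seg_between:
  assumes "0 < t" "t < 1" "p \<noteq> q" shows "min p q < seg p q t" "seg p q t < max p q"
proof -
  have "seg p q t = (1 - t) * p + t * q" by (simp add: seg_def algebra_simps)
  moreover have "(1 - t) * p < (1 - t) * q \<or> (1 - t) * q < (1 - t) * p" using assms by auto
  moreover have "p < q \<Longrightarrow> t * p < t * q" "q < p \<Longrightarrow> t * q < t * p" using assms by auto
  moreover have "p < q \<Longrightarrow> (1 - t) * p < (1 - t) * q" "q < p \<Longrightarrow> (1 - t) * q < (1 - t) * p" using assms by auto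
  ultimately show "min p q < seg p q t" "seg p q t < max p q"
    using assms(3) by (auto simp: min_def max_def algebra_simps)
qed

lemma seg_inj: "p \<noteq> q \<Longrightarrow> inj (seg p q)"
  by (auto simp: inj_def seg_def)

lemma seg_dist: "0 \<le> t \<Longrightarrow> t \<le> 1 \<Longrightarrow> \<bar>seg p q t - p\<bar> \<le> \<bar>q - p\<bar>"
  using mult_right_mono[of t 1 "\<bar>q - p\<bar>"] by (simp add: seg_def abs_mult)

lemma seg_continuous: "continuous_on S (seg p q)"
  unfolding seg_def by (intro continuous_intros)

text \<open>On the line the gaps are filled linearly.\<close>
lemma segs_gap_system:
  assumes A: "compact A" shows "gap_system A (segs A)"
  unfolding gap_system_def
proof (intro conjI ballI allI impI)
  show "compact A" by (rule A)
next
  fix \<gamma> assume "\<gamma> \<in> segs A"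
  then obtain p q where g: "\<gamma> = seg p q" "consec A p q \<or> consec A q p" by (auto simp: segs_def)
  then have pq: "p \<noteq> q" "p \<in> A" "q \<in> A" unfolding consec_def by auto
  show "continuous_on {0..1} \<gamma>" "\<gamma> 0 \<in> A" "\<gamma> 1 \<in> A" using g pq seg_continuous by auto
  show "inj_on \<gamma> {0..1}" using seg_inj pq g by (auto intro: inj_on_subset)
  show "(\<lambda>t. \<gamma> (1 - t)) \<in> segs A" unfolding g(1) seg_rev using g(2) by (auto simp: segs_def)
  fix t :: real assume t: "t \<in> {0<..<1}"
  have b: "min p q < \<gamma> t" "\<gamma> t < max p q" using seg_between[of t p q] t pq(1) g(1) by auto
  show "\<gamma> t \<notin> A"
    using g(2)
  proof
    assume c: "consec A p q"
    then show ?thesis using b consecD(3)[OF c] consecD(4)[OF c, of "\<gamma> t"] by auto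
  next
    assume c: "consec A q p"
    then show ?thesis using b consecD(3)[OF c] consecD(4)[OF c, of "\<gamma> t"] by auto
  qed
next
  fix \<gamma> \<gamma>' and s t :: real
  assume h: "\<gamma> \<in> segs A" "\<gamma>' \<in> segs A" "s \<in> {0<..<1}" "t \<in> {0<..<1}" "\<gamma> s = \<gamma>' t"
  obtain p q where g: "\<gamma> = seg p q" "consec A p q \<or> consec A q p" using h(1) by (auto simp: segs_def)
  obtain p' q' where g': "\<gamma>' = seg p' q'" "consec A p' q' \<or> consec A q' p'" using h(2) by (auto simp: segs_def)
  have ne: "p \<noteq> q" "p' \<noteq> q'" using g g' unfolding consec_def by auto
  have "consec A (min p q) (max p q)" "consec A (min p' q') (max p' q')"
    using g(2) g'(2) by (auto simp: min_def max_def dest: consecD(3))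
  moreover have "min p q < \<gamma> s" "\<gamma> s < max p q" "min p' q' < \<gamma> s" "\<gamma> s < max p' q'"
    using seg_between[of s p q] seg_between[of t p' q'] h g(1) g'(1) ne by auto
  ultimately have "min p q = min p' q'" "max p q = max p' q'"
    using consec_point_unique by blast+
  then have "(p' = p \<and> q' = q) \<or> (p' = q \<and> q' = p)" by (auto simp: min_def max_def split: if_splits)
  then show "\<gamma>' = \<gamma> \<and> t = s \<or> \<gamma>' = (\<lambda>t. \<gamma> (1 - t)) \<and> t = 1 - s"
  proof
    assume "p' = p \<and> q' = q"
    then show ?thesis using g g' h(5) seg_inj[OF ne(1)] by (auto dest: injD)
  next
    assume a: "p' = q \<and> q' = p"
    then have "seg q p (1 - s) = seg q p t" using g g' h(5) seg_rev[of q p] by (metis diff_diff_eq2 add_diff_cancel_left')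
    then have "t = 1 - s" using seg_inj[of q p] ne by (auto dest: injD)
    then show ?thesis unfolding g(1) g'(1) seg_rev using a by simp
  qed
next
  fix \<gamma> \<gamma>' assume "\<gamma> \<in> segs A" "\<gamma>' \<in> segs A" "\<gamma> 0 = \<gamma>' 0 \<and> \<gamma> 1 = \<gamma>' 1"
  then show "\<gamma> = \<gamma>'" by (auto simp: segs_def)
next
  fix \<epsilon> :: real assume e: "0 < \<epsilon>"
  let ?S = "{(a,b). consec A a b \<and> \<epsilon> \<le> b - a}"
  have "{\<gamma>\<in>segs A. \<exists>t\<in>{0..1}. \<epsilon> \<le> dist (\<gamma> 0) (\<gamma> t)} \<subseteq> (\<lambda>(p,q). seg p q) ` ?S \<union> (\<lambda>(p,q). seg q p) ` ?S"
  proof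
    fix \<gamma> assume "\<gamma> \<in> {\<gamma>\<in>segs A. \<exists>t\<in>{0..1}. \<epsilon> \<le> dist (\<gamma> 0) (\<gamma> t)}"
    then obtain p q t where g: "\<gamma> = seg p q" "consec A p q \<or> consec A q p" "0 \<le> t" "t \<le> 1"
      "\<epsilon> \<le> dist (seg p q 0) (seg p q t)" by (auto simp: segs_def)
    have "\<epsilon> \<le> \<bar>q - p\<bar>" using g(5) seg_dist[OF g(3,4), of p q] by (simp add: dist_real_def)
    then have "(p,q) \<in> ?S \<or> (q,p) \<in> ?S" using g(2) by (auto dest: consecD(3))
    then show "\<gamma> \<in> (\<lambda>(p,q). seg p q) ` ?S \<union> (\<lambda>(p,q). seg q p) ` ?S" using g(1) by force
  qed
  then show "finite {\<gamma>\<in>segs A. \<exists>t\<in>{0..1}. \<epsilon> \<le> dist (\<gamma> 0) (\<gamma> t)}"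
    by (rule finite_subset) (use finite_large_gaps[OF compact_imp_bounded[OF A] e] in simp)
qed

lemma filled_segs:
  assumes A: "compact A" and ab: "a \<in> A" "b \<in> A" "A \<subseteq> {a..b}"
  shows "filled A (segs A) = {a..b}"
proof
  show "filled A (segs A) \<subseteq> {a..b}"
  proof
    fix x assume "x \<in> filled A (segs A)"
    then consider "x \<in> A" | p q t where "consec A p q \<or> consec A q p" "t \<in> {0..1}" "x = seg p q t"
      unfolding filled_def segs_def by blast
    then show "x \<in> {a..b}"
    proof cases
      case 2
      then have pq: "p \<in> {a..b}" "q \<in> {a..b}" using ab consecD(1,2) by blast+
      have "t = 0 \<or> t = 1 \<or> (0 < t \<and> t < 1)" using 2(2) by force
      then show ?thesis using seg_between[of t p q] pq 2 consecD(3)[of A p q] consecD(3)[of A q p]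
        by (auto simp: min_def max_def split: if_splits)
    qed (use ab in auto)
  qed
  show "{a..b} \<subseteq> filled A (segs A)"
  proof
    fix x assume x: "x \<in> {a..b}"
    show "x \<in> filled A (segs A)"
    proof (cases "x \<in> A")
      case False
      then have "a < x" "x < b" using x ab by (auto simp: less_le)
      then obtain p q where pq: "consec A p q" "p < x" "x < q"
        using gap_around_point[OF compact_imp_closed[OF A] ab(1,2) _ _ False] by blast
      let ?t = "(x - p) / (q - p)"
      have "seg p q ?t = x" "0 \<le> ?t" "?t \<le> 1" using pq by (simp_all add: seg_def divide_simps)
      then have "x \<in> seg p q ` {0..1}" by (metis atLeastAtMost_iff imageI)
      then show ?thesis using pq(1) unfolding filled_def segs_def by blast
    qed (simp add: filled_def)
  qed
qed

text \<open>The extension across the gaps is continuous and injective on an interval, hence monotone, and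
  its image is an interval that meets \<open>N\<close> only in the image of \<open>A\<close>.\<close>
lemma gap_preserving_imp_monotone:
  assumes A: "compact A" and ab: "a \<in> A" "b \<in> A" "A \<subseteq> {a..b}" and N: "compact N"
    and g: "continuous_on A g" "inj_on g A" "g ` A \<subseteq> N"
    and gap: "\<And>p q. consec A p q \<Longrightarrow> consec N (g p) (g q) \<or> consec N (g q) (g p)"
  shows "strict_mono_on A g \<or> strict_mono_on A (\<lambda>x. - g x)"
    and "\<And>u v y. u \<in> A \<Longrightarrow> v \<in> A \<Longrightarrow> y \<in> N \<Longrightarrow> g u \<le> y \<Longrightarrow> y \<le> g v \<Longrightarrow> y \<in> g ` A"
proof -
  have pg: "preserves_gaps (segs A) (segs N) g"
    unfolding preserves_gaps_def
  proof
    fix \<gamma> assume "\<gamma> \<in> segs A"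
    then obtain p q where "\<gamma> = seg p q" "consec A p q \<or> consec A q p" by (auto simp: segs_def)
    then have "seg (g p) (g q) \<in> segs N" using gap[of p q] gap[of q p] unfolding segs_def by blast
    then show "\<exists>\<delta>\<in>segs N. \<delta> 0 = g (\<gamma> 0) \<and> \<delta> 1 = g (\<gamma> 1)"
      using \<open>\<gamma> = seg p q\<close> by (intro bexI[of _ "seg (g p) (g q)"]) auto
  qed
  interpret gap_map A "segs A" N "segs N" g
    by unfold_locales (use segs_gap_system A N g pg in auto)
  let ?G = extension
  have fill: "filled A (segs A) = {a..b}" using filled_segs A ab by blast
  have c: "continuous_on {a..b} ?G" and i: "inj_on ?G {a..b}"
    using extension_continuous extension_inj fill by auto
  have "strict_mono_on {a..b} ?G \<or> strict_antimono_on {a..b} ?G"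
    using c i injective_eq_monotone_map[of "{a..b}" ?G] by (simp add: is_interval_cc)
  then show "strict_mono_on A g \<or> strict_mono_on A (\<lambda>x. - g x)"
  proof
    assume h: "strict_mono_on {a..b} ?G"
    then have "strict_mono_on A ?G" using ab(3) by (rule monotone_on_subset)
    then have "strict_mono_on A g" by (simp add: monotone_on_def extension_base)
    then show ?thesis ..
  next
    assume h: "strict_antimono_on {a..b} ?G"
    then have "strict_antimono_on A ?G" using ab(3) by (rule monotone_on_subset)
    then have "strict_mono_on A (\<lambda>x. - g x)" by (simp add: monotone_on_def extension_base)
    then show ?thesis ..
  qed
  fix u v y assume h: "u \<in> A" "v \<in> A" "y \<in> N" "g u \<le> y" "y \<le> g v"
  have "connected (?G ` {a..b})" using c by (intro connected_continuous_image) auto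
  moreover have "g u \<in> ?G ` {a..b}" "g v \<in> ?G ` {a..b}" using h(1,2) ab(3) extension_base by (metis imageI subsetD)+
  ultimately have "y \<in> ?G ` {a..b}" using h(4,5) connected_contains_Icc[of "?G ` {a..b}" "g u" "g v"] by auto
  then obtain x where x: "x \<in> {a..b}" "y = ?G x" by auto
  then have "x \<in> A" using extension_off[of x] fill h(3) by auto
  then show "y \<in> g ` A" using x extension_base by auto
qed

section \<open>Locally monotone homeomorphisms of a Cantor set of reals\<close>

text \<open>The sign \<open>s\<close> is the local orientation of \<open>\<phi>\<close>.\<close>
definition locally_mono :: "real set \<Rightarrow> (real \<Rightarrow> real) \<Rightarrow> bool"
  where "locally_mono L \<phi> \<longleftrightarrow> (\<forall>x\<in>L. \<exists>\<delta>>0. \<exists>s\<in>{1,-1}. \<forall>y\<in>L. \<forall>z\<in>L.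
    \<bar>y - x\<bar> < \<delta> \<longrightarrow> \<bar>z - x\<bar> < \<delta> \<longrightarrow> y < z \<longrightarrow> s * \<phi> y < s * \<phi> z)"

text \<open>The elements of the group, written as total maps that are the identity outside \<open>L\<close>;
  then composition, inverse and powers are the usual ones of maps on the type.\<close>
definition PH :: "real set \<Rightarrow> (real \<Rightarrow> real) \<Rightarrow> bool"
  where "PH L \<phi> \<longleftrightarrow> \<phi> permutes L \<and> continuous_on L \<phi> \<and> locally_mono L \<phi>"

lemma locally_monoE:
  assumes "locally_mono L \<phi>" "x \<in> L"
  obtains \<delta> s where "\<delta> > 0" "s = 1 \<or> s = (-1::real)"
    "\<And>y z. y \<in> L \<Longrightarrow> z \<in> L \<Longrightarrow> \<bar>y - x\<bar> < \<delta> \<Longrightarrow> \<bar>z - x\<bar> < \<delta> \<Longrightarrow> y < z \<Longrightarrow> s * \<phi> y < s * \<phi> z"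
proof -
  obtain \<delta> s where d: "\<delta> > 0" "s \<in> {1,-1}" "\<forall>y\<in>L. \<forall>z\<in>L.
    \<bar>y - x\<bar> < \<delta> \<longrightarrow> \<bar>z - x\<bar> < \<delta> \<longrightarrow> y < z \<longrightarrow> s * \<phi> y < s * \<phi> z"
    using assms unfolding locally_mono_def by meson
  show ?thesis by (rule that[of \<delta> s]) (use d in blast)+
qed

lemma locally_monoI:
  assumes "\<And>x. x \<in> L \<Longrightarrow> \<exists>\<delta> s. \<delta> > 0 \<and> (s = 1 \<or> s = (-1::real)) \<and> (\<forall>y\<in>L. \<forall>z\<in>L.
    \<bar>y - x\<bar> < \<delta> \<longrightarrow> \<bar>z - x\<bar> < \<delta> \<longrightarrow> y < z \<longrightarrow> s * \<phi> y < s * \<phi> z)"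
  shows "locally_mono L \<phi>"
  unfolding locally_mono_def
proof
  fix x assume "x \<in> L"
  from assms[OF this] obtain \<delta> s where "\<delta> > 0" "s = 1 \<or> s = (-1::real)" "\<forall>y\<in>L. \<forall>z\<in>L.
    \<bar>y - x\<bar> < \<delta> \<longrightarrow> \<bar>z - x\<bar> < \<delta> \<longrightarrow> y < z \<longrightarrow> s * \<phi> y < s * \<phi> z" by blast
  then show "\<exists>\<delta>>0. \<exists>s\<in>{1,-1}. \<forall>y\<in>L. \<forall>z\<in>L.
    \<bar>y - x\<bar> < \<delta> \<longrightarrow> \<bar>z - x\<bar> < \<delta> \<longrightarrow> y < z \<longrightarrow> s * \<phi> y < s * \<phi> z"
    by (intro exI[of _ \<delta>] conjI bexI[of _ s]) auto
qed

lemma continuous_at_bound: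
  fixes \<phi> :: "real \<Rightarrow> real"
  assumes "continuous_on L \<phi>" "x \<in> L" "e > 0"
  obtains d where "d > 0" "\<And>y. y \<in> L \<Longrightarrow> \<bar>y - x\<bar> < d \<Longrightarrow> \<bar>\<phi> y - \<phi> x\<bar> < e"
  using assms unfolding continuous_on_iff dist_real_def by meson

text \<open>The inverse of a map, kept apart in notation from the inverse in a group.\<close>
abbreviation finv :: "('a \<Rightarrow> 'b) \<Rightarrow> 'b \<Rightarrow> 'a"
  where "finv f \<equiv> inv_into UNIV f"

lemma PH_id: "PH L id"
  unfolding PH_def
proof (intro conjI)
  show "locally_mono L id"
    by (rule locally_monoI) (rule exI[of _ 1], rule exI[of _ 1], simp)
qed (simp_all add: permutes_id)

lemma PH_comp:
  assumes "PH L \<phi>" "PH L \<psi>" shows "PH L (\<psi> \<circ> \<phi>)"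
proof -
  have p: "\<phi> permutes L" "\<psi> permutes L" and c: "continuous_on L \<phi>" "continuous_on L \<psi>"
    and m: "locally_mono L \<phi>" "locally_mono L \<psi>" using assms by (simp_all add: PH_def)
  have L: "\<phi> ` L = L" using p by (simp add: permutes_image)
  have "locally_mono L (\<psi> \<circ> \<phi>)"
  proof (rule locally_monoI)
    fix x assume x: "x \<in> L"
    then have fx: "\<phi> x \<in> L" using L by blast
    obtain \<delta> s where s: "\<delta> > 0" "s = 1 \<or> s = (-1::real)"
      "\<And>y z. y \<in> L \<Longrightarrow> z \<in> L \<Longrightarrow> \<bar>y - x\<bar> < \<delta> \<Longrightarrow> \<bar>z - x\<bar> < \<delta> \<Longrightarrow> y < z \<Longrightarrow> s * \<phi> y < s * \<phi> z"
      using locally_monoE[OF m(1) x] by metis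
    obtain \<epsilon> r where r: "\<epsilon> > 0" "r = 1 \<or> r = (-1::real)"
      "\<And>y z. y \<in> L \<Longrightarrow> z \<in> L \<Longrightarrow> \<bar>y - \<phi> x\<bar> < \<epsilon> \<Longrightarrow> \<bar>z - \<phi> x\<bar> < \<epsilon> \<Longrightarrow> y < z \<Longrightarrow> r * \<psi> y < r * \<psi> z"
      using locally_monoE[OF m(2) fx] by metis
    obtain d where d: "d > 0" "\<And>y. y \<in> L \<Longrightarrow> \<bar>y - x\<bar> < d \<Longrightarrow> \<bar>\<phi> y - \<phi> x\<bar> < \<epsilon>"
      using continuous_at_bound[OF c(1) x r(1)] by metis
    have "(s * r) * \<psi> (\<phi> y) < (s * r) * \<psi> (\<phi> z)"
      if h: "y \<in> L" "z \<in> L" "\<bar>y - x\<bar> < min \<delta> d" "\<bar>z - x\<bar> < min \<delta> d" "y < z" for y z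
    proof -
      have "\<phi> y \<in> L" "\<phi> z \<in> L" using h L by auto
      moreover have "\<bar>\<phi> y - \<phi> x\<bar> < \<epsilon>" "\<bar>\<phi> z - \<phi> x\<bar> < \<epsilon>" using d(2) h by auto
      moreover have "s * \<phi> y < s * \<phi> z" using s(3) h by auto
      ultimately show ?thesis using s(2) r(3)[of "\<phi> y" "\<phi> z"] r(3)[of "\<phi> z" "\<phi> y"] by auto
    qed
    moreover have "min \<delta> d > 0" "s * r = 1 \<or> s * r = -1" using s r d by auto
    ultimately show "\<exists>\<delta> s. \<delta> > 0 \<and> (s = 1 \<or> s = (-1::real)) \<and> (\<forall>y\<in>L. \<forall>z\<in>L.
      \<bar>y - x\<bar> < \<delta> \<longrightarrow> \<bar>z - x\<bar> < \<delta> \<longrightarrow> y < z \<longrightarrow> s * (\<psi> \<circ> \<phi>) y < s * (\<psi> \<circ> \<phi>) z)"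
      by (intro exI[of _ "min \<delta> d"] exI[of _ "s * r"]) auto
  qed
  moreover have "continuous_on L (\<psi> \<circ> \<phi>)" using c L by (metis continuous_on_compose)
  ultimately show ?thesis using p by (simp add: PH_def permutes_compose)
qed

lemma PH_inv:
  assumes K: "compact L" and f: "PH L \<phi>" shows "PH L (finv \<phi>)"
proof -
  have p: "\<phi> permutes L" and c: "continuous_on L \<phi>" and m: "locally_mono L \<phi>"
    using f by (simp_all add: PH_def)
  have L: "\<phi> ` L = L" using p by (simp add: permutes_image)
  have inv1: "\<And>x. finv \<phi> (\<phi> x) = x" "\<And>x. \<phi> (finv \<phi> x) = x" using p by (auto simp: permutes_inverses)
  have "continuous_on (\<phi> ` L) (finv \<phi>)"
    by (rule continuous_on_inv[OF c K]) (simp add: inv1)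
  then have ci: "continuous_on L (finv \<phi>)" by (simp add: L)
  have pi: "finv \<phi> permutes L" using p by (rule permutes_inv)
  have Li: "finv \<phi> ` L = L" using pi by (simp add: permutes_image)
  have "locally_mono L (finv \<phi>)"
  proof (rule locally_monoI)
    fix x assume x: "x \<in> L"
    then have fx: "finv \<phi> x \<in> L" using Li by blast
    obtain \<delta> s where s: "\<delta> > 0" "s = 1 \<or> s = (-1::real)"
      "\<And>y z. y \<in> L \<Longrightarrow> z \<in> L \<Longrightarrow> \<bar>y - finv \<phi> x\<bar> < \<delta> \<Longrightarrow> \<bar>z - finv \<phi> x\<bar> < \<delta> \<Longrightarrow> y < z \<Longrightarrow> s * \<phi> y < s * \<phi> z"
      using locally_monoE[OF m fx] by metis
    obtain d where d: "d > 0" "\<And>y. y \<in> L \<Longrightarrow> \<bar>y - x\<bar> < d \<Longrightarrow> \<bar>finv \<phi> y - finv \<phi> x\<bar> < \<delta>"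
      using continuous_at_bound[OF ci x s(1)] by metis
    have "s * finv \<phi> y < s * finv \<phi> z"
      if h: "y \<in> L" "z \<in> L" "\<bar>y - x\<bar> < d" "\<bar>z - x\<bar> < d" "y < z" for y z
    proof -
      have L2: "finv \<phi> y \<in> L" "finv \<phi> z \<in> L" using h Li by auto
      have b: "\<bar>finv \<phi> y - finv \<phi> x\<bar> < \<delta>" "\<bar>finv \<phi> z - finv \<phi> x\<bar> < \<delta>" using d(2) h by auto
      have "finv \<phi> y \<noteq> finv \<phi> z" using inv1(2) h(5) by (metis less_irrefl)
      then consider "finv \<phi> y < finv \<phi> z" | "finv \<phi> z < finv \<phi> y" by linarith
      then show ?thesis
      proof cases
        case 1
        then show ?thesis using s(2) s(3)[OF L2 b 1] h(5) by (auto simp: inv1)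
      next
        case 2
        then show ?thesis using s(2) s(3)[OF L2(2,1) b(2,1) 2] h(5) by (auto simp: inv1)
      qed
    qed
    then show "\<exists>\<delta> s. \<delta> > 0 \<and> (s = 1 \<or> s = (-1::real)) \<and> (\<forall>y\<in>L. \<forall>z\<in>L.
      \<bar>y - x\<bar> < \<delta> \<longrightarrow> \<bar>z - x\<bar> < \<delta> \<longrightarrow> y < z \<longrightarrow> s * finv \<phi> y < s * finv \<phi> z)"
      using d(1) s(2) by (intro exI[of _ d] exI[of _ s]) auto
  qed
  then show ?thesis using ci pi by (simp add: PH_def)
qed

lemma PH_pow: "PH L \<phi> \<Longrightarrow> PH L (\<phi> ^^ n)"
  by (induction n) (simp_all add: PH_id PH_comp[unfolded comp_def] comp_def)

text \<open>A jump of a monotone map would leave a hole in its image, and a compact set has a first point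
  beyond each hole.\<close>
lemma oiso_continuous:
  assumes B: "compact B" and \<phi>: "oiso A B \<phi>" shows "continuous_on A \<phi>"
  unfolding continuous_on_def
proof
  fix x assume x: "x \<in> A"
  have mono: "\<And>u v. u \<in> A \<Longrightarrow> v \<in> A \<Longrightarrow> u < v \<Longrightarrow> \<phi> u < \<phi> v" and im: "\<phi> ` A = B"
    using \<phi> by (auto simp: oiso_def monotone_on_def)
  have le: "\<And>u v. u \<in> A \<Longrightarrow> v \<in> A \<Longrightarrow> \<phi> u < \<phi> v \<Longrightarrow> u < v"
    using mono by (metis linorder_neqE_linordered_idom order_less_asym)
  have inA: "eventually (\<lambda>z. z \<in> A) (at x within A)"
    by (simp add: eventually_at_filter)
  show "(\<phi> \<longlongrightarrow> \<phi> x) (at x within A)"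
  proof (rule order_tendstoI)
    fix y assume y: "\<phi> x < y"
    show "eventually (\<lambda>z. \<phi> z < y) (at x within A)"
    proof (cases "B \<inter> {y..} = {}")
      case True
      then have "\<forall>z\<in>A. \<phi> z < y" using im by (metis IntI atLeast_iff empty_iff imageI not_le)
      then show ?thesis using inA by (auto elim: eventually_mono)
    next
      case False
      moreover have "compact (B \<inter> {y..})" using B by (simp add: compact_Int_closed)
      ultimately obtain b where b: "b \<in> B" "y \<le> b" "\<And>w. w \<in> B \<Longrightarrow> y \<le> w \<Longrightarrow> b \<le> w"
        using compact_attains_inf[of "B \<inter> {y..}"] by auto
      then obtain x0 where x0: "x0 \<in> A" "b = \<phi> x0" using im by auto
      have "x < x0" using le[OF x x0(1)] y b x0 by auto
      then have "eventually (\<lambda>z. z < x0) (at x within A)"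
        using order_tendstoD(2)[OF tendsto_ident_at] by blast
      then show ?thesis using inA
      proof eventually_elim
        case (elim z)
        then have "\<phi> z < b" using mono x0 by auto
        then show ?case using b(3)[of "\<phi> z"] elim im by (metis imageI not_le)
      qed
    qed
  next
    fix y assume y: "y < \<phi> x"
    show "eventually (\<lambda>z. y < \<phi> z) (at x within A)"
    proof (cases "B \<inter> {..y} = {}")
      case True
      then have "\<forall>z\<in>A. y < \<phi> z" using im by (metis IntI atMost_iff empty_iff imageI not_le)
      then show ?thesis using inA by (auto elim: eventually_mono)
    next
      case False
      moreover have "compact (B \<inter> {..y})" using B by (simp add: compact_Int_closed)
      ultimately obtain b where b: "b \<in> B" "b \<le> y" "\<And>w. w \<in> B \<Longrightarrow> w \<le> y \<Longrightarrow> w \<le> b"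
        using compact_attains_sup[of "B \<inter> {..y}"] by auto
      then obtain x0 where x0: "x0 \<in> A" "b = \<phi> x0" using im by auto
      have "x0 < x" using le[OF x0(1) x] y b x0 by auto
      then have "eventually (\<lambda>z. x0 < z) (at x within A)"
        using order_tendstoD(1)[OF tendsto_ident_at] by blast
      then show ?thesis using inA
      proof eventually_elim
        case (elim z)
        then have "b < \<phi> z" using mono x0 by auto
        then show ?case using b(3)[of "\<phi> z"] elim im by (metis imageI not_le)
      qed
    qed
  qed
qed

text \<open>Order automorphisms, with the same convention.\<close>
definition OA :: "real set \<Rightarrow> (real \<Rightarrow> real) \<Rightarrow> bool"
  where "OA L \<phi> \<longleftrightarrow> \<phi> permutes L \<and> strict_mono_on L \<phi>"

lemma OA_imp_PH:
  assumes "compact L" "OA L \<phi>" shows "PH L \<phi>"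
  unfolding PH_def
proof (intro conjI)
  show p: "\<phi> permutes L" using assms by (simp add: OA_def)
  then show "continuous_on L \<phi>" using assms oiso_continuous[of L L \<phi>]
    by (simp add: OA_def oiso_def permutes_image)
  have "\<forall>y\<in>L. \<forall>z\<in>L. y < z \<longrightarrow> \<phi> y < \<phi> z" using assms by (simp add: OA_def monotone_on_def)
  then show "locally_mono L \<phi>"
    by (intro locally_monoI) (rule exI[of _ 1], rule exI[of _ 1], simp)
qed

subsection \<open>One-sided limits and cyclic adjacency\<close>

definition llim :: "real set \<Rightarrow> real \<Rightarrow> bool"
  where "llim L x \<longleftrightarrow> (\<forall>e>0. \<exists>y\<in>L. x - e < y \<and> y < x)"

definition rlim :: "real set \<Rightarrow> real \<Rightarrow> bool"
  where "rlim L x \<longleftrightarrow> (\<forall>e>0. \<exists>y\<in>L. x < y \<and> y < x + e)"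

text \<open>The unbounded complementary intervals of \<open>L\<close> form one gap of the circle.\<close>
definition cadj :: "real set \<Rightarrow> real \<Rightarrow> real \<Rightarrow> bool"
  where "cadj L a b \<longleftrightarrow> consec L a b \<or> consec L b a \<or> (a = Inf L \<and> b = Sup L) \<or> (a = Sup L \<and> b = Inf L)"

lemma compact_Inf_Sup:
  fixes L :: "real set"
  assumes "compact L" "L \<noteq> {}"
  shows "Inf L \<in> L" "Sup L \<in> L" "\<And>x. x \<in> L \<Longrightarrow> Inf L \<le> x" "\<And>x. x \<in> L \<Longrightarrow> x \<le> Sup L"
proof -
  have b: "bounded L" and c: "closed L" using assms compact_imp_bounded compact_imp_closed by auto
  show "Inf L \<in> L" using closed_contains_Inf[OF assms(2) bounded_imp_bdd_below[OF b] c] .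
  show "Sup L \<in> L" using closed_contains_Sup[OF assms(2) bounded_imp_bdd_above[OF b] c] .
  show "\<And>x. x \<in> L \<Longrightarrow> Inf L \<le> x" "\<And>x. x \<in> L \<Longrightarrow> x \<le> Sup L"
    using b by (auto intro: cInf_lower cSup_upper bounded_imp_bdd_below bounded_imp_bdd_above)
qed

lemma cantor_compact [simp]: "cantor L \<Longrightarrow> compact L" "cantor L \<Longrightarrow> closed L" "cantor L \<Longrightarrow> L \<noteq> {}"
  by (auto simp: cantor_def compact_imp_closed)

lemmas cantor_Inf_Sup = compact_Inf_Sup[OF cantor_compact(1,3)]

lemma cantor_Inf_less_Sup: assumes "cantor L" shows "Inf L < Sup L"
proof -
  obtain x y where "x \<in> L" "y \<in> L" "x < y" using cantor_two_points[OF assms] .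
  then show ?thesis using cantor_Inf_Sup(3,4)[OF assms assms] by force
qed

lemma cantor_one_sided_limit:
  assumes "cantor L" "x \<in> L" shows "llim L x \<or> rlim L x"
proof (rule ccontr)
  assume "\<not> ?thesis"
  then obtain e d where "e > 0" "\<forall>y\<in>L. \<not> (x - e < y \<and> y < x)" "d > 0" "\<forall>y\<in>L. \<not> (x < y \<and> y < x + d)"
    unfolding llim_def rlim_def by meson
  moreover have "x islimpt L" using assms unfolding cantor_def by blast
  moreover have "0 < min e d" using \<open>e > 0\<close> \<open>d > 0\<close> by simp
  ultimately have "\<exists>y\<in>L. y \<noteq> x \<and> dist y x < min e d" unfolding islimpt_approachable by blast
  then obtain y where "y \<in> L" "y \<noteq> x" "dist y x < min e d" by blast
  then show False using \<open>\<forall>y\<in>L. \<not> (x - e < y \<and> y < x)\<close> \<open>\<forall>y\<in>L. \<not> (x < y \<and> y < x + d)\<close>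
    by (cases "y < x") (auto simp: dist_real_def)
qed

lemma consec_not_rlim:
  assumes "consec L a b" shows "\<not> rlim L a"
proof
  assume "rlim L a"
  moreover have "b - a > 0" using consecD(3)[OF assms] by simp
  ultimately obtain y where "y \<in> L" "a < y" "y < a + (b - a)" unfolding rlim_def by blast
  then show False using consecD(4)[OF assms] by force
qed

lemma consec_not_llim:
  assumes "consec L a b" shows "\<not> llim L b"
proof
  assume "llim L b"
  moreover have "b - a > 0" using consecD(3)[OF assms] by simp
  ultimately obtain y where "y \<in> L" "b - (b - a) < y" "y < b" unfolding llim_def by blast
  then show False using consecD(4)[OF assms] by force
qed

lemma not_llim_cases:
  assumes "compact L" "x \<in> L" "\<not> llim L x" shows "x = Inf L \<or> (\<exists>a. consec L a x)"
proof (rule ccontr)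
  assume n: "\<not> ?thesis"
  have "L \<noteq> {}" using assms by auto
  have "Inf L < x" using n compact_Inf_Sup(3)[OF assms(1) \<open>L \<noteq> {}\<close> assms(2)] by auto
  obtain e where e: "e > 0" "\<forall>y\<in>L. \<not> (x - e < y \<and> y < x)" using assms(3) unfolding llim_def by blast
  let ?z = "max (x - e / 2) ((Inf L + x) / 2)"
  have z: "x - e < ?z" "?z < x" "Inf L < ?z" using e(1) \<open>Inf L < x\<close> by (auto simp: less_max_iff_disj)
  then have "?z \<notin> L" using e(2) by blast
  from gap_around_point[OF compact_imp_closed[OF assms(1)] compact_Inf_Sup(1)[OF assms(1) \<open>L \<noteq> {}\<close>] assms(2) z(3,2) this]
  obtain a b where ab: "consec L a b" "a < ?z" "?z < b" "b \<le> x" by blast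
  then have "b = x" using e(2) z consecD(2)[OF ab(1)] by (metis less_trans order.order_iff_strict)
  then show False using ab n by auto
qed

lemma not_rlim_cases:
  assumes "compact L" "x \<in> L" "\<not> rlim L x" shows "x = Sup L \<or> (\<exists>a. consec L x a)"
proof (rule ccontr)
  assume n: "\<not> ?thesis"
  have "L \<noteq> {}" using assms by auto
  have "x < Sup L" using n compact_Inf_Sup(4)[OF assms(1) \<open>L \<noteq> {}\<close> assms(2)] by auto
  obtain e where e: "e > 0" "\<forall>y\<in>L. \<not> (x < y \<and> y < x + e)" using assms(3) unfolding rlim_def by blast
  let ?z = "min (x + e / 2) ((Sup L + x) / 2)"
  have z: "?z < x + e" "x < ?z" "?z < Sup L" using e(1) \<open>x < Sup L\<close> by (auto simp: min_less_iff_disj)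
  then have "?z \<notin> L" using e(2) by blast
  from gap_around_point[OF compact_imp_closed[OF assms(1)] assms(2) compact_Inf_Sup(2)[OF assms(1) \<open>L \<noteq> {}\<close>] z(2,3) this]
  obtain a b where ab: "consec L a b" "a < ?z" "?z < b" "x \<le> a" by blast
  then have "a = x" using e(2) z consecD(1)[OF ab(1)] by (metis less_trans order.order_iff_strict)
  then show False using ab n by auto
qed

lemma Inf_not_llim: "compact L \<Longrightarrow> \<not> llim L (Inf L)"
  unfolding llim_def using compact_Inf_Sup(3)[of L] by (metis empty_iff leD zero_less_one)

lemma Sup_not_rlim: "compact L \<Longrightarrow> \<not> rlim L (Sup L)"
  unfolding rlim_def using compact_Inf_Sup(4)[of L] by (metis empty_iff leD zero_less_one)

lemma cadj_sym: "cadj L a b \<Longrightarrow> cadj L b a"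
  by (auto simp: cadj_def)

lemma cadj_in:
  assumes "cantor L" "cadj L a b" shows "a \<in> L" "b \<in> L"
  using assms cantor_Inf_Sup(1,2)[OF assms(1) assms(1)] by (auto simp: cadj_def dest: consecD(1,2))

lemma cadj_unique:
  assumes L: "cantor L" and "cadj L a b" "cadj L a c" shows "b = c"
proof -
  have s: "(\<not> rlim L a \<and> (consec L a b \<or> (a = Sup L \<and> b = Inf L))) \<or> (\<not> llim L a \<and> (consec L b a \<or> (a = Inf L \<and> b = Sup L)))"
    if "cadj L a b" for b
    using that consec_not_rlim consec_not_llim Inf_not_llim Sup_not_rlim L unfolding cadj_def by (metis cantor_compact(1))
  have "llim L a \<or> rlim L a" using cantor_one_sided_limit L cadj_in assms(2) by blast
  have i: "Inf L \<noteq> Sup L" using cantor_Inf_less_Sup[OF L] by simp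
  have 1: "\<not> consec L (Sup L) d" "\<not> consec L d (Inf L)" for d
    using cantor_Inf_Sup(3,4)[OF L L] consecD by (meson leD)+
  show ?thesis
    using s[OF assms(2)] s[OF assms(3)] \<open>llim L a \<or> rlim L a\<close> 1 i consec_right_unique consec_left_unique by metis
qed

lemma cadj_irrefl: "cantor L \<Longrightarrow> \<not> cadj L a a"
  using cantor_Inf_less_Sup[of L] by (auto simp: cadj_def dest: consecD(3))

text \<open>A point that is not a limit from one side is followed there by a gap or is extreme, and the
  extreme points are neighbours on the circle.\<close>
lemma cadj_iff_one_sided:
  assumes L: "cantor L" and x: "x \<in> L"
  shows "(\<exists>b. cadj L x b) \<longleftrightarrow> \<not> (llim L x \<and> rlim L x)"
proof
  assume "\<exists>b. cadj L x b"
  then show "\<not> (llim L x \<and> rlim L x)"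
    unfolding cadj_def using consec_not_rlim consec_not_llim Inf_not_llim Sup_not_rlim L
    by (metis cantor_compact(1))
next
  assume "\<not> (llim L x \<and> rlim L x)"
  then show "\<exists>b. cadj L x b" unfolding cadj_def
    using not_llim_cases[OF cantor_compact(1)[OF L] x] not_rlim_cases[OF cantor_compact(1)[OF L] x] by metis
qed

lemma PH_two_sided:
  assumes f: "PH L \<phi>" and x: "x \<in> L" "llim L x" "rlim L x"
  shows "llim L (\<phi> x) \<and> rlim L (\<phi> x)"
proof -
  have p: "\<phi> permutes L" and c: "continuous_on L \<phi>" and m: "locally_mono L \<phi>"
    using f by (simp_all add: PH_def)
  have L: "\<phi> ` L = L" using p by (simp add: permutes_image)
  obtain \<delta> s where s: "\<delta> > 0" "s = 1 \<or> s = (-1::real)"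
      "\<And>y z. y \<in> L \<Longrightarrow> z \<in> L \<Longrightarrow> \<bar>y - x\<bar> < \<delta> \<Longrightarrow> \<bar>z - x\<bar> < \<delta> \<Longrightarrow> y < z \<Longrightarrow> s * \<phi> y < s * \<phi> z"
      using locally_monoE[OF m x(1)] by metis
  have "\<exists>y\<in>L. \<exists>z\<in>L. \<phi> x - e < y \<and> y < \<phi> x \<and> \<phi> x < z \<and> z < \<phi> x + e" if e: "e > 0" for e
  proof -
    obtain d where d: "d > 0" "\<And>y. y \<in> L \<Longrightarrow> \<bar>y - x\<bar> < d \<Longrightarrow> \<bar>\<phi> y - \<phi> x\<bar> < e"
      using continuous_at_bound[OF c x(1) e] by metis
    have "0 < min \<delta> d" using s d by simp
    then obtain y z where yz: "y \<in> L" "x - min \<delta> d < y" "y < x" "z \<in> L" "x < z" "z < x + min \<delta> d"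
      using x unfolding llim_def rlim_def by meson
    have "\<bar>\<phi> y - \<phi> x\<bar> < e" "\<bar>\<phi> z - \<phi> x\<bar> < e" using d(2) yz by auto
    moreover have "s * \<phi> y < s * \<phi> x" "s * \<phi> x < s * \<phi> z" using s(1,3) yz x(1) by auto
    moreover have "\<phi> y \<in> L" "\<phi> z \<in> L" using yz L by auto
    ultimately have "\<phi> y < \<phi> x \<and> \<phi> x < \<phi> z \<or> \<phi> z < \<phi> x \<and> \<phi> x < \<phi> y" using s(2) by auto
    then show ?thesis using \<open>\<phi> y \<in> L\<close> \<open>\<phi> z \<in> L\<close> \<open>\<bar>\<phi> y - \<phi> x\<bar> < e\<close> \<open>\<bar>\<phi> z - \<phi> x\<bar> < e\<close>
      by (meson abs_diff_less_iff)
  qed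
  then show ?thesis unfolding llim_def rlim_def by meson
qed

text \<open>Points with neighbours are the one-sided limits, and \<open>finv \<phi>\<close> takes two-sided
  limits to two-sided limits.\<close>
lemma PH_endpoint:
  assumes L: "cantor L" and f: "PH L \<phi>" and a: "cadj L a b" shows "\<exists>c. cadj L (\<phi> a) c"
proof -
  have p: "\<phi> permutes L" using f by (simp add: PH_def)
  have aL: "a \<in> L" "\<phi> a \<in> L" using cadj_in[OF L a] p by (auto simp: permutes_in_image)
  have "finv \<phi> (\<phi> a) = a" using p by (simp add: permutes_inverses)
  then have "\<not> (llim L (\<phi> a) \<and> rlim L (\<phi> a))"
    using PH_two_sided[OF PH_inv[OF cantor_compact(1)[OF L] f] aL(2)] cadj_iff_one_sided[OF L aL(1)] a by auto
  then show ?thesis using cadj_iff_one_sided[OF L aL(2)] by blast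
qed

text \<open>Near a point \<open>x\<close>, continuity of the inverse puts everything between the images of
  two nearby consecutive points into the monotone piece around \<open>x\<close>; so no point lies
  between them.\<close>
lemma PH_finite_broken_gaps:
  assumes L: "cantor L" and f: "PH L \<phi>"
  shows "finite {(a,b). consec L a b \<and> \<not> (consec L (\<phi> a) (\<phi> b) \<or> consec L (\<phi> b) (\<phi> a))}"
proof (rule finite_bad_gaps)
  show "compact L" using L by simp
  fix x assume x: "x \<in> L"
  have p: "\<phi> permutes L" and c: "continuous_on L \<phi>" and m: "locally_mono L \<phi>"
    using f by (simp_all add: PH_def)
  have im: "\<phi> ` L = L" using p by (simp add: permutes_image)
  have ci: "continuous_on L (finv \<phi>)" and pi: "finv \<phi> permutes L"
    using PH_inv[OF cantor_compact(1)[OF L] f] by (simp_all add: PH_def)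
  have inv1: "\<And>x. finv \<phi> (\<phi> x) = x" "\<And>x. \<phi> (finv \<phi> x) = x" using p by (auto simp: permutes_inverses)
  have fx: "\<phi> x \<in> L" using x im by blast
  obtain \<delta> s where s: "\<delta> > 0" "s = 1 \<or> s = (-1::real)"
      "\<And>y z. y \<in> L \<Longrightarrow> z \<in> L \<Longrightarrow> \<bar>y - x\<bar> < \<delta> \<Longrightarrow> \<bar>z - x\<bar> < \<delta> \<Longrightarrow> y < z \<Longrightarrow> s * \<phi> y < s * \<phi> z"
      using locally_monoE[OF m x(1)] by metis
  obtain \<epsilon> where e: "\<epsilon> > 0" "\<And>y. y \<in> L \<Longrightarrow> \<bar>y - \<phi> x\<bar> < \<epsilon> \<Longrightarrow> \<bar>finv \<phi> y - finv \<phi> (\<phi> x)\<bar> < \<delta>"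
    using continuous_at_bound[OF ci fx s(1)] by metis
  obtain d where d: "d > 0" "\<And>y. y \<in> L \<Longrightarrow> \<bar>y - x\<bar> < d \<Longrightarrow> \<bar>\<phi> y - \<phi> x\<bar> < \<epsilon>"
    using continuous_at_bound[OF c x e(1)] by metis
  have "consec L (\<phi> a) (\<phi> b) \<or> consec L (\<phi> b) (\<phi> a)"
    if h: "consec L a b" "\<bar>a - x\<bar> < min \<delta> d" "\<bar>b - x\<bar> < min \<delta> d" for a b
  proof -
    have ab: "a \<in> L" "b \<in> L" "a < b" using consecD[OF h(1)] by auto
    have fab: "\<phi> a \<in> L" "\<phi> b \<in> L" using ab im by auto
    have near: "\<bar>\<phi> a - \<phi> x\<bar> < \<epsilon>" "\<bar>\<phi> b - \<phi> x\<bar> < \<epsilon>" using d(2) ab h by auto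
    have sab: "s * \<phi> a < s * \<phi> b" using s(3) ab h by auto
    have no: "\<not> (s * \<phi> a < s * w \<and> s * w < s * \<phi> b)" if w: "w \<in> L" for w
    proof
      assume lt: "s * \<phi> a < s * w \<and> s * w < s * \<phi> b"
      then have "\<bar>w - \<phi> x\<bar> < \<epsilon>" using near s(2) by (auto simp: abs_less_iff)
      then have "\<bar>finv \<phi> w - x\<bar> < \<delta>" using e(2)[OF w] inv1 by simp
      moreover have wL: "finv \<phi> w \<in> L" using w pi by (simp add: permutes_in_image)
      ultimately have "\<not> finv \<phi> w < a" "\<not> b < finv \<phi> w"
        using s(3)[of "finv \<phi> w" a] s(3)[of b "finv \<phi> w"] h ab lt by (auto simp: inv1)
      moreover have "finv \<phi> w \<noteq> a" "finv \<phi> w \<noteq> b" using lt inv1(2)[of w] by auto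
      ultimately show False using consecD(4)[OF h(1) wL] by auto
    qed
    show ?thesis using s(2)
    proof
      assume "s = 1" then show ?thesis using no sab fab unfolding consec_def by force
    next
      assume "s = -1" then show ?thesis using no sab fab unfolding consec_def by force
    qed
  qed
  then show "\<exists>\<delta>>0. \<forall>a b. consec L a b \<and> \<bar>a - x\<bar> < \<delta> \<and> \<bar>b - x\<bar> < \<delta> \<longrightarrow>
      consec L (\<phi> a) (\<phi> b) \<or> consec L (\<phi> b) (\<phi> a)"
    using s(1) d(1) by (intro exI[of _ "min \<delta> d"]) auto
qed

lemma PH_finite_disc:
  assumes L: "cantor L" and f: "PH L \<phi>"
  shows "finite {a. \<exists>b. cadj L a b \<and> \<not> cadj L (\<phi> a) (\<phi> b)}"
proof -
  let ?S = "{(a,b). consec L a b \<and> \<not> (consec L (\<phi> a) (\<phi> b) \<or> consec L (\<phi> b) (\<phi> a))}"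
  have "{a. \<exists>b. cadj L a b \<and> \<not> cadj L (\<phi> a) (\<phi> b)} \<subseteq> fst ` ?S \<union> snd ` ?S \<union> {Inf L, Sup L}"
  proof
    fix a assume "a \<in> {a. \<exists>b. cadj L a b \<and> \<not> cadj L (\<phi> a) (\<phi> b)}"
    then obtain b where "cadj L a b" "\<not> cadj L (\<phi> a) (\<phi> b)" by blast
    then have "(a,b) \<in> ?S \<or> (b,a) \<in> ?S \<or> a \<in> {Inf L, Sup L}" unfolding cadj_def by auto
    then show "a \<in> fst ` ?S \<union> snd ` ?S \<union> {Inf L, Sup L}" by force
  qed
  then show ?thesis by (rule finite_subset) (use PH_finite_broken_gaps[OF L f] in simp)
qed

section \<open>Growth of the number of broken pairs of a matching\<close>

text \<open>A bijection \<open>f\<close> acts on the points of a matching \<open>R\<close>, of which it breaks finitely many pairs.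
  The pairs broken by the iterates either stay bounded in number or grow linearly.\<close>

locale matching_map =
  fixes R :: "'a \<Rightarrow> 'a \<Rightarrow> bool" and f :: "'a \<Rightarrow> 'a"
  assumes bij: "bij f"
    and unique: "\<And>a b c. R a b \<Longrightarrow> R a c \<Longrightarrow> b = c"
    and finite_broken: "finite {a. \<exists>b. R a b \<and> \<not> R (f a) (f b)}"
begin

definition broken :: "nat \<Rightarrow> 'a set"
  where "broken n = {a. \<exists>b. R a b \<and> \<not> R ((f ^^ n) a) ((f ^^ n) b)}"

definition stable :: "'a \<Rightarrow> 'a \<Rightarrow> bool"
  where "stable a b \<longleftrightarrow> eventually (\<lambda>i. R ((f ^^ i) a) ((f ^^ i) b)) sequentially"

definition unstable :: "'a set"
  where "unstable = {a. \<exists>b. R a b \<and> \<not> stable a b}"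

lemma stable_pow: "stable ((f ^^ k) a) ((f ^^ k) b) \<longleftrightarrow> stable a b"
proof -
  have "stable ((f ^^ k) a) ((f ^^ k) b) \<longleftrightarrow> eventually (\<lambda>i. R ((f ^^ (i + k)) a) ((f ^^ (i + k)) b)) sequentially"
    by (simp add: stable_def funpow_add)
  also have "\<dots> \<longleftrightarrow> stable a b"
    unfolding stable_def using eventually_sequentially_seg[of "\<lambda>i. R ((f ^^ i) a) ((f ^^ i) b)" k] .
  finally show ?thesis .
qed

lemma stable_map: "stable (f a) (f b) \<longleftrightarrow> stable a b"
  using stable_pow[of 1] by simp

lemma stable_unique:
  assumes "stable a b" "stable a c" shows "b = c"
proof -
  have "eventually (\<lambda>i. R ((f ^^ i) a) ((f ^^ i) b) \<and> R ((f ^^ i) a) ((f ^^ i) c)) sequentially"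
    using assms unfolding stable_def by (rule eventually_conj)
  then obtain i where "R ((f ^^ i) a) ((f ^^ i) b)" "R ((f ^^ i) a) ((f ^^ i) c)"
    unfolding eventually_sequentially by blast
  then have "(f ^^ i) b = (f ^^ i) c" by (rule unique)
  moreover have "inj (f ^^ i)" by (rule inj_fn[OF bij_is_inj[OF bij]])
  ultimately show ?thesis by (simp add: inj_eq)
qed

lemma finite_broken_pow: "finite (broken n)"
proof (induction n)
  case 0 then show ?case by (simp add: broken_def)
next
  case (Suc n)
  have "broken (Suc n) \<subseteq> broken n \<union> (f ^^ n) -` broken 1"
    by (auto simp: broken_def)
  moreover have "finite ((f ^^ n) -` broken 1)"
    using finite_broken inj_fn[OF bij_is_inj[OF bij]] by (intro finite_vimageI) (auto simp: broken_def)
  ultimately show ?case using Suc by (meson finite_UnI finite_subset)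
qed

text \<open>Infinitely many unstable pairs arrive, under different iterates, at one broken point \<open>c\<close>. The
  orbit of \<open>c\<close> is then infinite, so from some time on it avoids the broken points, both backwards
  and forwards. Hence its pair is matched at all early times and unmatched at all late times, and
  \<open>f ^^ n\<close> breaks all the pairs whose time moves from early to late.\<close>
lemma unstable_linear_growth:
  assumes "infinite unstable"
  shows "\<exists>M. \<forall>n. n \<le> card (broken n) + M"
proof -
  have "\<exists>i b. R a b \<and> \<not> stable a b \<and> R ((f ^^ i) a) ((f ^^ i) b) \<and> \<not> R ((f ^^ Suc i) a) ((f ^^ Suc i) b)"
    if a: "a \<in> unstable" for a
  proof -
    obtain b where b: "R a b" "\<not> stable a b" using a by (auto simp: unstable_def)
    have "\<exists>i. R ((f ^^ i) a) ((f ^^ i) b) \<and> \<not> R ((f ^^ Suc i) a) ((f ^^ Suc i) b)"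
    proof (rule ccontr)
      assume n: "\<nexists>i. R ((f ^^ i) a) ((f ^^ i) b) \<and> \<not> R ((f ^^ Suc i) a) ((f ^^ Suc i) b)"
      have "R ((f ^^ i) a) ((f ^^ i) b)" for i
      proof (induction i)
        case 0 then show ?case using b by simp
      next
        case (Suc i) then show ?case using n by blast
      qed
      then show False using b unfolding stable_def by simp
    qed
    then show ?thesis using b by blast
  qed
  then obtain I b where Ib: "\<And>a. a \<in> unstable \<Longrightarrow> R a (b a) \<and> \<not> stable a (b a) \<and>
      R ((f ^^ I a) a) ((f ^^ I a) (b a)) \<and> \<not> R ((f ^^ Suc (I a)) a) ((f ^^ Suc (I a)) (b a))"
    by metis
  define arrive where "arrive a = (f ^^ I a) a" for a
  have "arrive a \<in> broken 1" if "a \<in> unstable" for a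
    using Ib[OF that] by (auto simp: broken_def arrive_def)
  then have "finite (arrive ` unstable)" using finite_broken_pow[of 1] by (meson finite_subset image_subsetI)
  from pigeonhole_infinite[OF assms this] obtain a0 where
    a0: "a0 \<in> unstable" "infinite {a \<in> unstable. arrive a = arrive a0}" by blast
  define Y where "Y = {a \<in> unstable. arrive a = arrive a0}"
  define c where "c = arrive a0"
  define c' where "c' = (f ^^ I a0) (b a0)"
  have cc: "R c c'" "\<not> stable c c'"
    using Ib[OF a0(1)] stable_pow by (auto simp: c_def c'_def arrive_def)
  define g where "g = finv f"
  have gf: "g (f x) = x" "f (g x) = x" for x
    using bij by (simp_all add: g_def bij_is_inj bij_is_surj surj_f_inv_f)
  have cancel: "(g ^^ n) ((f ^^ n) x) = x" "(f ^^ n) ((g ^^ n) x) = x" for n x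
  proof -
    show "(g ^^ n) ((f ^^ n) x) = x"
      by (induction n arbitrary: x) (simp_all add: funpow_swap1 gf)
    show "(f ^^ n) ((g ^^ n) x) = x"
      by (induction n arbitrary: x) (simp_all add: funpow_swap1 gf)
  qed
  define p where "p i = (g ^^ i) c" for i
  define q where "q i = (g ^^ i) c'" for i
  have origin: "a = p (I a) \<and> R (p (I a)) (q (I a))" if a: "a \<in> Y" for a
  proof -
    have u: "a \<in> unstable" "(f ^^ I a) a = c" using a by (auto simp: Y_def c_def arrive_def)
    have "(f ^^ I a) (b a) = c'" using Ib[OF u(1)] u(2) cc(1) unique by metis
    then have "p (I a) = a" "q (I a) = b a" using cancel(1) u(2) unfolding p_def q_def by metis+
    then show ?thesis using Ib[OF u(1)] by simp
  qed
  have pY: "Y \<subseteq> range p" using origin by blast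
  have infY: "infinite Y" using a0 by (simp add: Y_def)
  have p_add: "p (i + j) = (g ^^ i) (p j)" for i j by (simp add: p_def funpow_add)
  \<comment> \<open>A repetition would make the backward orbit of \<open>c\<close> finite, but it contains the infinite set \<open>Y\<close>.\<close>
  have inj_p: "inj p"
  proof (rule linorder_injI, rule notI)
    fix i j :: nat assume ij: "i < j" "p i = p j"
    have "p k \<in> p ` {..<j}" for k
    proof (induction k rule: less_induct)
      case (less k)
      show ?case
      proof (cases "k < j")
        case False
        then have "p k = (g ^^ (k - j)) (p j)" using p_add[of "k - j" j] by simp
        also have "\<dots> = p (k - j + i)" using ij p_add by simp
        finally show ?thesis using less[of "k - j + i"] ij False by simp
      qed simp
    qed
    then have "range p \<subseteq> p ` {..<j}" by blast
    then show False using pY infY by (meson finite_imageI finite_lessThan finite_subset)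
  qed
  have inj_f: "inj (\<lambda>j. (f ^^ j) c)"
  proof (rule linorder_injI, rule notI)
    fix i j :: nat assume ij: "i < j" "(f ^^ i) c = (f ^^ j) c"
    have "(f ^^ j) (p j) = (f ^^ j) (p (j - i))"
    proof -
      have "(f ^^ j) (p j) = c" by (simp add: p_def cancel)
      also have "c = (g ^^ i) ((f ^^ j) c)" using ij(2) cancel(1)[of i c] by simp
      also have "\<dots> = (g ^^ i) ((f ^^ i) ((f ^^ (j - i)) c))" using ij(1)
        by (metis add_diff_inverse_nat funpow_add not_less_iff_gr_or_eq o_apply)
      also have "\<dots> = (f ^^ (j - i)) c" by (rule cancel(1))
      finally have e: "c = (f ^^ (j - i)) c" by (simp add: p_def cancel)
      then have "p (j - i) = c" unfolding p_def using cancel(1) by metis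
      then have "p (j - i) = p 0" by (simp add: p_def)
      then show ?thesis using inj_p ij(1) by (auto dest: injD)
    qed
    then have "p j = p (j - i)" using cancel(1) by metis
    then have "i = 0" using inj_p ij(1) by (auto dest: injD)
    then have "c = (f ^^ j) c" using ij by simp
    then have "p j = p 0" unfolding p_def using cancel(1) by (metis funpow_0)
    then show False using inj_p ij(1) by (auto dest: injD)
  qed
  have "finite ((\<lambda>j. (f ^^ j) c) -` broken 1)" "finite (p -` broken 1)"
    using finite_broken_pow[of 1] inj_f inj_p by (auto intro: finite_vimageI)
  then obtain N N' where "\<forall>j\<in>(\<lambda>j. (f ^^ j) c) -` broken 1. j < N" "\<forall>j\<in>p -` broken 1. j < N'"
    unfolding finite_nat_set_iff_bounded by meson
  then have N: "\<And>j. N \<le> j \<Longrightarrow> (f ^^ j) c \<notin> broken 1" and N': "\<And>j. N' \<le> j \<Longrightarrow> p j \<notin> broken 1"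
    by (meson leD vimage_eq)+
  have late: "\<not> R ((f ^^ j) c) ((f ^^ j) c')" if j: "N \<le> j" for j
  proof
    assume R: "R ((f ^^ j) c) ((f ^^ j) c')"
    have "R ((f ^^ i) c) ((f ^^ i) c')" if "j \<le> i" for i
      using that
    proof (induction i rule: dec_induct)
      case (step n)
      then show ?case using N[of n] j by (auto simp: broken_def)
    qed (rule R)
    then have "stable c c'" unfolding stable_def eventually_sequentially by blast
    then show False using cc by simp
  qed
  have early: "R (p i) (q i)" if i: "N' \<le> i" for i
  proof -
    have "infinite (I ` Y)"
    proof
      assume "finite (I ` Y)"
      then have "finite (p ` I ` Y)" by simp
      moreover have "Y \<subseteq> p ` I ` Y" using origin by blast
      ultimately show False using infY finite_subset by blast
    qed
    then obtain a where a: "a \<in> Y" "i \<le> I a"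
      by (metis (no_types, lifting) finite_nat_set_iff_bounded imageE le_cases not_less less_le_not_le)
    from a(2) show ?thesis
    proof (induction rule: inc_induct)
      case base show ?case using origin[OF a(1)] by blast
    next
      case (step n)
      have "p n = f (p (Suc n))" "q n = f (q (Suc n))" by (simp_all add: p_def q_def gf)
      moreover have "p (Suc n) \<notin> broken 1" using N' i step by simp
      ultimately show ?case using step by (auto simp: broken_def)
    qed
  qed
  have "n \<le> card (broken n) + (N + N')" for n
  proof -
    \<comment> \<open>The pair at \<open>p i\<close> is at time \<open>-i\<close>, which is early, and \<open>f ^^ n\<close> takes it to the late time \<open>n - i\<close>.\<close>
    have "p ` {N'..<n - N} \<subseteq> broken n"
    proof
      fix x assume "x \<in> p ` {N'..<n - N}"
      then obtain i where i: "x = p i" "N' \<le> i" "i < n - N" by auto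
      have eq: "(f ^^ n) ((g ^^ i) y) = (f ^^ (n - i)) y" for y
      proof -
        have "n = (n - i) + i" using i by simp
        then have "(f ^^ n) ((g ^^ i) y) = (f ^^ (n - i)) ((f ^^ i) ((g ^^ i) y))"
          by (metis funpow_add o_apply)
        then show ?thesis by (simp add: cancel)
      qed
      have "\<not> R ((f ^^ n) (p i)) ((f ^^ n) (q i))"
        unfolding p_def q_def eq using i by (intro late) simp
      then show "x \<in> broken n" using early[OF i(2)] i(1) by (auto simp: broken_def)
    qed
    then have "card (p ` {N'..<n - N}) \<le> card (broken n)"
      by (rule card_mono[OF finite_broken_pow])
    then show ?thesis using inj_p by (simp add: card_image inj_on_subset)
  qed
  then show ?thesis by blast
qed

lemma sublinear_imp_finite_unstable:
  assumes "(\<lambda>n. real (card (broken n)) / real n) \<longlonglongrightarrow> 0"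
  shows "finite unstable"
proof (rule ccontr)
  assume "infinite unstable"
  from unstable_linear_growth[OF this] obtain M where M: "\<And>n. n \<le> card (broken n) + M" by blast
  have "eventually (\<lambda>n. real (card (broken n)) / real n < 1/2) sequentially"
    using order_tendstoD(2)[OF assms, of "1/2"] by simp
  then obtain N where N: "\<And>n. N \<le> n \<Longrightarrow> real (card (broken n)) / real n < 1/2"
    unfolding eventually_sequentially by blast
  obtain n where n: "N \<le> n" "2 * M + 1 \<le> n" using nat_le_linear by blast
  have "real n > 0" using n by simp
  then have "real (card (broken n)) < real n / 2" using N[OF n(1)] by (simp add: field_simps)
  moreover have "real n \<le> real (card (broken n)) + real M" using M[of n] by (metis of_nat_add of_nat_le_iff)
  moreover have "2 * real M + 1 \<le> real n" using n(2) by linarith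
  ultimately show False by linarith
qed

text \<open>Suppose that \<open>f ^^ n\<close> breaks a stable pair. The images of its two points are stable
  partners, so the partner that the first image has under \<open>R\<close> forms an unstable pair
  with it. Hence all points of \<open>broken n\<close> are unstable or become so under \<open>f ^^
  n\<close>.\<close>
lemma finite_unstable_imp_bounded:
  assumes fin: "finite unstable" and dom: "\<And>a b. R a b \<Longrightarrow> \<exists>c. R (f a) c"
  shows "\<exists>B. \<forall>n. card (broken n) \<le> B"
proof (intro exI allI)
  fix n
  have dom_n: "\<exists>c. R ((f ^^ n) a) c" if "R a b" for a b
    using that by (induction n) (use dom in auto)
  have "broken n \<subseteq> unstable \<union> (f ^^ n) -` unstable"
  proof
    fix a assume "a \<in> broken n"
    then obtain b where b: "R a b" "\<not> R ((f ^^ n) a) ((f ^^ n) b)" by (auto simp: broken_def)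
    obtain c where c: "R ((f ^^ n) a) c" using dom_n[OF b(1)] by blast
    show "a \<in> unstable \<union> (f ^^ n) -` unstable"
    proof (cases "stable a b")
      case True
      then have "stable ((f ^^ n) a) ((f ^^ n) b)" by (simp add: stable_pow)
      then have "\<not> stable ((f ^^ n) a) c" using c b(2) stable_unique by metis
      then show ?thesis using c by (auto simp: unstable_def)
    next
      case False then show ?thesis using b by (auto simp: unstable_def)
    qed
  qed
  moreover have "inj (f ^^ n)" by (rule inj_fn[OF bij_is_inj[OF bij]])
  then have v: "finite ((f ^^ n) -` unstable)" "card ((f ^^ n) -` unstable) \<le> card unstable"
    using fin by (auto intro!: finite_vimageI card_inj_on_le[of "f ^^ n"] intro: inj_on_subset)
  ultimately have "card (broken n) \<le> card (unstable \<union> (f ^^ n) -` unstable)"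
    using fin by (intro card_mono) auto
  also have "\<dots> \<le> 2 * card unstable" using card_Un_le[of unstable "(f ^^ n) -` unstable"] v(2) by simp
  finally show "card (broken n) \<le> 2 * card unstable" .
qed

end

section \<open>Order automorphisms and piecewise order isomorphisms\<close>

lemma OA_D:
  assumes "OA L \<phi>"
  shows "\<phi> permutes L" "\<phi> ` L = L" "bij \<phi>" "\<And>x. x \<in> L \<Longrightarrow> \<phi> x \<in> L" "\<And>x. x \<notin> L \<Longrightarrow> \<phi> x = x"
    "\<And>x y. x \<in> L \<Longrightarrow> y \<in> L \<Longrightarrow> x < y \<Longrightarrow> \<phi> x < \<phi> y"
    "\<And>x y. x \<in> L \<Longrightarrow> y \<in> L \<Longrightarrow> \<phi> x < \<phi> y \<longleftrightarrow> x < y"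
    "\<And>x. finv \<phi> (\<phi> x) = x" "\<And>x. \<phi> (finv \<phi> x) = x"
proof -
  show p: "\<phi> permutes L" using assms by (simp add: OA_def)
  show "\<phi> ` L = L" "bij \<phi>" "\<And>x. x \<in> L \<Longrightarrow> \<phi> x \<in> L" "\<And>x. x \<notin> L \<Longrightarrow> \<phi> x = x"
    "\<And>x. finv \<phi> (\<phi> x) = x" "\<And>x. \<phi> (finv \<phi> x) = x"
    using p by (simp_all add: permutes_image permutes_bij permutes_in_image permutes_not_in permutes_inverses)
  show m: "\<And>x y. x \<in> L \<Longrightarrow> y \<in> L \<Longrightarrow> x < y \<Longrightarrow> \<phi> x < \<phi> y"
    using assms by (simp add: OA_def monotone_on_def)
  show "\<And>x y. x \<in> L \<Longrightarrow> y \<in> L \<Longrightarrow> \<phi> x < \<phi> y \<longleftrightarrow> x < y"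
    using m by (metis less_asym linorder_neqE_linordered_idom)
qed

lemma OAI:
  assumes "\<And>x. x \<notin> L \<Longrightarrow> \<phi> x = x" "\<phi> ` L = L" "\<And>x y. x \<in> L \<Longrightarrow> y \<in> L \<Longrightarrow> x < y \<Longrightarrow> \<phi> x < \<phi> y"
  shows "OA L \<phi>"
proof -
  have "strict_mono_on L \<phi>" using assms(3) by (simp add: monotone_on_def)
  moreover from this have "inj_on \<phi> L" by (rule strict_mono_on_imp_inj_on)
  then have "\<phi> permutes L" using assms(1,2) by (intro bij_imp_permutes) (simp_all add: bij_betw_def)
  ultimately show ?thesis by (simp add: OA_def)
qed

lemma OA_id: "OA L id"
  by (rule OAI) auto

lemma OA_comp: "OA L \<phi> \<Longrightarrow> OA L \<psi> \<Longrightarrow> OA L (\<psi> \<circ> \<phi>)"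
  unfolding OA_def by (auto simp: monotone_on_def permutes_in_image intro: permutes_compose)

lemma OA_inv:
  assumes "OA L \<phi>" shows "OA L (finv \<phi>)"
proof -
  note d = OA_D[OF assms]
  have p: "finv \<phi> permutes L" using d(1) by (rule permutes_inv)
  have "finv \<phi> x < finv \<phi> y" if "x \<in> L" "y \<in> L" "x < y" for x y
    using d(7)[of "finv \<phi> x" "finv \<phi> y"] that p by (simp add: d(9) permutes_in_image)
  then show ?thesis using p by (simp add: OA_def monotone_on_def)
qed

lemma OA_pow: "OA L \<phi> \<Longrightarrow> OA L (\<phi> ^^ n)"
  by (induction n) (simp_all add: OA_id[unfolded id_def] OA_id OA_comp[unfolded comp_def] comp_def)

text \<open>A map that preserves each of a family of convex blocks keeps the order of points in different
  blocks and need only be monotone inside the blocks.\<close>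
lemma blockwise_mono:
  fixes G :: "real \<Rightarrow> real"
  assumes sym: "\<And>x y. E x y \<Longrightarrow> E y x" and trans: "\<And>x y z. E x y \<Longrightarrow> E y z \<Longrightarrow> E x z"
    and conv: "\<And>x y z. E x y \<Longrightarrow> z \<in> L \<Longrightarrow> x < z \<Longrightarrow> z < y \<Longrightarrow> E x z"
    and G: "\<And>x. x \<in> L \<Longrightarrow> G x \<in> L" "\<And>x. x \<in> L \<Longrightarrow> E x (G x)"
      "\<And>x y. x \<in> L \<Longrightarrow> y \<in> L \<Longrightarrow> E x y \<Longrightarrow> x < y \<Longrightarrow> G x < G y"
    and x: "x \<in> L" "y \<in> L" "x < y"
  shows "G x < G y"
proof (cases "E x y")
  case False
  have n1: "\<not> E x (G y)" using False G(2)[OF x(2)] sym trans by blast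
  have n2: "\<not> E (G y) (G x)" using n1 G(2)[OF x(1)] sym trans by blast
  show ?thesis
  proof (rule ccontr)
    assume "\<not> G x < G y"
    then have ge: "G y \<le> G x" by simp
    have "\<not> y < G x" using conv[OF G(2)[OF x(1)] x(2) x(3)] False by blast
    moreover have "y \<noteq> G x" using G(2)[OF x(1)] False by auto
    ultimately have "G x < y" by simp
    moreover have "G y \<noteq> G x" using n1 G(2)[OF x(1)] by auto
    ultimately have "E (G y) (G x)" using conv[OF sym[OF G(2)[OF x(2)]] G(1)[OF x(1)]] ge by auto
    then show False using n2 by simp
  qed
qed (use G(3) x in auto)

text \<open>Infinite products: the copies of \<open>w n\<close> on the disjoint translates of \<open>A\<close> act together.\<close>
lemma OA_product:
  assumes T: "OA L T" and A: "A \<subseteq> L" "\<And>x y z. x \<in> A \<Longrightarrow> y \<in> A \<Longrightarrow> z \<in> L \<Longrightarrow> x < z \<Longrightarrow> z < y \<Longrightarrow> z \<in> A"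
    and w: "\<And>n. OA L (w n)" "\<And>n x. x \<notin> A \<Longrightarrow> w n x = x"
    and disj: "\<And>n x. n > 0 \<Longrightarrow> x \<in> A \<Longrightarrow> (T ^^ n) x \<notin> A"
  shows "\<exists>G. OA L G \<and> (\<forall>n. \<forall>x\<in>A. G ((T ^^ n) x) = (T ^^ n) (w n x)) \<and> (\<forall>x. (\<forall>n. x \<notin> (T ^^ n) ` A) \<longrightarrow> G x = x)"
proof -
  have Tn: "OA L (T ^^ n)" for n using T by (rule OA_pow)
  note dT = OA_D[OF Tn] and dw = OA_D[OF w(1)]
  have T_inj: "(T ^^ n) x = (T ^^ n) y \<longleftrightarrow> x = y" for n x y using dT(8)[of n] by metis
  have uniq: "n = m \<and> x = y" if h: "(T ^^ n) x = (T ^^ m) y" "x \<in> A" "y \<in> A" for n m x y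
  proof -
    have *: False if h: "(T ^^ n) x = (T ^^ m) y" "x \<in> A" "y \<in> A" "n < m" for n m x y
    proof -
      have "m = n + (m - n)" using h(4) by simp
      then have "(T ^^ m) y = (T ^^ n) ((T ^^ (m - n)) y)" by (metis funpow_add o_apply)
      then have "x = (T ^^ (m - n)) y" using h(1) T_inj by metis
      then show False using disj[of "m - n" y] h by auto
    qed
    have "n = m" using *[of n x m y] *[of m y n x] h by (metis linorder_neqE_nat)
    then show ?thesis using h T_inj by auto
  qed
  have wA: "w n x \<in> A" if x: "x \<in> A" for n x
  proof (rule ccontr)
    assume "w n x \<notin> A"
    then have "w n (w n x) = w n x" using w(2) by simp
    then have "w n x = x" using dw(8) by metis
    then show False using \<open>w n x \<notin> A\<close> x by simp
  qed
  define G where "G x = (if \<exists>n. \<exists>a\<in>A. x = (T ^^ n) a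
    then (case SOME (n, a). a \<in> A \<and> x = (T ^^ n) a of (n, a) \<Rightarrow> (T ^^ n) (w n a)) else x)" for x
  have G1: "G ((T ^^ n) a) = (T ^^ n) (w n a)" if a: "a \<in> A" for n a
  proof -
    have u: "(SOME (n', a'). a' \<in> A \<and> (T ^^ n) a = (T ^^ n') a') = (n, a)"
    proof (rule some_equality)
      show "case (n, a) of (n', a') \<Rightarrow> a' \<in> A \<and> (T ^^ n) a = (T ^^ n') a'" using a by simp
      show "p = (n, a)" if "case p of (n', a') \<Rightarrow> a' \<in> A \<and> (T ^^ n) a = (T ^^ n') a'" for p
        using that uniq[of n a "fst p" "snd p"] a by (cases p) auto
    qed
    have "\<exists>n'. \<exists>a'\<in>A. (T ^^ n) a = (T ^^ n') a'" using a by blast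
    then show ?thesis unfolding G_def u by simp
  qed
  have G0: "G x = x" if "\<And>n. x \<notin> (T ^^ n) ` A" for x
    using that unfolding G_def by auto
  define E where "E x y \<longleftrightarrow> x = y \<or> (\<exists>n. x \<in> (T ^^ n) ` A \<and> y \<in> (T ^^ n) ` A)" for x y
  have TL: "(T ^^ n) ` A \<subseteq> L" for n using A(1) dT(4)[of _ n] by blast
  have GL: "G x \<in> L" if x: "x \<in> L" for x
  proof (cases "\<exists>n. x \<in> (T ^^ n) ` A")
    case True
    then obtain n a where a: "a \<in> A" "x = (T ^^ n) a" by blast
    then have "(T ^^ n) (w n a) \<in> (T ^^ n) ` A" using wA by blast
    then show ?thesis using G1[OF a(1)] TL a(2) by (metis subsetD)
  qed (use G0 x in auto)
  have GE: "E x (G x)" for x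
  proof (cases "\<exists>n. x \<in> (T ^^ n) ` A")
    case True
    then obtain n a where a: "a \<in> A" "x = (T ^^ n) a" by blast
    then show ?thesis using G1[OF a(1)] wA[OF a(1)] unfolding E_def by blast
  qed (use G0 in \<open>auto simp: E_def\<close>)
  have mono: "G x < G y" if "x \<in> L" "y \<in> L" "x < y" for x y
  proof (rule blockwise_mono[of E L G, OF _ _ _ _ _ _ that])
    show "E y x" if "E x y" for x y using that unfolding E_def by blast
    show "E x z" if "E x y" "E y z" for x y z
      using that uniq unfolding E_def by (smt (verit) imageE)
    show "E x z" if h: "E x y" "z \<in> L" "x < z" "z < y" for x y z
    proof -
      obtain n a b where ab: "x = (T ^^ n) a" "y = (T ^^ n) b" "a \<in> A" "b \<in> A" using h unfolding E_def by auto
      have "z \<in> (T ^^ n) ` L" using dT(2) h(2) by simp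
      then obtain c where c: "z = (T ^^ n) c" "c \<in> L" by blast
      then have "a < c" "c < b" using h ab dT(7)[of _ _ n] A(1) by auto
      then have "c \<in> A" using A(2) ab c by blast
      then show ?thesis using ab c unfolding E_def by blast
    qed
    show "G x \<in> L" if "x \<in> L" for x using GL that .
    show "E x (G x)" for x by (rule GE)
    show "G x < G y" if h: "x \<in> L" "y \<in> L" "E x y" "x < y" for x y
    proof -
      obtain n a b where ab: "x = (T ^^ n) a" "y = (T ^^ n) b" "a \<in> A" "b \<in> A" using h unfolding E_def by auto
      have AL: "a \<in> L" "b \<in> L" using ab A(1) by auto
      have "a < b" using h(4) ab AL dT(7) by simp
      then have "w n a < w n b" using AL dw(6) by simp
      then show ?thesis using AL ab G1 dw(4) dT(6) by simp
    qed
  qed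
  have "L \<subseteq> G ` L"
  proof
    fix y assume y: "y \<in> L"
    show "y \<in> G ` L"
    proof (cases "\<exists>n. y \<in> (T ^^ n) ` A")
      case True
      then obtain n b where b: "b \<in> A" "y = (T ^^ n) b" by blast
      let ?a = "finv (w n) b"
      have "?a \<in> A"
      proof (rule ccontr)
        assume "?a \<notin> A"
        then show False using w(2)[of ?a n] dw(9)[of n b] b by simp
      qed
      then have "G ((T ^^ n) ?a) = y" "(T ^^ n) ?a \<in> (T ^^ n) ` A" using G1 b dw(9) by auto
      then have "G ((T ^^ n) ?a) = y" "(T ^^ n) ?a \<in> L" using TL by blast+
      then show ?thesis by blast
    qed (use G0 y in \<open>metis imageI\<close>)
  qed
  then have "G ` L = L" using GL by blast
  moreover have "G x = x" if "x \<notin> L" for x using G0[of x] that TL by blast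
  ultimately have "OA L G" using mono by (intro OAI)
  moreover have "\<forall>n. \<forall>x\<in>A. G ((T ^^ n) x) = (T ^^ n) (w n x)" using G1 by blast
  moreover have "\<forall>x. (\<forall>n. x \<notin> (T ^^ n) ` A) \<longrightarrow> G x = x" using G0 by blast
  ultimately show ?thesis by blast
qed

text \<open>Moving points inside a convex part keeps their order with the points outside.\<close>
lemma OA_extend:
  assumes I: "I = L \<inter> {s<..<t}" and S: "OA I S" shows "OA L S"
proof (rule OAI)
  note d = OA_D[OF S]
  show "S x = x" if "x \<notin> L" for x using that d(5) I by blast
  have eq: "S x = x" if "x \<in> L" "x \<notin> I" for x using that d(5) by blast
  have "L = I \<union> (L - I)" using I by blast
  moreover have "S ` (L - I) = L - I" using eq by force
  ultimately show "S ` L = L" using d(2) by (metis image_Un)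
  fix x y assume h: "x \<in> L" "y \<in> L" "x < y"
  show "S x < S y"
  proof (cases "x \<in> I"; cases "y \<in> I")
    assume "x \<in> I" "y \<in> I" then show ?thesis using d(6) h by blast
  next
    assume a: "x \<in> I" "y \<notin> I"
    then have "S x \<in> I" "S y = y" using d(4,5) by auto
    then show ?thesis using a h I by auto
  next
    assume a: "x \<notin> I" "y \<in> I"
    then have "S y \<in> I" "S x = x" using d(4,5) by auto
    then show ?thesis using a h I by auto
  qed (use d(5) h in auto)
qed

subsection \<open>Cells\<close>

text \<open>Cut points \<open>Z\<close> outside \<open>L\<close> divide it into cells, numbered from left to
  right by the number of cut points to their left. The outermost cells, and those between cut
  points in one gap, may be empty.\<close>
definition pos :: "real set \<Rightarrow> real \<Rightarrow> nat"
  where "pos Z x = card {z\<in>Z. z < x}"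

definition cell :: "real set \<Rightarrow> real set \<Rightarrow> nat \<Rightarrow> real set"
  where "cell L Z i = {x\<in>L. pos Z x = i}"

lemma pos_mono: "finite Z \<Longrightarrow> x \<le> y \<Longrightarrow> pos Z x \<le> pos Z y"
  unfolding pos_def by (intro card_mono) auto

lemma pos_le: "finite Z \<Longrightarrow> pos Z x \<le> card Z"
  unfolding pos_def by (intro card_mono) auto

lemma pos_eqI: "(\<And>z. z \<in> Z \<Longrightarrow> z < x \<longleftrightarrow> z < y) \<Longrightarrow> pos Z x = pos Z y"
  unfolding pos_def by (rule arg_cong[of _ _ card]) auto

lemma pos_locally_constant:
  assumes Z: "finite Z" "x \<notin> Z" shows "\<exists>\<delta>>0. \<forall>y. \<bar>y - x\<bar> < \<delta> \<longrightarrow> pos Z y = pos Z x"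
proof -
  have "open (- Z)" using Z(1) by (simp add: finite_imp_closed open_Compl)
  then obtain \<delta> where d: "\<delta> > 0" "\<And>z. dist z x < \<delta> \<Longrightarrow> z \<notin> Z" using Z(2) unfolding open_dist by auto
  have "pos Z y = pos Z x" if y: "\<bar>y - x\<bar> < \<delta>" for y
  proof (rule pos_eqI)
    fix z assume "z \<in> Z"
    then have "\<not> \<bar>z - x\<bar> < \<delta>" using d(2)[of z] by (auto simp: dist_real_def)
    then show "z < y \<longleftrightarrow> z < x" using y by auto
  qed
  then show ?thesis using d(1) by blast
qed

lemma closed_pos_set:
  assumes L: "closed L" and Z: "finite Z" "Z \<inter> L = {}"
  shows "closed {x\<in>L. P (pos Z x)}"
proof -
  have "{x\<in>L. P (pos Z x)} = (\<Union>W\<in>{W\<in>Pow Z. P (card W)}. L \<inter> (\<Inter>z\<in>W. {z..}) \<inter> (\<Inter>z\<in>Z - W. {..z}))" (is "?l = ?r")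
  proof
    show "?l \<subseteq> ?r"
    proof
      fix x assume x: "x \<in> ?l"
      then have "{z\<in>Z. z < x} \<in> {W\<in>Pow Z. P (card W)}" by (auto simp: pos_def)
      moreover have "x \<in> L \<inter> (\<Inter>z\<in>{z\<in>Z. z < x}. {z..}) \<inter> (\<Inter>z\<in>Z - {z\<in>Z. z < x}. {..z})" using x by auto
      ultimately show "x \<in> ?r" by blast
    qed
    show "?r \<subseteq> ?l"
    proof
      fix x assume "x \<in> ?r"
      then obtain W where W: "W \<subseteq> Z" "P (card W)" "x \<in> L" "\<forall>z\<in>W. z \<le> x" "\<forall>z\<in>Z - W. x \<le> z" by auto
      have "{z\<in>Z. z < x} = W"
      proof
        show "W \<subseteq> {z\<in>Z. z < x}" using W Z(2) by (auto simp: order.order_iff_strict)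
        show "{z\<in>Z. z < x} \<subseteq> W" using W by force
      qed
      then show "x \<in> ?l" using W by (simp add: pos_def)
    qed
  qed
  moreover have "closed ?r"
    using L Z(1) by (intro closed_UN closed_Int closed_INT) (auto simp: finite_Pow_iff)
  ultimately show ?thesis by simp
qed

lemma cell_cantor:
  assumes L: "cantor L" and Z: "finite Z" "Z \<inter> L = {}" and "cell L Z i \<noteq> {}"
  shows "cantor (cell L Z i)"
proof (rule cantor_clopen[OF L])
  show "closed (cell L Z i)" unfolding cell_def by (rule closed_pos_set) (use L Z in auto)
  have "L - cell L Z i = {x\<in>L. pos Z x \<noteq> i}" by (auto simp: cell_def)
  then show "closed (L - cell L Z i)" using closed_pos_set[of L Z "\<lambda>n. n \<noteq> i"] L Z by simp
qed (use assms in \<open>auto simp: cell_def\<close>)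

text \<open>Cells are convex in \<open>L\<close>, so their gaps are gaps of \<open>L\<close>, and no cut is
  made inside them.\<close>
lemma consec_cell:
  assumes Z: "finite Z" and c: "consec (cell L Z i) p q"
  shows "consec L p q" "(p + q) / 2 \<notin> Z"
proof -
  have pq: "p \<in> L" "q \<in> L" "pos Z p = i" "pos Z q = i" "p < q" using consecD(1-3)[OF c] by (auto simp: cell_def)
  have "z \<in> cell L Z i" if "z \<in> L" "p < z" "z < q" for z
    using pos_mono[OF Z, of p z] pos_mono[OF Z, of z q] that pq by (simp add: cell_def)
  then show "consec L p q" using pq consecD(4)[OF c] unfolding consec_def by force
  show "(p + q) / 2 \<notin> Z"
  proof
    assume z: "(p + q) / 2 \<in> Z"
    have "(p + q) / 2 \<in> {z\<in>Z. z < q}" "(p + q) / 2 \<notin> {z\<in>Z. z < p}" using z pq(5) by auto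
    moreover have "{z\<in>Z. z < p} \<subseteq> {z\<in>Z. z < q}" using pq(5) by auto
    ultimately have "{z\<in>Z. z < p} \<subset> {z\<in>Z. z < q}" by blast
    then have "pos Z p < pos Z q" unfolding pos_def using Z by (intro psubset_card_mono) auto
    then show False using pq by simp
  qed
qed

text \<open>Nonempty cells are Cantor sets, and any two Cantor sets are order isomorphic.\<close>
lemma cells_iso:
  assumes L: "cantor L" and Z: "finite Z" "Z \<inter> L = {}" and Z': "finite Z'" "Z' \<inter> L = {}"
    and \<tau>: "bij \<tau>" and ne: "\<And>i. cell L Z i = {} \<longleftrightarrow> cell L Z' (\<tau> i) = {}"
  shows "\<exists>u. u permutes L \<and> (\<forall>i. oiso (cell L Z i) (cell L Z' (\<tau> i)) u)"
proof -
  have "\<exists>\<phi>. oiso (cell L Z i) (cell L Z' (\<tau> i)) \<phi>" for i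
  proof (cases "cell L Z i = {}")
    case True
    then show ?thesis using ne[of i] by (auto simp: oiso_def)
  next
    case False
    then show ?thesis using cell_cantor[OF L Z, of i] cell_cantor[OF L Z', of "\<tau> i"] ne[of i] cantor_oiso by blast
  qed
  then obtain \<phi> where \<phi>: "\<And>i. oiso (cell L Z i) (cell L Z' (\<tau> i)) (\<phi> i)" by metis
  define u where "u x = (if x \<in> L then \<phi> (pos Z x) x else x)" for x
  have ueq: "u x = \<phi> i x" if "x \<in> cell L Z i" for i x using that by (auto simp: u_def cell_def)
  have iso: "oiso (cell L Z i) (cell L Z' (\<tau> i)) u" for i
  proof -
    have "strict_mono_on (cell L Z i) u" using \<phi>[of i] ueq by (simp add: oiso_def monotone_on_def)
    moreover have "u ` cell L Z i = cell L Z' (\<tau> i)" using \<phi>[of i] ueq by (simp add: oiso_def image_def)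
    ultimately show ?thesis by (simp add: oiso_def)
  qed
  have cover: "L = (\<Union>i. cell L Z i)" "L = (\<Union>i. cell L Z' i)" by (auto simp: cell_def)
  have "u ` L = (\<Union>i. cell L Z' (\<tau> i))"
    using iso unfolding oiso_def by (subst cover(1)) (auto simp: image_UN)
  also have "\<dots> = (\<Union>i. cell L Z' i)" using bij_is_surj[OF \<tau>] by (auto, metis surjD)
  finally have im: "u ` L = L" using cover(2) by simp
  have "inj_on u L"
  proof (rule inj_onI)
    fix x y assume h: "x \<in> L" "y \<in> L" "u x = u y"
    have xy: "x \<in> cell L Z (pos Z x)" "y \<in> cell L Z (pos Z y)" using h by (auto simp: cell_def)
    then have "u x \<in> cell L Z' (\<tau> (pos Z x))" "u y \<in> cell L Z' (\<tau> (pos Z y))" using iso by (auto simp: oiso_def)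
    then have "\<tau> (pos Z x) = \<tau> (pos Z y)" using h(3) by (simp add: cell_def)
    then have "pos Z x = pos Z y" using bij_is_inj[OF \<tau>] by (simp add: inj_eq)
    then have "y \<in> cell L Z (pos Z x)" using xy(2) by simp
    moreover have "inj_on u (cell L Z (pos Z x))"
      using iso[of "pos Z x"] strict_mono_on_imp_inj_on unfolding oiso_def by blast
    ultimately show "x = y" using xy(1) h(3) by (simp add: inj_on_eq_iff)
  qed
  then have "u permutes L" using im by (intro bij_imp_permutes) (auto simp: bij_betw_def u_def)
  then show ?thesis using iso by blast
qed

lemma cells_OA:
  assumes L: "cantor L" and Z: "finite Z" "Z \<inter> L = {}" and Z': "finite Z'" "Z' \<inter> L = {}"
    and ne: "\<And>i. cell L Z i = {} \<longleftrightarrow> cell L Z' i = {}"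
  shows "\<exists>u. OA L u \<and> (\<forall>x\<in>L. pos Z' (u x) = pos Z x)"
proof -
  obtain u where u: "u permutes L" "\<And>i. oiso (cell L Z i) (cell L Z' i) u"
    using cells_iso[OF L Z Z' bij_id] ne by (metis id_apply)
  have in_cell: "x \<in> cell L Z (pos Z x)" if "x \<in> L" for x using that by (simp add: cell_def)
  have p: "pos Z' (u x) = pos Z x" if x: "x \<in> L" for x
  proof -
    have "u x \<in> cell L Z' (pos Z x)" using u(2)[of "pos Z x"] in_cell[OF x] by (auto simp: oiso_def)
    then show ?thesis by (simp add: cell_def)
  qed
  have "u x < u y" if h: "x \<in> L" "y \<in> L" "x < y" for x y
  proof (cases "pos Z x = pos Z y")
    case True
    then have "y \<in> cell L Z (pos Z x)" using in_cell[OF h(2)] by simp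
    moreover have "strict_mono_on (cell L Z (pos Z x)) u" using u(2) by (simp add: oiso_def)
    ultimately show ?thesis using in_cell[OF h(1)] h(3) unfolding monotone_on_def by blast
  next
    case False
    then have "pos Z x < pos Z y" using pos_mono[OF Z(1), of x y] h by simp
    then have "\<not> u y \<le> u x" using pos_mono[OF Z'(1), of "u y" "u x"] p h by auto
    then show ?thesis by simp
  qed
  then have "OA L u" using u(1) by (simp add: OA_def monotone_on_def)
  then show ?thesis using p by blast
qed

lemma cells_PH:
  assumes L: "cantor L" and Z: "finite Z" "Z \<inter> L = {}" and Z': "finite Z'" "Z' \<inter> L = {}"
    and \<tau>: "bij \<tau>" and ne: "\<And>i. cell L Z i = {} \<longleftrightarrow> cell L Z' (\<tau> i) = {}"
  shows "\<exists>u. PH L u \<and> (\<forall>i. oiso (cell L Z i) (cell L Z' (\<tau> i)) u)"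
proof -
  obtain u where u: "u permutes L" "\<And>i. oiso (cell L Z i) (cell L Z' (\<tau> i)) u"
    using cells_iso[OF L Z Z' \<tau> ne] by blast
  have in_cell: "x \<in> cell L Z (pos Z x)" if "x \<in> L" for x using that by (simp add: cell_def)
  have cl: "closed (cell L Z i)" "compact (cell L Z' i)" for i
  proof -
    show "closed (cell L Z i)" unfolding cell_def by (rule closed_pos_set) (use L Z in auto)
    have "closed (cell L Z' i)" unfolding cell_def by (rule closed_pos_set) (use L Z' in auto)
    then show "compact (cell L Z' i)"
      using compact_Int_closed[OF cantor_compact(1)[OF L]] by (metis (no_types, lifting) Int_absorb1 cell_def mem_Collect_eq subsetI)
  qed
  have "L = (\<Union>i\<in>{..card Z}. cell L Z i)" using pos_le[OF Z(1)] by (auto simp: cell_def)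
  moreover have "continuous_on (\<Union>i\<in>{..card Z}. cell L Z i) u"
    by (rule continuous_on_closed_Union) (use cl oiso_continuous[OF cl(2) u(2)] in auto)
  ultimately have "continuous_on L u" by simp
  moreover have "locally_mono L u"
  proof (rule locally_monoI)
    fix x assume x: "x \<in> L"
    have "x \<notin> Z" using x Z(2) by auto
    then obtain \<delta> where d: "\<delta> > 0" "\<forall>y. \<bar>y - x\<bar> < \<delta> \<longrightarrow> pos Z y = pos Z x"
      using pos_locally_constant[OF Z(1)] by blast
    have same: "pos Z y = pos Z x" if "\<bar>y - x\<bar> < \<delta>" for y using d(2) that by blast
    have "u y < u z" if h: "y \<in> L" "z \<in> L" "\<bar>y - x\<bar> < \<delta>" "\<bar>z - x\<bar> < \<delta>" "y < z" for y z
    proof -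
      have "y \<in> cell L Z (pos Z x)" "z \<in> cell L Z (pos Z x)"
        using in_cell[OF h(1)] in_cell[OF h(2)] same[OF h(3)] same[OF h(4)] by simp_all
      moreover have "strict_mono_on (cell L Z (pos Z x)) u" using u(2) by (simp add: oiso_def)
      ultimately show ?thesis using h(5) unfolding monotone_on_def by blast
    qed
    then show "\<exists>\<delta> s. \<delta> > 0 \<and> (s = 1 \<or> s = (-1::real)) \<and> (\<forall>y\<in>L. \<forall>z\<in>L.
      \<bar>y - x\<bar> < \<delta> \<longrightarrow> \<bar>z - x\<bar> < \<delta> \<longrightarrow> y < z \<longrightarrow> s * u y < s * u z)"
      using d(1) by (intro exI[of _ \<delta>] exI[of _ 1]) auto
  qed
  ultimately show ?thesis using u by (auto simp: PH_def)
qed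

lemma pos_singleton: "pos {s} x = (if s < x then 1 else 0)"
proof -
  have "{z\<in>{s}. z < x} = (if s < x then {s} else {})" by auto
  then show ?thesis by (simp add: pos_def)
qed

lemma pos_pair: "s < t \<Longrightarrow> pos {s, t} x = (if t < x then 2 else if s < x then 1 else 0)"
proof -
  assume "s < t"
  then have "{z\<in>{s, t}. z < x} = (if t < x then {s, t} else if s < x then {s} else {})" by auto
  then show ?thesis using \<open>s < t\<close> by (simp add: pos_def)
qed

lemma cell_singleton:
  assumes "s \<notin> L"
  shows "cell L {s} i = (if i = 0 then L \<inter> {..<s} else if i = 1 then L \<inter> {s<..} else {})"
proof -
  have "x \<noteq> s" if "x \<in> L" for x using that assms by auto
  then have "\<not> s < x \<longleftrightarrow> x < s" if "x \<in> L" for x using that by force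
  then show ?thesis unfolding cell_def pos_singleton by auto
qed

lemma cell_pair:
  assumes "s < t" "s \<notin> L" "t \<notin> L"
  shows "cell L {s, t} i = (if i = 0 then L \<inter> {..<s} else if i = 1 then L \<inter> {s<..<t} else if i = 2 then L \<inter> {t<..} else {})"
proof -
  have "x \<noteq> s \<and> x \<noteq> t" if "x \<in> L" for x using that assms by auto
  then have "\<not> s < x \<longleftrightarrow> x < s" "\<not> t < x \<longleftrightarrow> x < t" if "x \<in> L" for x using that by force+
  then show ?thesis unfolding cell_def pos_pair[OF assms(1)] using assms(1) by auto
qed

lemma cantor_split:
  assumes "cantor L" obtains z where "z \<notin> L" "L \<inter> {..<z} \<noteq> {}" "L \<inter> {z<..} \<noteq> {}"
proof -
  obtain x y where xy: "x \<in> L" "y \<in> L" "x < y" using cantor_two_points[OF assms] .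
  then obtain z where z: "x < z" "z < y" "z \<notin> L" using assms unfolding cantor_def by blast
  show ?thesis by (rule that[of z]) (use xy z in auto)
qed

lemma cantor_rays:
  assumes L: "cantor L" and z: "z \<notin> L"
  shows "L \<inter> {..<z} \<noteq> {} \<Longrightarrow> cantor (L \<inter> {..<z})" "L \<inter> {z<..} \<noteq> {} \<Longrightarrow> cantor (L \<inter> {z<..})"
  using cell_cantor[OF L, of "{z}" 0] cell_cantor[OF L, of "{z}" 1] z by (simp_all add: cell_singleton)

lemma cantor_interval:
  assumes L: "cantor L" and st: "s < t" "s \<notin> L" "t \<notin> L" "L \<inter> {s<..<t} \<noteq> {}"
  shows "cantor (L \<inter> {s<..<t})"
  using cell_cantor[OF L, of "{s, t}" 1] st by (simp add: cell_pair)

text \<open>The three parts of \<open>L\<close> cut out by \<open>s\<close> and \<open>t\<close> are moved to the three parts cut out by \<open>t\<close> and a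
  point further to the right.\<close>
lemma shift_exists:
  assumes L: "cantor L" and st: "s < t" "s \<notin> L" "t \<notin> L"
    and ne: "L \<inter> {..<s} \<noteq> {}" "L \<inter> {s<..<t} \<noteq> {}" "L \<inter> {t<..} \<noteq> {}"
  obtains T where "OA L T" "\<And>x. x \<in> L \<Longrightarrow> s < x \<Longrightarrow> t < T x"
proof -
  obtain r where r: "r \<notin> L \<inter> {t<..}" "L \<inter> {t<..} \<inter> {..<r} \<noteq> {}" "L \<inter> {t<..} \<inter> {r<..} \<noteq> {}"
    using cantor_split[OF cantor_rays(2)[OF L st(3) ne(3)]] .
  have tr: "t < r" using r(2) by auto
  then have rL: "r \<notin> L" using r(1) by auto
  have "L \<inter> {..<t} \<noteq> {}" using ne(1) st(1) by fastforce
  moreover have "L \<inter> {t<..<r} \<noteq> {}" using r(2) by auto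
  moreover have "L \<inter> {r<..} \<noteq> {}" using r(3) by auto
  ultimately have "cell L {s, t} i = {} \<longleftrightarrow> cell L {t, r} i = {}" for i
    using ne by (simp add: cell_pair[OF st] cell_pair[OF tr st(3) rL])
  then obtain T where T: "OA L T" "\<forall>x\<in>L. pos {t, r} (T x) = pos {s, t} x"
    using cells_OA[OF L, of "{s, t}" "{t, r}"] st rL by auto
  have "t < T x" if "x \<in> L" "s < x" for x
  proof -
    have "0 < pos {s, t} x" using that(2) by (simp add: pos_pair[OF st(1)])
    then have "0 < pos {t, r} (T x)" using T(2) that(1) by simp
    then show ?thesis using tr by (auto simp: pos_pair[OF tr] split: if_splits)
  qed
  then show ?thesis using that T(1) by blast
qed

section \<open>Sequences of controlled word length\<close>

definition word_of :: "('a \<Rightarrow> 'a) list \<Rightarrow> 'a \<Rightarrow> 'a"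
  where "word_of ws = foldr (\<circ>) ws id"

definition words :: "('a \<Rightarrow> 'a) set \<Rightarrow> nat \<Rightarrow> ('a \<Rightarrow> 'a) set"
  where "words S n = {word_of ws | ws. set ws \<subseteq> S \<union> finv ` S \<and> length ws \<le> n}"

lemma word_of_simps [simp]: "word_of [] = id" "word_of (s # ws) = s \<circ> word_of ws"
  by (simp_all add: word_of_def)

lemma word_of_append: "word_of (xs @ ys) = word_of xs \<circ> word_of ys"
  by (induction xs) (simp_all add: comp_assoc)

lemma words_comp:
  assumes "u \<in> words S m" "v \<in> words S n" shows "u \<circ> v \<in> words S (m + n)"
proof -
  obtain xs ys where "u = word_of xs" "v = word_of ys" "set xs \<subseteq> S \<union> finv ` S" "length xs \<le> m"
    "set ys \<subseteq> S \<union> finv ` S" "length ys \<le> n" using assms unfolding words_def by blast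
  then show ?thesis unfolding words_def by (intro CollectI exI[of _ "xs @ ys"]) (simp add: word_of_append)
qed

lemma words_mono: "S \<subseteq> S' \<Longrightarrow> m \<le> n \<Longrightarrow> words S m \<subseteq> words S' n"
  unfolding words_def by fastforce

lemma words_id: "id \<in> words S n"
  unfolding words_def by (intro CollectI exI[of _ "[]"]) simp

lemma words_gen: "s \<in> S \<Longrightarrow> 1 \<le> n \<Longrightarrow> s \<in> words S n"
  unfolding words_def by (intro CollectI exI[of _ "[s]"]) simp

lemma words_pow: "s \<in> S \<Longrightarrow> s ^^ n \<in> words S n"
proof (induction n)
  case 0 then show ?case using words_id by (simp add: id_def)
next
  case (Suc n)
  then have "s ^^ n \<in> words S n" by blast
  then have "s \<circ> s ^^ n \<in> words S (1 + n)" by (rule words_comp[OF words_gen[OF Suc.prems order_refl]])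
  then show ?case by (simp only: funpow.simps plus_1_eq_Suc)
qed

lemma words_inv:
  assumes S: "\<And>s. s \<in> S \<Longrightarrow> bij s" and w: "w \<in> words S n" shows "finv w \<in> words S n"
proof -
  obtain ws where ws: "w = word_of ws" "set ws \<subseteq> S \<union> finv ` S" "length ws \<le> n"
    using w unfolding words_def by blast
  have b: "bij s" if "s \<in> S \<union> finv ` S" for s using that S bij_imp_bij_inv by blast
  have "finv (word_of ws) = word_of (rev (map finv ws)) \<and> bij (word_of ws)"
    using ws(2)
  proof (induction ws)
    case Nil then show ?case by (simp add: inv_id bij_id[unfolded id_def])
  next
    case (Cons s ws)
    then have "bij s" "bij (word_of ws)" "finv (word_of ws) = word_of (rev (map finv ws))" using b by auto
    then show ?case
      using o_inv_distrib[of s "word_of ws"] bij_comp[of "word_of ws" s]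
      by (simp only: word_of_simps rev.simps list.map word_of_append comp_id)
  qed
  moreover have "finv s \<in> S \<union> finv ` S" if "s \<in> S \<union> finv ` S" for s
    using that S inv_inv_eq by force
  then have "set (rev (map finv ws)) \<subseteq> S \<union> finv ` S" using ws(2) unfolding set_rev set_map by blast
  ultimately show ?thesis unfolding words_def
    by (intro CollectI exI[of _ "rev (map finv ws)"]) (use ws in simp)
qed

text \<open>One finite set of letters serves the whole sequence, and the length grows at most linearly with
  the index. Since the sequence is later made of the powers with exponents \<open>k ^ 2\<close>,
  any growth slower than \<open>k ^ 2\<close> would do.\<close>
definition controlled :: "real set \<Rightarrow> (nat \<Rightarrow> real \<Rightarrow> real) \<Rightarrow> bool"
  where "controlled L g \<longleftrightarrow> (\<exists>S C. finite S \<and> (\<forall>s\<in>S. PH L s) \<and> (\<forall>k. g k \<in> words S (C * (k + 1))))"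

lemma PH_bij: "PH L s \<Longrightarrow> bij s"
  unfolding PH_def using permutes_bij by blast

lemma controlled_comp:
  assumes "controlled L g" "controlled L h" shows "controlled L (\<lambda>k. g k \<circ> h k)"
proof -
  obtain S C S' C' where a: "finite S" "\<forall>s\<in>S. PH L s" "\<And>k. g k \<in> words S (C * (k + 1))"
    "finite S'" "\<forall>s\<in>S'. PH L s" "\<And>k. h k \<in> words S' (C' * (k + 1))"
    using assms unfolding controlled_def by blast
  have "g k \<circ> h k \<in> words (S \<union> S') ((C + C') * (k + 1))" for k
  proof -
    have "g k \<in> words (S \<union> S') (C * (k + 1))" "h k \<in> words (S \<union> S') (C' * (k + 1))"
      using a(3,6) words_mono[of S "S \<union> S'"] words_mono[of S' "S \<union> S'"] by blast+
    from words_comp[OF this] show ?thesis by (simp add: algebra_simps)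
  qed
  moreover have "finite (S \<union> S')" "\<forall>s\<in>S \<union> S'. PH L s" using a by auto
  ultimately show ?thesis unfolding controlled_def by blast
qed

lemma controlled_inv:
  assumes "controlled L g" shows "controlled L (\<lambda>k. finv (g k))"
proof -
  obtain S C where "finite S" "\<forall>s\<in>S. PH L s" "\<And>k. g k \<in> words S (C * (k + 1))"
    using assms unfolding controlled_def by blast
  then show ?thesis using words_inv[of S] PH_bij unfolding controlled_def by metis
qed

lemma controlled_finite:
  assumes "finite F" "\<And>s. s \<in> F \<Longrightarrow> PH L s" "\<And>k. g k \<in> F" shows "controlled L g"
  unfolding controlled_def
proof (rule exI[of _ F], rule exI[of _ 1], intro conjI allI)
  show "g k \<in> words F (1 * (k + 1))" for k using assms(3) by (rule words_gen) simp
qed (use assms in auto)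

lemma controlled_const: "PH L s \<Longrightarrow> controlled L (\<lambda>k. s)"
  by (rule controlled_finite[of "{s}"]) auto

lemma controlled_pow: "PH L s \<Longrightarrow> controlled L (\<lambda>k. s ^^ k)"
  unfolding controlled_def
proof (rule exI[of _ "{s}"], rule exI[of _ 1], intro conjI allI)
  show "s ^^ k \<in> words {s} (1 * (k + 1))" for k
    using words_pow[of s "{s}" k] words_mono[of "{s}" "{s}" k "k + 1"] by auto
qed auto

lemma controlled_cases:
  assumes "controlled L g" "controlled L h" "\<And>k. f k = g k \<or> f k = h k" shows "controlled L f"
proof -
  obtain S C S' C' where a: "finite S" "\<forall>s\<in>S. PH L s" "\<And>k. g k \<in> words S (C * (k + 1))"
    "finite S'" "\<forall>s\<in>S'. PH L s" "\<And>k. h k \<in> words S' (C' * (k + 1))"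
    using assms unfolding controlled_def by blast
  have "f k \<in> words (S \<union> S') ((C + C') * (k + 1))" for k
  proof -
    have "words S (C * (k + 1)) \<subseteq> words (S \<union> S') ((C + C') * (k + 1))"
      "words S' (C' * (k + 1)) \<subseteq> words (S \<union> S') ((C + C') * (k + 1))"
      by (intro words_mono mult_le_mono1; simp)+
    then show ?thesis using a(3,6) assms(3)[of k] by (metis subsetD)
  qed
  moreover have "finite (S \<union> S')" "\<forall>s\<in>S \<union> S'. PH L s" using a by auto
  ultimately show ?thesis unfolding controlled_def by blast
qed

subsection \<open>Automorphisms supported in an interval\<close>

lemma comp_inv_cancel: "bij f \<Longrightarrow> finv f (f x) = x" "bij f \<Longrightarrow> f (finv f x) = x"
  by (simp_all add: bij_is_inj bij_is_surj surj_f_inv_f)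

text \<open>Let \<open>A\<close> be the part of \<open>L\<close> between \<open>s1\<close> and
  \<open>t1\<close>, which contains the support of all \<open>u k\<close>, and let
  \<open>I\<close> be the part between \<open>s0\<close> and \<open>t0\<close>. Some automorphism
  \<open>S\<close> of \<open>I\<close> has disjoint translates of \<open>A\<close>, and some
  automorphism \<open>T\<close> of \<open>L\<close> has disjoint translates of \<open>I\<close>.
  With \<open>w k\<close> the product of the copies of \<open>u k\<close> on the translates of
  \<open>A\<close>, the map \<open>u k\<close> is the commutator of \<open>w k\<close> and
  \<open>S\<close>. All \<open>w k\<close> are stored in one map \<open>G\<close>, which acts as
  the copy of \<open>w k\<close> on the \<open>k\<close>-th translate of \<open>I\<close>;
  conjugating \<open>G\<close> by \<open>T ^^ k\<close> brings \<open>w k\<close> back to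
  \<open>I\<close>, and the commutator with \<open>S\<close>, which is the identity outside
  \<open>I\<close>, discards the rest.\<close>
lemma controlled_inner_interval:
  assumes L: "cantor L" and ord: "s0 < s1" "s1 < t1" "t1 < t0"
    and out: "s0 \<notin> L" "s1 \<notin> L" "t1 \<notin> L" "t0 \<notin> L"
    and ne: "L \<inter> {..<s0} \<noteq> {}" "L \<inter> {s0<..<s1} \<noteq> {}" "L \<inter> {s1<..<t1} \<noteq> {}" "L \<inter> {t1<..<t0} \<noteq> {}" "L \<inter> {t0<..} \<noteq> {}"
    and u: "\<And>k. OA L (u k)" "\<And>k x. x \<notin> L \<inter> {s1<..<t1} \<Longrightarrow> u k x = x"
  shows "controlled L u"
proof -
  define I where "I = L \<inter> {s0<..<t0}"
  define A where "A = L \<inter> {s1<..<t1}"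
  have AI: "A \<subseteq> I" "I \<subseteq> L" using ord by (auto simp: A_def I_def)
  have "I \<noteq> {}" using AI ne(3) by (auto simp: A_def)
  obtain T where T: "OA L T" "\<And>x. x \<in> L \<Longrightarrow> s0 < x \<Longrightarrow> t0 < T x"
    by (rule shift_exists[OF L, of s0 t0]) (use ord out ne \<open>I \<noteq> {}\<close> in \<open>auto simp: I_def\<close>)
  have cI: "cantor I" unfolding I_def using cantor_interval[OF L, of s0 t0] ord out \<open>I \<noteq> {}\<close> by (simp add: I_def)
  obtain S where S: "OA I S" "\<And>x. x \<in> I \<Longrightarrow> s1 < x \<Longrightarrow> t1 < S x"
  proof (rule shift_exists[OF cI, of s1 t1])
    show "s1 < t1" "s1 \<notin> I" "t1 \<notin> I" using ord out by (auto simp: I_def)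
    have "L \<inter> {s0<..<s1} \<subseteq> I \<inter> {..<s1}" "L \<inter> {s1<..<t1} \<subseteq> I \<inter> {s1<..<t1}" "L \<inter> {t1<..<t0} \<subseteq> I \<inter> {t1<..}"
      using ord by (auto simp: I_def)
    then show "I \<inter> {..<s1} \<noteq> {}" "I \<inter> {s1<..<t1} \<noteq> {}" "I \<inter> {t1<..} \<noteq> {}"
      using ne(2,3,4) by (metis subset_empty)+
  qed blast
  note dS = OA_D[OF S(1)] and dT = OA_D[OF T(1)]
  have SL: "OA L S" by (rule OA_extend[OF I_def S(1)])
  have S_out: "(S ^^ n) x \<notin> A" if n: "n > 0" and x: "x \<in> A" for n x
  proof -
    have "(S ^^ Suc m) x \<in> I \<and> t1 < (S ^^ Suc m) x" for m
    proof (induction m)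
      case 0 then show ?case using S(2)[of x] dS(4)[of x] x AI by (auto simp: A_def)
    next
      case (Suc m) then show ?case using S(2)[of "(S ^^ Suc m) x"] dS(4)[of "(S ^^ Suc m) x"] ord by auto
    qed
    then have "t1 < (S ^^ n) x" using n by (metis Suc_pred)
    then show ?thesis by (auto simp: A_def)
  qed
  have T_out: "(T ^^ n) x \<notin> I" if n: "n > 0" and x: "x \<in> I" for n x
  proof -
    have "(T ^^ Suc m) x \<in> L \<and> t0 < (T ^^ Suc m) x" for m
    proof (induction m)
      case 0 then show ?case using T(2)[of x] dT(4)[of x] x AI by (auto simp: I_def)
    next
      case (Suc m) then show ?case using T(2)[of "(T ^^ Suc m) x"] dT(4)[of "(T ^^ Suc m) x"] ord by auto
    qed
    then have "t0 < (T ^^ n) x" using n by (metis Suc_pred)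
    then show ?thesis by (auto simp: I_def)
  qed
  have "\<exists>w. OA L w \<and> (\<forall>n. \<forall>x\<in>A. w ((S ^^ n) x) = (S ^^ n) (u k x)) \<and> (\<forall>x. (\<forall>n. x \<notin> (S ^^ n) ` A) \<longrightarrow> w x = x)" for k
    by (rule OA_product[OF SL, of A "\<lambda>_. u k"]) (use u S_out in \<open>auto simp: A_def\<close>)
  then obtain w where w: "\<And>k. OA L (w k)" "\<And>k n x. x \<in> A \<Longrightarrow> w k ((S ^^ n) x) = (S ^^ n) (u k x)"
    "\<And>k x. (\<And>n. x \<notin> (S ^^ n) ` A) \<Longrightarrow> w k x = x" by metis
  have SnI: "(S ^^ n) x \<in> I" if "x \<in> I" for n x using that by (induction n) (use dS(4) in auto)
  have wI: "w k x = x" if "x \<notin> I" for k x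
    using w(3)[of x k] SnI that AI by blast
  have "\<exists>G. OA L G \<and> (\<forall>n. \<forall>x\<in>I. G ((T ^^ n) x) = (T ^^ n) (w n x)) \<and> (\<forall>x. (\<forall>n. x \<notin> (T ^^ n) ` I) \<longrightarrow> G x = x)"
    by (rule OA_product[OF T(1), of I w]) (use w(1) wI T_out in \<open>auto simp: I_def\<close>)
  then obtain G where G: "OA L G" "\<And>n x. x \<in> I \<Longrightarrow> G ((T ^^ n) x) = (T ^^ n) (w n x)" by blast
  define H where "H k = finv (T ^^ k) \<circ> G \<circ> T ^^ k" for k
  have HOA: "OA L (H k)" for k
    unfolding H_def by (intro OA_comp OA_inv OA_pow T(1) G(1))
  have PHs: "PH L T" "PH L S" "PH L G" using T(1) SL G(1) L by (auto intro: OA_imp_PH)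
  have bT: "bij (T ^^ k)" for k using OA_D(3)[OF OA_pow[OF T(1)]] .
  have Hw: "H k x = w k x" if "x \<in> I" for k x
    using G(2)[OF that, of k] comp_inv_cancel(1)[OF bT] by (simp add: H_def)
  have u_eq: "u k = H k \<circ> S \<circ> finv (H k) \<circ> finv S" for k
  proof -
    note dH = OA_D[OF HOA[of k]] and dw = OA_D[OF w(1)[of k]]
    have wII: "w k x \<in> I" if x: "x \<in> I" for x
    proof (rule ccontr)
      assume "w k x \<notin> I"
      then have "w k (w k x) = w k x" using wI by simp
      then have "w k x = x" using dw(8) by metis
      then show False using \<open>w k x \<notin> I\<close> x by simp
    qed
    \<comment> \<open>On a translate of \<open>A\<close> both sides act as the copy of \<open>u k\<close> followed by the shift. The factor \<open>u k\<close> on the left makes up for the first translate, \<open>A\<close> itself, which has no predecessor.\<close>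
    have key: "u k (S (H k x)) = H k (S x)" for x
    proof (cases "x \<in> I")
      case True
      then have SI: "S x \<in> I" using dS(4) by blast
      show ?thesis
      proof (cases "\<exists>n. x \<in> (S ^^ n) ` A")
        case True
        then obtain n a where a: "a \<in> A" "x = (S ^^ n) a" by blast
        have ua: "u k a \<in> A"
        proof (rule ccontr)
          assume n: "u k a \<notin> A"
          then have "u k (u k a) = u k a" using u(2) by (simp add: A_def)
          then have "u k a = a" using OA_D(8)[OF u(1)[of k]] by metis
          then show False using n a by simp
        qed
        have "S (H k x) = (S ^^ Suc n) (u k a)" using Hw[OF \<open>x \<in> I\<close>] w(2)[OF a(1)] a(2) by simp
        moreover have "(S ^^ Suc n) (u k a) \<notin> A" using S_out ua by blast
        ultimately have "u k (S (H k x)) = (S ^^ Suc n) (u k a)" using u(2) by (simp add: A_def)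
        moreover have "H k (S x) = (S ^^ Suc n) (u k a)" using Hw[OF SI] w(2)[OF a(1), of k "Suc n"] a(2) by simp
        ultimately show ?thesis by simp
      next
        case False
        then have hx: "H k x = x" using Hw[OF \<open>x \<in> I\<close>] w(3) by metis
        show ?thesis
        proof (cases "S x \<in> A")
          case True
          then show ?thesis using hx Hw[OF SI] w(2)[OF True, of k 0] by simp
        next
          case nA: False
          have "S x \<notin> (S ^^ n) ` A" for n
          proof
            assume h: "S x \<in> (S ^^ n) ` A"
            then obtain m where m: "n = Suc m" using nA by (cases n) auto
            then obtain a where "a \<in> A" "S x = S ((S ^^ m) a)" using h by auto
            then have "x = (S ^^ m) a" using dS(8) by metis
            then show False using \<open>\<nexists>n. x \<in> (S ^^ n) ` A\<close> \<open>a \<in> A\<close> by blast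
          qed
          then have "H k (S x) = S x" using Hw[OF SI] w(3) by metis
          then show ?thesis using hx u(2) nA by (simp add: A_def)
        qed
      qed
    next
      case False
      have "H k x \<notin> I"
      proof
        assume hI: "H k x \<in> I"
        have "finv (w k) (H k x) \<in> I"
        proof (rule ccontr)
          assume "finv (w k) (H k x) \<notin> I"
          then show False using wI[of "finv (w k) (H k x)" k] dw(9) hI by simp
        qed
        then have "H k (finv (w k) (H k x)) = H k x" using Hw dw(9) by metis
        then have "finv (w k) (H k x) = x" using dH(8) by metis
        then show False using \<open>finv (w k) (H k x) \<in> I\<close> False by simp
      qed
      moreover have "H k x \<notin> L \<inter> {s1<..<t1}" using \<open>H k x \<notin> I\<close> AI(1) unfolding A_def by blast
      ultimately have "S (H k x) = H k x" "S x = x" "u k (H k x) = H k x" using dS(5) False u(2) by simp_all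
      then show ?thesis by simp
    qed
    show ?thesis
    proof
      fix x
      have "u k (S (H k (finv (H k) (finv S x)))) = H k (S (finv (H k) (finv S x)))" by (rule key)
      then show "u k x = (H k \<circ> S \<circ> finv (H k) \<circ> finv S) x" by (simp add: dH(9) dS(9))
    qed
  qed
  have cH: "controlled L H" unfolding H_def
    by (intro controlled_comp controlled_inv controlled_pow controlled_const PHs)
  have "controlled L (\<lambda>k. H k \<circ> S \<circ> finv (H k) \<circ> finv S)"
    by (intro controlled_comp controlled_inv controlled_const cH PHs)
  then show ?thesis using u_eq by presburger
qed

text \<open>Only the order on \<open>X\<close> matters for the conjugate, because \<open>u\<close> fixes
  everything else; so \<open>\<rho>\<close> may disturb the order elsewhere.\<close>
lemma OA_conjugate:
  assumes u: "OA L u" "\<And>x. x \<notin> X \<Longrightarrow> u x = x" and \<rho>: "\<rho> permutes L" and X: "X \<subseteq> L" "oiso X A \<rho>"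
    and A: "\<And>x y z. x \<in> A \<Longrightarrow> y \<in> A \<Longrightarrow> z \<in> L \<Longrightarrow> x < z \<Longrightarrow> z < y \<Longrightarrow> z \<in> A"
  shows "OA L (\<rho> \<circ> u \<circ> finv \<rho>)" "\<And>x. x \<notin> A \<Longrightarrow> (\<rho> \<circ> u \<circ> finv \<rho>) x = x"
proof -
  note du = OA_D[OF u(1)]
  have r: "finv \<rho> (\<rho> x) = x" "\<rho> (finv \<rho> x) = x" for x using \<rho> by (auto simp: permutes_inverses)
  have AX: "\<rho> ` X = A" and mono: "\<And>x y. x \<in> X \<Longrightarrow> y \<in> X \<Longrightarrow> x < y \<Longrightarrow> \<rho> x < \<rho> y"
    using X(2) by (auto simp: oiso_def monotone_on_def)
  have XA: "finv \<rho> x \<in> X \<longleftrightarrow> x \<in> A" for x using AX r by (metis image_iff)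
  have uX: "u x \<in> X" if x: "x \<in> X" for x
  proof (rule ccontr)
    assume n: "u x \<notin> X"
    then have "u (u x) = u x" using u(2) by simp
    then have "u x = x" using du(8) by metis
    then show False using n x by simp
  qed
  show out: "\<And>x. x \<notin> A \<Longrightarrow> (\<rho> \<circ> u \<circ> finv \<rho>) x = x" using u(2) XA r by simp
  have p: "(\<rho> \<circ> u \<circ> finv \<rho>) permutes L" using \<rho> du(1) by (intro permutes_compose permutes_inv)
  have inA: "(\<rho> \<circ> u \<circ> finv \<rho>) x \<in> A" if "x \<in> A" for x
    using uX[of "finv \<rho> x"] XA[of x] that AX by auto
  define E where "E x y \<longleftrightarrow> x = y \<or> (x \<in> A \<and> y \<in> A)" for x y
  have "(\<rho> \<circ> u \<circ> finv \<rho>) x < (\<rho> \<circ> u \<circ> finv \<rho>) y" if "x \<in> L" "y \<in> L" "x < y" for x y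
  proof (rule blockwise_mono[of E L "\<rho> \<circ> u \<circ> finv \<rho>", OF _ _ _ _ _ _ that])
    show "E y x" if "E x y" for x y using that by (auto simp: E_def)
    show "E x z" if "E x y" "E y z" for x y z using that by (auto simp: E_def)
    show "E x z" if "E x y" "z \<in> L" "x < z" "z < y" for x y z using that A by (auto simp: E_def)
    show "(\<rho> \<circ> u \<circ> finv \<rho>) x \<in> L" if "x \<in> L" for x using that p by (simp only: permutes_in_image)
    show "E x ((\<rho> \<circ> u \<circ> finv \<rho>) x)" for x using inA out by (cases "x \<in> A") (auto simp: E_def)
    show "(\<rho> \<circ> u \<circ> finv \<rho>) x < (\<rho> \<circ> u \<circ> finv \<rho>) y" if h: "x \<in> L" "y \<in> L" "E x y" "x < y" for x y
    proof -
      have xy: "x \<in> A" "y \<in> A" using h by (auto simp: E_def)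
      then have fX: "finv \<rho> x \<in> X" "finv \<rho> y \<in> X" using XA by auto
      have "\<not> finv \<rho> y < finv \<rho> x" using mono[OF fX(2,1)] r h(4) by auto
      moreover have "finv \<rho> x \<noteq> finv \<rho> y" using r h(4) by (metis less_irrefl)
      ultimately have "finv \<rho> x < finv \<rho> y" by simp
      then have "u (finv \<rho> x) < u (finv \<rho> y)" using du(6) fX X(1) by blast
      then show ?thesis using mono uX fX by simp
    qed
  qed
  then show "OA L (\<rho> \<circ> u \<circ> finv \<rho>)" using p by (simp add: OA_def monotone_on_def)
qed

lemma inner_interval_exists:
  assumes L: "cantor L"
  obtains s0 s1 t1 t0 where "s0 < s1" "s1 < t1" "t1 < t0" "s0 \<notin> L" "s1 \<notin> L" "t1 \<notin> L" "t0 \<notin> L"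
    "L \<inter> {..<s0} \<noteq> {}" "L \<inter> {s0<..<s1} \<noteq> {}" "L \<inter> {s1<..<t1} \<noteq> {}" "L \<inter> {t1<..<t0} \<noteq> {}" "L \<inter> {t0<..} \<noteq> {}"
proof -
  obtain s0 where s0: "s0 \<notin> L" "L \<inter> {..<s0} \<noteq> {}" "L \<inter> {s0<..} \<noteq> {}" using cantor_split[OF L] .
  let ?L1 = "L \<inter> {s0<..}"
  have c1: "cantor ?L1" using cantor_rays(2)[OF L s0(1,3)] .
  obtain s1 where s1: "s1 \<notin> ?L1" "?L1 \<inter> {..<s1} \<noteq> {}" "?L1 \<inter> {s1<..} \<noteq> {}" using cantor_split[OF c1] .
  let ?L2 = "?L1 \<inter> {s1<..}"
  have c2: "cantor ?L2" using cantor_rays(2)[OF c1 s1(1,3)] .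
  obtain t1 where t1: "t1 \<notin> ?L2" "?L2 \<inter> {..<t1} \<noteq> {}" "?L2 \<inter> {t1<..} \<noteq> {}" using cantor_split[OF c2] .
  let ?L3 = "?L2 \<inter> {t1<..}"
  have c3: "cantor ?L3" using cantor_rays(2)[OF c2 t1(1,3)] .
  obtain t0 where t0: "t0 \<notin> ?L3" "?L3 \<inter> {..<t0} \<noteq> {}" "?L3 \<inter> {t0<..} \<noteq> {}" using cantor_split[OF c3] .
  have o: "s0 < s1" "s1 < t1" "t1 < t0" using s1(2) t1(2) t0(2) by auto
  show ?thesis
  proof (rule that[of s0 s1 t1 t0])
    show "s1 \<notin> L" using s1(1) o by auto
    show "t1 \<notin> L" using t1(1) o by auto
    show "t0 \<notin> L" using t0(1) o by auto
    have "?L1 \<inter> {..<s1} = L \<inter> {s0<..<s1}" "?L2 \<inter> {..<t1} = L \<inter> {s1<..<t1}" "?L3 \<inter> {..<t0} = L \<inter> {t1<..<t0}"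
      "?L3 \<inter> {t0<..} = L \<inter> {t0<..}" using o by auto
    then show "L \<inter> {s0<..<s1} \<noteq> {}" "L \<inter> {s1<..<t1} \<noteq> {}" "L \<inter> {t1<..<t0} \<noteq> {}" "L \<inter> {t0<..} \<noteq> {}"
      using s1(2) t1(2) t0(2,3) by simp_all
  qed (use o s0 in simp_all)
qed

text \<open>A half of \<open>L\<close> contains an end point of \<open>L\<close>, which every order automorphism fixes. So it has
  to be moved to the inside, by a piecewise order isomorphism, before the previous construction
  applies.\<close>
lemma controlled_half:
  assumes L: "cantor L" and z: "z \<notin> L" "L \<inter> {..<z} \<noteq> {}" "L \<inter> {z<..} \<noteq> {}"
    and X: "X = L \<inter> {..<z} \<or> X = L \<inter> {z<..}"
    and u: "\<And>k. OA L (u k)" "\<And>k x. x \<notin> X \<Longrightarrow> u k x = x"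
  shows "controlled L u"
proof -
  obtain s0 s1 t1 t0 where st: "s0 < s1" "s1 < t1" "t1 < t0" "s0 \<notin> L" "s1 \<notin> L" "t1 \<notin> L" "t0 \<notin> L"
    "L \<inter> {..<s0} \<noteq> {}" "L \<inter> {s0<..<s1} \<noteq> {}" "L \<inter> {s1<..<t1} \<noteq> {}" "L \<inter> {t1<..<t0} \<noteq> {}" "L \<inter> {t0<..} \<noteq> {}"
    using inner_interval_exists[OF L] .
  have ne: "L \<inter> {..<s1} \<noteq> {}" "L \<inter> {t1<..} \<noteq> {}" using st by fastforce+
  let ?A = "L \<inter> {s1<..<t1}"
  obtain \<rho> where \<rho>: "PH L \<rho>" "oiso X ?A \<rho>"
    using X
  proof
    assume X: "X = L \<inter> {..<z}"
    obtain r where r: "r \<notin> L \<inter> {z<..}" "L \<inter> {z<..} \<inter> {..<r} \<noteq> {}" "L \<inter> {z<..} \<inter> {r<..} \<noteq> {}"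
      using cantor_split[OF cantor_rays(2)[OF L z(1,3)]] .
    have zr: "z < r" "r \<notin> L" using r by auto
    have r': "L \<inter> {z<..<r} \<noteq> {}" "L \<inter> {r<..} \<noteq> {}" using r by auto

    \<comment> \<open>The half is the first of three cells; it trades places with the middle one.\<close>
    let ?t = "\<lambda>i::nat. if i = 0 then 1 else if i = 1 then 0 else i"
    have b: "bij ?t" by (rule o_bij[of ?t]) auto
    have "cell L {z, r} i = {} \<longleftrightarrow> cell L {s1, t1} (?t i) = {}" for i
      using z(2) r' ne st by (simp add: cell_pair[OF zr(1) z(1) zr(2)] cell_pair[OF st(2,5,6)])
    then obtain \<rho> where \<rho>: "PH L \<rho>" "\<And>i. oiso (cell L {z, r} i) (cell L {s1, t1} (?t i)) \<rho>"
      using cells_PH[OF L, of "{z, r}" "{s1, t1}" ?t] b z(1) zr(2) st(5,6) by auto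
    have "oiso X ?A \<rho>" using \<rho>(2)[of 0] by (simp add: X cell_pair[OF zr(1) z(1) zr(2)] cell_pair[OF st(2,5,6)])
    then show ?thesis using that \<rho>(1) by blast
  next
    assume X: "X = L \<inter> {z<..}"
    obtain r where r: "r \<notin> L \<inter> {..<z}" "L \<inter> {..<z} \<inter> {..<r} \<noteq> {}" "L \<inter> {..<z} \<inter> {r<..} \<noteq> {}"
      using cantor_split[OF cantor_rays(1)[OF L z(1,2)]] .
    have zr: "r < z" "r \<notin> L" using r by auto
    have r': "L \<inter> {r<..<z} \<noteq> {}" "L \<inter> {..<r} \<noteq> {}" using r by auto
    \<comment> \<open>The half is the last of three cells; it trades places with the middle one.\<close>
    let ?t = "\<lambda>i::nat. if i = 2 then 1 else if i = 1 then 2 else i"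
    have b: "bij ?t" by (rule o_bij[of ?t]) auto
    have "cell L {r, z} i = {} \<longleftrightarrow> cell L {s1, t1} (?t i) = {}" for i
      using z(3) r' ne st by (simp add: cell_pair[OF zr(1,2) z(1)] cell_pair[OF st(2,5,6)])
    then obtain \<rho> where \<rho>: "PH L \<rho>" "\<And>i. oiso (cell L {r, z} i) (cell L {s1, t1} (?t i)) \<rho>"
      using cells_PH[OF L, of "{r, z}" "{s1, t1}" ?t] b z(1) zr(2) st(5,6) by auto
    have "oiso X ?A \<rho>" using \<rho>(2)[of 2] by (simp add: X cell_pair[OF zr(1,2) z(1)] cell_pair[OF st(2,5,6)])
    then show ?thesis using that \<rho>(1) by blast
  qed
  have p: "\<rho> permutes L" using \<rho>(1) by (simp add: PH_def)
  have XL: "X \<subseteq> L" using X by auto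
  let ?v = "\<lambda>k. \<rho> \<circ> u k \<circ> finv \<rho>"
  have "controlled L ?v"
  proof (rule controlled_inner_interval[OF L st])
    show "OA L (?v k)" for k by (rule OA_conjugate(1)[OF u(1) u(2) p XL \<rho>(2)]) auto
    show "?v k x = x" if "x \<notin> ?A" for k x by (rule OA_conjugate(2)[OF u(1) u(2) p XL \<rho>(2) _ that]) auto
  qed
  then have "controlled L (\<lambda>k. finv \<rho> \<circ> ?v k \<circ> \<rho>)"
    using controlled_comp[OF controlled_comp[OF controlled_inv[OF controlled_const[OF \<rho>(1)]]] controlled_const[OF \<rho>(1)]]
    by blast
  moreover have "(\<lambda>k. finv \<rho> \<circ> ?v k \<circ> \<rho>) = u"
    by (rule ext)+ (simp add: permutes_inverses[OF p])
  ultimately show ?thesis by simp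
qed

subsection \<open>Fragmentation of order automorphisms\<close>

lemma OA_consec:
  assumes "OA L u" "consec L a b" shows "consec L (u a) (u b)"
proof -
  note d = OA_D[OF assms(1)]
  have ab: "a \<in> L" "b \<in> L" "a < b" using consecD[OF assms(2)] by auto
  have "{u a<..<u b} \<inter> L = {}"
  proof (rule ccontr)
    assume "{u a<..<u b} \<inter> L \<noteq> {}"
    then obtain y where y: "u a < y" "y < u b" "y \<in> u ` L" using d(2) by auto
    then obtain x where "y = u x" "x \<in> L" by blast
    then show False using y d(7) ab consecD(4)[OF assms(2), of x] by force
  qed
  then show ?thesis using ab d(4,6) by (simp add: consec_def)
qed

lemma OA_restrict:
  assumes u: "OA L u" and z: "\<And>x. x \<in> L \<Longrightarrow> z < u x \<longleftrightarrow> z < x" "z \<notin> L"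
  shows "OA L (\<lambda>x. if z < x then u x else x)" "OA L (\<lambda>x. if z < x then x else u x)"
proof -
  note d = OA_D[OF u]
  have neq: "x \<noteq> z" if "x \<in> L" for x using that z(2) by auto
  have iz: "z < finv u x \<longleftrightarrow> z < x" if "x \<in> L" for x
    using z(1)[of "finv u x"] OA_D(4)[OF OA_inv[OF u] that] d(9) by simp
  have L': "finv u x \<in> L" if "x \<in> L" for x using OA_D(4)[OF OA_inv[OF u] that] .
  show "OA L (\<lambda>x. if z < x then u x else x)"
  proof (rule OAI)
    show "(\<lambda>x. if z < x then u x else x) ` L = L"
    proof
      show "L \<subseteq> (\<lambda>x. if z < x then u x else x) ` L"
      proof
        fix y assume y: "y \<in> L"
        show "y \<in> (\<lambda>x. if z < x then u x else x) ` L"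
          by (rule image_eqI[of _ _ "if z < y then finv u y else y"]) (use y iz d(9) L' in auto)
      qed
    qed (use d(4) in auto)
    show "(if z < x then u x else x) < (if z < y then u y else y)" if "x \<in> L" "y \<in> L" "x < y" for x y
      using that d(6)[of x y] z(1)[of y] by auto
  qed (use d(5) in auto)
  show "OA L (\<lambda>x. if z < x then x else u x)"
  proof (rule OAI)
    show "(\<lambda>x. if z < x then x else u x) ` L = L"
    proof
      show "L \<subseteq> (\<lambda>x. if z < x then x else u x) ` L"
      proof
        fix y assume y: "y \<in> L"
        show "y \<in> (\<lambda>x. if z < x then x else u x) ` L"
          by (rule image_eqI[of _ _ "if z < y then y else finv u y"]) (use y iz d(9) L' in auto)
      qed
    qed (use d(4) in auto)
    show "(if z < x then x else u x) < (if z < y then y else u y)" if "x \<in> L" "y \<in> L" "x < y" for x y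
      using that d(6)[of x y] z(1)[of x] by auto
  qed (use d(5) in auto)
qed

text \<open>Let \<open>p\<close> be the place to which \<open>u\<close> moves the gap at \<open>z\<close>.
  If this is again the gap at \<open>z\<close>, then \<open>u\<close> is the product of its
  restrictions to the two sides. Otherwise an automorphism \<open>v\<close> of the right side
  moves \<open>p\<close> to \<open>r\<close>, and \<open>q\<close> moves \<open>z\<close> to
  \<open>r\<close>, so the restrictions can be taken of \<open>finv q \<circ> v \<circ> u\<close>.\<close>
lemma OA_fragment:
  assumes L: "cantor L" and z: "z \<notin> L" "L \<inter> {..<z} \<noteq> {}" "L \<inter> {z<..} \<noteq> {}"
    and r: "r \<notin> L" "z < r" "L \<inter> {z<..<r} \<noteq> {}" "L \<inter> {r<..} \<noteq> {}"
    and q: "OA L q" "\<And>x. x \<in> L \<Longrightarrow> r < q x \<longleftrightarrow> z < x"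
    and u: "OA L u" "\<And>x. x \<in> L \<Longrightarrow> z < x \<Longrightarrow> z < u x"
  shows "\<exists>v c a b. OA L v \<and> OA L a \<and> OA L b \<and> (c = id \<or> c = q) \<and>
    (\<forall>x. x \<notin> L \<inter> {z<..} \<longrightarrow> v x = x) \<and> (\<forall>x. x \<notin> L \<inter> {..<z} \<longrightarrow> a x = x) \<and> (\<forall>x. x \<notin> L \<inter> {z<..} \<longrightarrow> b x = x) \<and>
    u = finv v \<circ> c \<circ> a \<circ> b"
proof -
  have split: "\<exists>a b. OA L a \<and> OA L b \<and> (\<forall>x. x \<notin> L \<inter> {..<z} \<longrightarrow> a x = x) \<and> (\<forall>x. x \<notin> L \<inter> {z<..} \<longrightarrow> b x = x) \<and> m = a \<circ> b"
    if m: "OA L m" "\<And>x. x \<in> L \<Longrightarrow> z < m x \<longleftrightarrow> z < x" for m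
  proof (intro exI conjI allI impI)
    let ?b = "\<lambda>x. if z < x then m x else x" and ?a = "\<lambda>x. if z < x then x else m x"
    show "OA L ?a" "OA L ?b" using OA_restrict[OF m z(1)] by auto
    show "?a x = x" if "x \<notin> L \<inter> {..<z}" for x using that OA_D(5)[OF m(1)] z(1) by (cases "x \<in> L") (auto simp: not_less order.order_iff_strict)
    show "?b x = x" if "x \<notin> L \<inter> {z<..}" for x using that OA_D(5)[OF m(1)] by auto
    show "m = ?a \<circ> ?b"
    proof
      show "m x = (?a \<circ> ?b) x" for x
        using m(2)[of x] OA_D(5)[OF m(1), of x] by (cases "x \<in> L") auto
    qed
  qed
  note du = OA_D[OF u(1)] and dq = OA_D[OF q(1)]
  obtain y0 y1 where y01: "y0 \<in> L" "y0 < z" "y1 \<in> L" "z < y1" using z by auto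
  obtain m0 m1 where m01: "consec L m0 m1" "m0 < z" "z < m1"
    using gap_around_point[OF cantor_compact(2)[OF L] y01(1,3,2,4) z(1)] by blast
  have um: "consec L (u m0) (u m1)" using OA_consec[OF u(1) m01(1)] .
  have zm1: "z < u m1" using u(2) consecD(2)[OF m01(1)] m01(3) by auto
  show ?thesis
  proof (cases "u m0 < z")
    case True
    have "z < u x \<longleftrightarrow> z < x" if x: "x \<in> L" for x
    proof -
      have "x \<le> m0" if "\<not> z < x" using consecD(4)[OF m01(1) x] that m01 by linarith
      then have "u x \<le> u m0" if "\<not> z < x"
        using that du(6)[OF x consecD(1)[OF m01(1)]] by (auto simp: order.order_iff_strict)
      then show ?thesis using True u(2)[OF x] by (meson le_less_trans less_asym)
    qed
    from split[OF u(1) this] obtain a b where ab: "OA L a" "OA L b" "\<forall>x. x \<notin> L \<inter> {..<z} \<longrightarrow> a x = x"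
      "\<forall>x. x \<notin> L \<inter> {z<..} \<longrightarrow> b x = x" "u = a \<circ> b" by blast
    show ?thesis
      by (rule exI[of _ id], rule exI[of _ id], rule exI[of _ a], rule exI[of _ b])
         (use ab OA_id in \<open>simp add: inv_id\<close>)
  next
    case False
    then have zu: "z < u m0" using consecD(1)[OF um] z(1) by (metis linorder_neqE_linordered_idom)
    define p where "p = (u m0 + u m1) / 2"
    have p: "u m0 < p" "p < u m1" using consecD(3)[OF um] by (auto simp: p_def)
    then have pL: "p \<notin> L" using consecD(4)[OF um, of p] by auto
    have pz: "z < p" using zu p by simp
    have up: "p < u x \<longleftrightarrow> z < x" if x: "x \<in> L" for x
    proof -
      have "x \<le> m0 \<or> m1 \<le> x" using consecD(4)[OF m01(1) x] .
      then have "(u x \<le> u m0 \<and> x \<le> m0) \<or> (u m1 \<le> u x \<and> m1 \<le> x)"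
        using du(6)[OF x consecD(1)[OF m01(1)]] du(6)[OF consecD(2)[OF m01(1)] x] by (auto simp: order.order_iff_strict)
      then show ?thesis using p m01 by auto
    qed
    let ?C = "L \<inter> {z<..}"
    have C: "cantor ?C" using cantor_rays(2)[OF L z(1,3)] .
    have cp: "?C \<inter> {..<p} \<noteq> {}" "?C \<inter> {p<..} \<noteq> {}" "?C \<inter> {..<r} \<noteq> {}" "?C \<inter> {r<..} \<noteq> {}"
      using consecD(1,2)[OF um] zu p zm1 r by force+
    have pr: "p \<notin> ?C" "r \<notin> ?C" using pL r by auto
    have "cell ?C {p} i = {} \<longleftrightarrow> cell ?C {r} i = {}" for i
      using cp by (simp add: cell_singleton[OF pr(1)] cell_singleton[OF pr(2)])
    then obtain v where v: "OA ?C v" "\<forall>x\<in>?C. pos {r} (v x) = pos {p} x"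
      using cells_OA[OF C, of "{p}" "{r}"] pr by auto
    obtain B where B: "\<forall>x\<in>L. x < B"
      using compact_imp_bounded[OF cantor_compact(1)[OF L]] unfolding bounded_real
      by (metis abs_le_D1 less_add_one order_le_less_trans)
    have "?C = L \<inter> {z<..<B}" using B by auto
    then have vL: "OA L v" using OA_extend v(1) by blast
    note dv = OA_D[OF vL]
    have vout: "v x = x" if "x \<notin> ?C" for x using OA_D(5)[OF v(1) that] .
    have vC: "r < v x \<longleftrightarrow> p < x" if x: "x \<in> L" for x
    proof (cases "z < x")
      case True
      then have "pos {r} (v x) = pos {p} x" using v(2) x by auto
      then show ?thesis by (simp add: pos_singleton split: if_splits)
    next
      case False
      then show ?thesis using vout[of x] pz r(2) by auto
    qed
    define m where "m = finv q \<circ> v \<circ> u"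
    have m: "OA L m" unfolding m_def by (intro OA_comp OA_inv vL q(1) u(1))
    have qm: "q (m x) = v (u x)" for x by (simp add: m_def dq(9))
    have "z < m x \<longleftrightarrow> z < x" if x: "x \<in> L" for x
      using q(2)[OF OA_D(4)[OF m x]] qm[of x] vC[OF du(4)[OF x]] up[OF x] by simp
    from split[OF m this] obtain a b where ab: "OA L a" "OA L b" "\<forall>x. x \<notin> L \<inter> {..<z} \<longrightarrow> a x = x"
      "\<forall>x. x \<notin> L \<inter> {z<..} \<longrightarrow> b x = x" "m = a \<circ> b" by blast
    have "u = finv v \<circ> q \<circ> a \<circ> b"
    proof
      fix x
      have "finv v (q (m x)) = u x" using qm dv(8) by simp
      then show "u x = (finv v \<circ> q \<circ> a \<circ> b) x" using ab(5) by simp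
    qed
    then show ?thesis using ab vL vout by blast
  qed
qed

text \<open>For each \<open>k\<close>, one of \<open>u k\<close> and its inverse moves the gap at
  \<open>z\<close> to the right or fixes it, so that it can be fragmented into automorphisms of
  the two halves, which are controlled.\<close>
lemma controlled_OA:
  assumes L: "cantor L" and u: "\<And>k. OA L (u k)" shows "controlled L u"
proof -
  obtain z where z: "z \<notin> L" "L \<inter> {..<z} \<noteq> {}" "L \<inter> {z<..} \<noteq> {}" using cantor_split[OF L] .
  obtain r where r0: "r \<notin> L \<inter> {z<..}" "L \<inter> {z<..} \<inter> {..<r} \<noteq> {}" "L \<inter> {z<..} \<inter> {r<..} \<noteq> {}"
    using cantor_split[OF cantor_rays(2)[OF L z(1,3)]] .
  have r: "r \<notin> L" "z < r" "L \<inter> {z<..<r} \<noteq> {}" "L \<inter> {r<..} \<noteq> {}" "L \<inter> {..<r} \<noteq> {}" using r0 by auto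
  have "cell L {z} i = {} \<longleftrightarrow> cell L {r} i = {}" for i
    using z r by (simp add: cell_singleton[OF z(1)] cell_singleton[OF r(1)])
  then obtain q where q: "OA L q" "\<forall>x\<in>L. pos {r} (q x) = pos {z} x"
    using cells_OA[OF L, of "{z}" "{r}"] z(1) r(1) by auto
  have q2: "r < q x \<longleftrightarrow> z < x" if "x \<in> L" for x using q(2) that by (auto simp: pos_singleton split: if_splits)
  have expanding: "controlled L u" if u: "\<And>k. OA L (u k)" "\<And>k x. x \<in> L \<Longrightarrow> z < x \<Longrightarrow> z < u k x" for u
  proof -
    have "\<exists>v c a b. OA L v \<and> OA L a \<and> OA L b \<and> (c = id \<or> c = q) \<and>
      (\<forall>x. x \<notin> L \<inter> {z<..} \<longrightarrow> v x = x) \<and> (\<forall>x. x \<notin> L \<inter> {..<z} \<longrightarrow> a x = x) \<and> (\<forall>x. x \<notin> L \<inter> {z<..} \<longrightarrow> b x = x) \<and>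
      u k = finv v \<circ> c \<circ> a \<circ> b" for k
      by (rule OA_fragment[OF L z r(1-4) q(1) q2 u(1) u(2)])
    then obtain v c a b where f: "\<And>k. OA L (v k)" "\<And>k. OA L (a k)" "\<And>k. OA L (b k)" "\<And>k. c k = id \<or> c k = q"
      "\<And>k x. x \<notin> L \<inter> {z<..} \<Longrightarrow> v k x = x" "\<And>k x. x \<notin> L \<inter> {..<z} \<Longrightarrow> a k x = x" "\<And>k x. x \<notin> L \<inter> {z<..} \<Longrightarrow> b k x = x"
      "\<And>k. u k = finv (v k) \<circ> c k \<circ> a k \<circ> b k" by metis
    have "controlled L v" "controlled L a" "controlled L b"
      using controlled_half[OF L z, of "L \<inter> {z<..}" v] controlled_half[OF L z, of "L \<inter> {..<z}" a]
        controlled_half[OF L z, of "L \<inter> {z<..}" b] f by blast+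
    moreover have "controlled L c"
      by (rule controlled_finite[of "{id, q}"]) (use f(4) PH_id OA_imp_PH[OF cantor_compact(1)[OF L] q(1)] in auto)
    ultimately have "controlled L (\<lambda>k. finv (v k) \<circ> c k \<circ> a k \<circ> b k)"
      by (intro controlled_comp controlled_inv)
    then show ?thesis using f(8) by presburger
  qed
  define u' where "u' k = (if \<forall>x\<in>L. z < x \<longrightarrow> z < u k x then u k else finv (u k))" for k
  have "controlled L u'"
  proof (rule expanding)
    show "OA L (u' k)" for k using u OA_inv by (auto simp: u'_def)
    show "z < u' k x" if x: "x \<in> L" "z < x" for k x
    proof (cases "\<forall>x\<in>L. z < x \<longrightarrow> z < u k x")
      case False
      then obtain y where y: "y \<in> L" "z < y" "\<not> z < u k y" by blast
      note d = OA_D[OF u[of k]]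
      have "u k y < x" using y x by simp
      then have "y < finv (u k) x" using d(7)[OF y(1) OA_D(4)[OF OA_inv[OF u[of k]] x(1)]] d(9) by simp
      moreover have "u' k = finv (u k)" using False unfolding u'_def by (rule if_not_P)
      ultimately show ?thesis using y by simp
    qed (use x in \<open>auto simp: u'_def\<close>)
  qed
  then show ?thesis
  proof (rule controlled_cases[OF _ controlled_inv])
    show "controlled L u'" by fact
    show "u k = u' k \<or> u k = finv (u' k)" for k
      using inv_inv_eq[OF OA_D(3)[OF u[of k]]] by (auto simp: u'_def)
  qed
qed

section \<open>Sequences with boundedly many broken gaps are controlled\<close>

definition keeps_gap :: "real set \<Rightarrow> (real \<Rightarrow> real) \<Rightarrow> real \<Rightarrow> real \<Rightarrow> bool"
  where "keeps_gap L g a b \<longleftrightarrow> consec L (g a) (g b) \<or> consec L (g b) (g a)"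

text \<open>Midpoints are taken because cut points have to lie outside \<open>L\<close>.\<close>
definition cuts :: "real set \<Rightarrow> (real \<Rightarrow> real) \<Rightarrow> real set"
  where "cuts L g = {(a + b) / 2 | a b. consec L a b \<and> \<not> keeps_gap L g a b}"

lemma cuts_finite:
  assumes "cantor L" "PH L g" shows "finite (cuts L g)"
proof -
  have "cuts L g = (\<lambda>(a,b). (a + b) / 2) ` {(a,b). consec L a b \<and> \<not> keeps_gap L g a b}"
    unfolding cuts_def by (auto simp: image_def)
  then show ?thesis using PH_finite_broken_gaps[OF assms] unfolding keeps_gap_def by simp
qed

lemma cuts_disjoint: "cuts L g \<inter> L = {}"
proof -
  have "(a + b) / 2 \<notin> L" if "consec L a b" for a b
    using consecD(3)[OF that] consecD(4)[OF that, of "(a + b) / 2"] by auto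
  then show ?thesis unfolding cuts_def by blast
qed

lemma cell_gap_kept:
  assumes L: "cantor L" and g: "PH L g" and c: "consec (cell L (cuts L g) i) p q"
  shows "keeps_gap L g p q"
proof (rule ccontr)
  assume n: "\<not> keeps_gap L g p q"
  note cell = consec_cell[OF cuts_finite[OF L g] c]
  have "(p + q) / 2 \<in> cuts L g" using n cell(1) by (auto simp: cuts_def)
  then show False using cell(2) by simp
qed

text \<open>No gap of a cell is broken, so the map extends continuously and injectively to an interval.\<close>
lemma cell_monotone:
  assumes L: "cantor L" and g: "PH L g" and C: "C = cell L (cuts L g) i" "C \<noteq> {}"
  shows "strict_mono_on C g \<or> strict_mono_on C (\<lambda>x. - g x)"
    "\<And>u v y. u \<in> C \<Longrightarrow> v \<in> C \<Longrightarrow> y \<in> L \<Longrightarrow> g u \<le> y \<Longrightarrow> y \<le> g v \<Longrightarrow> y \<in> g ` C"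
proof -
  have cC: "cantor C" using cell_cantor[OF L cuts_finite[OF L g] cuts_disjoint] C by simp
  have CL: "C \<subseteq> L" using C by (auto simp: cell_def)
  have p: "g permutes L" and c: "continuous_on L g" using g by (simp_all add: PH_def)
  have inj: "inj_on g C" using permutes_inj[OF p] by (rule inj_on_subset) simp
  have cc: "continuous_on C g" using c CL by (rule continuous_on_subset)
  have im: "g ` C \<subseteq> L" using CL p by (auto simp: permutes_in_image)
  have sub: "C \<subseteq> {Inf C..Sup C}" using cantor_Inf_Sup(3,4)[OF cC cC] by auto
  note r = gap_preserving_imp_monotone[OF cantor_compact(1)[OF cC] cantor_Inf_Sup(1,2)[OF cC cC] sub
      cantor_compact(1)[OF L] cc inj im]
  have gap: "consec L (g p) (g q) \<or> consec L (g q) (g p)" if "consec C p q" for p q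
    using cell_gap_kept[OF L g, of i p q] that C(1) unfolding keeps_gap_def by simp
  show "strict_mono_on C g \<or> strict_mono_on C (\<lambda>x. - g x)"
    using r(1) gap by blast
  show "y \<in> g ` C" if "u \<in> C" "v \<in> C" "y \<in> L" "g u \<le> y" "y \<le> g v" for u v y
    using r(2)[OF _ that] gap by blast
qed

text \<open>The combinatorial type of a piecewise monotone map: which cells occur, on which of them the map
  increases, and in which order their images lie.\<close>
definition piece_type :: "real set \<Rightarrow> (real \<Rightarrow> real) \<Rightarrow> nat set \<times> nat set \<times> (nat \<times> nat) set"
  where "piece_type L g = (let C = cell L (cuts L g) in
    ({i. C i \<noteq> {}}, {i. C i \<noteq> {} \<and> strict_mono_on (C i) g},
     {(i, j). C i \<noteq> {} \<and> C j \<noteq> {} \<and> (\<forall>x\<in>C i. \<forall>y\<in>C j. g x < g y)}))"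

lemma finite_piece_types:
  assumes L: "cantor L"
  shows "finite (piece_type L ` {g. PH L g \<and> card (cuts L g) \<le> M})"
proof (rule finite_subset)
  show "finite (Pow {..M} \<times> Pow {..M} \<times> Pow ({..M} \<times> {..M}))" by simp
  show "piece_type L ` {g. PH L g \<and> card (cuts L g) \<le> M} \<subseteq> Pow {..M} \<times> Pow {..M} \<times> Pow ({..M} \<times> {..M})"
  proof
    fix t assume "t \<in> piece_type L ` {g. PH L g \<and> card (cuts L g) \<le> M}"
    then obtain g where g: "PH L g" "card (cuts L g) \<le> M" and t: "t = piece_type L g" by blast
    have "i \<le> M" if ne: "cell L (cuts L g) i \<noteq> {}" for i
    proof -
      obtain x where "pos (cuts L g) x = i" using ne by (auto simp: cell_def)
      then show ?thesis using pos_le[OF cuts_finite[OF L g(1)], of x] g(2) by simp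
    qed
    then show "t \<in> Pow {..M} \<times> Pow {..M} \<times> Pow ({..M} \<times> {..M})"
      unfolding t piece_type_def Let_def by blast
  qed
qed

text \<open>An order automorphism \<open>u\<close> takes the cells of \<open>g\<close> to those of
  \<open>g'\<close>. Then \<open>g' \<circ> u \<circ> finv g\<close> preserves the order: inside
  the image of one cell because both maps have the same direction there, and between different
  cells because the images of the cells do not interleave and lie in the same order.\<close>
lemma same_type_imp_double_coset:
  assumes L: "cantor L" and g: "PH L g" "PH L g'" and ty: "piece_type L g = piece_type L g'"
  shows "\<exists>u v. OA L u \<and> OA L v \<and> g' = v \<circ> g \<circ> finv u"
proof -
  let ?C = "cell L (cuts L g)" and ?D = "cell L (cuts L g')"
  note ty' = ty[unfolded piece_type_def Let_def prod.inject]
  note eq = conjunct1[OF ty'] conjunct1[OF conjunct2[OF ty']] conjunct2[OF conjunct2[OF ty']]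
  have t: "?C i \<noteq> {} \<longleftrightarrow> ?D i \<noteq> {}"
    "?C i \<noteq> {} \<and> strict_mono_on (?C i) g \<longleftrightarrow> ?D i \<noteq> {} \<and> strict_mono_on (?D i) g'"
    "?C i \<noteq> {} \<and> ?C j \<noteq> {} \<and> (\<forall>x\<in>?C i. \<forall>y\<in>?C j. g x < g y) \<longleftrightarrow>
       ?D i \<noteq> {} \<and> ?D j \<noteq> {} \<and> (\<forall>x\<in>?D i. \<forall>y\<in>?D j. g' x < g' y)" for i j
  proof -
    show "?C i \<noteq> {} \<longleftrightarrow> ?D i \<noteq> {}" using eqset_imp_iff[OF eq(1), of i] by (simp only: mem_Collect_eq)
    show "?C i \<noteq> {} \<and> strict_mono_on (?C i) g \<longleftrightarrow> ?D i \<noteq> {} \<and> strict_mono_on (?D i) g'"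
      using eqset_imp_iff[OF eq(2), of i] by (simp only: mem_Collect_eq)
    show "?C i \<noteq> {} \<and> ?C j \<noteq> {} \<and> (\<forall>x\<in>?C i. \<forall>y\<in>?C j. g x < g y) \<longleftrightarrow>
       ?D i \<noteq> {} \<and> ?D j \<noteq> {} \<and> (\<forall>x\<in>?D i. \<forall>y\<in>?D j. g' x < g' y)"
      using eqset_imp_iff[OF eq(3), of "(i, j)"] by (simp only: mem_Collect_eq prod.case)
  qed
  have fin: "finite (cuts L g)" "finite (cuts L g')" using cuts_finite L g by auto
  obtain u where u: "OA L u" "\<And>x. x \<in> L \<Longrightarrow> pos (cuts L g') (u x) = pos (cuts L g) x"
    using cells_OA[OF L fin(1) cuts_disjoint fin(2) cuts_disjoint] t(1) by blast
  note du = OA_D[OF u(1)]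
  have p: "g permutes L" "g' permutes L" using g by (simp_all add: PH_def)
  have gi: "finv g (g x) = x" "g (finv g x) = x" for x using p by (auto simp: permutes_inverses)
  have giL: "finv g x \<in> L" if "x \<in> L" for x using that permutes_inv[OF p(1)] by (simp add: permutes_in_image)
  define v where "v = g' \<circ> u \<circ> finv g"
  have "v permutes L" unfolding v_def using p du(1) by (intro permutes_compose permutes_inv)
  moreover have "v x < v y" if xy: "x \<in> L" "y \<in> L" "x < y" for x y
  proof -
    define a where "a = finv g x"
    define b where "b = finv g y"
    have ab: "a \<in> L" "b \<in> L" "g a = x" "g b = y" using giL gi xy by (auto simp: a_def b_def)
    define i where "i = pos (cuts L g) a"
    define j where "j = pos (cuts L g) b"
    have cells: "a \<in> ?C i" "b \<in> ?C j" "u a \<in> ?D i" "u b \<in> ?D j"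
      using ab u(2) du(4) by (auto simp: cell_def i_def j_def)
    have "g' (u a) < g' (u b)"
    proof (cases "i = j")
      case True
      then have c: "a \<in> ?C i" "b \<in> ?C i" "u a \<in> ?D i" "u b \<in> ?D i" using cells by auto
      show ?thesis
      proof (cases "strict_mono_on (?C i) g")
        case inc: True
        then have "strict_mono_on (?D i) g'" using t(2)[of i] c by blast
        moreover have "a < b"
        proof (rule ccontr)
          assume "\<not> a < b"
          then have "b < a \<or> a = b" by auto
          then show False using inc c ab xy(3) unfolding monotone_on_def by (metis less_asym less_irrefl)
        qed
        then have "u a < u b" using du(6) ab by blast
        ultimately show ?thesis using c unfolding monotone_on_def by blast
      next
        case dec: False
        then have d: "strict_mono_on (?C i) (\<lambda>x. - g x)"
          using cell_monotone(1)[OF L g(1) refl, of i] c by blast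
        have "\<not> strict_mono_on (?D i) g'" using t(2)[of i] c dec by blast
        then have d': "strict_mono_on (?D i) (\<lambda>x. - g' x)"
          using cell_monotone(1)[OF L g(2) refl, of i] c by blast
        have "b < a"
        proof (rule ccontr)
          assume "\<not> b < a"
          then have "a < b \<or> a = b" by auto
          then show False
          proof
            assume "a < b"
            then have "- g a < - g b" using d c unfolding monotone_on_def by blast
            then show False using ab xy(3) by simp
          qed (use ab xy(3) in auto)
        qed
        then have "u b < u a" using du(6) ab by blast
        then have "- g' (u b) < - g' (u a)" using d' c unfolding monotone_on_def by blast
        then show ?thesis by simp
      qed
    next
      case False
      have "g x' < g y'" if x': "x' \<in> ?C i" and y': "y' \<in> ?C j" for x' y'
      proof (rule ccontr)
        assume "\<not> g x' < g y'"
        then have le: "g y' \<le> g x'" by simp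
        have disj: "g ` ?C i \<inter> g ` ?C j = {}"
        proof -
          have "?C i \<inter> ?C j = {}" using False by (auto simp: cell_def)
          then show ?thesis using permutes_inj[OF p(1)] by (simp add: image_Int[symmetric])
        qed
        have CL: "?C i \<subseteq> L" "?C j \<subseteq> L" by (auto simp: cell_def)
        have gL: "g z \<in> L" if "z \<in> L" for z using that p(1) by (simp add: permutes_in_image)
        have ab2: "g a < g b" using ab xy by simp
        show False
        proof (cases "g b \<le> g x'")
          case True
          then have "g b \<in> g ` ?C i"
            using cell_monotone(2)[OF L g(1) refl _ cells(1) x' gL[OF ab(2)]] cells(1) ab2 by auto
          then show False using disj cells(2) by blast
        next
          case b: False
          then have "g x' \<in> g ` ?C j"
            using cell_monotone(2)[OF L g(1) refl _ y' cells(2) gL, of x'] cells(2) le x' CL by auto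
          then show False using disj x' by blast
        qed
      qed
      then have "\<forall>x\<in>?D i. \<forall>y\<in>?D j. g' x < g' y" using t(3)[of i j] cells by blast
      then show ?thesis using cells by blast
    qed
    then show ?thesis by (simp add: v_def a_def b_def)
  qed
  ultimately have "OA L v" by (simp add: OA_def monotone_on_def)
  moreover have "g' = v \<circ> g \<circ> finv u" by (rule ext) (simp add: v_def gi du(9))
  ultimately show ?thesis using u(1) by blast
qed

text \<open>There are finitely many types, so all but order automorphisms can be taken from a finite set of
  representatives.\<close>
lemma controlled_bounded_cuts:
  assumes L: "cantor L" and g: "\<And>k. PH L (g k)" "\<And>k. card (cuts L (g k)) \<le> M"
  shows "controlled L g"
proof -
  let ?P = "{g. PH L g \<and> card (cuts L g) \<le> M}"
  define rep where "rep \<tau> = (SOME h. h \<in> ?P \<and> piece_type L h = \<tau>)" for \<tau>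
  have rep: "rep (piece_type L h) \<in> ?P \<and> piece_type L (rep (piece_type L h)) = piece_type L h" if "h \<in> ?P" for h
    unfolding rep_def by (rule someI[of _ h]) (use that in simp)
  have gP: "g k \<in> ?P" for k using g by simp
  have "\<exists>u v. OA L u \<and> OA L v \<and> g k = v \<circ> rep (piece_type L (g k)) \<circ> finv u" for k
    by (rule same_type_imp_double_coset[OF L]) (use rep[OF gP, of k] g in auto)
  then obtain u v where uv: "\<And>k. OA L (u k)" "\<And>k. OA L (v k)"
    "\<And>k. g k = v k \<circ> rep (piece_type L (g k)) \<circ> finv (u k)" by metis
  have "controlled L (\<lambda>k. rep (piece_type L (g k)))"
  proof (rule controlled_finite[of "rep ` piece_type L ` ?P"])
    show "finite (rep ` piece_type L ` ?P)" using finite_piece_types[OF L] by simp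
    show "PH L s" if "s \<in> rep ` piece_type L ` ?P" for s using that rep by blast
    show "rep (piece_type L (g k)) \<in> rep ` piece_type L ` ?P" for k using gP by blast
  qed
  then have "controlled L (\<lambda>k. v k \<circ> rep (piece_type L (g k)) \<circ> finv (u k))"
    using controlled_comp[OF controlled_comp[OF controlled_OA[OF L, of v]] controlled_inv[OF controlled_OA[OF L, of u]]] uv(1,2)
    by blast
  moreover have "(\<lambda>k. v k \<circ> rep (piece_type L (g k)) \<circ> finv (u k)) = g"
    by (rule ext) (rule uv(3)[symmetric])
  ultimately show ?thesis by (rule back_subst[of "controlled L"])
qed

text \<open>A gap that is broken on the line but not on the circle is sent to the pair of extreme points; at
  most two left ends can be involved.\<close>
lemma card_cuts_le:
  assumes L: "cantor L" and g: "PH L g"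
  shows "card (cuts L g) \<le> card {a. \<exists>b. cadj L a b \<and> \<not> cadj L (g a) (g b)} + 2"
proof -
  let ?D = "{a. \<exists>b. cadj L a b \<and> \<not> cadj L (g a) (g b)}"
  let ?S = "{(a,b). consec L a b \<and> \<not> keeps_gap L g a b}"
  have p: "g permutes L" using g by (simp add: PH_def)
  have finD: "finite ?D" by (rule PH_finite_disc[OF L g])
  have finS: "finite ?S" using PH_finite_broken_gaps[OF L g] unfolding keeps_gap_def .
  have "cuts L g = (\<lambda>(a,b). (a + b) / 2) ` ?S" unfolding cuts_def by (auto simp: image_def)
  then have "card (cuts L g) \<le> card ?S" using card_image_le[OF finS] by simp
  also have "card ?S = card (fst ` ?S)"
  proof -
    have "inj_on fst ?S" by (rule inj_onI) (auto dest: consec_right_unique)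
    then show ?thesis by (simp add: card_image)
  qed
  also have "\<dots> \<le> card (?D \<union> {finv g (Inf L), finv g (Sup L)})"
  proof (rule card_mono)
    show "finite (?D \<union> {finv g (Inf L), finv g (Sup L)})" using finD by simp
    show "fst ` ?S \<subseteq> ?D \<union> {finv g (Inf L), finv g (Sup L)}"
    proof
      fix a assume "a \<in> fst ` ?S"
      then obtain b where ab: "consec L a b" "\<not> keeps_gap L g a b" by auto
      show "a \<in> ?D \<union> {finv g (Inf L), finv g (Sup L)}"
      proof (cases "cadj L (g a) (g b)")
        case True
        then have "g a = Inf L \<or> g a = Sup L" using ab(2) unfolding cadj_def keeps_gap_def by blast
        moreover have "finv g (g a) = a" using p by (simp add: permutes_inverses)
        ultimately show ?thesis by auto
      next
        case False
        moreover have "cadj L a b" using ab(1) by (simp add: cadj_def)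
        ultimately show ?thesis by blast
      qed
    qed
  qed
  also have "\<dots> \<le> card ?D + card {finv g (Inf L), finv g (Sup L)}" by (rule card_Un_le)
  also have "card {finv g (Inf L), finv g (Sup L)} \<le> 2" by (simp add: card_insert_if)
  finally show ?thesis by simp
qed

text \<open>Between two consecutive squares \<open>k ^ 2\<close> at most \<open>2 * k\<close> further factors \<open>f\<close> are needed, so
  controlling the powers \<open>f ^^ (k ^ 2)\<close> makes the length of \<open>f ^^ n\<close> of the order of \<open>sqrt n\<close>.\<close>
theorem bounded_imp_short_powers:
  assumes L: "cantor L" and f: "PH L f"
    and B: "\<And>n. card {a. \<exists>b. cadj L a b \<and> \<not> cadj L ((f ^^ n) a) ((f ^^ n) b)} \<le> B"
  shows "\<exists>S C. finite S \<and> (\<forall>s\<in>S. PH L s) \<and> (\<forall>n k. k\<^sup>2 \<le> n \<longrightarrow> n \<le> k\<^sup>2 + 2 * k \<longrightarrow> f ^^ n \<in> words S (C * (k + 1)))"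
proof -
  have "controlled L (\<lambda>k. f ^^ (k\<^sup>2))"
  proof (rule controlled_bounded_cuts[OF L, of _ "B + 2"])
    show "PH L (f ^^ k\<^sup>2)" for k using f by (rule PH_pow)
    show "card (cuts L (f ^^ k\<^sup>2)) \<le> B + 2" for k
      using card_cuts_le[OF L PH_pow[OF f], of "k\<^sup>2"] B[of "k\<^sup>2"] by linarith
  qed
  then obtain S C where S: "finite S" "\<forall>s\<in>S. PH L s" "\<And>k. f ^^ (k\<^sup>2) \<in> words S (C * (k + 1))"
    unfolding controlled_def by blast
  have "f ^^ n \<in> words (insert f S) ((C + 2) * (k + 1))" if n: "k\<^sup>2 \<le> n" "n \<le> k\<^sup>2 + 2 * k" for n k
  proof -
    have "n = k\<^sup>2 + (n - k\<^sup>2)" using n by simp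
    then have "f ^^ n = f ^^ (k\<^sup>2) \<circ> f ^^ (n - k\<^sup>2)" by (metis funpow_add)
    moreover have "f ^^ (k\<^sup>2) \<in> words (insert f S) (C * (k + 1))" using S(3) words_mono[of S "insert f S"] by blast
    moreover have "f ^^ (n - k\<^sup>2) \<in> words (insert f S) (n - k\<^sup>2)" by (rule words_pow) simp
    ultimately have "f ^^ n \<in> words (insert f S) (C * (k + 1) + (n - k\<^sup>2))" using words_comp by metis
    moreover have "C * (k + 1) + (n - k\<^sup>2) \<le> (C + 2) * (k + 1)" using n by (simp add: algebra_simps)
    ultimately show ?thesis using words_mono[of "insert f S" "insert f S"] by blast
  qed
  moreover have "finite (insert f S)" "\<forall>s\<in>insert f S. PH L s" using S f by auto
  ultimately show ?thesis by blast
qed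

section \<open>From the circle to the line\<close>

text \<open>The angle of \<open>z\<close> in the half-open interval of length \<open>2 * pi\<close> centred at \<open>m\<close>.\<close>
definition ang :: "real \<Rightarrow> complex \<Rightarrow> real"
  where "ang m z = m + Arg (z * cis (- m))"

lemma cis_ang: assumes "z \<in> circle" shows "cis (ang m z) = z"
proof -
  have n: "norm (z * cis (- m)) = 1" using assms by (simp add: norm_mult)
  then have "z * cis (- m) \<noteq> 0" by auto
  then have "cis (Arg (z * cis (- m))) = z * cis (- m)"
    using Arg_correct[of "z * cis (- m)"] n by (simp add: sgn_eq)
  then have "cis (ang m z) = cis m * (z * cis (- m))" by (simp add: ang_def cis_mult[symmetric])
  also have "\<dots> = z * (cis m * cis (- m))" by (simp add: mult_ac)
  also have "\<dots> = z" by (simp add: cis_mult)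
  finally show ?thesis .
qed

lemma ang_cis: assumes "m - pi < t" "t \<le> m + pi" shows "ang m (cis t) = t"
  using assms Arg_cis[of "t - m"] by (simp add: ang_def cis_mult)

lemma ang_range:
  assumes "z \<in> circle" "z \<noteq> cis (m + pi)" shows "m - pi < ang m z" "ang m z < m + pi"
proof -
  show "m - pi < ang m z" using mpi_less_Arg[of "z * cis (- m)"] by (simp add: ang_def)
  have "ang m z \<le> m + pi" using Arg_le_pi[of "z * cis (- m)"] by (simp add: ang_def)
  moreover have "ang m z \<noteq> m + pi" using cis_ang[OF assms(1), of m] assms(2) by metis
  ultimately show "ang m z < m + pi" by simp
qed

lemma continuous_ang: "continuous_on (circle - {cis (m + pi)}) (ang m)"
  unfolding ang_def
proof (intro continuous_intros)
  fix z assume z: "z \<in> circle - {cis (m + pi)}"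
  show "z * cis (- m) \<notin> \<real>\<^sub>\<le>\<^sub>0"
  proof
    assume "z * cis (- m) \<in> \<real>\<^sub>\<le>\<^sub>0"
    then obtain r where r: "z * cis (- m) = of_real r" "r \<le> 0" by (auto simp: nonpos_Reals_def)
    have "norm (z * cis (- m)) = 1" using z by (simp add: norm_mult)
    then have "r = -1" using r by simp
    then have "z * cis (- m) = cis pi" using r by simp
    then have e1: "z * cis (- m) * cis m = cis (m + pi)" by (simp only: cis_mult add.commute)
    have e2: "z * cis (- m) * cis m = z" by (simp add: mult.assoc cis_mult)
    have "z = cis (m + pi)" using e1 unfolding e2 .
    then show False using z by blast
  qed
qed

lemma cis_inj: assumes "cis s = cis t" "b - 2 * pi < s" "s \<le> b" "b - 2 * pi < t" "t \<le> b" shows "s = t"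
proof -
  have "ang (b - pi) (cis s) = s" by (rule ang_cis) (use assms in auto)
  moreover have "ang (b - pi) (cis t) = t" by (rule ang_cis) (use assms in auto)
  ultimately show ?thesis using assms(1) by metis
qed

lemma cis_shift: "cis (t + 2 * pi * of_int n) = cis t"
  using cis_multiple_2pi[of "of_int n"] by (simp add: cis_mult[symmetric] mult.commute)

lemma cis_add_2pi [simp]: "cis (t + 2 * pi) = cis t"
  using cis_shift[of t 1] by simp

lemma cis_eq_imp_shift:
  assumes "cis s = cis t" obtains n :: int where "s = t + 2 * pi * of_int n"
proof -
  have "cis (s - t) = 1" using assms by (simp add: cis_divide[symmetric])
  then have "cos (s - t) = 1" by (simp add: complex_eq_iff)
  then obtain n :: int where "s - t = of_int n * (2 * pi)" using cos_one_2pi_int by (metis mult.assoc)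
  then show ?thesis using that[of n] by (simp add: algebra_simps)
qed

lemma cis_homeo_interval:
  assumes "m - pi \<le> a" "b \<le> m + pi"
  shows "homeomorphism {a<..<b} (cis ` {a<..<b}) cis (ang m)"
proof (rule homeomorphismI)
  show "continuous_on {a<..<b} cis" by (intro continuous_intros)
  have eq: "ang m (cis t) = t" if "t \<in> {a<..<b}" for t using that assms by (intro ang_cis) auto
  have "cis ` {a<..<b} \<subseteq> circle - {cis (m + pi)}"
  proof
    fix z assume "z \<in> cis ` {a<..<b}"
    then obtain t where t: "z = cis t" "a < t" "t < b" by auto
    then have "cis t \<noteq> cis (m + pi)" using eq[of t] ang_cis[of m "m + pi"] assms by auto
    then show "z \<in> circle - {cis (m + pi)}" using t by simp
  qed
  then show "continuous_on (cis ` {a<..<b}) (ang m)" using continuous_ang continuous_on_subset by blast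
  show "ang m (cis t) = t" if "t \<in> {a<..<b}" for t using eq that .
  show "ang m ` cis ` {a<..<b} \<subseteq> {a<..<b}" using eq by auto
  show "cis (ang m z) = z" if "z \<in> cis ` {a<..<b}" for z using that eq by auto
qed simp

text \<open>Circle intervals can be rotated so that a prescribed angle is one of their angles.\<close>
lemma open_circle_intervalE:
  assumes "open_circle_interval I" "cis x \<in> I"
  obtains a b where "a < x" "x < b" "b \<le> a + 2 * pi" "I = cis ` {a<..<b}"
proof -
  obtain a b where ab: "b \<le> a + 2 * pi" "I = cis ` {a<..<b}"
    using assms(1) unfolding open_circle_interval_def by blast
  obtain t where t: "a < t" "t < b" "cis x = cis t" using assms(2) ab by auto
  obtain n :: int where n: "x = t + 2 * pi * of_int n" using cis_eq_imp_shift[OF t(3)] .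
  let ?c = "2 * pi * of_int n"
  have im: "cis ` {a<..<b} = cis ` {a + ?c<..<b + ?c}"
  proof
    show "cis ` {a<..<b} \<subseteq> cis ` {a + ?c<..<b + ?c}"
    proof
      fix z assume "z \<in> cis ` {a<..<b}"
      then obtain s where s: "z = cis s" "a < s" "s < b" by auto
      then show "z \<in> cis ` {a + ?c<..<b + ?c}" by (intro image_eqI[of _ _ "s + ?c"]) (simp_all add: cis_shift)
    qed
    show "cis ` {a + ?c<..<b + ?c} \<subseteq> cis ` {a<..<b}"
    proof
      fix z assume "z \<in> cis ` {a + ?c<..<b + ?c}"
      then obtain s where s: "z = cis s" "a + ?c < s" "s < b + ?c" by auto
      then show "z \<in> cis ` {a<..<b}"
        using cis_shift[of "s - ?c" n] by (intro image_eqI[of _ _ "s - ?c"]) simp_all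
    qed
  qed
  show ?thesis by (rule that[of "a + ?c" "b + ?c"]) (use t n ab im in auto)
qed

lemma cantor_dense_complement:
  assumes "cantor L" "a < b" shows "\<exists>z. a < z \<and> z < b \<and> z \<notin> L"
proof (rule ccontr)
  assume n: "\<not> ?thesis"
  let ?x = "a + (b - a) / 3" and ?y = "a + 2 * (b - a) / 3"
  have "a < ?x" "?x < ?y" "?y < b" using assms(2) by (auto simp: field_simps)
  moreover from this have "?x \<in> L" "?y \<in> L" using n by (meson less_trans)+
  ultimately show False using assms(1) n unfolding cantor_def by (meson less_trans)
qed

text \<open>A locally monotone map extends, near each point, to a homeomorphism between intervals: the
  monotone piece is completed by two outer points and the gaps are filled linearly.\<close>
lemma local_extension:
  assumes L: "cantor L" and \<phi>: "PH L \<phi>" and x: "x \<in> L" and e: "e > 0"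
  obtains p q c d G G' where "p < x" "x < q" "x - e < p" "q < x + e" "\<phi> x - e < c" "c < \<phi> x" "\<phi> x < d" "d < \<phi> x + e"
    "homeomorphism {p<..<q} {c<..<d} G G'" "\<forall>t\<in>L. p < t \<longrightarrow> t < q \<longrightarrow> G t = \<phi> t"
proof -
  have m: "locally_mono L \<phi>" and cont: "continuous_on L \<phi>" using \<phi> by (simp_all add: PH_def)
  obtain \<delta> s where s: "\<delta> > 0" "s = 1 \<or> s = (-1::real)"
      "\<And>y z. y \<in> L \<Longrightarrow> z \<in> L \<Longrightarrow> \<bar>y - x\<bar> < \<delta> \<Longrightarrow> \<bar>z - x\<bar> < \<delta> \<Longrightarrow> y < z \<Longrightarrow> s * \<phi> y < s * \<phi> z"
      using locally_monoE[OF m x] by metis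
  define e' where "e' = e / 2"
  have e': "e' > 0" "e' < e" using e by (auto simp: e'_def)
  obtain d0 where d0: "d0 > 0" "\<And>y. y \<in> L \<Longrightarrow> \<bar>y - x\<bar> < d0 \<Longrightarrow> \<bar>\<phi> y - \<phi> x\<bar> < e'"
    using continuous_at_bound[OF cont x e'(1)] by metis
  let ?r = "min \<delta> (min d0 e)"
  have r: "?r > 0" using s(1) d0(1) e by simp
  obtain p where p: "x - ?r < p" "p < x" "p \<notin> L" using cantor_dense_complement[OF L, of "x - ?r" x] r by auto
  obtain q where q: "x < q" "q < x + ?r" "q \<notin> L" using cantor_dense_complement[OF L, of x "x + ?r"] r by auto
  define A where "A = L \<inter> {p..q}"
  define A' where "A' = A \<union> {p, q}"
  \<comment> \<open>The outer points are sent beyond the images of all points between them, in the local direction \<open>s\<close>.\<close>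
  define \<psi> where "\<psi> t = (if t = p then \<phi> x - s * e' else if t = q then \<phi> x + s * e' else \<phi> t)" for t
  have A_in: "p < t \<and> t < q \<and> t \<in> L \<and> \<bar>t - x\<bar> < ?r" if t: "t \<in> A" for t
  proof -
    have "t \<noteq> p" "t \<noteq> q" using t p q by (auto simp: A_def)
    then have "p < t" "t < q" "t \<in> L" using t by (auto simp: A_def)
    then show ?thesis using p q by (auto simp: abs_less_iff)
  qed
  have \<psi>A: "\<psi> t = \<phi> t" if "t \<in> A" for t using A_in[OF that] by (simp add: \<psi>_def)
  have \<psi>p: "\<psi> p = \<phi> x - s * e'" "\<psi> q = \<phi> x + s * e'" using p q by (auto simp: \<psi>_def)
  have s2: "s * s = 1" using s(2) by auto
  have near: "\<bar>\<phi> t - \<phi> x\<bar> < e'" if "t \<in> A" for t using d0(2) A_in[OF that] by simp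
  have mono: "s * \<psi> y < s * \<psi> z" if h: "y \<in> A'" "z \<in> A'" "y < z" for y z
  proof -
    have pq: "p < q" using p q by simp
    consider "y \<in> A" "z \<in> A" | "y = p" "z \<in> A" | "y \<in> A" "z = q" | "y = p" "z = q"
      using h A_in pq unfolding A'_def by force
    then show ?thesis
    proof cases
      case 1 then show ?thesis using s(3) A_in h(3) \<psi>A by auto
    next
      case 2 then show ?thesis using near[of z] s(2) e' \<psi>p \<psi>A by auto
    next
      case 3 then show ?thesis using near[of y] s(2) e' \<psi>p \<psi>A by auto
    next
      case 4 then show ?thesis using s(2) e' \<psi>p by auto
    qed
  qed
  have inj: "inj_on \<psi> A'"
    by (rule inj_onI) (metis less_irrefl linorder_neqE_linordered_idom mono)
  have cA: "compact A" unfolding A_def using L by (simp add: compact_Int_closed)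
  have cA': "compact A'" unfolding A'_def using cA by (simp add: compact_Un)
  have "continuous_on A \<psi>"
  proof -
    have "continuous_on A \<phi>" using cont by (rule continuous_on_subset) (auto simp: A_def)
    then show ?thesis using \<psi>A by (simp cong: continuous_on_cong)
  qed
  then have c\<psi>: "continuous_on A' \<psi>" unfolding A'_def
    by (intro continuous_on_closed_Un) (use cA in \<open>auto intro: compact_imp_closed continuous_on_finite\<close>)
  let ?B = "\<psi> ` A'"
  have cB: "compact ?B" using c\<psi> cA' by (rule compact_continuous_image)
  let ?i = "the_inv_into A' \<psi>"
  have ii: "?i (\<psi> t) = t" if "t \<in> A'" for t using the_inv_into_f_f[OF inj that] .
  have hom: "homeomorphism A' ?B \<psi> ?i"
    by (rule homeomorphismI) (use c\<psi> continuous_on_inv_into[OF c\<psi> cA' inj] ii in auto)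
  have fw: "consec ?B (\<psi> u) (\<psi> v) \<or> consec ?B (\<psi> v) (\<psi> u)" if h: "consec A' u v" for u v
  proof -
    have uv: "u \<in> A'" "v \<in> A'" "u < v" using consecD[OF h] by auto
    have no: "\<not> (s * \<psi> u < s * y \<and> s * y < s * \<psi> v)" if yB: "y \<in> ?B" for y
    proof
      assume a: "s * \<psi> u < s * y \<and> s * y < s * \<psi> v"
      obtain w where w: "w \<in> A'" "y = \<psi> w" using yB by blast
      have "\<not> w < u" "\<not> v < w" "w \<noteq> u" "w \<noteq> v"
        using mono[OF w(1) uv(1)] mono[OF uv(2) w(1)] a w(2) by auto
      then show False using consecD(4)[OF h w(1)] by auto
    qed
    have "s * \<psi> u < s * \<psi> v" using mono uv by blast
    then show ?thesis using s(2) no uv unfolding consec_def by force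
  qed
  have bw: "consec A' u v \<or> consec A' v u" if h: "consec ?B (\<psi> u) (\<psi> v)" and uv: "u \<in> A'" "v \<in> A'" for u v
  proof -
    have "u \<noteq> v" using consecD(3)[OF h] by auto
    have no: False if w: "w \<in> A'" "min u v < w" "w < max u v" for w
    proof -
      have "s * \<psi> (min u v) < s * \<psi> w" "s * \<psi> w < s * \<psi> (max u v)"
        using mono uv w by (auto simp: min_def max_def)
      then have "\<psi> u < \<psi> w \<and> \<psi> w < \<psi> v \<or> \<psi> v < \<psi> w \<and> \<psi> w < \<psi> u"
        using s(2) by (auto simp: min_def max_def split: if_splits)
      moreover have "\<psi> w \<in> ?B" using w by blast
      ultimately show False using consecD(3)[OF h] consecD(4)[OF h, of "\<psi> w"] by auto
    qed
    show ?thesis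
    proof (cases "u < v")
      case True then show ?thesis using uv no unfolding consec_def by (auto simp: min_def max_def)
    next
      case False then show ?thesis using uv no \<open>u \<noteq> v\<close> unfolding consec_def by (auto simp: min_def max_def)
    qed
  qed
  have p1: "preserves_gaps (segs A') (segs ?B) \<psi>"
    unfolding preserves_gaps_def
  proof
    fix \<gamma> assume "\<gamma> \<in> segs A'"
    then obtain u v where "\<gamma> = seg u v" "consec A' u v \<or> consec A' v u" by (auto simp: segs_def)
    then have "seg (\<psi> u) (\<psi> v) \<in> segs ?B" using fw unfolding segs_def by blast
    then show "\<exists>\<delta>\<in>segs ?B. \<delta> 0 = \<psi> (\<gamma> 0) \<and> \<delta> 1 = \<psi> (\<gamma> 1)"
      using \<open>\<gamma> = seg u v\<close> by (intro bexI[of _ "seg (\<psi> u) (\<psi> v)"]) auto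
  qed
  have p2: "preserves_gaps (segs ?B) (segs A') ?i"
    unfolding preserves_gaps_def
  proof
    fix \<gamma> assume "\<gamma> \<in> segs ?B"
    then obtain y z where yz: "\<gamma> = seg y z" "consec ?B y z \<or> consec ?B z y" by (auto simp: segs_def)
    then have "y \<in> ?B" "z \<in> ?B" using consecD(1,2) by blast+
    then obtain u v where uv: "u \<in> A'" "v \<in> A'" "y = \<psi> u" "z = \<psi> v" by blast
    then have "consec A' u v \<or> consec A' v u" using bw yz(2) by blast
    then have "seg u v \<in> segs A'" unfolding segs_def by blast
    then show "\<exists>\<delta>\<in>segs A'. \<delta> 0 = ?i (\<gamma> 0) \<and> \<delta> 1 = ?i (\<gamma> 1)"
      using yz uv ii by (intro bexI[of _ "seg u v"]) auto
  qed
  define c where "c = \<phi> x - e'"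
  define d where "d = \<phi> x + e'"
  have B_sub: "?B \<subseteq> {c..d}" "c \<in> ?B" "d \<in> ?B" "{\<psi> p, \<psi> q} = {c, d}"
  proof -
    show eq: "{\<psi> p, \<psi> q} = {c, d}" using s(2) \<psi>p by (auto simp: c_def d_def)
    have "{\<psi> p, \<psi> q} \<subseteq> ?B" by (auto simp: A'_def)
    then show "c \<in> ?B" "d \<in> ?B" using eq by auto
    have "\<psi> t \<in> {c..d}" if "t \<in> A'" for t
    proof -
      have "t \<in> A \<or> t \<in> {p, q}" using that by (auto simp: A'_def)
      then show ?thesis
      proof
        assume "t \<in> A" then show ?thesis using near[of t] \<psi>A[of t] by (auto simp: c_def d_def)
      next
        assume "t \<in> {p, q}"
        then have "\<psi> t \<in> {c, d}" using eq by blast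
        then show ?thesis using e' by (auto simp: c_def d_def)
      qed
    qed
    then show "?B \<subseteq> {c..d}" by blast
  qed
  have fillA: "filled A' (segs A') = {p..q}"
    by (rule filled_segs[OF cA']) (use p q in \<open>auto simp: A'_def A_def\<close>)
  have fillB: "filled ?B (segs ?B) = {c..d}"
    by (rule filled_segs[OF cB]) (use B_sub in auto)
  obtain G G' where G: "homeomorphism {p..q} {c..d} G G'" "\<And>t. t \<in> A' \<Longrightarrow> G t = \<psi> t"
    using gap_homeomorphism_extends[OF segs_gap_system[OF cA'] segs_gap_system[OF cB] hom p1 p2]
    unfolding fillA fillB by blast
  have Gends: "{G p, G q} = {c, d}" using G(2) B_sub(4) by (auto simp: A'_def)
  have "G ` {p<..<q} = {c<..<d}"
  proof -
    have "inj_on G {p..q}" using G(1) unfolding homeomorphism_def by (auto intro: inj_on_inverseI)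
    moreover have "{p<..<q} = {p..q} - {p, q}" by auto
    moreover have "p < q" using p q by simp
    ultimately have "G ` {p<..<q} = G ` {p..q} - G ` {p, q}" by (simp add: inj_on_image_set_diff)
    also have "\<dots> = {c..d} - {c, d}" using G(1) Gends unfolding homeomorphism_def by simp
    also have "\<dots> = {c<..<d}" by auto
    finally show ?thesis .
  qed
  then have "homeomorphism {p<..<q} {c<..<d} G G'"
    using homeomorphism_of_subsets[OF G(1), of "{p<..<q}" "{c<..<d}"] by force
  moreover have "G t = \<phi> t" if "t \<in> L" "p < t" "t < q" for t
  proof -
    have "t \<in> A" using that by (simp add: A_def)
    then show ?thesis using G(2) \<psi>A by (simp add: A'_def)
  qed
  moreover have "\<phi> x - e < c" "c < \<phi> x" "\<phi> x < d" "d < \<phi> x + e" using e' by (auto simp: c_def d_def)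
  ultimately show ?thesis using that[of p q c d G G'] p q by auto
qed

text \<open>The circle is cut open at a point outside \<open>K\<close>, which turns \<open>K\<close> into a
  set \<open>L\<close> of angles.\<close>
locale circle_cantor =
  fixes K :: "complex set" and m :: real
  assumes K: "cantor_subset K" and m: "cis (m + pi) \<notin> K"
begin

definition L :: "real set" where "L = ang m ` K"

lemma K_circle: "z \<in> K \<Longrightarrow> z \<in> circle"
  using K unfolding cantor_subset_def by blast

lemma cis_ang_K: "z \<in> K \<Longrightarrow> cis (ang m z) = z"
  using K_circle cis_ang by blast

lemma K_eq: "K = cis ` L"
proof -
  have "cis ` L = (\<lambda>z. cis (ang m z)) ` K" by (simp add: L_def image_image)
  also have "\<dots> = K" using cis_ang_K by simp
  finally show ?thesis by simp
qed

lemma cis_L: "t \<in> L \<Longrightarrow> cis t \<in> K"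
  using K_eq by blast

lemma ang_K: "z \<in> K \<Longrightarrow> ang m z \<in> L"
  by (simp add: L_def)

lemma L_range: "t \<in> L \<Longrightarrow> m - pi < t \<and> t < m + pi"
proof -
  assume "t \<in> L"
  then obtain z where z: "z \<in> K" "t = ang m z" by (auto simp: L_def)
  then have "z \<noteq> cis (m + pi)" using m by auto
  then show ?thesis using ang_range[OF K_circle[OF z(1)], of m] z(2) by simp
qed

lemma ang_L: "t \<in> L \<Longrightarrow> ang m (cis t) = t"
  using L_range ang_cis by fastforce

lemma cis_in_K_iff: assumes "m - pi < t" "t \<le> m + pi" shows "cis t \<in> K \<longleftrightarrow> t \<in> L"
  using ang_cis[OF assms] ang_K cis_L by metis

lemma ang_cont: "continuous_on K (ang m)"
proof (rule continuous_on_subset[OF continuous_ang])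
  show "K \<subseteq> circle - {cis (m + pi)}" using K_circle m by blast
qed

lemma L_cantor: "cantor L"
  unfolding cantor_def
proof (intro conjI ballI impI)
  have cK: "compact K" "infinite K" using K by (auto simp: cantor_subset_def)
  show "compact L" unfolding L_def using ang_cont cK(1) by (rule compact_continuous_image)
  have "K \<noteq> {}" using cK by auto
  then show "L \<noteq> {}" by (simp add: L_def)
next
  fix x assume x: "x \<in> L"
  have lim: "cis x islimpt K" using K cis_L[OF x] by (simp add: cantor_subset_def)
  show "x islimpt L" unfolding islimpt_approachable
  proof (intro allI impI)
    fix e :: real assume "e > 0"
    then obtain d where d: "d > 0" "\<And>z. z \<in> K \<Longrightarrow> dist z (cis x) < d \<Longrightarrow> dist (ang m z) (ang m (cis x)) < e"
      using ang_cont cis_L[OF x] unfolding continuous_on_iff by metis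
    obtain z where z: "z \<in> K" "z \<noteq> cis x" "dist z (cis x) < d" using lim d(1) unfolding islimpt_approachable by blast
    then show "\<exists>x'\<in>L. x' \<noteq> x \<and> dist x' x < e"
      using d(2)[OF z(1,3)] ang_L[OF x] ang_K[OF z(1)] cis_ang_K[OF z(1)] by (intro bexI[of _ "ang m z"]) auto
  qed
next
  fix x y assume xy: "x \<in> L" "y \<in> L" "x < y"
  show "\<exists>z>x. z < y \<and> z \<notin> L"
  proof (rule ccontr)
    assume n: "\<not> ?thesis"
    have "{x..y} \<subseteq> L"
    proof
      fix z assume "z \<in> {x..y}"
      then show "z \<in> L" using n xy by (cases "z = x \<or> z = y") (auto simp: less_le)
    qed
    then have "cis ` {x..y} \<subseteq> K" using cis_L by blast
    moreover have "connected (cis ` {x..y})" by (intro connected_continuous_image continuous_intros) simp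
    moreover have "cis x \<in> cis ` {x..y}" "cis y \<in> cis ` {x..y}" using xy by auto
    ultimately have "cis y \<in> connected_component_set K (cis x)"
      by (meson connected_component_maximal subsetD)
    then have "cis y = cis x" using K cis_L[OF xy(1)] unfolding cantor_subset_def by blast
    then have "y = x" using ang_L xy by metis
    then show False using xy by simp
  qed
qed

lemma L_compact [simp]: "compact L" "closed L" "L \<noteq> {}"
  using L_cantor by simp_all

text \<open>Elements of the group are undefined outside \<open>K\<close>, while the maps of the line are the
  identity outside \<open>L\<close>.\<close>
definition to_K :: "(real \<Rightarrow> real) \<Rightarrow> complex \<Rightarrow> complex"
  where "to_K \<phi> = (\<lambda>z\<in>K. cis (\<phi> (ang m z)))"

definition to_L :: "(complex \<Rightarrow> complex) \<Rightarrow> real \<Rightarrow> real"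
  where "to_L f t = (if t \<in> L then ang m (f (cis t)) else t)"

lemma to_K_in_Homeo:
  assumes \<phi>: "PH L \<phi>" shows "to_K \<phi> \<in> carrier (Homeo_lt K)"
proof -
  have p: "\<phi> permutes L" and c: "continuous_on L \<phi>" using \<phi> by (simp_all add: PH_def)
  have \<phi>': "PH L (finv \<phi>)" using PH_inv[OF _ \<phi>] by simp
  have p': "finv \<phi> permutes L" and c': "continuous_on L (finv \<phi>)" using \<phi>' by (simp_all add: PH_def)
  have inv1: "finv \<phi> (\<phi> t) = t" "\<phi> (finv \<phi> t) = t" for t using p by (auto simp: permutes_inverses)
  have hom: "homeomorphism K K (to_K \<phi>) (to_K (finv \<phi>))"
  proof -
    have *: "continuous_on K (to_K \<psi>)" if "continuous_on L \<psi>" for \<psi>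
    proof -
      have "continuous_on K (\<psi> \<circ> ang m)" using ang_cont that by (intro continuous_on_compose) (simp_all add: L_def)
      then have "continuous_on K (\<lambda>z. cis (\<psi> (ang m z)))" unfolding comp_def by (intro continuous_intros)
      then show ?thesis by (simp add: to_K_def cong: continuous_on_cong)
    qed
    have m1: "to_K \<psi> z \<in> K" if "\<psi> permutes L" "z \<in> K" for \<psi> z
      using that by (simp add: to_K_def cis_L ang_K permutes_in_image)
    have m2: "ang m (to_K \<psi> z) = \<psi> (ang m z)" if "\<psi> permutes L" "z \<in> K" for \<psi> z
      using that by (simp add: to_K_def ang_L ang_K permutes_in_image)
    show ?thesis
    proof (rule homeomorphismI)
      show "to_K (finv \<phi>) (to_K \<phi> z) = z" if "z \<in> K" for z
      proof -
        have "to_K (finv \<phi>) (to_K \<phi> z) = cis (finv \<phi> (ang m (to_K \<phi> z)))" using m1[OF p that] by (simp add: to_K_def)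
        then show ?thesis using m2[OF p that] inv1 cis_ang_K[OF that] by simp
      qed
      show "to_K \<phi> (to_K (finv \<phi>) z) = z" if "z \<in> K" for z
      proof -
        have "to_K \<phi> (to_K (finv \<phi>) z) = cis (\<phi> (ang m (to_K (finv \<phi>) z)))" using m1[OF p' that] by (simp add: to_K_def)
        then show ?thesis using m2[OF p' that] inv1 cis_ang_K[OF that] by simp
      qed
    qed (use * c c' m1 p p' in auto)
  qed
  have "bij_betw (to_K \<phi>) K K" using hom unfolding homeomorphism_def bij_betw_def
    by (auto intro: inj_on_inverseI)
  then have "to_K \<phi> \<in> Bij K" by (simp add: Bij_def to_K_def)
  moreover have "locally_monotone_homeo K (to_K \<phi>)"
    unfolding locally_monotone_homeo_def
  proof (intro conjI ballI)
    show "\<exists>f'. homeomorphism K K (to_K \<phi>) f'" using hom by blast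
    fix z assume z: "z \<in> K"
    define x where "x = ang m z"
    have x: "x \<in> L" "z = cis x" using z by (simp_all add: x_def ang_K cis_ang_K)
    have fx: "\<phi> x \<in> L" using x p by (simp add: permutes_in_image)
    define e where "e = min (min (x - (m - pi)) (m + pi - x)) (min (\<phi> x - (m - pi)) (m + pi - \<phi> x))"
    have e: "e > 0" using L_range[OF x(1)] L_range[OF fx] by (simp add: e_def)
    have e_le: "m - pi \<le> x - e" "x + e \<le> m + pi" "m - pi \<le> \<phi> x - e" "\<phi> x + e \<le> m + pi"
      by (auto simp: e_def)
    obtain p q c d G G' where G: "p < x" "x < q" "x - e < p" "q < x + e" "\<phi> x - e < c" "c < \<phi> x" "\<phi> x < d" "d < \<phi> x + e"
      "homeomorphism {p<..<q} {c<..<d} G G'" "\<forall>t\<in>L. p < t \<longrightarrow> t < q \<longrightarrow> G t = \<phi> t"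
      using local_extension[OF L_cantor \<phi> x(1) e] .
    have r: "m - pi \<le> p" "q \<le> m + pi" "m - pi \<le> c" "d \<le> m + pi" using G e_le by auto
    let ?I = "cis ` {p<..<q}" and ?J = "cis ` {c<..<d}"
    have h1: "homeomorphism {p<..<q} ?I cis (ang m)" using cis_homeo_interval[OF r(1,2)] .
    have h2: "homeomorphism {c<..<d} ?J cis (ang m)" using cis_homeo_interval[OF r(3,4)] .
    have hh: "homeomorphism ?I ?J (cis \<circ> (G \<circ> ang m)) ((cis \<circ> G') \<circ> ang m)"
      using homeomorphism_compose[OF homeomorphism_compose[OF homeomorphism_symD[OF h1] G(9)] h2] by (simp add: comp_assoc)
    have eq: "\<forall>y \<in> ?I \<inter> K. to_K \<phi> y = (cis \<circ> (G \<circ> ang m)) y"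
    proof
      fix y assume y: "y \<in> ?I \<inter> K"
      then obtain t where t: "y = cis t" "p < t" "t < q" by auto
      have ty: "ang m y = t" using t r by (auto intro: ang_cis)
      then have "t \<in> L" using y ang_K by auto
      then show "to_K \<phi> y = (cis \<circ> (G \<circ> ang m)) y" using y ty G(10) t by (simp add: to_K_def)
    qed
    have "open_circle_interval ?I" "open_circle_interval ?J"
      unfolding open_circle_interval_def using G r by (intro exI conjI; linarith?; simp)+
    moreover have "z \<in> ?I" using x G by auto
    moreover have "to_K \<phi> z \<in> ?J" using z G by (simp add: to_K_def x_def[symmetric])
    ultimately show "\<exists>I J g g'. open_circle_interval I \<and> open_circle_interval J \<and> z \<in> I \<and> to_K \<phi> z \<in> J \<and>
       homeomorphism I J g g' \<and> (\<forall>y \<in> I \<inter> K. to_K \<phi> y = g y)" using hh eq by blast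
  qed
  ultimately show ?thesis by (simp add: Homeo_lt_def)
qed

lemma to_L_PH:
  assumes f: "f \<in> carrier (Homeo_lt K)" shows "PH L (to_L f)"
proof -
  have fB: "f \<in> Bij K" and lm: "locally_monotone_homeo K f" using f by (simp_all add: Homeo_lt_def)
  have bij: "bij_betw f K K" using fB by (simp add: Bij_def)
  obtain f' where f': "homeomorphism K K f f'" using lm unfolding locally_monotone_homeo_def by blast
  have fK: "f z \<in> K" if "z \<in> K" for z using that bij by (auto simp: bij_betw_def)
  have cis_to_L: "cis (to_L f t) = f (cis t)" if "t \<in> L" for t
    using that by (simp add: to_L_def cis_ang_K fK cis_L)
  have perm: "to_L f permutes L"
  proof (rule bij_imp_permutes)
    show "bij_betw (to_L f) L L" unfolding bij_betw_def
    proof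
      show "inj_on (to_L f) L"
      proof (rule inj_onI)
        fix s t assume h: "s \<in> L" "t \<in> L" "to_L f s = to_L f t"
        then have "f (cis s) = f (cis t)" using cis_to_L by metis
        then have "cis s = cis t" using bij h(1,2) cis_L by (auto simp: bij_betw_def dest: inj_onD)
        then show "s = t" using ang_L h by metis
      qed
      show "to_L f ` L = L"
      proof
        show "to_L f ` L \<subseteq> L" by (auto simp: to_L_def ang_K fK cis_L)
        show "L \<subseteq> to_L f ` L"
        proof
          fix y assume y: "y \<in> L"
          then have "cis y \<in> f ` K" using cis_L bij by (simp add: bij_betw_def)
          then obtain z where z: "z \<in> K" "cis y = f z" by blast
          then have "to_L f (ang m z) = y" using ang_L[OF y] by (simp add: to_L_def ang_K cis_ang_K)
          then show "y \<in> to_L f ` L" using ang_K[OF z(1)] by blast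
        qed
      qed
    qed
  qed (simp add: to_L_def)
  have cont: "continuous_on L (to_L f)"
  proof -
    have c: "continuous_on K f" using f' by (simp add: homeomorphism_def)
    have "continuous_on L cis" by (intro continuous_intros)
    then have "continuous_on L (\<lambda>t. f (cis t))"
      by (rule continuous_on_compose2[OF c]) (use cis_L in blast)
    then have "continuous_on L (\<lambda>t. ang m (f (cis t)))"
      by (rule continuous_on_compose2[OF ang_cont]) (use fK cis_L in auto)
    then show ?thesis by (simp add: to_L_def cong: continuous_on_cong)
  qed
  have "locally_mono L (to_L f)"
  proof (rule locally_monoI)
    fix x assume x: "x \<in> L"
    let ?y = "to_L f x"
    obtain I J g g' where g: "open_circle_interval I" "open_circle_interval J" "cis x \<in> I" "f (cis x) \<in> J"
      "homeomorphism I J g g'" "\<forall>y \<in> I \<inter> K. f y = g y"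
      using lm cis_L[OF x] unfolding locally_monotone_homeo_def by blast
    obtain a b where ab: "a < x" "x < b" "b \<le> a + 2 * pi" "I = cis ` {a<..<b}"
      using open_circle_intervalE[OF g(1,3)] .
    have "cis ?y \<in> J" using g(4) cis_to_L[OF x] by simp
    then obtain c d where cd: "c < ?y" "?y < d" "d \<le> c + 2 * pi" "J = cis ` {c<..<d}"
      using open_circle_intervalE[OF g(2)] by blast
    let ?m = "(a + b) / 2" and ?n = "(c + d) / 2"
    have h1: "homeomorphism {a<..<b} I cis (ang ?m)" unfolding ab(4) by (rule cis_homeo_interval) (use ab(3) in \<open>auto simp: field_simps\<close>)
    have h2: "homeomorphism {c<..<d} J cis (ang ?n)" unfolding cd(4) by (rule cis_homeo_interval) (use cd(3) in \<open>auto simp: field_simps\<close>)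
    define v where "v = ang ?n \<circ> (g \<circ> cis)"
    have hv: "homeomorphism {a<..<b} {c<..<d} v (ang ?m \<circ> g' \<circ> cis)"
      unfolding v_def using homeomorphism_compose[OF homeomorphism_compose[OF h1 g(5)] homeomorphism_symD[OF h2]] by simp
    then have "continuous_on {a<..<b} v" "inj_on v {a<..<b}"
      unfolding homeomorphism_def by (auto intro: inj_on_inverseI)
    then have mono: "strict_mono_on {a<..<b} v \<or> strict_antimono_on {a<..<b} v"
      using injective_eq_monotone_map[of "{a<..<b}" v] by (simp add: is_interval_oo)
    obtain d0 where d0: "d0 > 0" "\<And>t. t \<in> L \<Longrightarrow> \<bar>t - x\<bar> < d0 \<Longrightarrow> \<bar>to_L f t - ?y\<bar> < min (?y - c) (d - ?y)"
      using continuous_at_bound[OF cont x, of "min (?y - c) (d - ?y)"] cd by auto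
    define \<delta> where "\<delta> = min d0 (min (x - a) (b - x))"
    have eq: "t \<in> {a<..<b} \<and> to_L f t = v t" if t: "t \<in> L" "\<bar>t - x\<bar> < \<delta>" for t
    proof -
      have tab: "t \<in> {a<..<b}" using t(2) by (auto simp: \<delta>_def abs_less_iff)
      have "\<bar>to_L f t - ?y\<bar> < min (?y - c) (d - ?y)" using d0(2) t by (simp add: \<delta>_def)
      then have r: "c < to_L f t" "to_L f t < d" by (auto simp: abs_less_iff)
      have "g (cis t) = cis (to_L f t)" using g(6) ab(4) tab cis_L[OF t(1)] cis_to_L[OF t(1)] by auto
      then have "v t = ang ?n (cis (to_L f t))" by (simp add: v_def)
      also have "\<dots> = to_L f t" using h2 r unfolding homeomorphism_def by auto
      finally show ?thesis using tab by simp
    qed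
    have "\<delta> > 0" using d0(1) ab by (simp add: \<delta>_def)
    from mono show "\<exists>\<delta> s. \<delta> > 0 \<and> (s = 1 \<or> s = (-1::real)) \<and> (\<forall>y\<in>L. \<forall>z\<in>L.
      \<bar>y - x\<bar> < \<delta> \<longrightarrow> \<bar>z - x\<bar> < \<delta> \<longrightarrow> y < z \<longrightarrow> s * to_L f y < s * to_L f z)"
    proof
      assume a: "strict_mono_on {a<..<b} v"
      have "1 * to_L f y < 1 * to_L f z" if "y \<in> L" "z \<in> L" "\<bar>y - x\<bar> < \<delta>" "\<bar>z - x\<bar> < \<delta>" "y < z" for y z
        using a eq[OF that(1,3)] eq[OF that(2,4)] that(5) unfolding monotone_on_def by simp
      then show ?thesis using \<open>\<delta> > 0\<close> by blast
    next
      assume a: "strict_antimono_on {a<..<b} v"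
      have "-1 * to_L f y < -1 * to_L f z" if "y \<in> L" "z \<in> L" "\<bar>y - x\<bar> < \<delta>" "\<bar>z - x\<bar> < \<delta>" "y < z" for y z
        using a eq[OF that(1,3)] eq[OF that(2,4)] that(5) unfolding monotone_on_def by simp
      then show ?thesis using \<open>\<delta> > 0\<close> by blast
    qed
  qed
  then show ?thesis using perm cont by (simp add: PH_def)
qed

lemma cis_to_L: "f \<in> carrier (Homeo_lt K) \<Longrightarrow> t \<in> L \<Longrightarrow> cis (to_L f t) = f (cis t)"
proof -
  assume f: "f \<in> carrier (Homeo_lt K)" and t: "t \<in> L"
  have "f (cis t) \<in> K" using f cis_L[OF t] by (auto simp: Homeo_lt_def Bij_def bij_betw_def)
  then show ?thesis using t by (simp add: to_L_def cis_ang_K)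
qed

lemma to_K_to_L: "f \<in> carrier (Homeo_lt K) \<Longrightarrow> to_K (to_L f) = f"
proof (rule ext)
  fix z assume f: "f \<in> carrier (Homeo_lt K)"
  show "to_K (to_L f) z = f z"
  proof (cases "z \<in> K")
    case True
    then show ?thesis using cis_to_L[OF f ang_K[OF True]] by (simp add: to_K_def cis_ang_K)
  next
    case False
    then show ?thesis using f by (simp add: to_K_def Homeo_lt_def Bij_def extensional_def)
  qed
qed

text \<open>From here on the group can be studied on the line.\<close>
lemma carrier_Homeo: "carrier (Homeo_lt K) = to_K ` {\<phi>. PH L \<phi>}"
proof
  show "carrier (Homeo_lt K) \<subseteq> to_K ` {\<phi>. PH L \<phi>}"
  proof
    fix f assume f: "f \<in> carrier (Homeo_lt K)"
    show "f \<in> to_K ` {\<phi>. PH L \<phi>}"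
      by (rule image_eqI[of _ _ "to_L f"]) (use to_K_to_L[OF f] to_L_PH[OF f] in simp_all)
  qed
  show "to_K ` {\<phi>. PH L \<phi>} \<subseteq> carrier (Homeo_lt K)" using to_K_in_Homeo by blast
qed

lemma to_K_comp:
  assumes "PH L \<phi>" "PH L \<psi>" shows "to_K \<phi> \<otimes>\<^bsub>Homeo_lt K\<^esub> to_K \<psi> = to_K (\<phi> \<circ> \<psi>)"
proof -
  have b: "to_K \<phi> \<in> Bij K" "to_K \<psi> \<in> Bij K" using to_K_in_Homeo assms by (auto simp: Homeo_lt_def)
  have p: "\<psi> permutes L" using assms(2) by (simp add: PH_def)
  have "compose K (to_K \<phi>) (to_K \<psi>) = to_K (\<phi> \<circ> \<psi>)"
  proof
    fix z show "compose K (to_K \<phi>) (to_K \<psi>) z = to_K (\<phi> \<circ> \<psi>) z"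
      using p by (cases "z \<in> K") (simp_all add: compose_def to_K_def cis_L ang_K ang_L permutes_in_image)
  qed
  then show ?thesis using b by (simp add: Homeo_lt_def BijGroup_def)
qed

lemma to_K_one: "\<one>\<^bsub>Homeo_lt K\<^esub> = to_K id"
  by (rule ext) (simp add: Homeo_lt_def BijGroup_def to_K_def cis_ang_K restrict_def)

lemma group_Homeo: "group (Homeo_lt K)"
proof (rule groupI)
  fix x y z assume "x \<in> carrier (Homeo_lt K)" "y \<in> carrier (Homeo_lt K)" "z \<in> carrier (Homeo_lt K)"
  then obtain a b c where "PH L a" "PH L b" "PH L c" "x = to_K a" "y = to_K b" "z = to_K c"
    unfolding carrier_Homeo by blast
  then show "x \<otimes>\<^bsub>Homeo_lt K\<^esub> y \<otimes>\<^bsub>Homeo_lt K\<^esub> z = x \<otimes>\<^bsub>Homeo_lt K\<^esub> (y \<otimes>\<^bsub>Homeo_lt K\<^esub> z)"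
    by (simp add: to_K_comp PH_comp comp_assoc)
next
  fix x y assume "x \<in> carrier (Homeo_lt K)" "y \<in> carrier (Homeo_lt K)"
  then obtain a b where "PH L a" "PH L b" "x = to_K a" "y = to_K b" unfolding carrier_Homeo by blast
  then show "x \<otimes>\<^bsub>Homeo_lt K\<^esub> y \<in> carrier (Homeo_lt K)" by (simp add: to_K_comp to_K_in_Homeo PH_comp)
next
  show "\<one>\<^bsub>Homeo_lt K\<^esub> \<in> carrier (Homeo_lt K)" by (simp add: to_K_one to_K_in_Homeo PH_id)
next
  fix x assume "x \<in> carrier (Homeo_lt K)"
  then obtain a where a: "PH L a" "x = to_K a" unfolding carrier_Homeo by blast
  then show "\<one>\<^bsub>Homeo_lt K\<^esub> \<otimes>\<^bsub>Homeo_lt K\<^esub> x = x" by (simp add: to_K_one to_K_comp PH_id)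
  have "finv a \<circ> a = id" using a(1) permutes_inv_o(2) unfolding PH_def by blast
  then show "\<exists>y\<in>carrier (Homeo_lt K). y \<otimes>\<^bsub>Homeo_lt K\<^esub> x = \<one>\<^bsub>Homeo_lt K\<^esub>"
    using a PH_inv[of L a] by (intro bexI[of _ "to_K (finv a)"]) (simp_all add: to_K_comp to_K_in_Homeo to_K_one)
qed

lemma to_K_inv:
  assumes "PH L \<phi>" shows "inv\<^bsub>Homeo_lt K\<^esub> (to_K \<phi>) = to_K (finv \<phi>)"
proof (rule group.inv_equality[OF group_Homeo])
  have i: "PH L (finv \<phi>)" using PH_inv assms by simp
  have "finv \<phi> \<circ> \<phi> = id" using assms permutes_inv_o(2) unfolding PH_def by blast
  then show "to_K (finv \<phi>) \<otimes>\<^bsub>Homeo_lt K\<^esub> to_K \<phi> = \<one>\<^bsub>Homeo_lt K\<^esub>" using i assms by (simp add: to_K_comp to_K_one)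
  show "to_K \<phi> \<in> carrier (Homeo_lt K)" "to_K (finv \<phi>) \<in> carrier (Homeo_lt K)" using to_K_in_Homeo assms i by auto
qed

lemma to_K_pow: "PH L \<phi> \<Longrightarrow> to_K \<phi> [^]\<^bsub>Homeo_lt K\<^esub> (n::nat) = to_K (\<phi> ^^ n)"
proof (induction n)
  case 0 then show ?case by (simp add: to_K_one id_def nat_pow_def)
next
  case (Suc n)
  interpret group "Homeo_lt K" by (rule group_Homeo)
  have "to_K \<phi> [^]\<^bsub>Homeo_lt K\<^esub> Suc n = to_K (\<phi> ^^ n) \<otimes>\<^bsub>Homeo_lt K\<^esub> to_K \<phi>" using Suc by (simp add: nat_pow_Suc)
  then show ?case using Suc.prems by (simp only: to_K_comp PH_pow funpow_Suc_right)
qed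

end

section \<open>Discontinuities\<close>

lemma circle_angle: assumes "z \<in> circle" obtains t where "b - 2 * pi < t" "t \<le> b" "z = cis t"
proof -
  have "b - 2 * pi < ang (b - pi) z" "ang (b - pi) z \<le> b"
    using mpi_less_Arg[of "z * cis (- (b - pi))"] Arg_le_pi[of "z * cis (- (b - pi))"] by (auto simp: ang_def)
  then show ?thesis using that cis_ang[OF assms, of "b - pi"] by metis
qed

lemma arc_complement:
  assumes "a < b" "b < a + 2 * pi" shows "cis ` {a<..<b} = circle - cis ` {b..a + 2 * pi}"
proof
  show "cis ` {a<..<b} \<subseteq> circle - cis ` {b..a + 2 * pi}"
  proof
    fix z assume "z \<in> cis ` {a<..<b}"
    then obtain t where t: "z = cis t" "a < t" "t < b" by auto
    have "z \<noteq> cis s" if "s \<in> {b..a + 2 * pi}" for s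
    proof
      assume "z = cis s"
      then have "t = s" using cis_inj[of t s "a + 2 * pi"] t that assms by auto
      then show False using t that by auto
    qed
    moreover have "z \<in> circle" using t by simp
    ultimately show "z \<in> circle - cis ` {b..a + 2 * pi}" by blast
  qed
  show "circle - cis ` {b..a + 2 * pi} \<subseteq> cis ` {a<..<b}"
  proof
    fix z assume z: "z \<in> circle - cis ` {b..a + 2 * pi}"
    obtain t where t: "a + 2 * pi - 2 * pi < t" "t \<le> a + 2 * pi" "z = cis t" using circle_angle z by blast
    then have "\<not> b \<le> t" using z by auto
    then show "z \<in> cis ` {a<..<b}" using t by auto
  qed
qed

lemma closed_cis_Icc: "closed (cis ` {a..b})"
  by (intro compact_imp_closed compact_continuous_image continuous_intros) simp

lemma arc_ends_notin:
  assumes "a < b" "b < a + 2 * pi" shows "cis a \<notin> cis ` {a<..<b}" "cis b \<notin> cis ` {a<..<b}"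
proof -
  have "cis a = cis (a + 2 * pi)" by simp
  then show "cis a \<notin> cis ` {a<..<b}" "cis b \<notin> cis ` {a<..<b}"
    unfolding arc_complement[OF assms] using assms by (auto intro: image_eqI[of _ _ "a + 2 * pi"])
qed

lemma cis_Icc_eq: "a < b \<Longrightarrow> cis ` {a..b} = cis ` {a<..<b} \<union> {cis a, cis b}"
proof -
  assume "a < b"
  then have "{a..b} = {a<..<b} \<union> {a, b}" by auto
  then show ?thesis by (simp add: image_Un)
qed

lemma ends_in_closure_arc: assumes "a < b" shows "cis ` {a..b} \<subseteq> closure (cis ` {a<..<b})"
proof -
  have "cis ` closure {a<..<b} \<subseteq> closure (cis ` {a<..<b})"
    by (rule image_closure_subset) (auto intro: continuous_intros closure_subset[THEN subsetD])
  then show ?thesis using assms by simp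
qed

lemma circle_endpoints_arc:
  assumes "a < b" "b < a + 2 * pi" shows "circle_endpoints (cis ` {a<..<b}) = {cis a, cis b}"
proof -
  let ?C = "cis ` {a<..<b}"
  have "?C = circle \<inter> (- cis ` {b..a + 2 * pi})" using arc_complement[OF assms] by auto
  then have "openin (top_of_set circle) ?C" using closed_cis_Icc openin_open by (metis open_Compl)
  then have "top_of_set circle interior_of ?C = ?C" by (rule interior_of_openin)
  moreover have "top_of_set circle closure_of ?C = cis ` {a..b}"
  proof -
    have "closure ?C \<subseteq> cis ` {a..b}" by (rule closure_minimal) (auto simp: closed_cis_Icc)
    then have "closure ?C = cis ` {a..b}" using ends_in_closure_arc[OF assms(1)] by blast
    moreover have "circle \<inter> ?C = ?C" "circle \<inter> cis ` {a..b} = cis ` {a..b}" by auto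
    ultimately show ?thesis by (simp add: closure_of_subtopology)
  qed
  ultimately have "circle_endpoints ?C = cis ` {a..b} - ?C" by (simp add: circle_endpoints_def frontier_of_def)
  then show ?thesis using cis_Icc_eq[OF assms(1)] arc_ends_notin[OF assms] by auto
qed

text \<open>A compact set of angles shorter than one turn. Its unbounded gap becomes bounded once the first
  angle is repeated one turn later.\<close>
locale arc_set =
  fixes L :: "real set"
  assumes compact_L: "compact L" and ne: "L \<noteq> {}" and Inf_less: "Inf L < Sup L" and Sup_less: "Sup L < Inf L + 2 * pi"
begin

definition turn :: "real set" where "turn = insert (Inf L + 2 * pi) L"

lemmas Inf_Sup = compact_Inf_Sup[OF compact_L ne]

lemma consec_turn: "consec turn a b \<longleftrightarrow> consec L a b \<or> (a = Sup L \<and> b = Inf L + 2 * pi)"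
proof
  assume c: "consec turn a b"
  show "consec L a b \<or> (a = Sup L \<and> b = Inf L + 2 * pi)"
  proof (cases "b = Inf L + 2 * pi")
    case True
    then have "a \<in> L" using consecD(1,3)[OF c] by (auto simp: turn_def)
    moreover have "Sup L \<le> a" using consecD(4)[OF c, of "Sup L"] Inf_Sup(2) True Sup_less by (auto simp: turn_def)
    ultimately show ?thesis using True Inf_Sup(4)[of a] by simp
  next
    case False
    then have b: "b \<in> L" using consecD(2)[OF c] by (auto simp: turn_def)
    then have "a < Inf L + 2 * pi" using consecD(3)[OF c] Inf_Sup(4)[OF b] Sup_less by linarith
    then have "a \<in> L" using consecD(1)[OF c] by (auto simp: turn_def)
    then show ?thesis using b c unfolding consec_def turn_def by auto
  qed
next
  assume "consec L a b \<or> (a = Sup L \<and> b = Inf L + 2 * pi)"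
  then show "consec turn a b"
  proof
    assume c: "consec L a b"
    then have "b < Inf L + 2 * pi" using Inf_Sup(4)[OF consecD(2)[OF c]] Sup_less by linarith
    then show ?thesis using c unfolding consec_def turn_def by auto
  next
    assume ab: "a = Sup L \<and> b = Inf L + 2 * pi"
    have "x \<le> Sup L" if "x \<in> L" for x using Inf_Sup(4) that .
    then show ?thesis using ab Inf_Sup(2) Sup_less unfolding consec_def turn_def by force
  qed
qed

lemma consec_turn_bounds:
  assumes "consec turn a b" shows "Inf L \<le> a" "a < b" "b \<le> Inf L + 2 * pi" "b < a + 2 * pi" "a \<in> L" "cis b \<in> cis ` L"
proof -
  have *: "Inf L \<le> a \<and> a < b \<and> b \<le> Inf L + 2 * pi \<and> b < a + 2 * pi \<and> a \<in> L \<and> cis b \<in> cis ` L"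
    using assms unfolding consec_turn
  proof
    assume c: "consec L a b"
    note d = consecD[OF c]
    show ?thesis using d(1-3) Inf_Sup(3)[OF d(1)] Inf_Sup(4)[OF d(2)] Sup_less by auto
  next
    assume "a = Sup L \<and> b = Inf L + 2 * pi"
    then show ?thesis using Inf_Sup(1,2) Inf_Sup(3)[of "Sup L"] Sup_less Inf_less by auto
  qed
  then show "Inf L \<le> a" "a < b" "b \<le> Inf L + 2 * pi" "b < a + 2 * pi" "a \<in> L" "cis b \<in> cis ` L" by auto
qed

lemma cis_turn_cases:
  assumes "cis s = cis t" "s \<in> {Inf L..Inf L + 2 * pi}" "t \<in> {Inf L..Inf L + 2 * pi}"
  shows "s = t \<or> (s = Inf L \<and> t = Inf L + 2 * pi) \<or> (s = Inf L + 2 * pi \<and> t = Inf L)"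
proof (cases "s = Inf L")
  case True
  then have "cis (Inf L + 2 * pi) = cis t" using assms(1) by simp
  then have "t = Inf L \<or> t = Inf L + 2 * pi"
    using cis_inj[of "Inf L + 2 * pi" t "Inf L + 2 * pi"] assms(3) by (cases "t = Inf L") auto
  then show ?thesis using True by auto
next
  case s: False
  show ?thesis
  proof (cases "t = Inf L")
    case True
    then have "cis s = cis (Inf L + 2 * pi)" using assms(1) by simp
    then have "s = Inf L + 2 * pi" using cis_inj[of s "Inf L + 2 * pi" "Inf L + 2 * pi"] assms(2) s by auto
    then show ?thesis using True by auto
  next
    case False
    then show ?thesis using cis_inj[of s t "Inf L + 2 * pi"] assms s by auto
  qed
qed

lemma gap_arc_avoids: assumes "consec turn a b" shows "cis ` {a<..<b} \<inter> cis ` L = {}"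
proof (rule ccontr)
  assume "cis ` {a<..<b} \<inter> cis ` L \<noteq> {}"
  then obtain t s where t: "a < t" "t < b" "s \<in> L" "cis t = cis s" by auto
  note bd = consec_turn_bounds[OF assms]
  have "s \<in> {Inf L..Inf L + 2 * pi}" using Inf_Sup(3,4)[OF t(3)] Sup_less by auto
  then have "t = s" using cis_turn_cases[OF t(4)] t bd by auto
  then have "t \<in> turn" using t by (simp add: turn_def)
  then show False using consecD(4)[OF assms] t by force
qed

end

context circle_cantor
begin

lemma L_arc_set: "arc_set L"
proof
  have I: "Inf L \<in> L" "Sup L \<in> L" using cantor_Inf_Sup(1,2)[OF L_cantor L_cantor] by auto
  show "Sup L < Inf L + 2 * pi" using L_range[OF I(1)] L_range[OF I(2)] by linarith
qed (use cantor_Inf_less_Sup[OF L_cantor] in auto)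

end

sublocale circle_cantor \<subseteq> arc: arc_set L
  by (rule L_arc_set)

context circle_cantor
begin

lemma arc_in_complement: assumes "consec arc.turn a b" shows "cis ` {a<..<b} \<subseteq> circle - K"
  using arc.gap_arc_avoids[OF assms] K_eq by auto

lemma component_arc:
  assumes c: "consec arc.turn a b" and x: "x \<in> cis ` {a<..<b}"
  shows "connected_component_set (circle - K) x = cis ` {a<..<b}"
proof
  note bd = arc.consec_turn_bounds[OF c]
  have ab: "a < b" "b < a + 2 * pi" using bd by auto
  have "connected (cis ` {a<..<b})" by (intro connected_continuous_image continuous_intros) simp
  then show "cis ` {a<..<b} \<subseteq> connected_component_set (circle - K) x"
    using x arc_in_complement[OF c] by (intro connected_component_maximal)
  let ?D = "connected_component_set (circle - K) x"
  have D: "?D \<subseteq> circle - K" "connected ?D" "x \<in> ?D"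
    using arc_in_complement[OF c] x by (auto simp: connected_component_subset connected_component_refl)
  have ends: "cis a \<in> K" "cis b \<in> K" using bd cis_L K_eq by auto
  have cover: "?D \<subseteq> cis ` {a..b} \<union> cis ` {b..a + 2 * pi}"
    using D(1) arc_complement[OF ab] cis_Icc_eq[OF ab(1)] by blast
  have disj: "cis ` {a..b} \<inter> cis ` {b..a + 2 * pi} \<inter> ?D = {}"
  proof (rule ccontr)
    assume "\<not> ?thesis"
    then obtain z where z: "z \<in> cis ` {a..b}" "z \<in> cis ` {b..a + 2 * pi}" "z \<in> ?D" by blast
    have "z \<notin> cis ` {a<..<b}" using z(2) unfolding arc_complement[OF ab] by blast
    then have "z = cis a \<or> z = cis b" using z(1) unfolding cis_Icc_eq[OF ab(1)] by blast
    then have "z \<in> K" using ends by auto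
    then show False using D(1) z(3) by auto
  qed
  have "x \<in> cis ` {a..b} \<inter> ?D" using x D(3) cis_Icc_eq[OF ab(1)] by blast
  then have "cis ` {b..a + 2 * pi} \<inter> ?D = {}"
    using connected_closedD[OF D(2) disj cover closed_cis_Icc closed_cis_Icc] by blast
  then show "?D \<subseteq> cis ` {a<..<b}" using D(1) arc_complement[OF ab] by blast
qed

text \<open>The arc between consecutive angles is connected, and its two end points belong to
  \<open>K\<close>, so that it cannot be enlarged.\<close>
lemma components_circle: "components (circle - K) = {cis ` {a<..<b} | a b. consec arc.turn a b}"
proof
  show "components (circle - K) \<subseteq> {cis ` {a<..<b} | a b. consec arc.turn a b}"
  proof
    fix C assume "C \<in> components (circle - K)"
    then obtain x where x: "x \<in> circle - K" "C = connected_component_set (circle - K) x" by (auto simp: components_def)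
    obtain t where t: "Inf L + 2 * pi - 2 * pi < t" "t \<le> Inf L + 2 * pi" "x = cis t" using circle_angle x(1) by blast
    have tn: "t \<notin> arc.turn" using x(1) t(3) cis_L[of t] cis_L[OF arc.Inf_Sup(1)] by (auto simp: arc.turn_def)
    then have t': "Inf L < t" "t < Inf L + 2 * pi" using t by (auto simp: arc.turn_def less_le)
    have "closed arc.turn" by (simp add: arc.turn_def)
    moreover have "Inf L \<in> arc.turn" "Inf L + 2 * pi \<in> arc.turn" using arc.Inf_Sup(1) by (auto simp: arc.turn_def)
    ultimately obtain a b where ab: "consec arc.turn a b" "a < t" "t < b" using gap_around_point[OF _ _ _ t' tn] by blast
    then have "x \<in> cis ` {a<..<b}" using t(3) by auto
    then have "C = cis ` {a<..<b}" using component_arc[OF ab(1)] x(2) by simp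
    then show "C \<in> {cis ` {a<..<b} | a b. consec arc.turn a b}" using ab(1) by blast
  qed
  show "{cis ` {a<..<b} | a b. consec arc.turn a b} \<subseteq> components (circle - K)"
  proof clarify
    fix a b assume c: "consec arc.turn a b"
    then have x: "cis ((a + b) / 2) \<in> cis ` {a<..<b}" using arc.consec_turn_bounds(2) by (intro imageI) auto
    then have "cis ((a + b) / 2) \<in> circle - K" using arc_in_complement[OF c] by blast
    then show "cis ` {a<..<b} \<in> components (circle - K)"
      using component_arc[OF c x] unfolding components_def by blast
  qed
qed

lemma cadj_iff_component:
  assumes xy: "x \<in> L" "y \<in> L"
  shows "cadj L x y \<longleftrightarrow> (\<exists>J\<in>components (circle - K). {cis x, cis y} = circle_endpoints J)"
proof -
  have "(\<exists>J\<in>components (circle - K). {cis x, cis y} = circle_endpoints J) \<longleftrightarrow>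
      (\<exists>a b. consec arc.turn a b \<and> {cis x, cis y} = circle_endpoints (cis ` {a<..<b}))"
    unfolding components_circle by blast
  also have "\<dots> \<longleftrightarrow> (\<exists>a b. consec arc.turn a b \<and> {cis x, cis y} = {cis a, cis b})"
    using circle_endpoints_arc arc.consec_turn_bounds by (metis (no_types, lifting))
  also have "\<dots> \<longleftrightarrow> cadj L x y"
  proof
    assume "\<exists>a b. consec arc.turn a b \<and> {cis x, cis y} = {cis a, cis b}"
    then obtain a b where ab: "consec arc.turn a b" "{cis x, cis y} = {cis a, cis b}" by blast
    define b' where "b' = (if b = Inf L + 2 * pi then Inf L else b)"
    have b': "b' \<in> L" "cis b' = cis b"
      using ab(1) arc.Inf_Sup(1) arc.Sup_less arc.Inf_Sup(4) unfolding arc.consec_turn b'_def by (auto dest: consecD(2))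
    have aL: "a \<in> L" using arc.consec_turn_bounds(5)[OF ab(1)] .
    have "ang m ` {cis x, cis y} = ang m ` {cis a, cis b'}" using ab(2) b'(2) by simp
    then have "{x, y} = {a, b'}" using ang_L xy aL b'(1) by simp
    moreover have "cadj L a b'"
      using ab(1) arc.Inf_Sup(4) arc.Sup_less unfolding arc.consec_turn cadj_def b'_def by (force dest: consecD(2))
    ultimately show "cadj L x y" using cadj_sym by (auto simp: doubleton_eq_iff)
  next
    assume "cadj L x y"
    then consider "consec L x y" | "consec L y x" | "x = Inf L" "y = Sup L" | "x = Sup L" "y = Inf L"
      unfolding cadj_def by blast
    then show "\<exists>a b. consec arc.turn a b \<and> {cis x, cis y} = {cis a, cis b}"
    proof cases
      case 1 then show ?thesis unfolding arc.consec_turn by blast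
    next
      case 2 then show ?thesis unfolding arc.consec_turn by blast
    next
      case 3 then show ?thesis unfolding arc.consec_turn
        by (intro exI[of _ "Sup L"] exI[of _ "Inf L + 2 * pi"]) auto
    next
      case 4 then show ?thesis unfolding arc.consec_turn
        by (intro exI[of _ "Sup L"] exI[of _ "Inf L + 2 * pi"]) auto
    qed
  qed
  finally show ?thesis by simp
qed

definition disc :: "(real \<Rightarrow> real) \<Rightarrow> real set"
  where "disc \<phi> = {a. \<exists>b. cadj L a b \<and> \<not> cadj L (\<phi> a) (\<phi> b)}"

lemma Disc_eq:
  assumes \<phi>: "PH L \<phi>" shows "Disc K (to_K \<phi>) = cis ` disc \<phi>"
proof -
  have p: "\<phi> permutes L" using \<phi> by (simp add: PH_def)
  have tk: "to_K \<phi> (cis t) = cis (\<phi> t)" if "t \<in> L" for t using that by (simp add: to_K_def cis_L ang_L)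
  have \<phi>L: "\<phi> t \<in> L" if "t \<in> L" for t using that p by (simp add: permutes_in_image)
  have eps: "\<exists>x y. x \<in> L \<and> y \<in> L \<and> circle_endpoints I = {cis x, cis y}" if I: "I \<in> components (circle - K)" for I
  proof -
    obtain a b where ab: "consec arc.turn a b" "I = cis ` {a<..<b}" using I components_circle by auto
    obtain y where "y \<in> L" "cis b = cis y" using arc.consec_turn_bounds(6)[OF ab(1)] by auto
    moreover have "circle_endpoints I = {cis a, cis b}"
      unfolding ab(2) using arc.consec_turn_bounds[OF ab(1)] by (intro circle_endpoints_arc) auto
    ultimately show ?thesis using arc.consec_turn_bounds(5)[OF ab(1)] by (intro exI[of _ a] exI[of _ y]) simp
  qed
  show ?thesis
  proof
    show "Disc K (to_K \<phi>) \<subseteq> cis ` disc \<phi>"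
    proof
      fix z assume "z \<in> Disc K (to_K \<phi>)"
      then obtain I where I: "I \<in> components (circle - K)" "z \<in> circle_endpoints I"
        "\<not> (\<exists>J \<in> components (circle - K). to_K \<phi> ` circle_endpoints I = circle_endpoints J)" by (auto simp: Disc_def)
      obtain x y where xy: "x \<in> L" "y \<in> L" "circle_endpoints I = {cis x, cis y}" using eps[OF I(1)] by blast
      have "cadj L x y" using cadj_iff_component[OF xy(1,2)] I(1) xy(3) by metis
      moreover have "\<not> cadj L (\<phi> x) (\<phi> y)"
        using cadj_iff_component[OF \<phi>L[OF xy(1)] \<phi>L[OF xy(2)]] I(3) xy tk by simp
      ultimately have "x \<in> disc \<phi>" "y \<in> disc \<phi>" using cadj_sym unfolding disc_def by blast+
      then show "z \<in> cis ` disc \<phi>" using I(2) xy(3) by auto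
    qed
    show "cis ` disc \<phi> \<subseteq> Disc K (to_K \<phi>)"
    proof
      fix z assume "z \<in> cis ` disc \<phi>"
      then obtain x y where xy: "z = cis x" "cadj L x y" "\<not> cadj L (\<phi> x) (\<phi> y)" by (auto simp: disc_def)
      have L2: "x \<in> L" "y \<in> L" using cadj_in[OF L_cantor xy(2)] by auto
      obtain I where I: "I \<in> components (circle - K)" "{cis x, cis y} = circle_endpoints I"
        using cadj_iff_component[OF L2] xy(2) by blast
      have "to_K \<phi> ` circle_endpoints I = {cis (\<phi> x), cis (\<phi> y)}" using I(2)[symmetric] tk L2 by simp
      then have "\<not> (\<exists>J \<in> components (circle - K). to_K \<phi> ` circle_endpoints I = circle_endpoints J)"
        using cadj_iff_component[OF \<phi>L[OF L2(1)] \<phi>L[OF L2(2)]] xy(3) by simp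
      moreover have "z \<in> circle_endpoints I" using I(2) xy(1) by blast
      moreover have "z \<in> K" using xy(1) cis_L[OF L2(1)] by simp
      ultimately show "z \<in> Disc K (to_K \<phi>)" using I(1) unfolding Disc_def by blast
    qed
  qed
qed

lemma disc_sub_L: "disc \<phi> \<subseteq> L"
  using cadj_in[OF L_cantor] unfolding disc_def by blast

lemma num_disc_eq: assumes "PH L \<phi>" shows "num_disc K (to_K \<phi>) = card (disc \<phi>)"
proof -
  have "inj_on cis (disc \<phi>)" by (rule inj_onI) (metis ang_L disc_sub_L subsetD)
  then show ?thesis unfolding num_disc_def Disc_eq[OF assms] by (rule card_image)
qed

lemma disc_finite: "PH L \<phi> \<Longrightarrow> finite (disc \<phi>)"
  unfolding disc_def by (rule PH_finite_disc[OF L_cantor])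

text \<open>A point that is broken by \<open>\<phi> \<circ> \<psi>\<close> is broken by
  \<open>\<psi>\<close>, or its image is broken by \<open>\<phi>\<close>.\<close>
lemma disc_comp: "PH L \<phi> \<Longrightarrow> PH L \<psi> \<Longrightarrow> card (disc (\<phi> \<circ> \<psi>)) \<le> card (disc \<phi>) + card (disc \<psi>)"
proof -
  assume a: "PH L \<phi>" "PH L \<psi>"
  have inj: "inj \<psi>" using PH_bij[OF a(2)] by (simp add: bij_is_inj)
  have "disc (\<phi> \<circ> \<psi>) \<subseteq> \<psi> -` disc \<phi> \<union> disc \<psi>" unfolding disc_def by auto
  moreover have f: "finite (\<psi> -` disc \<phi>)" using disc_finite[OF a(1)] inj by (rule finite_vimageI)
  ultimately have "card (disc (\<phi> \<circ> \<psi>)) \<le> card (\<psi> -` disc \<phi> \<union> disc \<psi>)"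
    using disc_finite[OF a(2)] by (intro card_mono) auto
  also have "\<dots> \<le> card (\<psi> -` disc \<phi>) + card (disc \<psi>)" by (rule card_Un_le)
  also have "card (\<psi> -` disc \<phi>) \<le> card (disc \<phi>)"
    using disc_finite[OF a(1)] inj by (intro card_inj_on_le[of \<psi>]) (auto intro: inj_on_subset)
  finally show ?thesis by simp
qed

lemma disc_inv: "PH L \<phi> \<Longrightarrow> card (disc (finv \<phi>)) \<le> card (disc \<phi>)"
proof -
  assume \<phi>: "PH L \<phi>"
  have i: "PH L (finv \<phi>)" using PH_inv[OF _ \<phi>] by simp
  have p: "\<phi> permutes L" using \<phi> by (simp add: PH_def)
  have inv1: "\<And>x. finv \<phi> (\<phi> x) = x" "\<And>x. \<phi> (finv \<phi> x) = x" using p by (auto simp: permutes_inverses)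
  have "disc (finv \<phi>) \<subseteq> \<phi> ` disc \<phi>"
  proof
    fix y assume "y \<in> disc (finv \<phi>)"
    then obtain z where z: "cadj L y z" "\<not> cadj L (finv \<phi> y) (finv \<phi> z)" by (auto simp: disc_def)
    obtain c where c: "cadj L (finv \<phi> y) c" using PH_endpoint[OF L_cantor i z(1)] by blast
    have "\<not> cadj L (\<phi> (finv \<phi> y)) (\<phi> c)"
    proof
      assume "cadj L (\<phi> (finv \<phi> y)) (\<phi> c)"
      then have "\<phi> c = z" using cadj_unique[OF L_cantor _ z(1)] inv1 by simp
      then show False using c z(2) inv1 by auto
    qed
    then have "finv \<phi> y \<in> disc \<phi>" using c unfolding disc_def by blast
    then show "y \<in> \<phi> ` disc \<phi>" using inv1(2) by (metis imageI)
  qed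
  then have "card (disc (finv \<phi>)) \<le> card (\<phi> ` disc \<phi>)" using disc_finite[OF \<phi>] by (intro card_mono) auto
  also have "\<dots> \<le> card (disc \<phi>)" by (rule card_image_le[OF disc_finite[OF \<phi>]])
  finally show ?thesis .
qed

end

section \<open>Distortion\<close>

abbreviation gprod :: "('a, 'b) monoid_scheme \<Rightarrow> 'a list \<Rightarrow> 'a"
  where "gprod G ws \<equiv> foldr (\<lambda>x y. x \<otimes>\<^bsub>G\<^esub> y) ws \<one>\<^bsub>G\<^esub>"

context group
begin

lemma gprod_closed: "set ws \<subseteq> carrier G \<Longrightarrow> gprod G ws \<in> carrier G"
  by (induction ws) auto

lemma gprod_append: "set xs \<subseteq> carrier G \<Longrightarrow> set ys \<subseteq> carrier G \<Longrightarrow> gprod G (xs @ ys) = gprod G xs \<otimes> gprod G ys"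
  by (induction xs) (auto simp: gprod_closed m_assoc)

lemma generate_imp_word:
  assumes S: "S \<subseteq> carrier G" and g: "g \<in> generate G S"
  shows "\<exists>ws. set ws \<subseteq> S \<union> m_inv G ` S \<and> gprod G ws = g"
  using g
proof induction
  case one then show ?case by (intro exI[of _ "[]"]) simp
next
  case (incl h) then show ?case using S by (intro exI[of _ "[h]"]) auto
next
  case (inv h) then show ?case using S by (intro exI[of _ "[inv h]"]) auto
next
  case (eng h1 h2)
  then obtain xs ys where w: "set xs \<subseteq> S \<union> m_inv G ` S" "gprod G xs = h1" "set ys \<subseteq> S \<union> m_inv G ` S" "gprod G ys = h2" by blast
  have "S \<union> m_inv G ` S \<subseteq> carrier G" using S by auto
  then have "gprod G (xs @ ys) = h1 \<otimes> h2" using gprod_append w by blast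
  then show ?case using w by (intro exI[of _ "xs @ ys"]) auto
qed

lemma word_imp_generate: "set ws \<subseteq> S \<union> m_inv G ` S \<Longrightarrow> gprod G ws \<in> generate G S"
proof (induction ws)
  case Nil then show ?case by (simp add: generate.one)
next
  case (Cons w ws)
  then have "w \<in> generate G S" by (auto intro: generate.incl generate.inv)
  then show ?case using Cons by (auto intro: generate.eng)
qed

end

lemma word_length_le:
  assumes "set ws \<subseteq> S \<union> m_inv G ` S" "gprod G ws = g" shows "word_length G S g \<le> length ws"
  unfolding word_length_def by (rule Least_le) (use assms in blast)

lemma word_length_attained:
  assumes "set ws \<subseteq> S \<union> m_inv G ` S" "gprod G ws = g"
  shows "\<exists>ws. length ws = word_length G S g \<and> set ws \<subseteq> S \<union> m_inv G ` S \<and> gprod G ws = g"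
proof -
  let ?P = "\<lambda>n. \<exists>ws. length ws = n \<and> set ws \<subseteq> S \<union> m_inv G ` S \<and> gprod G ws = g"
  have "?P (length ws)" using assms by blast
  then show ?thesis unfolding word_length_def by (rule LeastI)
qed

context circle_cantor
begin

lemma num_disc_word:
  assumes "set ws \<subseteq> carrier (Homeo_lt K)" "\<And>w. w \<in> set ws \<Longrightarrow> num_disc K w \<le> C"
  shows "num_disc K (gprod (Homeo_lt K) ws) \<le> C * length ws"
  using assms
proof (induction ws)
  case Nil
  have "disc id = {}" by (simp add: disc_def)
  then show ?case using num_disc_eq[OF PH_id] by (simp add: to_K_one)
next
  case (Cons w ws)
  interpret group "Homeo_lt K" by (rule group_Homeo)
  obtain \<phi> where \<phi>: "PH L \<phi>" "w = to_K \<phi>" using Cons.prems(1) carrier_Homeo by auto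
  have "gprod (Homeo_lt K) ws \<in> carrier (Homeo_lt K)" using gprod_closed Cons.prems(1) by simp
  then obtain \<psi> where \<psi>: "PH L \<psi>" "gprod (Homeo_lt K) ws = to_K \<psi>" using carrier_Homeo by auto
  have "num_disc K (gprod (Homeo_lt K) (w # ws)) = card (disc (\<phi> \<circ> \<psi>))"
    using \<phi> \<psi> num_disc_eq[OF PH_comp[OF \<psi>(1) \<phi>(1)]] by (simp add: to_K_comp)
  also have "\<dots> \<le> card (disc \<phi>) + card (disc \<psi>)" by (rule disc_comp[OF \<phi>(1) \<psi>(1)])
  also have "card (disc \<phi>) \<le> C" using Cons.prems(2)[of w] \<phi> num_disc_eq by simp
  also have "card (disc \<psi>) \<le> C * length ws" using Cons \<psi> num_disc_eq by simp
  finally show ?case by simp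
qed

lemma num_disc_inv: "g \<in> carrier (Homeo_lt K) \<Longrightarrow> num_disc K (inv\<^bsub>Homeo_lt K\<^esub> g) \<le> num_disc K g"
proof -
  assume "g \<in> carrier (Homeo_lt K)"
  then obtain \<phi> where \<phi>: "PH L \<phi>" "g = to_K \<phi>" using carrier_Homeo by auto
  then show ?thesis using disc_inv num_disc_eq PH_inv[OF _ \<phi>(1)] by (simp add: to_K_inv)
qed

text \<open>The number of discontinuities is subadditive, hence bounded by a multiple of the word
  length.\<close>
lemma distorted_imp_sublinear:
  assumes "distorted (Homeo_lt K) f"
  shows "(\<lambda>n. real (num_disc K (f [^]\<^bsub>Homeo_lt K\<^esub> (n::nat))) / real n) \<longlonglongrightarrow> 0"
proof -
  interpret G: group "Homeo_lt K" by (rule group_Homeo)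
  let ?G = "Homeo_lt K"
  obtain H S where H: "subgroup H ?G" and f: "f \<in> H" and S: "finite S" "S \<subseteq> H" "generate (?G\<lparr>carrier := H\<rparr>) S = H"
    and lim: "(\<lambda>n::nat. real (word_length (?G\<lparr>carrier := H\<rparr>) S (f [^]\<^bsub>?G\<lparr>carrier := H\<rparr>\<^esub> n)) / real n) \<longlonglongrightarrow> 0"
    using assms unfolding distorted_def distorted_fg_def by auto
  let ?H = "?G\<lparr>carrier := H\<rparr>"
  interpret H: group ?H by (rule G.subgroup_imp_group[OF H])
  have HG: "H \<subseteq> carrier ?G" using subgroup.subset[OF H] .
  define C where "C = Max (insert 0 (num_disc K ` S))"
  have C: "num_disc K s \<le> C" if "s \<in> S \<union> m_inv ?H ` S" for s
  proof -
    have *: "num_disc K s \<le> C" if "s \<in> S" for s unfolding C_def using S(1) that by (intro Max_ge) auto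
    have "num_disc K (inv\<^bsub>?H\<^esub> s) \<le> C" if "s \<in> S" for s
    proof -
      have "inv\<^bsub>?H\<^esub> s = inv\<^bsub>?G\<^esub> s" using G.m_inv_consistent[OF H] that S(2) by blast
      then show ?thesis using num_disc_inv[of s] *[OF that] that S(2) HG by auto
    qed
    then show ?thesis using * that by auto
  qed
  have bound: "num_disc K (f [^]\<^bsub>?G\<^esub> n) \<le> C * word_length ?H S (f [^]\<^bsub>?H\<^esub> n)" for n :: nat
  proof -
    have e: "f [^]\<^bsub>?H\<^esub> n = f [^]\<^bsub>?G\<^esub> n" using G.nat_pow_consistent by metis
    have "f [^]\<^bsub>?H\<^esub> n \<in> carrier ?H" using f H.nat_pow_closed[of f n] by simp
    then have "f [^]\<^bsub>?H\<^esub> n \<in> generate ?H S" using S(3) by simp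
    from H.generate_imp_word[OF _ this] obtain ws where "set ws \<subseteq> S \<union> m_inv ?H ` S" "gprod ?H ws = f [^]\<^bsub>?H\<^esub> n"
      using S(2) by auto
    from word_length_attained[OF this] obtain ws where
      ws: "length ws = word_length ?H S (f [^]\<^bsub>?H\<^esub> n)" "set ws \<subseteq> S \<union> m_inv ?H ` S" "gprod ?H ws = f [^]\<^bsub>?H\<^esub> n" by blast
    have "inv\<^bsub>?H\<^esub> s \<in> H" if "s \<in> S" for s using H.inv_closed[of s] that S(2) by auto
    then have "set ws \<subseteq> carrier ?G" using ws(2) S(2) HG by blast
    moreover have "gprod ?G ws = f [^]\<^bsub>?G\<^esub> n" using ws(3) e by simp
    moreover have "num_disc K w \<le> C" if "w \<in> set ws" for w using C ws(2) that by blast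
    ultimately show ?thesis using num_disc_word[of ws C] ws(1) by simp
  qed
  show ?thesis
  proof (rule tendsto_sandwich[OF always_eventually always_eventually tendsto_const])
    show "\<forall>n. 0 \<le> real (num_disc K (f [^]\<^bsub>?G\<^esub> (n::nat))) / real n" by simp
    show "\<forall>n. real (num_disc K (f [^]\<^bsub>?G\<^esub> (n::nat))) / real n \<le> real C * (real (word_length ?H S (f [^]\<^bsub>?H\<^esub> n)) / real n)"
    proof
      fix n :: nat
      have "real (num_disc K (f [^]\<^bsub>?G\<^esub> n)) \<le> real C * real (word_length ?H S (f [^]\<^bsub>?H\<^esub> n))"
        using bound[of n] by (metis of_nat_le_iff of_nat_mult)
      then show "real (num_disc K (f [^]\<^bsub>?G\<^esub> n)) / real n \<le> real C * (real (word_length ?H S (f [^]\<^bsub>?H\<^esub> n)) / real n)"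
        using divide_right_mono[of _ _ "real n"] by (metis of_nat_0_le_iff times_divide_eq_right)
    qed
    show "(\<lambda>n. real C * (real (word_length ?H S (f [^]\<^bsub>?H\<^esub> n)) / real n)) \<longlonglongrightarrow> 0"
      using tendsto_mult_right_zero[OF lim] .
  qed
qed

text \<open>Words in maps of the line translate letter by letter into words of the group.\<close>
lemma words_to_K:
  assumes S: "\<And>s. s \<in> S \<Longrightarrow> PH L s" and w: "w \<in> words S n"
  shows "\<exists>ws. length ws \<le> n \<and> set ws \<subseteq> to_K ` S \<union> m_inv (Homeo_lt K) ` to_K ` S \<and> gprod (Homeo_lt K) ws = to_K w \<and> PH L w"
proof -
  obtain vs where vs: "w = word_of vs" "set vs \<subseteq> S \<union> finv ` S" "length vs \<le> n"
    using w unfolding words_def by blast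
  have "gprod (Homeo_lt K) (map to_K vs) = to_K (word_of vs) \<and> PH L (word_of vs)"
    using vs(2)
  proof (induction vs)
    case Nil show ?case unfolding word_of_simps(1) list.map foldr.simps id_apply to_K_one id_def using PH_id[unfolded id_def] by simp
  next
    case (Cons v vs)
    then have v: "PH L v" using S PH_inv[OF L_compact(1)] by auto
    have IH: "gprod (Homeo_lt K) (map to_K vs) = to_K (word_of vs)" "PH L (word_of vs)" using Cons by auto
    have "PH L (v \<circ> word_of vs)" using PH_comp[OF IH(2) v] .
    moreover have "gprod (Homeo_lt K) (map to_K (v # vs)) = to_K v \<otimes>\<^bsub>Homeo_lt K\<^esub> gprod (Homeo_lt K) (map to_K vs)"
      by (simp only: list.map foldr.simps comp_apply)
    ultimately show ?case unfolding word_of_simps(2) using IH(1) to_K_comp[OF v IH(2)] by metis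
  qed
  moreover have "to_K v \<in> to_K ` S \<union> m_inv (Homeo_lt K) ` to_K ` S" if "v \<in> S \<union> finv ` S" for v
    using that S to_K_inv by (auto simp: image_iff)
  then have "set (map to_K vs) \<subseteq> to_K ` S \<union> m_inv (Homeo_lt K) ` to_K ` S" using vs(2) unfolding set_map by blast
  ultimately show ?thesis using vs(1,3) by (intro exI[of _ "map to_K vs"]) simp
qed

text \<open>For \<open>n\<close> between two consecutive squares, \<open>f ^ n\<close> has length at most a
  multiple of \<open>sqrt n + 1\<close> in the subgroup generated by the letters of the words.\<close>
theorem bounded_imp_distorted:
  assumes f: "f \<in> carrier (Homeo_lt K)" and B: "\<And>n::nat. num_disc K (f [^]\<^bsub>Homeo_lt K\<^esub> n) \<le> B"
  shows "distorted (Homeo_lt K) f"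
proof -
  interpret G: group "Homeo_lt K" by (rule group_Homeo)
  let ?G = "Homeo_lt K"
  obtain \<phi> where \<phi>: "PH L \<phi>" "f = to_K \<phi>" using f carrier_Homeo by auto
  have "card (disc (\<phi> ^^ n)) \<le> B" for n
    using B[of n] num_disc_eq[OF PH_pow[OF \<phi>(1)]] to_K_pow[OF \<phi>(1)] \<phi>(2) by simp
  then obtain S C where S: "finite S" "\<forall>s\<in>S. PH L s"
    "\<And>n k. k\<^sup>2 \<le> n \<Longrightarrow> n \<le> k\<^sup>2 + 2 * k \<Longrightarrow> \<phi> ^^ n \<in> words S (C * (k + 1))"
    using bounded_imp_short_powers[OF L_cantor \<phi>(1), of B] unfolding disc_def by blast
  let ?S = "to_K ` S"
  have SG: "?S \<subseteq> carrier ?G" using S(2) to_K_in_Homeo by blast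
  define H where "H = generate ?G ?S"
  have H: "subgroup H ?G" unfolding H_def by (rule G.generate_is_subgroup[OF SG])
  have SH: "?S \<subseteq> H" unfolding H_def by (auto intro: generate.incl)
  let ?H = "?G\<lparr>carrier := H\<rparr>"
  have inv_eq: "m_inv ?H ` ?S = m_inv ?G ` ?S" using G.m_inv_consistent[OF H] SH by (intro image_cong) auto
  have short: "f [^]\<^bsub>?G\<^esub> n \<in> H \<and> word_length ?H ?S (f [^]\<^bsub>?H\<^esub> n) \<le> C * (k + 1)"
    if n: "k\<^sup>2 \<le> n" "n \<le> k\<^sup>2 + 2 * k" for n k :: nat
  proof -
    obtain ws where ws: "length ws \<le> C * (k + 1)" "set ws \<subseteq> ?S \<union> m_inv ?G ` ?S" "gprod ?G ws = to_K (\<phi> ^^ n)"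
      using words_to_K[of S, OF _ S(3)[OF n]] S(2) by blast
    have e: "f [^]\<^bsub>?H\<^esub> n = f [^]\<^bsub>?G\<^esub> n" using G.nat_pow_consistent by metis
    have g: "gprod ?G ws = f [^]\<^bsub>?G\<^esub> n" using ws(3) \<phi> to_K_pow by simp
    have "word_length ?H ?S (f [^]\<^bsub>?H\<^esub> n) \<le> length ws"
      by (rule word_length_le) (use ws(2) inv_eq g e in auto)
    moreover have "f [^]\<^bsub>?G\<^esub> n \<in> H" using G.word_imp_generate[OF ws(2)] g unfolding H_def by simp
    ultimately show ?thesis using ws(1) by simp
  qed
  have fH: "f \<in> H" using short[of 1 1] to_K_pow[OF \<phi>(1), of 1] \<phi>(2) by simp
  have lim: "(\<lambda>n::nat. real (word_length ?H ?S (f [^]\<^bsub>?H\<^esub> n)) / real n) \<longlonglongrightarrow> 0"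
  proof (rule tendsto_sandwich[OF always_eventually always_eventually tendsto_const])
    show "\<forall>n. 0 \<le> real (word_length ?H ?S (f [^]\<^bsub>?H\<^esub> n)) / real n" by simp
    show "\<forall>n. real (word_length ?H ?S (f [^]\<^bsub>?H\<^esub> n)) / real n \<le> real C * (sqrt (real n) + 1) / real n"
    proof
      fix n :: nat
      obtain k where k: "k\<^sup>2 \<le> n" "n < (Suc k)\<^sup>2"
      proof -
        have "\<exists>k. k\<^sup>2 \<le> n \<and> n < (Suc k)\<^sup>2"
        proof (induction n)
          case 0 then show ?case by (intro exI[of _ 0]) simp
        next
          case (Suc n)
          then obtain k where k: "k\<^sup>2 \<le> n" "n < (Suc k)\<^sup>2" by blast
          show ?case
          proof (cases "Suc n < (Suc k)\<^sup>2")
            case True then show ?thesis using k by (intro exI[of _ k]) auto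
          next
            case False
            then have "Suc n = (Suc k)\<^sup>2" using k by simp
            then show ?thesis by (intro exI[of _ "Suc k"]) (simp add: power2_eq_square)
          qed
        qed
        then show thesis using that by blast
      qed
      have "n \<le> k\<^sup>2 + 2 * k" using k(2) by (simp add: power2_eq_square)
      from short[OF k(1) this] have "real (word_length ?H ?S (f [^]\<^bsub>?H\<^esub> n)) \<le> real (C * (k + 1))"
        using of_nat_le_iff by blast
      also have "\<dots> = real C * (real k + 1)" by (simp add: algebra_simps)
      also have "\<dots> \<le> real C * (sqrt (real n) + 1)"
      proof -
        have "(real k)\<^sup>2 \<le> real n" using k(1) by (metis of_nat_le_iff of_nat_power)
        then have "real k \<le> sqrt (real n)" by (rule real_le_rsqrt)
        then show ?thesis by (intro mult_left_mono) auto
      qed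
      finally show "real (word_length ?H ?S (f [^]\<^bsub>?H\<^esub> n)) / real n \<le> real C * (sqrt (real n) + 1) / real n"
        by (rule divide_right_mono) simp
    qed
    show "(\<lambda>n. real C * (sqrt (real n) + 1) / real n) \<longlonglongrightarrow> 0" by real_asymp
  qed
  have "generate ?H ?S = carrier ?H" using G.generate_consistent[OF SH H] by (simp add: H_def)
  then have "distorted_fg ?H f" unfolding distorted_fg_def using fH S(1) SH lim
    by (intro conjI exI[of _ ?S]) auto
  then show ?thesis unfolding distorted_def using H by blast
qed

lemma matching_map_cadj:
  assumes "PH L \<phi>" shows "matching_map (cadj L) \<phi>"
proof
  show "bij \<phi>" using PH_bij[OF assms] .
  show "b = c" if "cadj L a b" "cadj L a c" for a b c using cadj_unique[OF L_cantor that] .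
  show "finite {a. \<exists>b. cadj L a b \<and> \<not> cadj L (\<phi> a) (\<phi> b)}" by (rule PH_finite_disc[OF L_cantor assms])
qed

lemma sublinear_imp_finite_unstable:
  assumes \<phi>: "PH L \<phi>"
    and lim: "(\<lambda>n. real (num_disc K (to_K \<phi> [^]\<^bsub>Homeo_lt K\<^esub> (n::nat))) / real n) \<longlonglongrightarrow> 0"
  shows "finite (matching_map.unstable (cadj L) \<phi>)"
proof -
  interpret matching_map "cadj L" \<phi> by (rule matching_map_cadj[OF \<phi>])
  have "num_disc K (to_K \<phi> [^]\<^bsub>Homeo_lt K\<^esub> n) = card (broken n)" for n :: nat
    using num_disc_eq[OF PH_pow[OF \<phi>]] to_K_pow[OF \<phi>] by (simp add: broken_def disc_def)
  then show ?thesis using sublinear_imp_finite_unstable lim by simp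
qed

lemma finite_unstable_imp_bounded:
  assumes \<phi>: "PH L \<phi>" and fin: "finite (matching_map.unstable (cadj L) \<phi>)"
  shows "\<exists>B. \<forall>n::nat. num_disc K (to_K \<phi> [^]\<^bsub>Homeo_lt K\<^esub> n) \<le> B"
proof -
  interpret matching_map "cadj L" \<phi> by (rule matching_map_cadj[OF \<phi>])
  have "num_disc K (to_K \<phi> [^]\<^bsub>Homeo_lt K\<^esub> n) = card (broken n)" for n :: nat
    using num_disc_eq[OF PH_pow[OF \<phi>]] to_K_pow[OF \<phi>] by (simp add: broken_def disc_def)
  then show ?thesis using finite_unstable_imp_bounded[OF fin] PH_endpoint[OF L_cantor \<phi>] by simp
qed

lemma bounded_imp_sublinear:
  assumes "\<And>n::nat. d n \<le> (B::nat)" shows "(\<lambda>n. real (d n) / real n) \<longlonglongrightarrow> 0"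
proof (rule tendsto_sandwich[OF always_eventually always_eventually tendsto_const])
  show "\<forall>n. 0 \<le> real (d n) / real n" by simp
  show "\<forall>n. real (d n) / real n \<le> real B / real n" using assms by (simp add: divide_right_mono)
  show "(\<lambda>n. real B / real n) \<longlonglongrightarrow> 0" by real_asymp
qed

theorem distorted_iff_bounded:
  assumes f: "f \<in> carrier (Homeo_lt K)"
  shows "distorted (Homeo_lt K) f \<longleftrightarrow> (\<exists>B. \<forall>n::nat. num_disc K (f [^]\<^bsub>Homeo_lt K\<^esub> n) \<le> B)"
proof
  obtain \<phi> where \<phi>: "PH L \<phi>" "f = to_K \<phi>" using f carrier_Homeo by auto
  show "distorted (Homeo_lt K) f \<Longrightarrow> \<exists>B. \<forall>n::nat. num_disc K (f [^]\<^bsub>Homeo_lt K\<^esub> n) \<le> B"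
    using distorted_imp_sublinear sublinear_imp_finite_unstable[OF \<phi>(1)] finite_unstable_imp_bounded[OF \<phi>(1)] \<phi>(2) by simp
  show "\<exists>B. \<forall>n::nat. num_disc K (f [^]\<^bsub>Homeo_lt K\<^esub> n) \<le> B \<Longrightarrow> distorted (Homeo_lt K) f"
    using bounded_imp_distorted[OF f] by blast
qed

end

section \<open>Multihomeomorphisms have boundedly many discontinuities\<close>

text \<open>A disjoint union of circles becomes a metric space once the natural numbers, which index the
  circles, carry a metric.\<close>
instantiation nat :: metric_space
begin

definition dist_nat :: "nat \<Rightarrow> nat \<Rightarrow> real" where "dist_nat m n = \<bar>real m - real n\<bar>"

definition uniformity_nat :: "(nat \<times> nat) filter"
  where "uniformity_nat = (INF e\<in>{0<..}. principal {(x, y). dist x y < e})"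

instance
proof
  show "uniformity = (INF e\<in>{0<..}. principal {(x::nat, y). dist x y < e})" by (rule uniformity_nat_def)
  have dist_lt_1: "x = y" if "dist x y < 1" for x y :: nat using that by (simp add: dist_nat_def)
  have "\<forall>\<^sub>F (x', y) in uniformity. x' = x \<longrightarrow> y \<in> U" if "x \<in> U" for x and U :: "nat set"
    unfolding uniformity_nat_def
    by (rule eventually_INF1[of 1]) (use that dist_lt_1 in \<open>auto simp: eventually_principal\<close>)
  then show "open U = (\<forall>x\<in>U. \<forall>\<^sub>F (x', y) in uniformity. x' = x \<longrightarrow> y \<in> U)" for U :: "nat set"
    using open_discrete[of U] by blast
qed (auto simp: dist_nat_def)

end

text \<open>A purely topological form of being the two end points of a complementary interval of
  \<open>A\<close>; it is therefore preserved by the homeomorphisms of the surrounding space.\<close>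
definition gap_ends :: "'a::topological_space set \<Rightarrow> 'a set \<Rightarrow> 'a \<Rightarrow> 'a \<Rightarrow> bool"
  where "gap_ends X A p q \<longleftrightarrow> p \<noteq> q \<and> p \<in> A \<and> q \<in> A \<and>
    (\<exists>C. connected C \<and> C \<subseteq> X - A \<and> p \<in> closure C \<and> q \<in> closure C)"

lemma continuous_on_epsilon:
  assumes "continuous_on S f" "x \<in> S" "(e::real) > 0"
  shows "\<exists>d>0. \<forall>y\<in>S. dist y x < d \<longrightarrow> dist (f y) (f x) < e"
  using assms unfolding continuous_on_iff by blast

lemma gap_ends_sym: "gap_ends X A p q \<Longrightarrow> gap_ends X A q p"
  unfolding gap_ends_def by blast

lemma gap_ends_homeomorphism:
  assumes X: "closed X" and F: "homeomorphism X X F F'" and A: "A \<subseteq> X" "F ` A = A" and g: "gap_ends X A p q"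
  shows "gap_ends X A (F p) (F q)"
proof -
  obtain C where C: "connected C" "C \<subseteq> X - A" "p \<in> closure C" "q \<in> closure C" and pq: "p \<noteq> q" "p \<in> A" "q \<in> A"
    using g unfolding gap_ends_def by blast
  have inj: "inj_on F X" using F unfolding homeomorphism_def by (auto intro: inj_on_inverseI)
  have cont: "continuous_on X F" and im: "F ` X = X" using F unfolding homeomorphism_def by auto
  have cl: "closure C \<subseteq> X" using C(2) X by (intro closure_minimal) auto
  have "F ` closure C \<subseteq> closure (F ` C)"
    by (rule image_closure_subset[OF continuous_on_subset[OF cont cl] closed_closure closure_subset])
  then have "F p \<in> closure (F ` C)" "F q \<in> closure (F ` C)" using C by auto
  moreover have "connected (F ` C)" using C cont by (intro connected_continuous_image) (auto intro: continuous_on_subset)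
  moreover have "F ` C \<subseteq> X - A"
  proof -
    have "F ` C \<subseteq> F ` (X - A)" using C(2) by blast
    also have "F ` (X - A) = X - A" using inj_on_image_set_diff[OF inj, of X A] A im by auto
    finally show ?thesis .
  qed
  moreover have "F p \<noteq> F q" using pq A inj by (auto dest: inj_onD)
  moreover have "F p \<in> A" "F q \<in> A" using pq A by auto
  ultimately show ?thesis unfolding gap_ends_def by blast
qed

text \<open>Angles are measured from \<open>z0\<close>. A complementary connected set that has \<open>z0\<close> in its closure
  contains all angles on one side of \<open>z0\<close> up to its other limit point in \<open>M\<close>; two of them cannot lie
  on different sides, since \<open>z0\<close> is not isolated.\<close>
lemma circle_gap_end_unique:
  assumes M: "M \<subseteq> circle" and z0: "z0 \<in> M" "z0 islimpt M"
    and D: "connected D" "D \<subseteq> circle - M" "z0 \<in> closure D" and w: "w \<in> closure D" "w \<in> M" "w \<noteq> z0"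
    and D': "connected D'" "D' \<subseteq> circle - M" "z0 \<in> closure D'" and w': "w' \<in> closure D'" "w' \<in> M" "w' \<noteq> z0"
  shows "w = w'"
proof -
  \<comment> \<open>With this choice \<open>z0\<close> lies at the two ends \<open>m - pi\<close> and \<open>m + pi\<close> of the range of angles.\<close>
  define m where "m = ang 0 z0 - pi"
  have zm: "cis (m + pi) = z0" using cis_ang[of z0 0] M z0 by (auto simp: m_def)
  have rng: "m - pi < ang m z \<and> ang m z < m + pi \<and> cis (ang m z) = z" if "z \<in> circle" "z \<noteq> z0" for z
    using ang_range[of z m] cis_ang[of z m] that zm by auto
  have ca: "continuous_on (circle - {z0}) (ang m)" using continuous_ang[of m] zm by simp
  have far: "z0 \<notin> closure S" if S: "S \<subseteq> cis ` {a..b}" "m - pi < a" "b < m + pi" for S a b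
  proof
    assume "z0 \<in> closure S"
    moreover have "closure S \<subseteq> cis ` {a..b}" using S(1) closed_cis_Icc by (rule closure_minimal)
    ultimately obtain t where t: "cis (m + pi) = cis t" "a \<le> t" "t \<le> b" using zm by auto
    have "m + pi = t" by (rule cis_inj[OF t(1), of "m + pi"]) (use t S in auto)
    then show False using t S by simp
  qed
  have side: "({m - pi<..<ang m w} \<inter> ang m ` M = {}) \<or> ({ang m w<..<m + pi} \<inter> ang m ` (M - {z0}) = {})"
    if D: "connected D" "D \<subseteq> circle - M" "z0 \<in> closure D" and w: "w \<in> closure D" "w \<in> M" "w \<noteq> z0" for D w
  proof -
    let ?I = "ang m ` D" and ?r = "ang m w"
    have D0: "D \<subseteq> circle - {z0}" using D z0 by auto
    have r: "m - pi < ?r" "?r < m + pi" using rng[of w] w M by auto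
    have "connected ?I" using D(1) continuous_on_subset[OF ca D0] by (rule connected_continuous_image[rotated])
    then have ivl: "x \<in> ?I" if "a \<in> ?I" "b \<in> ?I" "a \<le> x" "x \<le> b" for a b x
      using connected_contains_Icc[of ?I a b] that by auto
    have near: "\<exists>t\<in>?I. \<bar>t - ?r\<bar> < e" if "e > 0" for e
    proof -
      have "w \<in> circle - {z0}" using w M by auto
      then obtain d where d: "d > 0" "\<forall>z\<in>circle - {z0}. dist z w < d \<longrightarrow> dist (ang m z) ?r < e"
        using ca \<open>e > 0\<close> unfolding continuous_on_iff by blast
      obtain z where "z \<in> D" "dist z w < d" using w(1) d(1) unfolding closure_approachable by blast
      then show ?thesis using d(2) D0 by (auto simp: dist_real_def)
    qed
    have avoid: "ang m z \<notin> ?I" if z: "z \<in> M" "z \<noteq> z0" for z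
    proof
      assume "ang m z \<in> ?I"
      then obtain y where y: "y \<in> D" "ang m z = ang m y" by auto
      then have "z = y" using rng[of z] rng[of y] z M D0 by (metis DiffD1 insertI1 DiffD2 subsetD)
      then show False using y z D(2) by auto
    qed
    have ends: "(\<exists>t\<in>?I. t < m - pi + e) \<or> (\<exists>t\<in>?I. m + pi - e < t)" if e: "e > 0" for e
    proof (rule ccontr)
      assume n: "\<not> ?thesis"
      have "D \<subseteq> cis ` {m - pi + e..m + pi - e}"
      proof
        fix z assume z: "z \<in> D"
        then have "m - pi + e \<le> ang m z" "ang m z \<le> m + pi - e" using n by (auto simp: not_less)
        moreover have "z \<in> circle" "z \<noteq> z0" using z D0 by auto
        then have "cis (ang m z) = z" using rng by blast
        ultimately show "z \<in> cis ` {m - pi + e..m + pi - e}" by (metis atLeastAtMost_iff imageI)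
      qed
      then show False using far[of D "m - pi + e" "m + pi - e"] e D(3) by auto
    qed
    show ?thesis
    proof (cases "\<forall>e>0. \<exists>t\<in>?I. t < m - pi + e")
      case True
      have "{m - pi<..<?r} \<subseteq> ?I"
      proof
        fix t assume t: "t \<in> {m - pi<..<?r}"
        obtain a where "a \<in> ?I" "a < m - pi + (t - (m - pi))" using True t by (metis diff_gt_0_iff_gt greaterThanLessThan_iff)
        moreover obtain b where "b \<in> ?I" "\<bar>b - ?r\<bar> < ?r - t" using near[of "?r - t"] t by auto
        ultimately show "t \<in> ?I" using ivl[of a b t] by auto
      qed
      moreover have "ang m z0 \<notin> {m - pi<..<?r}" using zm r ang_cis[of m "m + pi"] by auto
      ultimately have "{m - pi<..<?r} \<inter> ang m ` M = {}" using avoid by blast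
      then show ?thesis ..
    next
      case False
      then obtain e0 where e0: "e0 > 0" "\<forall>t\<in>?I. \<not> t < m - pi + e0" by blast
      have rt: "\<exists>t\<in>?I. m + pi - e < t" if "e > 0" for e
      proof -
        have "\<not> (\<exists>t\<in>?I. t < m - pi + min e e0)"
        proof
          assume "\<exists>t\<in>?I. t < m - pi + min e e0"
          then obtain t where "t \<in> ?I" "t < m - pi + min e e0" ..
          then show False using bspec[OF e0(2)] by fastforce
        qed
        moreover have "0 < min e e0" using that e0(1) by simp
        ultimately obtain t where t: "t \<in> ?I" "m + pi - min e e0 < t" using ends[of "min e e0"] by blast
        have "m + pi - e < t" using t(2) by linarith
        then show ?thesis using t(1) by blast
      qed
      have "{?r<..<m + pi} \<subseteq> ?I"
      proof
        fix t assume t: "t \<in> {?r<..<m + pi}"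
        obtain b where "b \<in> ?I" "m + pi - (m + pi - t) < b" using rt[of "m + pi - t"] t by auto
        moreover obtain a where "a \<in> ?I" "\<bar>a - ?r\<bar> < t - ?r" using near[of "t - ?r"] t by auto
        ultimately show "t \<in> ?I" using ivl[of a b t] by auto
      qed
      then show ?thesis using avoid by blast
    qed
  qed
  have rw: "m - pi < ang m w" "ang m w < m + pi" "m - pi < ang m w'" "ang m w' < m + pi"
    "cis (ang m w) = w" "cis (ang m w') = w'" using rng[of w] rng[of w'] w w' M by auto
  have in_img: "ang m w \<in> ang m ` M" "ang m w' \<in> ang m ` M" "ang m w \<in> ang m ` (M - {z0})" "ang m w' \<in> ang m ` (M - {z0})"
    using w w' by auto
  have mixed: False if h: "{m - pi<..<r} \<inter> ang m ` M = {}" "{r'<..<m + pi} \<inter> ang m ` (M - {z0}) = {}" "m - pi < r" "r' < m + pi" for r r'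
  proof -
    have "M - {z0} \<subseteq> cis ` {r..r'}"
    proof
      fix z assume z: "z \<in> M - {z0}"
      then have a: "m - pi < ang m z" "ang m z < m + pi" "cis (ang m z) = z" using rng[of z] M by auto
      have "ang m z \<in> ang m ` M" "ang m z \<in> ang m ` (M - {z0})" using z by blast+
      then have "ang m z \<notin> {m - pi<..<r}" "ang m z \<notin> {r'<..<m + pi}" using h(1,2) by blast+
      then have "ang m z \<in> {r..r'}" using a by simp
      then show "z \<in> cis ` {r..r'}" using a(3) by (metis imageI)
    qed
    then have "z0 \<notin> closure (M - {z0})" using far h(3,4) by blast
    then show False using z0(2) islimpt_in_closure by blast
  qed
  have outside: "t \<notin> I" if "I \<inter> S = {}" "t \<in> S" for t :: real and I S using that by blast
  have "ang m w = ang m w'"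
    using side[OF D w] side[OF D' w']
  proof (elim disjE)
    assume a: "{m - pi<..<ang m w} \<inter> ang m ` M = {}" "{m - pi<..<ang m w'} \<inter> ang m ` M = {}"
    have "ang m w \<notin> {m - pi<..<ang m w'}" "ang m w' \<notin> {m - pi<..<ang m w}"
      using outside[OF a(2) in_img(1)] outside[OF a(1) in_img(2)] .
    then show ?thesis using rw(1-4) by simp
  next
    assume a: "{ang m w<..<m + pi} \<inter> ang m ` (M - {z0}) = {}" "{ang m w'<..<m + pi} \<inter> ang m ` (M - {z0}) = {}"
    have "ang m w' \<notin> {ang m w<..<m + pi}" "ang m w \<notin> {ang m w'<..<m + pi}"
      using outside[OF a(1) in_img(4)] outside[OF a(2) in_img(3)] .
    then show ?thesis using rw(1-4) by simp
  next
    assume "{m - pi<..<ang m w} \<inter> ang m ` M = {}" "{ang m w'<..<m + pi} \<inter> ang m ` (M - {z0}) = {}"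
    then show ?thesis using mixed rw by blast
  next
    assume "{ang m w<..<m + pi} \<inter> ang m ` (M - {z0}) = {}" "{m - pi<..<ang m w'} \<inter> ang m ` M = {}"
    then show ?thesis using mixed rw by blast
  qed
  then show ?thesis using rw by metis
qed

lemma open_fibre: "open ({k::nat} \<times> (UNIV::complex set))" "closed ({k::nat} \<times> (UNIV::complex set))"
  "closed ((- {k::nat}) \<times> (UNIV::complex set))"
  by (auto intro!: open_Times closed_Times simp: open_discrete closed_def)

text \<open>The fibres over the discrete index set are open and closed.\<close>
lemma connected_in_fibre:
  fixes C :: "(nat \<times> complex) set"
  assumes C: "connected C" and p: "(k, z) \<in> closure C"
  shows "C \<subseteq> {k} \<times> UNIV" "z \<in> closure (snd ` C)" "connected (snd ` C)"
proof -
  have "({k} \<times> UNIV) \<inter> C \<noteq> {}"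
    using p open_fibre(1)[of k] by (metis SigmaI UNIV_I insertI1 open_Int_closure_eq_empty disjoint_iff)
  moreover have "C \<subseteq> {k} \<times> UNIV \<union> (- {k}) \<times> UNIV" by auto
  moreover have "({k} \<times> UNIV) \<inter> ((- {k}) \<times> UNIV) \<inter> C = {}" by auto
  ultimately have "((- {k}) \<times> UNIV) \<inter> C = {}"
    using C open_fibre(2,3)[of k] unfolding connected_closed by blast
  then show "C \<subseteq> {k} \<times> UNIV" by auto
  have "snd ` closure C \<subseteq> closure (snd ` C)"
    by (rule image_closure_subset) (auto intro: continuous_intros closure_subset[THEN subsetD])
  then show "z \<in> closure (snd ` C)" using p by force
  show "connected (snd ` C)" using C by (intro connected_continuous_image continuous_intros)
qed

text \<open>A point that is not isolated has gaps on at most one side.\<close>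
lemma gap_ends_unique:
  assumes A: "A \<subseteq> multicircle n" and p: "p islimpt A" and q: "gap_ends (multicircle n) A p q" "gap_ends (multicircle n) A p q'"
  shows "q = q'"
proof -
  obtain k z0 where kz: "p = (k, z0)" by (cases p)
  define M where "M = {z. (k, z) \<in> A}"
  have M: "M \<subseteq> circle" using A by (auto simp: M_def multicircle_def)
  have z0: "z0 \<in> M" using q(1) kz by (simp add: gap_ends_def M_def)
  have lim: "z0 islimpt M"
    unfolding islimpt_approachable
  proof (intro allI impI)
    fix e :: real assume "e > 0"
    then have e: "min e 1 > 0" by simp
    then obtain y where y: "y \<in> A" "y \<noteq> p" "dist y p < min e 1" using p unfolding islimpt_approachable by blast
    obtain j z where jz: "y = (j, z)" by (cases y)
    have d: "dist j k \<le> dist y p" "dist z z0 \<le> dist y p"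
      using dist_fst_le[of y p] dist_snd_le[of y p] jz kz by auto
    then have "dist j k < 1" using y(3) by simp
    then have "j = k" by (simp add: dist_nat_def)
    then show "\<exists>x'\<in>M. x' \<noteq> z0 \<and> dist x' z0 < e" using y jz kz d(2) by (intro bexI[of _ z]) (auto simp: M_def)
  qed
  have *: "\<exists>D w. q = (k, w) \<and> connected D \<and> D \<subseteq> circle - M \<and> z0 \<in> closure D \<and> w \<in> closure D \<and> w \<in> M \<and> w \<noteq> z0"
    if q: "gap_ends (multicircle n) A p q" for q
  proof -
    obtain C where C: "connected C" "C \<subseteq> multicircle n - A" "p \<in> closure C" "q \<in> closure C" and pq: "p \<noteq> q" "q \<in> A"
      using q unfolding gap_ends_def by blast
    note f = connected_in_fibre[OF C(1) C(3)[unfolded kz]]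
    have "closure C \<subseteq> {k} \<times> UNIV" using f(1) open_fibre(2) by (rule closure_minimal)
    then obtain w where w: "q = (k, w)" using C(4) by auto
    have "snd ` C \<subseteq> circle - M" using C(2) f(1) by (auto simp: M_def multicircle_def)
    moreover have "w \<in> closure (snd ` C)" using connected_in_fibre(2)[OF C(1), of k w] C(4) w by simp
    ultimately show ?thesis using f(2,3) w pq kz by (intro exI[of _ "snd ` C"] exI[of _ w]) (auto simp: M_def)
  qed
  obtain D w where D: "q = (k, w)" "connected D" "D \<subseteq> circle - M" "z0 \<in> closure D" "w \<in> closure D" "w \<in> M" "w \<noteq> z0"
    using *[OF q(1)] by blast
  obtain D' w' where D': "q' = (k, w')" "connected D'" "D' \<subseteq> circle - M" "z0 \<in> closure D'" "w' \<in> closure D'" "w' \<in> M" "w' \<noteq> z0"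
    using *[OF q(2)] by blast
  have "w = w'" using circle_gap_end_unique[OF M z0 lim D(2-7) D'(2-7)] .
  then show ?thesis using D D' by simp
qed

context circle_cantor
begin

text \<open>Near each point, \<open>h\<close> is monotone into one arc, and by continuity of its inverse
  every point of the image near by comes from the monotone piece. So the open arc between the
  images of two nearby consecutive points avoids the image of \<open>K\<close>.\<close>
lemma broken_by_embedding_finite:
  assumes h: "h ` K \<subseteq> multicircle n" "locally_monotone_map K n h" "homeomorphism K (h ` K) h h'"
  shows "finite {(a, b). consec L a b \<and> \<not> gap_ends (multicircle n) (h ` K) (h (cis a)) (h (cis b))}"
proof (rule finite_bad_gaps)
  show "compact L" by simp
  fix x assume x: "x \<in> L"
  let ?A = "h ` K"
  have hinv: "h' (h z) = z" if "z \<in> K" for z using h(3) that by (simp add: homeomorphism_def)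
  have ch: "continuous_on K h" "continuous_on ?A h'" using h(3) by (simp_all add: homeomorphism_def)
  obtain a0 b0 c d k u where l: "a0 < b0" "b0 \<le> a0 + 2 * pi" "c < d" "d \<le> c + 2 * pi" "k < n" "cis x \<in> cis ` {a0<..<b0}"
    and T: "let T = {t \<in> {a0<..<b0}. cis t \<in> K} in u ` T \<subseteq> {c<..<d} \<and> (mono_on T u \<or> antimono_on T u) \<and>
          (\<forall>t\<in>T. h (cis t) = (k, cis (u t)))"
    using h(2) cis_L[OF x] unfolding locally_monotone_map_def by meson
  define T where "T = {t \<in> {a0<..<b0}. cis t \<in> K}"
  have T1: "u ` T \<subseteq> {c<..<d}" "mono_on T u \<or> antimono_on T u" "\<And>t. t \<in> T \<Longrightarrow> h (cis t) = (k, cis (u t))"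
    using T unfolding T_def Let_def by auto
  obtain t0 where t0: "a0 < t0" "t0 < b0" "cis x = cis t0" using l(6) by auto
  obtain N :: int where N: "x = t0 + 2 * pi * of_int N" using cis_eq_imp_shift[OF t0(3)] .
  define sh where "sh = 2 * pi * real_of_int N"
  have cs: "cis (t - sh) = cis t" for t using cis_shift[of "t - sh" N] by (simp add: sh_def)
  define v where "v t = u (t - sh)" for t
  define \<delta>1 where "\<delta>1 = min (t0 - a0) (b0 - t0)"
  have d1: "\<delta>1 > 0" using t0 by (simp add: \<delta>1_def)
  have inT: "t - sh \<in> T" if "t \<in> L" "\<bar>t - x\<bar> < \<delta>1" for t
    using that N cis_L[OF that(1)] cs[of t] by (auto simp: T_def \<delta>1_def sh_def abs_less_iff)
  have hv: "h (cis t) = (k, cis (v t))" "c < v t" "v t < d" if t: "t \<in> L" "\<bar>t - x\<bar> < \<delta>1" for t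
    using T1(3)[OF inT[OF t]] T1(1) inT[OF t] cs[of t] by (auto simp: v_def)
  have vinj: "r = t" if "r \<in> L" "\<bar>r - x\<bar> < \<delta>1" "t \<in> L" "\<bar>t - x\<bar> < \<delta>1" "v r = v t" for r t
  proof -
    have "h (cis r) = h (cis t)" using hv(1) that by simp
    then have "cis r = cis t" using hinv cis_L that by metis
    then show ?thesis using ang_L that by metis
  qed
  obtain s where s: "s = 1 \<or> s = (-1::real)" "\<And>r t. r \<in> L \<Longrightarrow> \<bar>r - x\<bar> < \<delta>1 \<Longrightarrow> t \<in> L \<Longrightarrow> \<bar>t - x\<bar> < \<delta>1 \<Longrightarrow> r < t \<Longrightarrow> s * v r < s * v t"
  proof -
    from T1(2) show ?thesis
    proof
      assume m: "mono_on T u"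
      have "1 * v r < 1 * v t" if "r \<in> L" "\<bar>r - x\<bar> < \<delta>1" "t \<in> L" "\<bar>t - x\<bar> < \<delta>1" "r < t" for r t
      proof -
        have "v r \<le> v t" unfolding v_def by (rule mono_onD[OF m inT inT]) (use that in auto)
        moreover have "v r \<noteq> v t" using vinj[OF that(1-4)] that(5) by auto
        ultimately show ?thesis by simp
      qed
      then show ?thesis using that[of 1] by blast
    next
      assume m: "antimono_on T u"
      have "-1 * v r < -1 * v t" if "r \<in> L" "\<bar>r - x\<bar> < \<delta>1" "t \<in> L" "\<bar>t - x\<bar> < \<delta>1" "r < t" for r t
      proof -
        have "r - sh \<le> t - sh" using that by simp
        then have "v t \<le> v r" using m inT[OF that(1,2)] inT[OF that(3,4)] unfolding monotone_on_def v_def by blast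
        moreover have "v r \<noteq> v t" using vinj[OF that(1-4)] that(5) by auto
        ultimately show ?thesis by simp
      qed
      then show ?thesis using that[of "-1"] by blast
    qed
  qed
  have x1: "\<bar>x - x\<bar> < \<delta>1" using d1 by simp
  have hx: "h (cis x) \<in> ?A" using cis_L[OF x] by blast
  have "continuous_on ?A (\<lambda>y. ang m (h' y))"
    by (rule continuous_on_compose2[OF ang_cont ch(2)]) (use hinv in auto)
  from continuous_on_epsilon[OF this hx d1]
  obtain \<eta> where eta: "\<eta> > 0" "\<forall>y\<in>?A. dist y (h (cis x)) < \<eta> \<longrightarrow> \<bar>ang m (h' y) - ang m (h' (h (cis x)))\<bar> < \<delta>1"
    unfolding dist_real_def by blast
  have "continuous_on UNIV (\<lambda>w::real. (k, cis w))" by (intro continuous_intros)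
  from continuous_on_epsilon[OF this UNIV_I eta(1), of "v x"]
  obtain \<epsilon> where eps: "\<epsilon> > 0" "\<forall>w. \<bar>w - v x\<bar> < \<epsilon> \<longrightarrow> dist (k, cis w) (k, cis (v x)) < \<eta>"
    unfolding dist_real_def by blast
  have pull: "\<exists>r\<in>L. \<bar>r - x\<bar> < \<delta>1 \<and> w = v r" if w: "(k, cis w) \<in> ?A" "\<bar>w - v x\<bar> < \<epsilon>" "c < w" "w < d" for w
  proof -
    obtain z where z: "z \<in> K" "(k, cis w) = h z" using w(1) by auto
    have "dist (h z) (h (cis x)) < \<eta>" using eps(2)[rule_format, OF w(2)] unfolding z(2) hv(1)[OF x x1] .
    then have r1: "\<bar>ang m z - x\<bar> < \<delta>1" using bspec[OF eta(2), of "h z"] z(1) hinv cis_L[OF x] ang_L[OF x] by simp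
    have "h z = (k, cis (v (ang m z)))" using hv(1)[OF ang_K[OF z(1)] r1] cis_ang_K[OF z(1)] by simp
    then have "cis w = cis (v (ang m z))" using z(2) by simp
    then have "w = v (ang m z)"
      using hv(2,3)[OF ang_K[OF z(1)] r1] w(3,4) l(4) by (intro cis_inj[of _ _ d]) auto
    then show ?thesis using r1 ang_K[OF z(1)] by blast
  qed
  have cv: "\<exists>\<delta>>0. \<delta> \<le> \<delta>1 \<and> (\<forall>t\<in>L. \<bar>t - x\<bar> < \<delta> \<longrightarrow> \<bar>v t - v x\<bar> < \<epsilon>)"
  proof -
    let ?m = "(c + d) / 2"
    have arc: "cis (v t) \<in> circle - {cis (?m + pi)} \<and> ang ?m (cis (v t)) = v t" if t: "t \<in> L" "\<bar>t - x\<bar> < \<delta>1" for t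
    proof -
      have r: "?m - pi < v t" "v t < ?m + pi" using hv(2,3)[OF t] l(3,4) by (auto simp: field_simps)
      then have a: "ang ?m (cis (v t)) = v t" by (intro ang_cis) auto
      moreover have "ang ?m (cis (?m + pi)) = ?m + pi" by (rule ang_cis) auto
      ultimately have "cis (v t) \<noteq> cis (?m + pi)" using r by auto
      then show ?thesis using a by simp
    qed
    have sub: "cis (v x) \<in> circle - {cis (?m + pi)}" using arc[OF x x1] by blast
    obtain e2 where e2: "e2 > 0" "\<forall>z\<in>circle - {cis (?m + pi)}. dist z (cis (v x)) < e2 \<longrightarrow> dist (ang ?m z) (ang ?m (cis (v x))) < \<epsilon>"
      using continuous_on_epsilon[OF continuous_ang[of ?m] sub eps(1)] by blast
    have "continuous_on L (\<lambda>t. h (cis t))"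
      by (rule continuous_on_compose2[OF ch(1)]) (auto intro: continuous_intros cis_L)
    from continuous_on_epsilon[OF this x e2(1)]
    obtain e3 where e3: "e3 > 0" "\<forall>t\<in>L. \<bar>t - x\<bar> < e3 \<longrightarrow> dist (h (cis t)) (h (cis x)) < e2"
      by (auto simp: dist_real_def)
    have "\<bar>v t - v x\<bar> < \<epsilon>" if t: "t \<in> L" "\<bar>t - x\<bar> < min \<delta>1 e3" for t
    proof -
      have t1: "\<bar>t - x\<bar> < \<delta>1" using t by simp
      have "dist (cis (v t)) (cis (v x)) \<le> dist (h (cis t)) (h (cis x))"
        using dist_snd_le[of "h (cis t)" "h (cis x)"] hv(1)[OF t(1) t1] hv(1)[OF x x1] by simp
      also have "\<dots> < e2" using e3(2) t by simp
      finally have "dist (ang ?m (cis (v t))) (ang ?m (cis (v x))) < \<epsilon>" using e2(2) arc[OF t(1) t1] by blast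
      then show ?thesis using arc[OF t(1) t1] arc[OF x x1] by (simp add: dist_real_def)
    qed
    then show ?thesis using d1 e3(1) by (intro exI[of _ "min \<delta>1 e3"]) auto
  qed
  then obtain \<delta> where d: "\<delta> > 0" "\<delta> \<le> \<delta>1" "\<And>t. t \<in> L \<Longrightarrow> \<bar>t - x\<bar> < \<delta> \<Longrightarrow> \<bar>v t - v x\<bar> < \<epsilon>" by blast
  have "gap_ends (multicircle n) ?A (h (cis a)) (h (cis b))"
    if ab: "consec L a b" "\<bar>a - x\<bar> < \<delta>" "\<bar>b - x\<bar> < \<delta>" for a b
  proof -
    have L2: "a \<in> L" "b \<in> L" "a < b" using consecD[OF ab(1)] by auto
    have n1: "\<bar>a - x\<bar> < \<delta>1" "\<bar>b - x\<bar> < \<delta>1" using ab d(2) by auto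
    have sv: "s * v a < s * v b" using s(2) L2 n1 by blast
    define lo where "lo = min (v a) (v b)"
    define hi where "hi = max (v a) (v b)"
    have "v a \<noteq> v b" using sv by auto
    then have lohi: "lo < hi" by (auto simp: lo_def hi_def min_def max_def)
    let ?C = "{k} \<times> cis ` {lo<..<hi}"
    have "connected ?C" by (intro connected_Times connected_continuous_image continuous_intros) auto
    moreover have "?C \<subseteq> multicircle n - ?A"
    proof
      fix y assume "y \<in> ?C"
      then obtain w where w: "y = (k, cis w)" "lo < w" "w < hi" by auto
      have "y \<notin> ?A"
      proof
        assume yA: "y \<in> ?A"
        have "\<bar>v a - v x\<bar> < \<epsilon>" "\<bar>v b - v x\<bar> < \<epsilon>" using d(3) L2 ab by auto
        then have "\<bar>w - v x\<bar> < \<epsilon>" using w by (auto simp: lo_def hi_def min_def max_def abs_less_iff split: if_splits)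
        moreover have "c < w" "w < d" using w hv(2,3)[OF L2(1) n1(1)] hv(2,3)[OF L2(2) n1(2)] by (auto simp: lo_def hi_def)
        moreover have "(k, cis w) \<in> ?A" using yA w(1) by simp
        ultimately have "\<exists>r\<in>L. \<bar>r - x\<bar> < \<delta>1 \<and> w = v r" by (intro pull)
        then obtain r where r: "r \<in> L" "\<bar>r - x\<bar> < \<delta>1" "w = v r" by blast
        have "s * v a < s * v r" "s * v r < s * v b"
          using sv s(1) w r(3) by (auto simp: lo_def hi_def min_def max_def split: if_splits)
        then have "\<not> r < a" "r \<noteq> a" "\<not> b < r" "r \<noteq> b" using s(2)[OF r(1,2) L2(1) n1(1)] s(2)[OF L2(2) n1(2) r(1,2)] by auto
        then show False using consecD(4)[OF ab(1) r(1)] by auto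
      qed
      then show "y \<in> multicircle n - ?A" using w(1) l(5) by (simp add: multicircle_def)
    qed
    moreover have "(k, cis lo) \<in> closure ?C" "(k, cis hi) \<in> closure ?C"
      using ends_in_closure_arc[OF lohi] lohi by (auto simp: closure_Times)
    then have "h (cis a) \<in> closure ?C" "h (cis b) \<in> closure ?C"
      using hv(1)[OF L2(1) n1(1)] hv(1)[OF L2(2) n1(2)] by (auto simp: lo_def hi_def min_def max_def split: if_splits)
    moreover have "h (cis a) \<noteq> h (cis b)" using hinv cis_L ang_L L2 by (metis less_irrefl)
    moreover have "h (cis a) \<in> ?A" "h (cis b) \<in> ?A" using cis_L L2 by auto
    ultimately show ?thesis unfolding gap_ends_def by blast
  qed
  then show "\<exists>\<delta>>0. \<forall>a b. consec L a b \<and> \<bar>a - x\<bar> < \<delta> \<and> \<bar>b - x\<bar> < \<delta> \<longrightarrow>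
      gap_ends (multicircle n) ?A (h (cis a)) (h (cis b))" using d(1) by blast
qed

text \<open>The homeomorphism \<open>F\<close> preserves gap ends. The embedding takes adjacent points of
  \<open>K\<close> to gap ends except at the finite set \<open>E\<close> of points, and a gap end
  has only one partner; so a point at which \<open>f ^ n\<close> is discontinuous lies in
  \<open>E\<close> or is moved into \<open>E\<close>.\<close>
theorem multihomeomorphism_imp_bounded:
  assumes f: "f \<in> carrier (Homeo_lt K)" and mh: "multihomeomorphism K f"
  shows "\<exists>B. \<forall>n::nat. num_disc K (f [^]\<^bsub>Homeo_lt K\<^esub> n) \<le> B"
proof -
  obtain \<phi> where \<phi>: "PH L \<phi>" "f = to_K \<phi>" using f carrier_Homeo by auto
  obtain N h h' F F' where h: "h ` K \<subseteq> multicircle N" "locally_monotone_map K N h" "homeomorphism K (h ` K) h h'"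
    and F: "homeomorphism (multicircle N) (multicircle N) F F'" "\<forall>y \<in> h ` K. h (f (h' y)) = F y"
    using mh unfolding multihomeomorphism_def by blast
  let ?A = "h ` K" and ?X = "multicircle N"
  have hinv: "h' (h z) = z" if "z \<in> K" for z using h(3) that by (simp add: homeomorphism_def)
  have p: "\<phi> permutes L" using \<phi> by (simp add: PH_def)
  have Fh: "F (h (cis t)) = h (cis (\<phi> t))" if t: "t \<in> L" for t
  proof -
    have "F (h (cis t)) = h (f (h' (h (cis t))))" using F(2) cis_L[OF t] by simp
    also have "\<dots> = h (cis (\<phi> t))" using hinv[OF cis_L[OF t]] t by (simp add: \<phi>(2) to_K_def cis_L ang_L)
    finally show ?thesis .
  qed
  have A_eq: "?A = (\<lambda>t. h (cis t)) ` L" using arg_cong[OF K_eq, of "(`) h"] by (simp only: image_image)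
  have FA: "F ` ?A = ?A"
  proof -
    have "F ` ?A = (\<lambda>t. h (cis (\<phi> t))) ` L" unfolding A_eq image_image using Fh by simp
    also have "\<dots> = (\<lambda>t. h (cis t)) ` \<phi> ` L" by (simp add: image_image)
    finally show ?thesis using permutes_image[OF p] A_eq by simp
  qed
  have cX: "closed ?X" unfolding multicircle_def by (intro closed_Times) (auto intro: finite_imp_closed)
  have Fn: "gap_ends ?X ?A (h (cis ((\<phi> ^^ n) a))) (h (cis ((\<phi> ^^ n) b)))"
    if "gap_ends ?X ?A (h (cis a)) (h (cis b))" "a \<in> L" "b \<in> L" for a b n
  proof (induction n)
    case 0 then show ?case using that by simp
  next
    case (Suc n)
    have q: "(\<phi> ^^ n) permutes L" using PH_pow[OF \<phi>(1)] by (simp add: PH_def)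
    then have "(\<phi> ^^ n) a \<in> L" "(\<phi> ^^ n) b \<in> L" using that by (simp_all add: permutes_in_image)
    then show ?case using gap_ends_homeomorphism[OF cX F(1) h(1) FA Suc] Fh by simp
  qed
  let ?Bad = "{(a, b). consec L a b \<and> \<not> gap_ends ?X ?A (h (cis a)) (h (cis b))}"
  define E where "E = {a. \<exists>b. cadj L a b \<and> \<not> gap_ends ?X ?A (h (cis a)) (h (cis b))}"
  have finE: "finite E"
  proof (rule finite_subset)
    show "E \<subseteq> fst ` ?Bad \<union> snd ` ?Bad \<union> {Inf L, Sup L}"
    proof
      fix a assume "a \<in> E"
      then obtain b where b: "cadj L a b" "\<not> gap_ends ?X ?A (h (cis a)) (h (cis b))" by (auto simp: E_def)
      have "(a, b) \<in> ?Bad \<or> (b, a) \<in> ?Bad \<or> a \<in> {Inf L, Sup L}"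
        using b gap_ends_sym unfolding cadj_def by blast
      then show "a \<in> fst ` ?Bad \<union> snd ` ?Bad \<union> {Inf L, Sup L}" by force
    qed
    show "finite (fst ` ?Bad \<union> snd ` ?Bad \<union> {Inf L, Sup L})" using broken_by_embedding_finite[OF h] by simp
  qed
  have lim: "h (cis t) islimpt ?A" if t: "t \<in> L" for t
  proof (rule iffD2[OF islimpt_approachable], intro allI impI)
    fix e :: real assume e: "e > 0"
    have "continuous_on K h" using h(3) by (simp add: homeomorphism_def)
    then obtain d where d: "d > 0" "\<forall>z\<in>K. dist z (cis t) < d \<longrightarrow> dist (h z) (h (cis t)) < e"
      using continuous_on_epsilon[OF _ cis_L[OF t] e] by blast
    have "cis t islimpt K" using K cis_L[OF t] by (simp add: cantor_subset_def)
    then obtain z where z: "z \<in> K" "z \<noteq> cis t" "dist z (cis t) < d" using d(1) unfolding islimpt_approachable by blast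
    then have "h z \<noteq> h (cis t)" using hinv cis_L[OF t] by metis
    then show "\<exists>x'\<in>?A. x' \<noteq> h (cis t) \<and> dist x' (h (cis t)) < e" using d(2) z by blast
  qed
  have "num_disc K (f [^]\<^bsub>Homeo_lt K\<^esub> n) \<le> 2 * card E" for n :: nat
  proof -
    let ?\<psi> = "\<phi> ^^ n"
    have \<psi>: "PH L ?\<psi>" using \<phi>(1) by (rule PH_pow)
    then have q: "?\<psi> permutes L" by (simp add: PH_def)
    have sub: "disc ?\<psi> \<subseteq> E \<union> ?\<psi> -` E"
    proof
      fix a assume "a \<in> disc ?\<psi>"
      then obtain b where b: "cadj L a b" "\<not> cadj L (?\<psi> a) (?\<psi> b)" by (auto simp: disc_def)
      have ab: "a \<in> L" "b \<in> L" using cadj_in[OF L_cantor b(1)] by auto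
      have ab': "?\<psi> a \<in> L" "?\<psi> b \<in> L" using ab q by (simp_all add: permutes_in_image)
      show "a \<in> E \<union> ?\<psi> -` E"
      proof (rule ccontr)
        assume n: "a \<notin> E \<union> ?\<psi> -` E"
        then have "gap_ends ?X ?A (h (cis a)) (h (cis b))" using b(1) by (auto simp: E_def)
        then have g1: "gap_ends ?X ?A (h (cis (?\<psi> a))) (h (cis (?\<psi> b)))" using Fn ab by blast
        obtain c where c: "cadj L (?\<psi> a) c" using PH_endpoint[OF L_cantor \<psi> b(1)] by blast
        then have g2: "gap_ends ?X ?A (h (cis (?\<psi> a))) (h (cis c))" using n by (auto simp: E_def)
        have "h (cis c) = h (cis (?\<psi> b))" using gap_ends_unique[OF h(1) lim[OF ab'(1)] g2 g1] .
        then have "cis c = cis (?\<psi> b)" using hinv cis_L ab'(2) cadj_in(2)[OF L_cantor c] by metis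
        then have "c = ?\<psi> b" using ang_L ab'(2) cadj_in(2)[OF L_cantor c] by metis
        then show False using b(2) c by simp
      qed
    qed
    have inj: "inj ?\<psi>" using PH_bij[OF \<psi>] by (simp add: bij_is_inj)
    have fv: "finite (?\<psi> -` E)" using finE inj by (rule finite_vimageI)
    have "card (disc ?\<psi>) \<le> card (E \<union> ?\<psi> -` E)" using sub finE fv by (intro card_mono) auto
    also have "\<dots> \<le> card E + card (?\<psi> -` E)" by (rule card_Un_le)
    also have "card (?\<psi> -` E) \<le> card E" using finE inj by (intro card_inj_on_le[of ?\<psi>]) (auto intro: inj_on_subset)
    finally show ?thesis using num_disc_eq[OF \<psi>] to_K_pow[OF \<phi>(1)] \<phi>(2) by simp
  qed
  then show ?thesis by blast
qed

end

section \<open>Rearranging the pieces along a matching\<close>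

text \<open>Otherwise take the last point up to \<open>y\<close> with the value at \<open>x\<close>. It is
  not a limit from the right, so a gap follows it, and the other end of the gap has the same
  value.\<close>
lemma constant_across_gaps:
  fixes c :: "real \<Rightarrow> nat"
  assumes M: "compact M" and loc: "\<And>x. x \<in> M \<Longrightarrow> \<exists>\<delta>>0. \<forall>y\<in>M. \<bar>y - x\<bar> < \<delta> \<longrightarrow> c y = c x"
    and gap: "\<And>p q. consec M p q \<Longrightarrow> c p = c q" and xy: "x \<in> M" "y \<in> M"
  shows "c x = c y"
proof -
  have *: "c x = c y" if xy: "x \<in> M" "y \<in> M" "x < y" for x y
  proof (rule ccontr)
    assume ne: "c x \<noteq> c y"
    define S where "S = {z\<in>M. z \<le> y \<and> c z = c x}"
    have cM: "closed M" using M by (rule compact_imp_closed)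
    have "closed S" unfolding closed_limpt
    proof (intro allI impI)
      fix l assume l: "l islimpt S"
      have "S \<subseteq> M" "S \<subseteq> {..y}" by (auto simp: S_def)
      then have lM: "l \<in> M" "l \<le> y" using l cM closed_limpt islimpt_subset closed_atMost by (metis, metis atMost_iff)
      obtain d where d: "d > 0" "\<forall>z\<in>M. \<bar>z - l\<bar> < d \<longrightarrow> c z = c l" using loc[OF lM(1)] by blast
      obtain z where "z \<in> S" "dist z l < d" using l d(1) unfolding islimpt_approachable by blast
      then have "c l = c x" using d(2) by (auto simp: S_def dist_real_def)
      then show "l \<in> S" using lM by (simp add: S_def)
    qed
    then have "compact S" using M compact_Int_closed[of M S] by (simp add: S_def Int_absorb1 subset_eq Collect_conj_eq Int_assoc[symmetric])
    moreover have "x \<in> S" using xy by (simp add: S_def)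
    ultimately obtain a where a: "a \<in> S" "\<forall>z\<in>S. z \<le> a" using compact_attains_sup[of S] by blast
    have aM: "a \<in> M" "c a = c x" "a < y" using a(1) ne by (auto simp: S_def less_le)
    have nr: "\<not> rlim M a"
    proof
      assume r: "rlim M a"
      obtain d where d: "d > 0" "\<forall>z\<in>M. \<bar>z - a\<bar> < d \<longrightarrow> c z = c a" using loc[OF aM(1)] by blast
      have "0 < min d (y - a)" using d(1) aM(3) by simp
      then obtain z where z: "z \<in> M" "a < z" "z < a + min d (y - a)" using r unfolding rlim_def by blast
      then have "z \<in> S" using d(2) aM by (auto simp: S_def)
      then show False using a(2) z(2) by force
    qed
    have "a \<noteq> Sup M" using aM(3) compact_Inf_Sup(4)[OF M, of y] xy by force
    then obtain b where b: "consec M a b" using not_rlim_cases[OF M aM(1) nr] by blast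
    have "b \<le> y" using consecD(4)[OF b xy(2)] aM(3) by simp
    then have "b \<in> S" using gap[OF b] consecD(2)[OF b] aM by (auto simp: S_def)
    then show False using a(2) consecD(3)[OF b] by force
  qed
  show ?thesis using *[of x y] *[of y x] xy by (metis linorder_neqE_linordered_idom)
qed

text \<open>A cut and rearranged copy of \<open>L\<close>: finitely many compact sets of reals, the components, to which
  the pieces of \<open>L\<close> are moved by affine maps.\<close>
locale arrangement =
  fixes L :: "real set" and h :: "real \<Rightarrow> nat \<times> real"
  assumes L: "cantor L" and inj: "inj_on h L"
    and affine: "\<And>x. x \<in> L \<Longrightarrow> \<exists>\<delta>>0. \<exists>k s c. s \<noteq> 0 \<and> (\<forall>y\<in>L. \<bar>y - x\<bar> < \<delta> \<longrightarrow> h y = (k, s * y + c))"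
begin

definition comp :: "nat \<Rightarrow> real set" where "comp k = {w. (k, w) \<in> h ` L}"

lemma comp_h: "x \<in> L \<Longrightarrow> snd (h x) \<in> comp (fst (h x))"
  by (simp add: comp_def)

lemma compE: assumes "w \<in> comp k" obtains x where "x \<in> L" "h x = (k, w)"
  using assms by (auto simp: comp_def)

lemma h_eq: "x \<in> L \<Longrightarrow> y \<in> L \<Longrightarrow> fst (h x) = fst (h y) \<Longrightarrow> snd (h x) = snd (h y) \<Longrightarrow> x = y"
  using inj_onD[OF inj, of x y] prod_eqI[of "h x" "h y"] by blast

lemma affineE:
  assumes "x \<in> L"
  obtains \<delta> k s c where "\<delta> > 0" "s \<noteq> 0" "\<forall>y\<in>L. \<bar>y - x\<bar> < \<delta> \<longrightarrow> h y = (k, s * y + c)" "h x = (k, s * x + c)"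
proof -
  obtain \<delta> k s c where *: "\<delta> > 0" "s \<noteq> 0" "\<forall>y\<in>L. \<bar>y - x\<bar> < \<delta> \<longrightarrow> h y = (k, s * y + c)"
    using affine[OF assms] by blast
  then have "h x = (k, s * x + c)" using assms by simp
  then show ?thesis using that * by blast
qed

lemma continuous_h: "continuous_on L h"
proof (rule iffD2[OF continuous_on_iff], intro ballI allI impI)
  fix x and e :: real assume x: "x \<in> L" and e: "e > 0"
  obtain \<delta> k s c where a: "\<delta> > 0" "s \<noteq> 0" "\<forall>y\<in>L. \<bar>y - x\<bar> < \<delta> \<longrightarrow> h y = (k, s * y + c)" "h x = (k, s * x + c)"
    using affineE[OF x] .
  have "dist (h y) (h x) < e" if y: "y \<in> L" "dist y x < min \<delta> (e / \<bar>s\<bar>)" for y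
  proof -
    have "h y = (k, s * y + c)" using a(3) y by (simp add: dist_real_def)
    then have "dist (h y) (h x) = \<bar>s * y - s * x\<bar>" using a(4) by (simp add: dist_Pair_Pair dist_real_def)
    also have "\<dots> = \<bar>s\<bar> * \<bar>y - x\<bar>" by (simp add: abs_mult[symmetric] right_diff_distrib)
    also have "\<dots> < e" using y(2) a(2) by (simp add: dist_real_def field_simps)
    finally show ?thesis .
  qed
  moreover have "0 < min \<delta> (e / \<bar>s\<bar>)" using a e by simp
  ultimately show "\<exists>d>0. \<forall>y\<in>L. dist y x < d \<longrightarrow> dist (h y) (h x) < e" by blast
qed

lemma compact_comp: "compact (comp k)"
proof -
  have "compact (h ` L \<inter> {k} \<times> UNIV)"
    using continuous_h cantor_compact(1)[OF L]
    by (intro compact_Int_closed compact_continuous_image closed_Times) auto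
  then have "compact (snd ` (h ` L \<inter> {k} \<times> UNIV))" by (intro compact_continuous_image continuous_intros)
  moreover have "snd ` (h ` L \<inter> {k} \<times> UNIV) = comp k"
  proof
    show "comp k \<subseteq> snd ` (h ` L \<inter> {k} \<times> UNIV)"
    proof
      fix w assume "w \<in> comp k"
      then have "(k, w) \<in> h ` L \<inter> {k} \<times> UNIV" by (simp add: comp_def)
      then show "w \<in> snd ` (h ` L \<inter> {k} \<times> UNIV)" by (rule image_eqI[rotated]) simp
    qed
    show "snd ` (h ` L \<inter> {k} \<times> UNIV) \<subseteq> comp k"
    proof (rule image_subsetI)
      fix p assume "p \<in> h ` L \<inter> {k} \<times> UNIV"
      then have "p \<in> h ` L" "fst p = k" by (simp_all add: mem_Times_iff)
      then have "(k, snd p) \<in> h ` L" by (metis prod.collapse)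
      then show "snd p \<in> comp k" by (simp add: comp_def)
    qed
  qed
  ultimately show ?thesis by simp
qed

text \<open>The inverse of \<open>h\<close> is continuous by compactness of \<open>L\<close>.\<close>
lemma inverse_near:
  assumes x: "x \<in> L" and e: "e > 0"
  shows "\<exists>\<eta>>0. \<forall>y\<in>L. fst (h y) = fst (h x) \<longrightarrow> \<bar>snd (h y) - snd (h x)\<bar> < \<eta> \<longrightarrow> \<bar>y - x\<bar> < e"
proof -
  let ?g = "the_inv_into L h"
  have "continuous_on (h ` L) ?g" by (rule continuous_on_inv_into[OF continuous_h cantor_compact(1)[OF L] inj])
  moreover have "h x \<in> h ` L" using x by blast
  ultimately obtain \<eta> where eta: "\<eta> > 0" "\<forall>p\<in>h ` L. dist p (h x) < \<eta> \<longrightarrow> dist (?g p) (?g (h x)) < e"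
    using e unfolding continuous_on_iff by blast
  have "\<bar>y - x\<bar> < e" if y: "y \<in> L" "fst (h y) = fst (h x)" "\<bar>snd (h y) - snd (h x)\<bar> < \<eta>" for y
  proof -
    have "dist (h y) (h x) = \<bar>snd (h y) - snd (h x)\<bar>"
      using y(2) by (cases "h y"; cases "h x") (simp add: dist_Pair_Pair dist_real_def)
    then have "dist (?g (h y)) (?g (h x)) < e" using eta(2) y by simp
    then show ?thesis using the_inv_into_f_f[OF inj] x y by (simp add: dist_real_def)
  qed
  then show ?thesis using eta(1) by blast
qed

text \<open>The affine local form exchanges or preserves the two sides of a point.\<close>
lemma sides:
  assumes x: "x \<in> L"
  shows "(llim (comp (fst (h x))) (snd (h x)) \<longleftrightarrow> llim L x) \<and> (rlim (comp (fst (h x))) (snd (h x)) \<longleftrightarrow> rlim L x) \<or>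
    (llim (comp (fst (h x))) (snd (h x)) \<longleftrightarrow> rlim L x) \<and> (rlim (comp (fst (h x))) (snd (h x)) \<longleftrightarrow> llim L x)"
proof -
  obtain \<delta> k s c where a: "\<delta> > 0" "s \<noteq> 0" "\<forall>y\<in>L. \<bar>y - x\<bar> < \<delta> \<longrightarrow> h y = (k, s * y + c)" "h x = (k, s * x + c)"
    using affineE[OF x] .
  let ?w = "s * x + c"
  have up: "\<exists>v\<in>comp k. \<bar>v - ?w\<bar> < e \<and> (v < ?w \<longleftrightarrow> s * (y - x) < 0) \<and> v \<noteq> ?w"
    if e: "e > 0" and y: "y \<in> L" "\<bar>y - x\<bar> < min \<delta> (e / \<bar>s\<bar>)" "y \<noteq> x" for e y
  proof -
    have hy: "h y = (k, s * y + c)" using a(3) y by simp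
    have "\<bar>(s * y + c) - ?w\<bar> = \<bar>s\<bar> * \<bar>y - x\<bar>" by (simp add: abs_mult[symmetric] right_diff_distrib)
    also have "\<dots> < e" using y(2) a(2) by (simp add: field_simps)
    finally have "\<bar>(s * y + c) - ?w\<bar> < e" .
    moreover have "s * y + c \<in> comp k" using comp_h[OF y(1)] hy by simp
    moreover have "(s * y + c < ?w) = (s * (y - x) < 0)" by (auto simp: right_diff_distrib)
    moreover have "s * y + c \<noteq> ?w" using y(3) a(2) by simp
    ultimately show ?thesis by blast
  qed
  have down: "\<exists>y\<in>L. \<bar>y - x\<bar> < e \<and> v = s * y + c"
    if e: "e > 0" and v: "v \<in> comp k" "\<bar>v - ?w\<bar> < \<eta>"
      and \<eta>: "\<forall>y\<in>L. fst (h y) = fst (h x) \<longrightarrow> \<bar>snd (h y) - snd (h x)\<bar> < \<eta> \<longrightarrow> \<bar>y - x\<bar> < min e \<delta>" for e v \<eta>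
  proof -
    obtain y where y: "y \<in> L" "h y = (k, v)" using compE[OF v(1)] .
    then have "\<bar>y - x\<bar> < min e \<delta>" using \<eta> v(2) a(4) by simp
    then show ?thesis using y a(3) by auto
  qed
  have ss: "s * s > 0" using a(2) not_real_square_gt_zero by blast
  have lim_iff: "(\<forall>e>0. \<exists>v\<in>comp k. \<bar>v - ?w\<bar> < e \<and> r * s * (v - ?w) < 0) \<longleftrightarrow> (\<forall>e>0. \<exists>y\<in>L. \<bar>y - x\<bar> < e \<and> r * (y - x) < 0)"
    if r: "r = 1 \<or> r = -1" for r :: real
  proof
    assume L1: "\<forall>e>0. \<exists>v\<in>comp k. \<bar>v - ?w\<bar> < e \<and> r * s * (v - ?w) < 0"
    show "\<forall>e>0. \<exists>y\<in>L. \<bar>y - x\<bar> < e \<and> r * (y - x) < 0"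
    proof (intro allI impI)
      fix e :: real assume e: "e > 0"
      then have "min e \<delta> > 0" using a(1) by simp
      then obtain \<eta> where eta: "\<eta> > 0" "\<forall>y\<in>L. fst (h y) = fst (h x) \<longrightarrow> \<bar>snd (h y) - snd (h x)\<bar> < \<eta> \<longrightarrow> \<bar>y - x\<bar> < min e \<delta>"
        using inverse_near[OF x] by blast
      obtain v where v: "v \<in> comp k" "\<bar>v - ?w\<bar> < \<eta>" "r * s * (v - ?w) < 0" using L1 eta(1) by blast
      obtain y where y: "y \<in> L" "\<bar>y - x\<bar> < e" "v = s * y + c" using down[OF e v(1,2) eta(2)] by blast
      have "(s * s) * (r * (y - x)) < (s * s) * 0" using v(3) by (simp add: y(3) algebra_simps)
      then have "r * (y - x) < 0" using ss by (simp only: mult_less_cancel_left_pos)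
      then show "\<exists>y\<in>L. \<bar>y - x\<bar> < e \<and> r * (y - x) < 0" using y by blast
    qed
  next
    assume L2: "\<forall>e>0. \<exists>y\<in>L. \<bar>y - x\<bar> < e \<and> r * (y - x) < 0"
    show "\<forall>e>0. \<exists>v\<in>comp k. \<bar>v - ?w\<bar> < e \<and> r * s * (v - ?w) < 0"
    proof (intro allI impI)
      fix e :: real assume e: "e > 0"
      then have "min \<delta> (e / \<bar>s\<bar>) > 0" using a by simp
      then obtain y where y: "y \<in> L" "\<bar>y - x\<bar> < min \<delta> (e / \<bar>s\<bar>)" "r * (y - x) < 0" using L2 by blast
      have hy: "h y = (k, s * y + c)" using a(3) y by simp
      have "\<bar>(s * y + c) - ?w\<bar> = \<bar>s\<bar> * \<bar>y - x\<bar>" by (simp add: abs_mult[symmetric] right_diff_distrib)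
      also have "\<dots> < e" using y(2) a(2) by (simp add: field_simps)
      finally have "\<bar>(s * y + c) - ?w\<bar> < e" .
      moreover have "s * y + c \<in> comp k" using comp_h[OF y(1)] hy by simp
      moreover have "r * s * ((s * y + c) - ?w) < 0"
        using mult_pos_neg[OF ss y(3)] by (simp add: algebra_simps)
      ultimately show "\<exists>v\<in>comp k. \<bar>v - ?w\<bar> < e \<and> r * s * (v - ?w) < 0" by blast
    qed
  qed
  have lr: "llim M z \<longleftrightarrow> (\<forall>e>0. \<exists>y\<in>M. \<bar>y - z\<bar> < e \<and> 1 * (y - z) < 0)"
    "rlim M z \<longleftrightarrow> (\<forall>e>0. \<exists>y\<in>M. \<bar>y - z\<bar> < e \<and> -1 * (y - z) < 0)" for M z
  proof -
    have "z - e < y \<and> y < z \<longleftrightarrow> \<bar>y - z\<bar> < e \<and> 1 * (y - z) < 0" if "e > 0" for e y :: real using that by auto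
    then show "llim M z \<longleftrightarrow> (\<forall>e>0. \<exists>y\<in>M. \<bar>y - z\<bar> < e \<and> 1 * (y - z) < 0)" unfolding llim_def by meson
    have "z < y \<and> y < z + e \<longleftrightarrow> \<bar>y - z\<bar> < e \<and> -1 * (y - z) < 0" if "e > 0" for e y :: real using that by auto
    then show "rlim M z \<longleftrightarrow> (\<forall>e>0. \<exists>y\<in>M. \<bar>y - z\<bar> < e \<and> -1 * (y - z) < 0)" unfolding rlim_def by meson
  qed
  have sgn: "r * s * t < 0 \<longleftrightarrow> (if s > 0 then r * t < 0 else (- r) * t < 0)" for r t :: real
  proof -
    have e: "r * s * t = s * (r * t)" by simp
    show ?thesis unfolding e using a(2) mult_less_0_iff[of s "r * t"] by auto
  qed
  show ?thesis
    using lim_iff[of 1] lim_iff[of "-1"] unfolding a(4) fst_conv snd_conv lr sgn by (cases "s > 0") simp_all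
qed

lemma comp_one_sided: "x \<in> L \<Longrightarrow> llim (comp (fst (h x))) (snd (h x)) \<or> rlim (comp (fst (h x))) (snd (h x))"
  using sides[of x] cantor_one_sided_limit[OF L, of x] by blast

definition is_end :: "real \<Rightarrow> bool"
  where "is_end x \<longleftrightarrow> snd (h x) = Inf (comp (fst (h x))) \<or> snd (h x) = Sup (comp (fst (h x)))"

definition neighbours :: "real \<Rightarrow> real \<Rightarrow> bool"
  where "neighbours x y \<longleftrightarrow> x \<in> L \<and> y \<in> L \<and> fst (h x) = fst (h y) \<and>
    (consec (comp (fst (h x))) (snd (h x)) (snd (h y)) \<or> consec (comp (fst (h x))) (snd (h y)) (snd (h x)))"

lemma comp_nonempty: "x \<in> L \<Longrightarrow> comp (fst (h x)) \<noteq> {}"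
  using comp_h by blast

lemmas comp_bounds = compact_Inf_Sup[OF compact_comp]

text \<open>A point with a neighbour in \<open>L\<close> is a one-sided limit, and remains one in its
  component.\<close>
lemma end_or_neighbour:
  assumes x: "x \<in> L" and c: "cadj L x b" shows "is_end x \<or> (\<exists>y. neighbours x y)"
proof -
  let ?M = "comp (fst (h x))" and ?w = "snd (h x)"
  have "\<not> (llim ?M ?w \<and> rlim ?M ?w)" using sides[OF x] cadj_iff_one_sided[OF L x] c by blast
  moreover have w: "?w \<in> ?M" using comp_h[OF x] .
  ultimately consider "?w = Inf ?M" | "?w = Sup ?M" | v where "consec ?M v ?w \<or> consec ?M ?w v"
    using not_llim_cases[OF compact_comp w] not_rlim_cases[OF compact_comp w] by blast
  then show ?thesis
  proof cases
    case (3 v)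
    then have "v \<in> ?M" using consecD(1,2) by blast
    then obtain y where "y \<in> L" "h y = (fst (h x), v)" by (rule compE)
    then have "neighbours x y" using 3 x by (auto simp: neighbours_def)
    then show ?thesis by blast
  qed (auto simp: is_end_def)
qed

lemma end_not_neighbour: assumes "is_end x" shows "\<not> neighbours x y"
proof
  assume n: "neighbours x y"
  then have x: "x \<in> L" by (simp add: neighbours_def)
  let ?M = "comp (fst (h x))"
  have w: "snd (h x) \<in> ?M" "snd (h y) \<in> ?M" using comp_h[OF x] comp_h[of y] n by (auto simp: neighbours_def)
  have lim: "llim ?M (snd (h x)) \<or> rlim ?M (snd (h x))" by (rule comp_one_sided[OF x])
  from assms show False unfolding is_end_def
  proof
    assume i: "snd (h x) = Inf ?M"
    have "\<not> consec ?M (snd (h y)) (snd (h x))" using i comp_bounds(3)[OF comp_nonempty[OF x] w(2)] by (auto dest: consecD(3))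
    then have "consec ?M (snd (h x)) (snd (h y))" using n by (auto simp: neighbours_def)
    then show False using lim i Inf_not_llim[OF compact_comp] consec_not_rlim by metis
  next
    assume i: "snd (h x) = Sup ?M"
    have "\<not> consec ?M (snd (h x)) (snd (h y))" using i comp_bounds(4)[OF comp_nonempty[OF x] w(2)] by (auto dest: consecD(3))
    then have "consec ?M (snd (h y)) (snd (h x))" using n by (auto simp: neighbours_def)
    then show False using lim i Sup_not_rlim[OF compact_comp] consec_not_llim by metis
  qed
qed

lemma end_one_sided: assumes "x \<in> L" "is_end x" shows "\<exists>b. cadj L x b"
  using assms(2) sides[OF assms(1)] Inf_not_llim[OF compact_comp] Sup_not_rlim[OF compact_comp]
    cadj_iff_one_sided[OF L assms(1)] unfolding is_end_def by metis

definition labels :: "nat set" where "labels = fst ` h ` L"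

text \<open>Neighbours within a component, where the two ends of a component count as neighbours.\<close>
definition glued :: "real \<Rightarrow> real \<Rightarrow> bool"
  where "glued x y \<longleftrightarrow> neighbours x y \<or> (x \<in> L \<and> y \<in> L \<and> x \<noteq> y \<and> fst (h x) = fst (h y) \<and> is_end x \<and> is_end y)"

lemma ends_pair:
  assumes "x \<in> L" "y \<in> L" "z \<in> L" "fst (h x) = fst (h y)" "fst (h x) = fst (h z)" "is_end x" "is_end y" "is_end z" "x \<noteq> y" "x \<noteq> z"
  shows "y = z"
proof -
  have "snd (h x) \<noteq> snd (h y)" "snd (h x) \<noteq> snd (h z)" using h_eq assms by metis+
  then have "snd (h y) = snd (h z)" using assms(4-8) unfolding is_end_def by metis
  then show ?thesis using h_eq[OF assms(2,3)] assms(4,5) by simp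
qed

lemma neighbours_sym: "neighbours x y \<Longrightarrow> neighbours y x"
  by (auto simp: neighbours_def)

lemma label_locally_constant:
  assumes "x \<in> L" shows "\<exists>\<delta>>0. \<forall>y\<in>L. \<bar>y - x\<bar> < \<delta> \<longrightarrow> fst (h y) = fst (h x)"
proof -
  obtain \<delta> k s c where "\<delta> > 0" "s \<noteq> 0" "\<forall>y\<in>L. \<bar>y - x\<bar> < \<delta> \<longrightarrow> h y = (k, s * y + c)" "h x = (k, s * x + c)"
    using affineE[OF assms] .
  then show ?thesis by (intro exI[of _ \<delta>]) auto
qed

end

text \<open>An arrangement is along \<open>S\<close> if it only creates neighbours that are matched by
  \<open>S\<close>. A map that preserves \<open>S\<close> then takes neighbours to matched points.\<close>
locale matched_arrangement = arrangement +
  fixes S :: "real \<Rightarrow> real \<Rightarrow> bool"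
  assumes S_sym: "\<And>x y. S x y \<Longrightarrow> S y x" and S_unique: "\<And>x y z. S x y \<Longrightarrow> S x z \<Longrightarrow> y = z"
    and S_in: "\<And>x y. S x y \<Longrightarrow> x \<in> L" and S_irrefl: "\<And>x. \<not> S x x"
    and S_end: "\<And>x y. S x y \<Longrightarrow> \<exists>b. cadj L x b"
    and finite_labels: "finite labels"
    and neighbours_matched: "\<And>x y. neighbours x y \<Longrightarrow> S x y"
begin

text \<open>The component of \<open>y\<close> is moved to the right of the component of \<open>x\<close>, after reflections
  that make \<open>x\<close> the last and \<open>y\<close> the first point.\<close>
lemma merge:
  assumes xy: "S x y" "fst (h x) \<noteq> fst (h y)" "is_end x" "is_end y"
  shows "\<exists>h'. matched_arrangement L h' S \<and> card (fst ` h' ` L) < card labels"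
proof -
  define i where "i = fst (h x)"
  define j where "j = fst (h y)"
  define wx where "wx = snd (h x)"
  define wy where "wy = snd (h y)"
  have ij: "i \<noteq> j" using xy(2) by (simp add: i_def j_def)
  have L2: "x \<in> L" "y \<in> L" using S_in xy(1) S_sym by blast+
  have hx: "h x = (i, wx)" "h y = (j, wy)" by (simp_all add: i_def j_def wx_def wy_def)
  have "\<exists>s::real. (s = 1 \<or> s = -1) \<and> (\<forall>w\<in>comp i. s * (w - wx) \<le> 0)"
  proof -
    note b = comp_bounds(3,4)[OF comp_nonempty[OF L2(1)], unfolded hx fst_conv]
    have "wx = Inf (comp i) \<or> wx = Sup (comp i)" using xy(3) unfolding is_end_def hx fst_conv snd_conv .
    then show ?thesis
    proof
      assume "wx = Inf (comp i)"
      then show ?thesis using b(1) by (intro exI[of _ "-1"]) simp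
    next
      assume "wx = Sup (comp i)"
      then show ?thesis using b(2) by (intro exI[of _ "1"]) simp
    qed
  qed
  then obtain s where s: "s = 1 \<or> s = (-1::real)" "\<And>w. w \<in> comp i \<Longrightarrow> s * (w - wx) \<le> 0" by blast
  have "\<exists>s::real. (s = 1 \<or> s = -1) \<and> (\<forall>w\<in>comp j. 0 \<le> s * (w - wy))"
  proof -
    note b = comp_bounds(3,4)[OF comp_nonempty[OF L2(2)], unfolded hx fst_conv]
    have "wy = Inf (comp j) \<or> wy = Sup (comp j)" using xy(4) unfolding is_end_def hx fst_conv snd_conv .
    then show ?thesis
    proof
      assume "wy = Inf (comp j)"
      then show ?thesis using b(1) by (intro exI[of _ "1"]) simp
    next
      assume "wy = Sup (comp j)"
      then show ?thesis using b(2) by (intro exI[of _ "-1"]) simp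
    qed
  qed
  then obtain r where r: "r = 1 \<or> r = (-1::real)" "\<And>w. w \<in> comp j \<Longrightarrow> 0 \<le> r * (w - wy)" by blast
  \<comment> \<open>After the reflections one component lies in the nonpositive reals and the other is moved to the right of \<open>1\<close>.\<close>
  define h' where "h' t = (if fst (h t) = i then (i, s * (snd (h t) - wx))
     else if fst (h t) = j then (i, 1 + r * (snd (h t) - wy)) else h t)" for t
  have h'_i: "h' t = (i, s * (snd (h t) - wx))" if "fst (h t) = i" for t using that by (simp add: h'_def)
  have h'_j: "h' t = (i, 1 + r * (snd (h t) - wy))" if "fst (h t) = j" for t using that ij by (simp add: h'_def)
  have neg: "snd (h' t) \<le> 0" "fst (h' t) = i" if "t \<in> L" "fst (h t) = i" for t
    using s(2)[of "snd (h t)"] comp_h[OF that(1)] unfolding h'_i[OF that(2)] that(2) by simp_all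
  have pos1: "1 \<le> snd (h' t)" "fst (h' t) = i" if "t \<in> L" "fst (h t) = j" for t
    using r(2)[of "snd (h t)"] comp_h[OF that(1)] unfolding h'_j[OF that(2)] that(2) by simp_all
  have other: "h' t = h t" if "fst (h t) \<noteq> i" "fst (h t) \<noteq> j" for t using that by (simp add: h'_def)
  have lab: "fst (h' t) = i \<longleftrightarrow> fst (h t) = i \<or> fst (h t) = j" for t by (auto simp: h'_def)
  have inj': "inj_on h' L"
  proof (rule inj_onI)
    fix t1 t2 assume t: "t1 \<in> L" "t2 \<in> L" "h' t1 = h' t2"
    consider "fst (h t1) = i" "fst (h t2) = i" | "fst (h t1) = j" "fst (h t2) = j"
      | "fst (h t1) = i" "fst (h t2) = j" | "fst (h t1) = j" "fst (h t2) = i"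
      | "fst (h t1) \<noteq> i" "fst (h t1) \<noteq> j" "fst (h t2) \<noteq> i" "fst (h t2) \<noteq> j"
      using lab[of t1] lab[of t2] t(3) by auto
    then show "t1 = t2"
    proof cases
      case 1
      have "s * (snd (h t1) - wx) = s * (snd (h t2) - wx)" using t(3) unfolding h'_i[OF 1(1)] h'_i[OF 1(2)] by simp
      then have "snd (h t1) = snd (h t2)" using s(1) by auto
      then show ?thesis using h_eq[OF t(1,2)] 1 by simp
    next
      case 2
      have "r * (snd (h t1) - wy) = r * (snd (h t2) - wy)" using t(3) unfolding h'_j[OF 2(1)] h'_j[OF 2(2)] by simp
      then have "snd (h t1) = snd (h t2)" using r(1) by auto
      then show ?thesis using h_eq[OF t(1,2)] 2 by simp
    next
      case 3 then show ?thesis using neg(1)[OF t(1)] pos1(1)[OF t(2)] t(3) by auto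
    next
      case 4 then show ?thesis using neg(1)[OF t(2)] pos1(1)[OF t(1)] t(3) by auto
    next
      case 5
      have "h t1 = h t2" using t(3) unfolding other[OF 5(1,2)] other[OF 5(3,4)] .
      from inj_onD[OF inj this t(1,2)] show ?thesis .
    qed
  qed
  have affine': "\<exists>\<delta>>0. \<exists>k s c. s \<noteq> 0 \<and> (\<forall>u\<in>L. \<bar>u - t\<bar> < \<delta> \<longrightarrow> h' u = (k, s * u + c))" if t: "t \<in> L" for t
  proof -
    obtain \<delta> k q c where a: "\<delta> > 0" "q \<noteq> 0" "\<forall>u\<in>L. \<bar>u - t\<bar> < \<delta> \<longrightarrow> h u = (k, q * u + c)" "h t = (k, q * t + c)"
      using affineE[OF t] .
    consider "k = i" | "k = j" | "k \<noteq> i" "k \<noteq> j" by blast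
    then show ?thesis
    proof cases
      case 1
      then have "\<forall>u\<in>L. \<bar>u - t\<bar> < \<delta> \<longrightarrow> h' u = (i, (s * q) * u + s * (c - wx))"
        using a(3) by (auto simp: h'_def algebra_simps)
      moreover have "s * q \<noteq> 0" using s(1) a(2) by auto
      ultimately show ?thesis using a(1) by blast
    next
      case 2
      then have "\<forall>u\<in>L. \<bar>u - t\<bar> < \<delta> \<longrightarrow> h' u = (i, (r * q) * u + (1 + r * (c - wy)))"
        using a(3) ij by (auto simp: h'_def algebra_simps)
      moreover have "r * q \<noteq> 0" using r(1) a(2) by auto
      ultimately show ?thesis using a(1) by blast
    next
      case 3
      then have "\<forall>u\<in>L. \<bar>u - t\<bar> < \<delta> \<longrightarrow> h' u = (k, q * u + c)" using a(3) by (auto simp: h'_def)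
      then show ?thesis using a(1,2) by blast
    qed
  qed
  interpret A: arrangement L h' using L inj' affine' by unfold_locales
  have one: "S t1 t2" if t: "t1 \<in> L" "t2 \<in> L" "fst (h' t1) = fst (h' t2)"
      and c: "consec (A.comp (fst (h' t1))) (snd (h' t1)) (snd (h' t2))" for t1 t2
  proof -
    note cd = consecD[OF c]
    have btw: False if u: "u \<in> L" "fst (h' u) = fst (h' t1)" "snd (h' t1) < snd (h' u)" "snd (h' u) < snd (h' t2)" for u
      using cd(4)[of "snd (h' u)"] A.comp_h[OF u(1)] u(2-4) by auto
    have nb: "S t1 t2" if same: "fst (h t1) = k" "fst (h t2) = k"
      and mono: "\<And>u v. u \<in> L \<Longrightarrow> v \<in> L \<Longrightarrow> fst (h u) = k \<Longrightarrow> fst (h v) = k \<Longrightarrow> snd (h' u) < snd (h' v) \<longleftrightarrow> q * snd (h u) < q * snd (h v)"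
      and lk: "\<And>u. fst (h u) = k \<Longrightarrow> fst (h' u) = fst (h' t1)" and q: "q = 1 \<or> q = (-1::real)" for k q
    proof -
      have "q * snd (h t1) < q * snd (h t2)" using mono[OF t(1,2) same] cd(3) by simp
      moreover have "\<not> (q * snd (h t1) < q * w \<and> q * w < q * snd (h t2))" if w: "w \<in> comp k" for w
      proof
        assume lt: "q * snd (h t1) < q * w \<and> q * w < q * snd (h t2)"
        obtain u where u: "u \<in> L" "h u = (k, w)" using compE[OF w] .
        then show False using btw[OF u(1) lk] mono[OF t(1) u(1) same(1)] mono[OF u(1) t(2) _ same(2)] lt by simp
      qed
      moreover have "snd (h t1) \<in> comp k" "snd (h t2) \<in> comp k" using comp_h t(1,2) same by metis+
      ultimately have "consec (comp k) (snd (h t1)) (snd (h t2)) \<or> consec (comp k) (snd (h t2)) (snd (h t1))"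
        using q unfolding consec_def by force
      then have "neighbours t1 t2" using t(1,2) same by (simp add: neighbours_def)
      then show ?thesis by (rule neighbours_matched)
    qed
    consider "fst (h t1) = i" "fst (h t2) = i" | "fst (h t1) = j" "fst (h t2) = j"
      | "fst (h t1) = i" "fst (h t2) = j" | "fst (h t1) = j" "fst (h t2) = i"
      | "fst (h t1) \<noteq> i" "fst (h t1) \<noteq> j" "fst (h t2) = fst (h t1)"
      using lab[of t1] lab[of t2] t(3) other[of t1] other[of t2] by metis
    then show ?thesis
    proof cases
      case 1
      show ?thesis by (rule nb[OF 1 _ _ s(1)]) (simp_all add: h'_i 1 right_diff_distrib)
    next
      case 2
      show ?thesis by (rule nb[OF 2 _ _ r(1)]) (simp_all add: h'_j 2 right_diff_distrib)
    next
      case 3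
      have l: "fst (h' t1) = i" using lab 3 by blast
      have "h' x = (i, 0)" "h' y = (i, 1)" using hx ij by (auto simp: h'_def)
      then have "snd (h' t1) = 0" "snd (h' t2) = 1"
        using btw[OF L2(1)] btw[OF L2(2)] l neg(1)[OF t(1) 3(1)] pos1(1)[OF t(2) 3(2)] by force+
      then have "h' t1 = h' x" "h' t2 = h' y"
        using \<open>h' x = (i, 0)\<close> \<open>h' y = (i, 1)\<close> l t(3) by (simp_all add: prod_eq_iff)
      then have "t1 = x" "t2 = y" using inj' t(1,2) L2 by (auto dest: inj_onD)
      then show ?thesis using xy(1) by simp
    next
      case 4
      then show ?thesis using pos1(1)[OF t(1)] neg(1)[OF t(2)] cd(3) by auto
    next
      case 5
      have e: "h' u = h u" if "fst (h u) = fst (h t1)" for u using other that 5 by simp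
      show ?thesis by (rule nb[of "fst (h t1)" 1]) (use 5 e in auto)
    qed
  qed
  have "fst ` h' ` L \<subseteq> labels - {j}"
  proof
    fix k assume "k \<in> fst ` h' ` L"
    then obtain t where t: "t \<in> L" "k = fst (h' t)" by auto
    have iL: "i \<in> labels" using L2(1) hx(1) unfolding labels_def by force
    show "k \<in> labels - {j}"
    proof (cases "fst (h t) = i \<or> fst (h t) = j")
      case True
      then have "k = i" using lab[of t] t(2) by simp
      then show ?thesis using iL ij by simp
    next
      case False then show ?thesis using other t by (auto simp: labels_def)
    qed
  qed
  moreover have "j \<in> labels" using L2(2) hx(2) unfolding labels_def by force
  ultimately have less: "fst ` h' ` L \<subset> labels" by blast
  have fin: "finite (fst ` h' ` L)" using less finite_labels by (meson finite_subset psubset_imp_subset)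
  have "matched_arrangement L h' S"
  proof unfold_locales
    show "finite A.labels" using fin by (simp add: A.labels_def)
    show "S t1 t2" if n: "A.neighbours t1 t2" for t1 t2
      using one[of t1 t2] one[of t2 t1] n S_sym unfolding A.neighbours_def by metis
  qed (use S_sym S_unique S_in S_irrefl S_end in blast)+
  then show ?thesis using psubset_card_mono[OF finite_labels less] by blast
qed

text \<open>Used to number the components from \<open>0\<close> and to shrink them to less than one turn of
  a circle.\<close>
lemma relabel:
  assumes \<iota>: "inj_on \<iota> labels" and \<kappa>: "\<kappa> > 0"
  shows "matched_arrangement L (\<lambda>t. (\<iota> (fst (h t)), \<kappa> * snd (h t))) S"
proof -
  let ?h = "\<lambda>t. (\<iota> (fst (h t)), \<kappa> * snd (h t))"
  have lab: "\<iota> (fst (h t)) = \<iota> (fst (h u)) \<longleftrightarrow> fst (h t) = fst (h u)" if "t \<in> L" "u \<in> L" for t u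
    using \<iota> that unfolding labels_def by (auto dest: inj_onD)
  interpret A: arrangement L ?h
  proof
    show "inj_on ?h L" by (rule inj_onI) (use lab \<kappa> in \<open>auto intro: h_eq\<close>)
    fix t assume t: "t \<in> L"
    obtain \<delta> k q c where a: "\<delta> > 0" "q \<noteq> 0" "\<forall>u\<in>L. \<bar>u - t\<bar> < \<delta> \<longrightarrow> h u = (k, q * u + c)" "h t = (k, q * t + c)"
      using affineE[OF t] .
    have "\<forall>u\<in>L. \<bar>u - t\<bar> < \<delta> \<longrightarrow> ?h u = (\<iota> k, (\<kappa> * q) * u + \<kappa> * c)" using a(3) by (auto simp: algebra_simps)
    moreover have "\<kappa> * q \<noteq> 0" using \<kappa> a(2) by simp
    ultimately show "\<exists>\<delta>>0. \<exists>k s c. s \<noteq> 0 \<and> (\<forall>y\<in>L. \<bar>y - t\<bar> < \<delta> \<longrightarrow> ?h y = (k, s * y + c))" using a(1) by blast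
  qed (rule L)
  have comp: "A.comp (\<iota> (fst (h t))) = (*) \<kappa> ` comp (fst (h t))" if t: "t \<in> L" for t
  proof
    show "A.comp (\<iota> (fst (h t))) \<subseteq> (*) \<kappa> ` comp (fst (h t))"
    proof
      fix w assume "w \<in> A.comp (\<iota> (fst (h t)))"
      then obtain u where u: "u \<in> L" "?h u = (\<iota> (fst (h t)), w)" by (rule A.compE)
      then have "fst (h u) = fst (h t)" using lab t by simp
      then show "w \<in> (*) \<kappa> ` comp (fst (h t))" using u comp_h[OF u(1)] by auto
    qed
    show "(*) \<kappa> ` comp (fst (h t)) \<subseteq> A.comp (\<iota> (fst (h t)))"
    proof
      fix w assume "w \<in> (*) \<kappa> ` comp (fst (h t))"
      then obtain v where v: "v \<in> comp (fst (h t))" "w = \<kappa> * v" by auto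
      obtain u where u: "u \<in> L" "h u = (fst (h t), v)" using compE[OF v(1)] .
      then show "w \<in> A.comp (\<iota> (fst (h t)))" using A.comp_h[OF u(1)] v(2) by simp
    qed
  qed
  have cons: "consec ((*) \<kappa> ` M) (\<kappa> * a) (\<kappa> * b) \<longleftrightarrow> consec M a b" for M a b
  proof
    assume c: "consec ((*) \<kappa> ` M) (\<kappa> * a) (\<kappa> * b)"
    have ab: "a \<in> M" "b \<in> M" "a < b" using consecD(1-3)[OF c] \<kappa> by auto
    have "\<not> (a < x \<and> x < b)" if "x \<in> M" for x using consecD(4)[OF c imageI[OF that]] \<kappa> by auto
    then have "{a<..<b} \<inter> M = {}" by auto
    then show "consec M a b" using ab by (simp add: consec_def)
  next
    assume "consec M a b"
    then show "consec ((*) \<kappa> ` M) (\<kappa> * a) (\<kappa> * b)" using \<kappa> unfolding consec_def by auto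
  qed
  have nb: "A.neighbours x y \<longleftrightarrow> neighbours x y" for x y
    unfolding A.neighbours_def neighbours_def using lab comp cons by auto
  show ?thesis
  proof unfold_locales
    show "finite A.labels"
    proof -
      have "A.labels = \<iota> ` labels" unfolding A.labels_def labels_def by (simp add: image_image)
      then show ?thesis using finite_labels by simp
    qed
  qed (use S_sym S_unique S_in S_irrefl S_end neighbours_matched nb in blast)+
qed

end

section \<open>Arrangements with the least number of components\<close>

context matched_arrangement
begin

lemma S_L: "S x y \<Longrightarrow> x \<in> L \<and> y \<in> L"
  using S_in S_sym by blast

lemma glued_label: "glued x y \<Longrightarrow> fst (h x) = fst (h y)"
  by (auto simp: glued_def neighbours_def)

lemma glued_in: "glued x y \<Longrightarrow> x \<in> L \<and> y \<in> L"
  by (auto simp: glued_def neighbours_def)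

text \<open>With the least number of components, no end of a component is matched with a point of another
  component, since the two components could be merged.\<close>
lemma minimal_glued:
  assumes min: "\<And>h'. matched_arrangement L h' S \<Longrightarrow> card labels \<le> card (fst ` h' ` L)" and xy: "S x y"
  shows "glued x y"
proof -
  have L2: "x \<in> L" "y \<in> L" "S y x" "x \<noteq> y" using S_L xy S_sym S_irrefl by blast+
  show ?thesis
  proof (cases "(\<exists>z. neighbours x z) \<or> (\<exists>z. neighbours y z)")
    case True
    then have "neighbours x y \<or> neighbours y x" using neighbours_matched S_unique xy L2(3) by metis
    then show ?thesis using neighbours_sym by (auto simp: glued_def)
  next
    case False
    obtain b b' where b: "cadj L x b" "cadj L y b'" using S_end xy L2(3) by blast
    then have e: "is_end x" "is_end y" using end_or_neighbour[OF L2(1) b(1)] end_or_neighbour[OF L2(2) b(2)] False by blast+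
    have "fst (h x) = fst (h y)"
    proof (rule ccontr)
      assume "fst (h x) \<noteq> fst (h y)"
      from merge[OF xy this e] show False using min by (meson leD)
    qed
    then show ?thesis using e L2 by (simp add: glued_def)
  qed
qed

context
  fixes \<phi>
  assumes min: "\<And>h'. matched_arrangement L h' S \<Longrightarrow> card labels \<le> card (fst ` h' ` L)"
    and \<phi>: "PH L \<phi>" and S\<phi>: "\<And>x y. S (\<phi> x) (\<phi> y) \<longleftrightarrow> S x y"
begin

lemma \<phi>L: "x \<in> L \<Longrightarrow> \<phi> x \<in> L"
  using \<phi> by (simp add: PH_def permutes_in_image)

text \<open>Neighbours in a component are matched, their images are matched, and matched points lie in one
  component. So the component of \<open>\<phi> x\<close> is a locally constant function of
  \<open>x\<close> that agrees across all gaps of the component of \<open>x\<close>.\<close>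
lemma same_component:
  assumes xy: "x \<in> L" "y \<in> L" "fst (h x) = fst (h y)"
  shows "fst (h (\<phi> x)) = fst (h (\<phi> y))"
proof -
  define k where "k = fst (h x)"
  define g where "g w = the_inv_into L h (k, w)" for w
  have g: "g (snd (h t)) = t" if t: "t \<in> L" "fst (h t) = k" for t
  proof -
    have "(k, snd (h t)) = h t" using t(2) by (simp add: prod_eq_iff)
    then show ?thesis unfolding g_def using the_inv_into_f_f[OF inj t(1)] by simp
  qed
  have cont: "continuous_on L \<phi>" using \<phi> by (simp add: PH_def)
  have "fst (h (\<phi> (g (snd (h x))))) = fst (h (\<phi> (g (snd (h y)))))"
  proof (rule constant_across_gaps[OF compact_comp[of k], where c = "\<lambda>v. fst (h (\<phi> (g v)))" and x = "snd (h x)" and y = "snd (h y)"])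
    fix w assume "w \<in> comp k"
    then obtain t where t: "t \<in> L" "h t = (k, w)" by (rule compE)
    obtain d where d: "d > 0" "\<forall>u\<in>L. \<bar>u - \<phi> t\<bar> < d \<longrightarrow> fst (h u) = fst (h (\<phi> t))"
      using label_locally_constant[OF \<phi>L[OF t(1)]] by blast
    obtain e where e: "e > 0" "\<And>u. u \<in> L \<Longrightarrow> \<bar>u - t\<bar> < e \<Longrightarrow> \<bar>\<phi> u - \<phi> t\<bar> < d"
      using continuous_at_bound[OF cont t(1) d(1)] by metis
    obtain \<eta> where eta: "\<eta> > 0" "\<forall>u\<in>L. fst (h u) = fst (h t) \<longrightarrow> \<bar>snd (h u) - snd (h t)\<bar> < \<eta> \<longrightarrow> \<bar>u - t\<bar> < e"
      using inverse_near[OF t(1) e(1)] by blast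
    have "fst (h (\<phi> (g v))) = fst (h (\<phi> (g w)))" if v: "v \<in> comp k" "\<bar>v - w\<bar> < \<eta>" for v
    proof -
      obtain u where u: "u \<in> L" "h u = (k, v)" using compE[OF v(1)] .
      have "\<bar>u - t\<bar> < e" using eta(2) u t v(2) by simp
      then have "fst (h (\<phi> u)) = fst (h (\<phi> t))" using d(2) e(2) \<phi>L u(1) by blast
      moreover have "g v = u" "g w = t" using g[OF u(1)] g[OF t(1)] u t by auto
      ultimately show ?thesis by simp
    qed
    then show "\<exists>\<delta>>0. \<forall>v\<in>comp k. \<bar>v - w\<bar> < \<delta> \<longrightarrow> fst (h (\<phi> (g v))) = fst (h (\<phi> (g w)))" using eta(1) by blast
  next
    fix p q assume c: "consec (comp k) p q"
    obtain t where t: "t \<in> L" "h t = (k, p)" using compE[OF consecD(1)[OF c]] .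
    obtain u where u: "u \<in> L" "h u = (k, q)" using compE[OF consecD(2)[OF c]] .
    have "neighbours t u" using t u c by (simp add: neighbours_def)
    then have "S (\<phi> t) (\<phi> u)" using neighbours_matched S\<phi> by blast
    then have "fst (h (\<phi> t)) = fst (h (\<phi> u))" using minimal_glued[OF min] glued_label by blast
    moreover have "g p = t" "g q = u" using g[OF t(1)] g[OF u(1)] u t by auto
    ultimately show "fst (h (\<phi> (g p))) = fst (h (\<phi> (g q)))" by simp
  next
    show "snd (h x) \<in> comp k" "snd (h y) \<in> comp k" using comp_h[OF xy(1)] comp_h[OF xy(2)] xy(3) by (simp_all add: k_def)
  qed
  then show ?thesis using g[OF xy(1)] g[OF xy(2)] xy(3) by (simp add: k_def)
qed

text \<open>Matched points have matched images. The remaining glued points are the two ends of a component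
  when these are unmatched; their images are unmatched points with a neighbour in
  \<open>L\<close>, hence ends, and lie in one component.\<close>
lemma glued_preserved:
  assumes g: "glued x y" shows "glued (\<phi> x) (\<phi> y)"
proof (cases "S x y")
  case True
  then show ?thesis using S\<phi> minimal_glued[OF min] by blast
next
  case False
  then have "\<not> neighbours x y" using neighbours_matched by blast
  then have e: "x \<in> L" "y \<in> L" "x \<noteq> y" "fst (h x) = fst (h y)" "is_end x" "is_end y" using g by (auto simp: glued_def)
  have p: "\<phi> permutes L" using \<phi> by (simp add: PH_def)
  have inv1: "\<phi> (finv \<phi> z) = z" for z using p by (simp add: permutes_inverses)
  have unmatched: "\<not> S t z" if t: "t \<in> L" "u \<in> L" "t \<noteq> u" "fst (h t) = fst (h u)" "is_end t" "is_end u" "\<not> S t u" for t u z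
  proof
    assume s: "S t z"
    then have gz: "glued t z" using minimal_glued[OF min, of t z] by blast
    moreover have "\<not> neighbours t z" using end_not_neighbour t(5) by blast
    ultimately have "z \<in> L" "t \<noteq> z" "fst (h t) = fst (h z)" "is_end z" by (auto simp: glued_def)
    then have "u = z" using ends_pair[OF t(1,2) _ t(4) _ t(5,6)] t(3) by blast
    then show False using s t(7) by simp
  qed
  have unm: "\<not> S x z" "\<not> S y z" for z
    using unmatched[OF e(1,2,3,4,5,6) False] unmatched[OF e(2,1) _ _ e(6,5)] e(3,4) False S_sym by metis+
  have unm': "\<not> S (\<phi> x) z" "\<not> S (\<phi> y) z" for z
    using unm[of "finv \<phi> z"] S\<phi>[of x "finv \<phi> z"] S\<phi>[of y "finv \<phi> z"] inv1 by auto
  have "is_end (\<phi> t)" if t: "t \<in> L" "is_end t" "\<And>z. \<not> S (\<phi> t) z" for t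
  proof -
    obtain b where "cadj L t b" using end_one_sided[OF t(1,2)] by blast
    then obtain c where "cadj L (\<phi> t) c" using PH_endpoint[OF L \<phi>] by blast
    then show ?thesis using end_or_neighbour[OF \<phi>L[OF t(1)]] neighbours_matched t(3) by blast
  qed
  then have "is_end (\<phi> x)" "is_end (\<phi> y)" using e unm' by blast+
  moreover have "\<phi> x \<noteq> \<phi> y" using e(3) permutes_inj[OF p] by (simp add: inj_eq)
  moreover have "fst (h (\<phi> x)) = fst (h (\<phi> y))" using same_component e by blast
  ultimately show ?thesis using \<phi>L e by (simp add: glued_def)
qed

end

end

section \<open>The gaps of compact subsets of several circles\<close>

text \<open>Each \<open>M i\<close> is wound onto a circle of its own. It is shorter than one turn, so one
  further arc leads from its last point to its first.\<close>
locale circle_family =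
  fixes n :: nat and M :: "nat \<Rightarrow> real set"
  assumes M: "\<And>i. i < n \<Longrightarrow> compact (M i)" "\<And>i. i < n \<Longrightarrow> infinite (M i)" "\<And>i. i < n \<Longrightarrow> M i \<subseteq> {-1<..<1}"
begin

lemma arc_set_M: assumes i: "i < n" shows "arc_set (M i)"
proof
  have ne: "M i \<noteq> {}" using M(2)[OF i] by auto
  note b = compact_Inf_Sup[OF M(1)[OF i] ne]
  show "M i \<noteq> {}" "compact (M i)" using ne M(1)[OF i] by auto
  show "Inf (M i) < Sup (M i)"
  proof (rule ccontr)
    assume "\<not> ?thesis"
    then have "x = Inf (M i)" if "x \<in> M i" for x using b(3,4)[OF that] by simp
    then have "M i \<subseteq> {Inf (M i)}" by blast
    then show False using M(2)[OF i] finite_subset by blast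
  qed
  show "Sup (M i) < Inf (M i) + 2 * pi" 
  proof -
    have "-1 < Inf (M i)" "Sup (M i) < 1" using b(1,2) M(3)[OF i] by auto
    then show ?thesis using pi_gt3 by linarith
  qed
qed

definition on_circle :: "nat \<Rightarrow> (real \<Rightarrow> real) \<Rightarrow> real \<Rightarrow> nat \<times> complex"
  where "on_circle i \<gamma> t = (i, cis (\<gamma> t))"

definition base :: "(nat \<times> complex) set" where "base = (\<Union>i<n. {i} \<times> cis ` M i)"

text \<open>The gap system of the union: the arcs that fill the gaps of each \<open>M i\<close>, the outer
  one included.\<close>
definition arcs :: "(real \<Rightarrow> nat \<times> complex) set"
  where "arcs = (\<Union>i<n. on_circle i ` segs (arc_set.turn (M i)))"

lemma arcsE:
  assumes "\<gamma> \<in> arcs"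
  obtains i p q where "i < n" "\<gamma> = on_circle i (seg p q)" "consec (arc_set.turn (M i)) p q \<or> consec (arc_set.turn (M i)) q p"
  using assms unfolding arcs_def segs_def by blast

lemma arcsI: "i < n \<Longrightarrow> consec (arc_set.turn (M i)) p q \<or> consec (arc_set.turn (M i)) q p \<Longrightarrow> on_circle i (seg p q) \<in> arcs"
  unfolding arcs_def segs_def by blast

lemma on_circle_rev: "(\<lambda>t. on_circle i (seg p q) (1 - t)) = on_circle i (seg q p)"
  by (rule ext) (simp add: on_circle_def seg_def algebra_simps)

lemma seg_inside:
  assumes i: "i < n" and c: "consec (arc_set.turn (M i)) p q \<or> consec (arc_set.turn (M i)) q p" and t: "0 < t" "t < 1"
  shows "Inf (M i) < seg p q t" "seg p q t < Inf (M i) + 2 * pi"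
proof -
  interpret arc_set "M i" by (rule arc_set_M[OF i])
  have ne: "p \<noteq> q" using c by (auto dest: consecD(3))
  have "Inf (M i) \<le> min p q" "max p q \<le> Inf (M i) + 2 * pi"
    using c consec_turn_bounds[of p q] consec_turn_bounds[of q p] by (auto simp: min_def max_def)
  then show "Inf (M i) < seg p q t" "seg p q t < Inf (M i) + 2 * pi" using seg_between[OF t ne] by linarith+
qed

text \<open>The first point of \<open>M i\<close> is the only one that occurs at two angles of the turn. It
  cannot be joined to one point in two ways, since \<open>M i\<close> has more than two points.\<close>
lemma ends_determine:
  assumes i: "i < n" and c: "consec (arc_set.turn (M i)) p q \<or> consec (arc_set.turn (M i)) q p"
    and c': "consec (arc_set.turn (M i)) p' q' \<or> consec (arc_set.turn (M i)) q' p'"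
    and e: "cis p = cis p'" "cis q = cis q'"
  shows "p = p' \<and> q = q'"
proof -
  interpret arc_set "M i" by (rule arc_set_M[OF i])
  let ?a = "Inf (M i)" and ?b = "Inf (M i) + 2 * pi"
  have rng: "p \<in> {?a..?b}" "q \<in> {?a..?b}" "p' \<in> {?a..?b}" "q' \<in> {?a..?b}"
    using c c' consec_turn_bounds(1-3)[of p q] consec_turn_bounds(1-3)[of q p]
      consec_turn_bounds(1-3)[of p' q'] consec_turn_bounds(1-3)[of q' p'] by auto
  have nSup: "\<not> consec (M i) ?a (Sup (M i))"
  proof
    assume "consec (M i) ?a (Sup (M i))"
    then have "x = ?a \<or> x = Sup (M i)" if "x \<in> M i" for x
      using consecD(4)[of "M i" ?a "Sup (M i)" x] Inf_Sup(3,4)[OF that] that by auto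
    then have "M i \<subseteq> {?a, Sup (M i)}" by blast
    then show False using M(2)[OF i] finite_subset by blast
  qed
  have low: "v = Sup (M i)" if "consec turn u v \<or> consec turn v u" "u = ?b" for u v
    using that consec_turn consecD(2)[of "M i" v ?b] Inf_Sup(4)[of ?b] Sup_less Inf_Sup(3)
    by (metis consec_turn_bounds(2,3) consecD(1) linorder_not_less order_less_irrefl)
  have up: "consec (M i) ?a v" if "consec turn u v \<or> consec turn v u" "u = ?a" for u v
    using that consec_turn Inf_less consec_turn_bounds(1,2) by (metis linorder_not_less order_less_irrefl)
  have key: False if h: "consec turn u v \<or> consec turn v u" "u = ?a" "consec turn u' v' \<or> consec turn v' u'" "u' = ?b" "cis v = cis v'" for u v u' v'
  proof -
    have v: "consec (M i) ?a v" "v' = Sup (M i)" using up[OF h(1,2)] low[OF h(3,4)] by auto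
    have vM: "v \<in> M i" using consecD(2)[OF v(1)] .
    then have "v = Sup (M i)"
      using cis_turn_cases[of v v'] h(5) v(2) Inf_Sup(3,4)[OF vM] Inf_Sup(2) Sup_less Inf_less consecD(3)[OF v(1)] by auto
    then show False using v(1) nSup by simp
  qed
  have "p = p'"
    using cis_turn_cases[OF e(1) rng(1,3)] key[OF c _ c' _ e(2)] key[OF c' _ c _ e(2)[symmetric]] by blast
  moreover have "q = q'"
    using cis_turn_cases[OF e(2) rng(2,4)] key[of q p q' p'] key[of q' p' q p] c c' e(1) by metis
  ultimately show ?thesis by blast
qed

lemma base_ends:
  assumes i: "i < n" and c: "consec (arc_set.turn (M i)) p q \<or> consec (arc_set.turn (M i)) q p"
  shows "(i, cis p) \<in> base"
proof -
  interpret arc_set "M i" by (rule arc_set_M[OF i])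
  have "cis p \<in> cis ` M i" using c consec_turn_bounds(5,6) by blast
  then show ?thesis using i by (auto simp: base_def)
qed

lemma gap_system_arcs: "gap_system base arcs"
  unfolding gap_system_def
proof (intro conjI ballI allI impI)
  show "compact base" unfolding base_def
    using M(1) by (intro compact_UN compact_Times compact_continuous_image continuous_intros) auto
next
  fix \<gamma> assume "\<gamma> \<in> arcs"
  then obtain i p q where g: "i < n" "\<gamma> = on_circle i (seg p q)" "consec (arc_set.turn (M i)) p q \<or> consec (arc_set.turn (M i)) q p"
    by (rule arcsE)
  interpret arc_set "M i" by (rule arc_set_M[OF g(1)])
  have ne: "p \<noteq> q" using g(3) by (auto dest: consecD(3))
  show "continuous_on {0..1} \<gamma>" unfolding g(2) on_circle_def
    by (intro continuous_intros seg_continuous)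
  show "\<gamma> 0 \<in> base" "\<gamma> 1 \<in> base" using base_ends[OF g(1)] g(2,3) by (auto simp: on_circle_def)
  show "(\<lambda>t. \<gamma> (1 - t)) \<in> arcs" unfolding g(2) on_circle_rev using g(1,3) by (auto intro: arcsI)
  show "inj_on \<gamma> {0..1}"
  proof (rule inj_onI)
    fix s t :: real assume st: "s \<in> {0..1}" "t \<in> {0..1}" "\<gamma> s = \<gamma> t"
    have b: "max p q < min p q + 2 * pi"
      using g(3) consec_turn_bounds(2,4)[of p q] consec_turn_bounds(2,4)[of q p] by (auto simp: min_def max_def)
    have r: "min p q \<le> seg p q t \<and> seg p q t \<le> max p q" if "t \<in> {0..1}" for t
    proof -
      have "t = 0 \<or> t = 1 \<or> (0 < t \<and> t < 1)" using that by force
      then show ?thesis using seg_between[of t p q] ne by (auto simp: less_imp_le)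
    qed
    have "cis (seg p q s) = cis (seg p q t)" using st(3) g(2) by (simp add: on_circle_def)
    then have "seg p q s = seg p q t"
      by (rule cis_inj[of _ _ "max p q"]) (use r[OF st(1)] r[OF st(2)] b in auto)
    then show "s = t" using seg_inj[OF ne] by (simp add: inj_eq)
  qed
  fix t :: real assume t: "t \<in> {0<..<1}"
  have "cis (seg p q t) \<notin> cis ` M i"
  proof -
    have "seg p q t \<in> {min p q<..<max p q}" using seg_between[of t p q] t ne by auto
    moreover have "consec turn (min p q) (max p q)" using g(3) by (auto simp: min_def max_def dest: consecD(3))
    ultimately show ?thesis using gap_arc_avoids by blast
  qed
  then show "\<gamma> t \<notin> base" by (auto simp: g(2) on_circle_def base_def)
next
  fix \<gamma> \<gamma>' and s t :: real
  assume h: "\<gamma> \<in> arcs" "\<gamma>' \<in> arcs" "s \<in> {0<..<1}" "t \<in> {0<..<1}" "\<gamma> s = \<gamma>' t"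
  obtain i p q where g: "i < n" "\<gamma> = on_circle i (seg p q)" "consec (arc_set.turn (M i)) p q \<or> consec (arc_set.turn (M i)) q p"
    using arcsE[OF h(1)] .
  obtain j p' q' where g': "j < n" "\<gamma>' = on_circle j (seg p' q')" "consec (arc_set.turn (M j)) p' q' \<or> consec (arc_set.turn (M j)) q' p'"
    using arcsE[OF h(2)] .
  have ij: "j = i" and ce: "cis (seg p q s) = cis (seg p' q' t)" using h(5) g(2) g'(2) by (auto simp: on_circle_def)
  have c': "consec (arc_set.turn (M i)) p' q' \<or> consec (arc_set.turn (M i)) q' p'" using g'(3) ij by simp
  interpret arc_set "M i" by (rule arc_set_M[OF g(1)])
  have "seg p q s = seg p' q' t"
    using ce by (rule cis_inj[of _ _ "Inf (M i) + 2 * pi"])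
      (use seg_inside[OF g(1,3), of s] seg_inside[OF g(1) c', of t] h(3,4) in auto)
  moreover have "seg p q \<in> segs turn" "seg p' q' \<in> segs turn" using g(3) c' unfolding segs_def by blast+
  moreover have "compact turn" unfolding turn_def using compact_L by (rule compact_insert)
  ultimately have "(seg p' q' = seg p q \<and> t = s) \<or> (seg p' q' = (\<lambda>t. seg p q (1 - t)) \<and> t = 1 - s)"
    using segs_gap_system[of turn] h(3,4) unfolding gap_system_def by blast
  then show "\<gamma>' = \<gamma> \<and> t = s \<or> \<gamma>' = (\<lambda>t. \<gamma> (1 - t)) \<and> t = 1 - s"
    unfolding g(2) g'(2) ij on_circle_rev seg_rev by auto
next
  fix \<gamma> \<gamma>' assume h: "\<gamma> \<in> arcs" "\<gamma>' \<in> arcs" "\<gamma> 0 = \<gamma>' 0 \<and> \<gamma> 1 = \<gamma>' 1"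
  obtain i p q where g: "i < n" "\<gamma> = on_circle i (seg p q)" "consec (arc_set.turn (M i)) p q \<or> consec (arc_set.turn (M i)) q p"
    using arcsE[OF h(1)] .
  obtain j p' q' where g': "j < n" "\<gamma>' = on_circle j (seg p' q')" "consec (arc_set.turn (M j)) p' q' \<or> consec (arc_set.turn (M j)) q' p'"
    using arcsE[OF h(2)] .
  have ij: "j = i" and ce: "cis p = cis p'" "cis q = cis q'" using h(3) g(2) g'(2) by (auto simp: on_circle_def)
  show "\<gamma> = \<gamma>'" using ends_determine[OF g(1,3) _ ce] g'(3) g(2) g'(2) ij by simp
next
  fix e :: real assume e: "0 < e"
  \<comment> \<open>All angles in question lie between \<open>-1\<close> and \<open>1 + 2 * pi\<close>.\<close>
  have "\<exists>d>0. \<forall>x y. x \<in> {-10..10} \<longrightarrow> y \<in> {-10..10} \<longrightarrow> dist x y < d \<longrightarrow> dist (cis x) (cis y) < e"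
  proof -
    have "uniformly_continuous_on {-10..10::real} cis"
      by (rule compact_uniformly_continuous) (auto intro: continuous_intros)
    then show ?thesis using e unfolding uniformly_continuous_on_def by (metis dist_commute)
  qed
  then obtain d where d: "d > 0" "\<And>x y. x \<in> {-10..10} \<Longrightarrow> y \<in> {-10..10} \<Longrightarrow> dist x y < d \<Longrightarrow> dist (cis x) (cis y) < e" by blast
  have "{\<gamma>\<in>arcs. \<exists>t\<in>{0..1}. e \<le> dist (\<gamma> 0) (\<gamma> t)} \<subseteq>
      (\<Union>i<n. on_circle i ` {\<gamma>\<in>segs (arc_set.turn (M i)). \<exists>t\<in>{0..1}. d \<le> dist (\<gamma> 0) (\<gamma> t)})"
  proof
    fix \<gamma> assume "\<gamma> \<in> {\<gamma>\<in>arcs. \<exists>t\<in>{0..1}. e \<le> dist (\<gamma> 0) (\<gamma> t)}"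
    then have a: "\<gamma> \<in> arcs" and "\<exists>t\<in>{0..1}. e \<le> dist (\<gamma> 0) (\<gamma> t)" by auto
    then obtain t where t: "t \<in> {0..1}" "e \<le> dist (\<gamma> 0) (\<gamma> t)" by blast
    obtain i p q where g: "i < n" "\<gamma> = on_circle i (seg p q)" "consec (arc_set.turn (M i)) p q \<or> consec (arc_set.turn (M i)) q p"
      using arcsE[OF a] .
    interpret arc_set "M i" by (rule arc_set_M[OF g(1)])
    have I: "-1 < Inf (M i)" "Inf (M i) < 1" using M(3)[OF g(1)] Inf_Sup(1) by auto
    have pq: "Inf (M i) \<le> p" "p \<le> Inf (M i) + 2 * pi" "Inf (M i) \<le> q" "q \<le> Inf (M i) + 2 * pi"
      using g(3) consec_turn_bounds(1-3)[of p q] consec_turn_bounds(1-3)[of q p] by auto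
    have ne: "p \<noteq> q" using g(3) by (auto dest: consecD(3))
    have st: "Inf (M i) \<le> seg p q t" "seg p q t \<le> Inf (M i) + 2 * pi"
    proof -
      have "t = 0 \<or> t = 1 \<or> (0 < t \<and> t < 1)" using t(1) by force
      then show "Inf (M i) \<le> seg p q t" "seg p q t \<le> Inf (M i) + 2 * pi"
        using pq seg_inside[OF g(1,3), of t] by auto
    qed
    have "\<not> dist p (seg p q t) < d"
    proof
      assume "dist p (seg p q t) < d"
      then have "dist (cis p) (cis (seg p q t)) < e" using d(2) I pq st pi_less_4 by force
      then show False using t(2) g(2) by (simp add: on_circle_def dist_Pair_Pair)
    qed
    then have "\<exists>t\<in>{0..1}. d \<le> dist (seg p q 0) (seg p q t)" using t(1) by (intro bexI[of _ t]) auto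
    moreover have "seg p q \<in> segs turn" using g(3) unfolding segs_def by blast
    ultimately show "\<gamma> \<in> (\<Union>i<n. on_circle i ` {\<gamma>\<in>segs (arc_set.turn (M i)). \<exists>t\<in>{0..1}. d \<le> dist (\<gamma> 0) (\<gamma> t)})"
      using g(1,2) by blast
  qed
  moreover have fin: "finite {\<gamma>\<in>segs (arc_set.turn (M i)). \<exists>t\<in>{0..1}. d \<le> dist (\<gamma> 0) (\<gamma> t)}" if i: "i < n" for i
  proof -
    interpret arc_set "M i" by (rule arc_set_M[OF i])
    have "compact turn" unfolding turn_def using compact_L by (rule compact_insert)
    then show ?thesis using segs_gap_system[of turn] d(1) unfolding gap_system_def by blast
  qed
  moreover have "finite (\<Union>i<n. on_circle i ` {\<gamma>\<in>segs (arc_set.turn (M i)). \<exists>t\<in>{0..1}. d \<le> dist (\<gamma> 0) (\<gamma> t)})"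
    by (intro finite_UN_I finite_imageI fin) auto
  ultimately show "finite {\<gamma>\<in>arcs. \<exists>t\<in>{0..1}. e \<le> dist (\<gamma> 0) (\<gamma> t)}" using finite_subset by blast
qed

lemma filled_arcs: "filled base arcs = multicircle n"
proof
  show "filled base arcs \<subseteq> multicircle n"
    unfolding filled_def base_def arcs_def multicircle_def on_circle_def by auto
  show "multicircle n \<subseteq> filled base arcs"
  proof
    fix y assume "y \<in> multicircle n"
    then obtain i z where iz: "y = (i, z)" "i < n" "z \<in> circle" by (auto simp: multicircle_def)
    interpret arc_set "M i" by (rule arc_set_M[OF iz(2)])
    obtain t where t: "Inf (M i) + 2 * pi - 2 * pi < t" "t \<le> Inf (M i) + 2 * pi" "z = cis t"
      using circle_angle[OF iz(3)] by blast
    have ct: "compact turn" unfolding turn_def using compact_L by (rule compact_insert)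
    have sub: "turn \<subseteq> {Inf (M i)..Inf (M i) + 2 * pi}"
    proof
      fix x assume "x \<in> turn"
      then have "x = Inf (M i) + 2 * pi \<or> x \<in> M i" by (auto simp: turn_def)
      then show "x \<in> {Inf (M i)..Inf (M i) + 2 * pi}" using Inf_Sup(3,4)[of x] Sup_less by auto
    qed
    have "filled turn (segs turn) = {Inf (M i)..Inf (M i) + 2 * pi}"
      by (rule filled_segs[OF ct _ _ sub]) (use Inf_Sup(1) in \<open>auto simp: turn_def\<close>)
    then have "t \<in> filled turn (segs turn)" using t by simp
    then consider "t \<in> turn" | \<gamma> s where "\<gamma> \<in> segs turn" "s \<in> {0..1}" "t = \<gamma> s" unfolding filled_def by blast
    then show "y \<in> filled base arcs"
    proof cases
      case 1
      then have "cis t \<in> cis ` M i" using Inf_Sup(1) by (auto simp: turn_def)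
      then show ?thesis using iz t(3) by (auto simp: filled_def base_def)
    next
      case (2 \<gamma> s)
      have "on_circle i \<gamma> \<in> arcs" using 2(1) iz(2) by (auto simp: arcs_def)
      moreover have "y = on_circle i \<gamma> s" using iz t(3) 2(3) by (simp add: on_circle_def)
      ultimately show ?thesis using 2(2) unfolding filled_def by blast
    qed
  qed
qed

end

section \<open>Bounded discontinuities give a multihomeomorphism\<close>

context circle_cantor
begin

text \<open>Cutting \<open>L\<close> at the finitely many unstable gaps gives a first arrangement.\<close>
lemma initial_arrangement:
  assumes \<phi>: "PH L \<phi>" and fin: "finite (matching_map.unstable (cadj L) \<phi>)"
  shows "\<exists>h. matched_arrangement L h (matching_map.stable (cadj L) \<phi>)"
proof -
  interpret matching_map "cadj L" \<phi> by (rule matching_map_cadj[OF \<phi>])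
  let ?P = "{(a, b). consec L a b \<and> \<not> stable a b}"
  define Z where "Z = (\<lambda>(a, b). (a + b) / 2) ` ?P"
  have i: "inj_on fst ?P" by (rule inj_onI) (auto dest: consec_right_unique)
  have "fst ` ?P \<subseteq> unstable" by (auto simp: unstable_def cadj_def)
  then have "finite (fst ` ?P)" using fin by (rule finite_subset)
  then have "finite ?P" using i by (rule finite_imageD)
  then have finZ: "finite Z" by (simp add: Z_def)
  have ZL: "z \<notin> L" if "z \<in> Z" for z
  proof -
    have "z \<in> (\<lambda>(a, b). (a + b) / 2) ` ?P" using that by (simp only: Z_def)
    then obtain p where p: "z = (case p of (a, b) \<Rightarrow> (a + b) / 2)" "p \<in> ?P" by (rule imageE)
    obtain a b where "p = (a, b)" by (cases p)
    then have "consec L a b" "z = (a + b) / 2" using p by auto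
    then show ?thesis using consecD(3)[of L a b] consecD(4)[of L a b z] by auto
  qed
  let ?h = "\<lambda>t. (pos Z t, t)"
  have st_pow: "\<exists>i. cadj L ((\<phi> ^^ i) x) ((\<phi> ^^ i) y)" if "stable x y" for x y
    using that unfolding stable_def eventually_sequentially by blast
  have pw: "(\<phi> ^^ i) permutes L" for i using PH_pow[OF \<phi>] by (simp add: PH_def)
  interpret A: arrangement L ?h
  proof
    show "inj_on ?h L" by (rule inj_onI) simp
    fix x assume "x \<in> L"
    then have "x \<notin> Z" using ZL by blast
    then obtain \<delta> where d: "\<delta> > 0" "\<forall>y. \<bar>y - x\<bar> < \<delta> \<longrightarrow> pos Z y = pos Z x" using pos_locally_constant[OF finZ] by blast
    have "\<forall>y\<in>L. \<bar>y - x\<bar> < \<delta> \<longrightarrow> ?h y = (pos Z x, 1 * y + 0)"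
    proof (intro ballI impI)
      fix y assume "\<bar>y - x\<bar> < \<delta>"
      then have "pos Z y = pos Z x" using d(2) by blast
      then show "?h y = (pos Z x, 1 * y + 0)" by simp
    qed
    moreover have "(1::real) \<noteq> 0" by simp
    ultimately show "\<exists>\<delta>>0. \<exists>k s c. s \<noteq> 0 \<and> (\<forall>y\<in>L. \<bar>y - x\<bar> < \<delta> \<longrightarrow> ?h y = (k, s * y + c))" using d(1) by blast
  qed (rule L_cantor)
  have comp: "A.comp k = cell L Z k" for k by (auto simp: A.comp_def cell_def)
  have "matched_arrangement L ?h stable"
  proof unfold_locales
    show sym: "stable y x" if "stable x y" for x y
      using that unfolding stable_def by (rule eventually_mono) (rule cadj_sym)
    show "y = z" if "stable x y" "stable x z" for x y z using stable_unique[OF that] .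
    show "x \<in> L" if xy: "stable x y" for x y
    proof -
      obtain i where "cadj L ((\<phi> ^^ i) x) ((\<phi> ^^ i) y)" using st_pow[OF xy] by blast
      then have "(\<phi> ^^ i) x \<in> L" using cadj_in[OF L_cantor] by blast
      then show ?thesis using permutes_in_image[OF pw] by blast
    qed
    show "\<not> stable x x" for x using st_pow[of x x] cadj_irrefl[OF L_cantor] by blast
    show "\<exists>b. cadj L x b" if xy: "stable x y" for x y
    proof -
      obtain i where c: "cadj L ((\<phi> ^^ i) x) ((\<phi> ^^ i) y)" using st_pow[OF xy] by blast
      have "PH L (finv (\<phi> ^^ i))" using PH_inv[OF _ PH_pow[OF \<phi>]] by simp
      from PH_endpoint[OF L_cantor this c] show ?thesis using permutes_inverses(2)[OF pw] by simp
    qed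
    show "finite A.labels"
    proof (rule finite_subset)
      show "A.labels \<subseteq> {..card Z}" using pos_le[OF finZ] by (auto simp: A.labels_def)
    qed simp
    have one: "stable x y" if c: "consec (cell L Z k) x y" for k x y
    proof (rule ccontr)
      assume "\<not> stable x y"
      then have "(x + y) / 2 \<in> Z" using consec_cell(1)[OF finZ c] unfolding Z_def by force
      then show False using consec_cell(2)[OF finZ c] by simp
    qed
    show "stable x y" if "A.neighbours x y" for x y
      using that one sym unfolding A.neighbours_def comp by auto
  qed
  then show ?thesis by blast
qed

text \<open>In an arrangement with the least number of components, \<open>\<phi>\<close> and its inverse
  preserve glued pairs, which are the end points of the complementary arcs once every component is
  wound onto a circle. So the map extends across these arcs to a homeomorphism of the circles.\<close>
theorem finite_unstable_imp_multihomeomorphism: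
  assumes \<phi>: "PH L \<phi>" and fin: "finite (matching_map.unstable (cadj L) \<phi>)"
  shows "multihomeomorphism K (to_K \<phi>)"
proof -
  interpret mm: matching_map "cadj L" \<phi> by (rule matching_map_cadj[OF \<phi>])
  let ?S = "mm.stable"
  obtain h0 where h0: "matched_arrangement L h0 ?S"
    "\<forall>h'. matched_arrangement L h' ?S \<longrightarrow> card (fst ` h0 ` L) \<le> card (fst ` h' ` L)"
  proof -
    obtain h where "matched_arrangement L h ?S" using initial_arrangement[OF \<phi> fin] by blast
    from ex_has_least_nat[of "\<lambda>h. matched_arrangement L h ?S", OF this, of "\<lambda>h. card (fst ` h ` L)"]
    show ?thesis using that by blast
  qed
  interpret h0: matched_arrangement L h0 ?S by (rule h0(1))
  define n where "n = card h0.labels"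
  obtain \<iota> where \<iota>: "bij_betw \<iota> h0.labels {0..<n}" using ex_bij_betw_finite_nat[OF h0.finite_labels] unfolding n_def by blast
  have "compact (snd ` h0 ` L)"
    by (intro compact_continuous_image continuous_intros h0.continuous_h) (simp add: L_compact)
  then have "bounded (snd ` h0 ` L)" by (rule compact_imp_bounded)
  then obtain B where B: "\<forall>w\<in>snd ` h0 ` L. \<bar>w\<bar> \<le> B" unfolding bounded_real ..
  \<comment> \<open>The factor makes all components fit into an interval shorter than one turn.\<close>
  define \<kappa> where "\<kappa> = 1 / (\<bar>B\<bar> + 1)"
  have \<kappa>: "\<kappa> > 0" by (simp add: \<kappa>_def)
  define h where "h t = (\<iota> (fst (h0 t)), \<kappa> * snd (h0 t))" for t
  have ma: "matched_arrangement L h ?S"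
    unfolding h_def by (rule h0.relabel[OF bij_betw_imp_inj_on[OF \<iota>] \<kappa>])
  interpret h: matched_arrangement L h ?S by (rule ma)
  have labels: "h.labels = {0..<n}"
  proof -
    have "h.labels = \<iota> ` h0.labels" unfolding h.labels_def h0.labels_def h_def by (simp add: image_image)
    then show ?thesis using \<iota> by (simp add: bij_betw_def)
  qed
  have lab_n: "fst (h t) < n" if "t \<in> L" for t
  proof -
    have "fst (h t) \<in> h.labels" using that by (simp add: h.labels_def)
    then show ?thesis using labels by simp
  qed
  have small: "-1 < snd (h t) \<and> snd (h t) < 1" if "t \<in> L" for t
  proof -
    have "\<bar>snd (h0 t)\<bar> < \<bar>B\<bar> + 1" using bspec[OF B, of "snd (h0 t)"] that by simp
    then have "\<kappa> * \<bar>snd (h0 t)\<bar> < 1" by (simp add: \<kappa>_def field_simps)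
    moreover have "\<bar>snd (h t)\<bar> = \<kappa> * \<bar>snd (h0 t)\<bar>" using \<kappa> by (simp add: h_def abs_mult)
    ultimately have "\<bar>snd (h t)\<bar> < 1" by simp
    then show ?thesis by (simp add: abs_less_iff)
  qed
  have min: "card h.labels \<le> card (fst ` h' ` L)" if "matched_arrangement L h' ?S" for h'
    using h0(2) that labels by (simp add: n_def h0.labels_def)
  define M where "M i = h.comp i" for i
  interpret F: circle_family n M
  proof
    fix i assume i: "i < n"
    then have "i \<in> h.labels" using labels by simp
    then obtain x where x: "x \<in> L" "fst (h x) = i" unfolding h.labels_def by blast
    show "compact (M i)" unfolding M_def by (rule h.compact_comp)
    show "M i \<subseteq> {-1<..<1}"
    proof
      fix w assume "w \<in> M i"
      then obtain t where t: "t \<in> L" "h t = (i, w)" unfolding M_def by (rule h.compE)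
      show "w \<in> {-1<..<1}" using small[OF t(1)] t(2) by simp
    qed
    show "infinite (M i)"
    proof
      assume f: "finite (M i)"
      obtain \<delta> k s c where a: "\<delta> > 0" "s \<noteq> 0" "\<forall>y\<in>L. \<bar>y - x\<bar> < \<delta> \<longrightarrow> h y = (k, s * y + c)" "h x = (k, s * x + c)"
        using h.affineE[OF x(1)] .
      have "x islimpt L" using L_cantor x(1) unfolding cantor_def by blast
      then have "infinite (L \<inter> ball x \<delta>)" using a(1) islimpt_eq_infinite_ball by blast
      moreover have "(\<lambda>y. s * y + c) ` (L \<inter> ball x \<delta>) \<subseteq> M i"
      proof
        fix w assume "w \<in> (\<lambda>y. s * y + c) ` (L \<inter> ball x \<delta>)"
        then obtain y where y: "y \<in> L" "\<bar>y - x\<bar> < \<delta>" "w = s * y + c" by (auto simp: dist_real_def abs_minus_commute)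
        then show "w \<in> M i" using a(3,4) x(2) h.comp_h[OF y(1)] by (simp add: M_def)
      qed
      moreover have "inj_on (\<lambda>y. s * y + c) (L \<inter> ball x \<delta>)" using a(2) by (simp add: inj_on_def)
      ultimately show False using f by (meson finite_imageD finite_subset)
    qed
  qed
  define H where "H t = (fst (h t), cis (snd (h t)))" for t
  have pi1: "(1::real) < pi" using pi_gt3 by simp
  have H_inj: "inj_on H L"
  proof (rule inj_onI)
    fix s t assume st: "s \<in> L" "t \<in> L" "H s = H t"
    have "cis (snd (h s)) = cis (snd (h t))" using st by (simp add: H_def)
    then have "snd (h s) = snd (h t)"
      by (rule cis_inj[of _ _ pi]) (use small[OF st(1)] small[OF st(2)] pi1 in auto)
    then show "s = t" using st h.h_eq by (simp add: H_def)
  qed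
  have H_cont: "continuous_on L H" unfolding H_def by (intro continuous_intros h.continuous_h)
  have base: "F.base = H ` L"
  proof
    show "F.base \<subseteq> H ` L"
    proof
      fix y assume "y \<in> F.base"
      then obtain i w where w: "y = (i, cis w)" "w \<in> h.comp i" by (auto simp: F.base_def M_def)
      then obtain t where "t \<in> L" "h t = (i, w)" using h.compE by blast
      then show "y \<in> H ` L" using w(1) by (intro image_eqI[of _ _ t]) (simp_all add: H_def)
    qed
    show "H ` L \<subseteq> F.base" using lab_n h.comp_h by (auto simp: F.base_def M_def H_def)
  qed
  have glued_arc: "\<exists>\<gamma>\<in>F.arcs. \<gamma> 0 = H x \<and> \<gamma> 1 = H y" if g: "h.glued x y" for x y
  proof -
    define i where "i = fst (h x)"
    have L2: "x \<in> L" "y \<in> L" and lab: "fst (h x) = i" "fst (h y) = i"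
      using h.glued_in[OF g] h.glued_label[OF g] by (auto simp: i_def)
    have i: "i < n" using lab_n[OF L2(1)] lab by simp
    interpret arc_set "M i" by (rule F.arc_set_M[OF i])
    have w: "snd (h x) \<in> M i" "snd (h y) \<in> M i" using h.comp_h[OF L2(1)] h.comp_h[OF L2(2)] lab by (simp_all add: M_def)
    have "\<exists>p q. (consec turn p q \<or> consec turn q p) \<and> cis p = cis (snd (h x)) \<and> cis q = cis (snd (h y))"
      using g unfolding h.glued_def
    proof
      assume "h.neighbours x y"
      then have "consec (M i) (snd (h x)) (snd (h y)) \<or> consec (M i) (snd (h y)) (snd (h x))"
        using lab by (simp add: h.neighbours_def M_def)
      then have "consec turn (snd (h x)) (snd (h y)) \<or> consec turn (snd (h y)) (snd (h x))" unfolding consec_turn by blast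
      then show ?thesis by blast
    next
      assume e: "x \<in> L \<and> y \<in> L \<and> x \<noteq> y \<and> fst (h x) = fst (h y) \<and> h.is_end x \<and> h.is_end y"
      have ne: "snd (h x) \<noteq> snd (h y)" using h.h_eq e by blast
      have "snd (h x) = Inf (M i) \<or> snd (h x) = Sup (M i)" "snd (h y) = Inf (M i) \<or> snd (h y) = Sup (M i)"
        using e lab unfolding h.is_end_def M_def by auto
      then consider "snd (h x) = Inf (M i)" "snd (h y) = Sup (M i)" | "snd (h x) = Sup (M i)" "snd (h y) = Inf (M i)"
        using ne by auto
      then show ?thesis
      proof cases
        case 1 then show ?thesis unfolding consec_turn by (intro exI[of _ "Inf (M i) + 2 * pi"] exI[of _ "Sup (M i)"]) auto
      next
        case 2 then show ?thesis unfolding consec_turn by (intro exI[of _ "Sup (M i)"] exI[of _ "Inf (M i) + 2 * pi"]) auto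
      qed
    qed
    then obtain p q where pq: "consec turn p q \<or> consec turn q p" "cis p = cis (snd (h x))" "cis q = cis (snd (h y))" by blast
    show ?thesis
      by (rule bexI[OF _ F.arcsI[OF i pq(1)]]) (use pq lab in \<open>simp add: F.on_circle_def H_def\<close>)
  qed
  have arc_glued: "\<exists>x y. h.glued x y \<and> \<gamma> 0 = H x \<and> \<gamma> 1 = H y" if \<gamma>: "\<gamma> \<in> F.arcs" for \<gamma>
  proof -
    obtain i p q where g: "i < n" "\<gamma> = F.on_circle i (seg p q)" "consec (arc_set.turn (M i)) p q \<or> consec (arc_set.turn (M i)) q p"
      using F.arcsE[OF \<gamma>] .
    interpret arc_set "M i" by (rule F.arc_set_M[OF g(1)])
    have key: "\<exists>x y. h.glued x y \<and> (i, cis p) = H x \<and> (i, cis q) = H y" if c: "consec turn p q" for p q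
      using c unfolding consec_turn
    proof
      assume c: "consec (M i) p q"
      obtain x where x: "x \<in> L" "h x = (i, p)" using h.compE[OF consecD(1)[OF c, unfolded M_def]] .
      obtain y where y: "y \<in> L" "h y = (i, q)" using h.compE[OF consecD(2)[OF c, unfolded M_def]] .
      have "h.glued x y" using x y c unfolding h.glued_def h.neighbours_def M_def by simp
      then show ?thesis using x y by (intro exI[of _ x] exI[of _ y]) (simp add: H_def)
    next
      assume c: "p = Sup (M i) \<and> q = Inf (M i) + 2 * pi"
      obtain x where x: "x \<in> L" "h x = (i, Sup (M i))" using h.compE[OF Inf_Sup(2)[unfolded M_def]] unfolding M_def .
      obtain y where y: "y \<in> L" "h y = (i, Inf (M i))" using h.compE[OF Inf_Sup(1)[unfolded M_def]] unfolding M_def .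
      have "x \<noteq> y" using x y Inf_less by auto
      then have "h.glued x y" using x y unfolding h.glued_def h.is_end_def M_def by simp
      then show ?thesis using x y c by (intro exI[of _ x] exI[of _ y]) (simp add: H_def)
    qed
    have sym: "h.glued y x" if "h.glued x y" for x y using that h.neighbours_sym unfolding h.glued_def by metis
    have "\<exists>x y. h.glued x y \<and> (i, cis p) = H x \<and> (i, cis q) = H y" using g(3) key[of p q] key[of q p] sym by blast
    then show ?thesis using g(2) by (simp add: F.on_circle_def)
  qed
  have \<phi>i: "PH L (finv \<phi>)" using PH_inv[OF _ \<phi>] by simp
  have p: "\<phi> permutes L" "finv \<phi> permutes L" using \<phi> \<phi>i by (simp_all add: PH_def)
  have inv1: "finv \<phi> (\<phi> t) = t" "\<phi> (finv \<phi> t) = t" for t using p(1) by (auto simp: permutes_inverses)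
  have S1: "?S (\<phi> x) (\<phi> y) \<longleftrightarrow> ?S x y" for x y by (rule mm.stable_map)
  have S2: "?S (finv \<phi> x) (finv \<phi> y) \<longleftrightarrow> ?S x y" for x y using S1[of "finv \<phi> x" "finv \<phi> y"] inv1 by simp
  have gl1: "h.glued x y \<Longrightarrow> h.glued (\<phi> x) (\<phi> y)" for x y by (rule h.glued_preserved[OF min \<phi> S1])
  have gl2: "h.glued x y \<Longrightarrow> h.glued (finv \<phi> x) (finv \<phi> y)" for x y by (rule h.glued_preserved[OF min \<phi>i S2])
  let ?Hi = "the_inv_into L H"
  have Hi: "?Hi (H t) = t" if "t \<in> L" for t using the_inv_into_f_f[OF H_inj that] .
  have Hi_cont: "continuous_on (H ` L) ?Hi" by (rule continuous_on_inv_into[OF H_cont _ H_inj]) simp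
  define g where "g y = H (\<phi> (?Hi y))" for y
  define g' where "g' y = H (finv \<phi> (?Hi y))" for y
  have gH: "g (H t) = H (\<phi> t)" "g' (H t) = H (finv \<phi> t)" if "t \<in> L" for t using Hi[OF that] by (simp_all add: g_def g'_def)
  have \<phi>L: "\<phi> t \<in> L" "finv \<phi> t \<in> L" if "t \<in> L" for t using that p by (simp_all add: permutes_in_image)
  have cont_conj: "continuous_on (H ` L) (\<lambda>y. H (\<psi> (?Hi y)))" if "continuous_on L \<psi>" "\<And>t. t \<in> L \<Longrightarrow> \<psi> t \<in> L" for \<psi>
  proof -
    have "continuous_on (H ` L) (\<lambda>y. \<psi> (?Hi y))" by (rule continuous_on_compose2[OF that(1) Hi_cont]) (use Hi in auto)
    then show ?thesis by (rule continuous_on_compose2[OF H_cont]) (use Hi that(2) in auto)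
  qed
  have hom: "homeomorphism (H ` L) (H ` L) g g'"
  proof (rule homeomorphismI)
    show "continuous_on (H ` L) g" unfolding g_def by (rule cont_conj) (use \<phi> \<phi>L in \<open>auto simp: PH_def\<close>)
    show "continuous_on (H ` L) g'" unfolding g'_def by (rule cont_conj) (use \<phi>i \<phi>L in \<open>auto simp: PH_def\<close>)
    show "g ` H ` L \<subseteq> H ` L" "g' ` H ` L \<subseteq> H ` L" using gH \<phi>L by auto
    show "g' (g y) = y" if "y \<in> H ` L" for y using that gH \<phi>L inv1 by auto
    show "g (g' y) = y" if "y \<in> H ` L" for y using that gH \<phi>L inv1 by auto
  qed
  have pr: "preserves_gaps F.arcs F.arcs G" if G: "\<And>t. t \<in> L \<Longrightarrow> G (H t) = H (\<psi> t)" "\<And>x y. h.glued x y \<Longrightarrow> h.glued (\<psi> x) (\<psi> y)" for G \<psi>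
    unfolding preserves_gaps_def
  proof
    fix \<gamma> assume "\<gamma> \<in> F.arcs"
    then obtain x y where xy: "h.glued x y" "\<gamma> 0 = H x" "\<gamma> 1 = H y" using arc_glued by blast
    have "x \<in> L" "y \<in> L" using h.glued_in[OF xy(1)] by auto
    then show "\<exists>\<delta>\<in>F.arcs. \<delta> 0 = G (\<gamma> 0) \<and> \<delta> 1 = G (\<gamma> 1)"
      using glued_arc[OF G(2)[OF xy(1)]] xy G(1) by simp
  qed
  have pg: "preserves_gaps F.arcs F.arcs g"
    by (rule pr[of g \<phi>]) (erule gH(1), erule gl1)
  have pg': "preserves_gaps F.arcs F.arcs g'"
    by (rule pr[of g' "finv \<phi>"]) (erule gH(2), erule gl2)
  obtain FF FF' where FF: "homeomorphism (multicircle n) (multicircle n) FF FF'" "\<forall>y\<in>H ` L. FF y = g y"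
    using gap_homeomorphism_extends[OF F.gap_system_arcs F.gap_system_arcs, unfolded F.filled_arcs, unfolded base, OF hom pg pg']
    by blast
  define hK where "hK z = H (ang m z)" for z
  have hK_im: "hK ` K = H ` L" by (simp add: hK_def L_def image_image)
  have hK_cont: "continuous_on K hK" unfolding hK_def
    by (rule continuous_on_compose2[OF H_cont ang_cont]) (simp add: L_def)
  have hK_inj: "inj_on hK K"
  proof (rule inj_onI)
    fix y z assume yz: "y \<in> K" "z \<in> K" "hK y = hK z"
    then have "ang m y = ang m z" using H_inj ang_K by (auto simp: hK_def dest: inj_onD)
    then show "y = z" using cis_ang_K yz by metis
  qed
  have cK: "compact K" using K by (simp add: cantor_subset_def)
  let ?hi = "the_inv_into K hK"
  have hi: "?hi (hK z) = z" if "z \<in> K" for z using the_inv_into_f_f[OF hK_inj that] .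
  have hom_K: "homeomorphism K (hK ` K) hK ?hi"
    by (rule homeomorphismI) (use hK_cont continuous_on_inv_into[OF hK_cont cK hK_inj] hi in auto)
  have lmm: "locally_monotone_map K n hK"
    unfolding locally_monotone_map_def
  proof
    fix z assume z: "z \<in> K"
    define x where "x = ang m z"
    have x: "x \<in> L" "z = cis x" using z by (simp_all add: x_def ang_K cis_ang_K)
    obtain \<delta> k s c where a: "\<delta> > 0" "s \<noteq> 0" "\<forall>y\<in>L. \<bar>y - x\<bar> < \<delta> \<longrightarrow> h y = (k, s * y + c)" "h x = (k, s * x + c)"
      using h.affineE[OF x(1)] .
    define a0 where "a0 = max (x - \<delta>) (m - pi)"
    define b0 where "b0 = min (x + \<delta>) (m + pi)"
    have ab: "a0 < x" "x < b0" "b0 \<le> a0 + 2 * pi" "m - pi \<le> a0" "b0 \<le> m + pi"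
      using L_range[OF x(1)] a(1) by (auto simp: a0_def b0_def)
    define T where "T = {t \<in> {a0<..<b0}. cis t \<in> K}"
    have T: "t \<in> L \<and> h t = (k, s * t + c)" if "t \<in> T" for t
    proof -
      have t: "a0 < t" "t < b0" "cis t \<in> K" using that by (auto simp: T_def)
      then have "t \<in> L" using cis_in_K_iff[of t] ab by auto
      moreover have "\<bar>t - x\<bar> < \<delta>" using t by (auto simp: a0_def b0_def abs_less_iff)
      ultimately show ?thesis using a(3) by blast
    qed
    let ?u = "\<lambda>t. s * t + c"
    have "?u ` T \<subseteq> {-1<..<1}"
    proof
      fix w assume "w \<in> ?u ` T"
      then obtain t where t: "t \<in> T" "w = s * t + c" by blast
      then have "w = snd (h t)" "t \<in> L" using T by auto
      then show "w \<in> {-1<..<1}" using small by simp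
    qed
    moreover have "mono_on T ?u \<or> antimono_on T ?u"
    proof (cases "s > 0")
      case True then have "mono_on T ?u" by (intro mono_onI) simp
      then show ?thesis ..
    next
      case False then have "antimono_on T ?u" by (intro monotone_onI) (simp add: mult_left_mono_neg)
      then show ?thesis ..
    qed
    moreover have "\<forall>t\<in>T. hK (cis t) = (k, cis (?u t))"
      using T by (simp add: hK_def ang_L H_def)
    moreover have "z \<in> cis ` {a0<..<b0}" using x(2) ab by auto
    moreover have "k < n" using lab_n[OF x(1)] a(4) by simp
    moreover have "a0 < b0" "(-1::real) < 1" "(1::real) \<le> -1 + 2 * pi" using ab pi1 by auto
    ultimately have big: "a0 < b0 \<and> b0 \<le> a0 + 2 * pi \<and> (-1::real) < 1 \<and> (1::real) \<le> -1 + 2 * pi \<and> k < n \<and> z \<in> cis ` {a0<..<b0} \<and>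
       (let T = {t \<in> {a0<..<b0}. cis t \<in> K} in
          ?u ` T \<subseteq> {-1<..<1} \<and> (mono_on T ?u \<or> antimono_on T ?u) \<and> (\<forall>t\<in>T. hK (cis t) = (k, cis (?u t))))"
      using ab(3) unfolding Let_def T_def[symmetric] by (intro conjI)
    show "\<exists>a b c d k u. a < b \<and> b \<le> a + 2 * pi \<and> c < d \<and> d \<le> c + 2 * pi \<and> k < n \<and> z \<in> cis ` {a<..<b} \<and>
       (let T = {t \<in> {a<..<b}. cis t \<in> K} in
          u ` T \<subseteq> {c<..<d} \<and> (mono_on T u \<or> antimono_on T u) \<and> (\<forall>t\<in>T. hK (cis t) = (k, cis (u t))))"
      by (rule exI[of _ a0], rule exI[of _ b0], rule exI[of _ "-1"], rule exI[of _ 1], rule exI[of _ k], rule exI[of _ ?u], rule big)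
  qed
  have conj: "hK (to_K \<phi> (?hi y)) = FF y" if "y \<in> hK ` K" for y
  proof -
    obtain z where z: "z \<in> K" "y = hK z" using \<open>y \<in> hK ` K\<close> by blast
    have "FF y = H (\<phi> (ang m z))" using FF(2) gH(1)[OF ang_K[OF z(1)]] z ang_K[OF z(1)] by (simp add: hK_def)
    moreover have "to_K \<phi> z = cis (\<phi> (ang m z))" using z(1) by (simp add: to_K_def)
    ultimately show ?thesis using hi[OF z(1)] z(2) ang_L \<phi>L(1)[OF ang_K[OF z(1)]] by (simp add: hK_def)
  qed
  have n1: "1 \<le> n"
  proof -
    obtain x where "x \<in> L" using L_compact(3) by blast
    then show ?thesis using lab_n by fastforce
  qed
  have into: "hK ` K \<subseteq> multicircle n" unfolding hK_im using lab_n by (auto simp: multicircle_def H_def)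
  show ?thesis unfolding multihomeomorphism_def using n1 into lmm hom_K FF(1) conj by blast
qed

end

theorem theorem2p4:
  fixes K :: "complex set" and f :: "complex \<Rightarrow> complex"
  assumes "cantor_subset K" and "f \<in> carrier (Homeo_lt K)"
  shows "(distorted (Homeo_lt K) f \<longleftrightarrow>
            (\<exists>B::nat. \<forall>n::nat. num_disc K (f [^]\<^bsub>Homeo_lt K\<^esub> n) \<le> B)) \<and>
         ((\<exists>B::nat. \<forall>n::nat. num_disc K (f [^]\<^bsub>Homeo_lt K\<^esub> n) \<le> B) \<longleftrightarrow>
            multihomeomorphism K f)"
proof -
  \<comment> \<open>The circle is connected, a Cantor set is not.\<close>
  have "\<exists>z\<in>circle. z \<notin> K"
  proof (rule ccontr)
    assume "\<not> ?thesis"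
    then have K: "K = circle" using assms(1) by (auto simp: cantor_subset_def)
    have "connected (cis ` {0..1::real})" by (intro connected_continuous_image continuous_intros) simp
    moreover have "cis ` {0..1::real} \<subseteq> K" using K by auto
    moreover have "cis 0 \<in> cis ` {0..1::real}" "cis 1 \<in> cis ` {0..1::real}" by (simp_all del: cis_zero)
    ultimately have "cis 1 \<in> connected_component_set K (cis 0)" by (meson connected_component_maximal subsetD)
    moreover have "connected_component_set K (cis 0) = {cis 0}" using assms(1) K by (simp add: cantor_subset_def del: cis_zero)
    ultimately have "cis 1 = cis 0" by auto
    then have "(1::real) = 0" by (rule cis_inj[of _ _ 1]) (use pi_gt3 in auto)
    then show False by simp
  qed
  then obtain z where z: "z \<in> circle" "z \<notin> K" by blast
  interpret circle_cantor K "ang 0 z - pi"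
    by unfold_locales (use assms(1) z cis_ang[OF z(1), of 0] in auto)
  obtain \<phi> where \<phi>: "PH L \<phi>" "f = to_K \<phi>" using assms(2) carrier_Homeo by auto
  have "multihomeomorphism K f" if B: "\<exists>B::nat. \<forall>n::nat. num_disc K (f [^]\<^bsub>Homeo_lt K\<^esub> n) \<le> B"
  proof -
    obtain B where "\<And>n::nat. num_disc K (f [^]\<^bsub>Homeo_lt K\<^esub> n) \<le> B" using B by blast
    then have "(\<lambda>n. real (num_disc K (f [^]\<^bsub>Homeo_lt K\<^esub> (n::nat))) / real n) \<longlonglongrightarrow> 0" by (rule bounded_imp_sublinear)
    then show ?thesis
      using finite_unstable_imp_multihomeomorphism[OF \<phi>(1)] sublinear_imp_finite_unstable[OF \<phi>(1)] \<phi>(2) by simp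
  qed
  then show ?thesis using distorted_iff_bounded[OF assms(2)] multihomeomorphism_imp_bounded[OF assms(2)] by blast
qed

end
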